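(* Let $\varphi$ be a probability density on $\mathbb{R}^d$, let $K:=\widehat\varphi:\mathbb{R}^d\to\mathbb{C}$, and let $\omega$ be the permanental point process on $\mathbb{R}^d$ associated with the translation-invariant kernel $K(x,y):=K(x-y)$. Then, almost surely, the autocorrelation measure $\gamma$ and the diffraction measure $\widehat\gamma$ of $\omega$ exist and are given by \[ \gamma=\delta_0+\bigl(1+|K|^2\bigr)\,\lambda^d\qquad\text{and}\qquad\widehat\gamma=\delta_0+\bigl(1+(\varphi\ast\varphi_-)\bigr)\,\lambda^d , \] where $\varphi_-(x):=\varphi(-x)$.
   Context: A point process on $\mathbb{R}^d$ is a random variable $\omega$ with values in the space of locally finite $\mathbb{N}_0\cup\{\infty\}$-valued Borel measures on $\mathbb{R}^d$. Writing $\omega=\sum_{i\in I}\delta_{x_i}$, put $\omega^{\bullet k}:=\sum_{i_1,\dots,i_k\in I\ \text{distinct}}\delta_{(x_{i_1},\dots,x_{i_k})}$. If $\mathbb{E}(\omega(A)^k)<\infty$ for all bounded Borel $A$, the $k$th factorial moment measure is the expectation measure $\mathbb{E}(\omega^{\bullet k}(\cdot))$ on $(\mathbb{R}^d)^k$; if it is absolutely continuous, its density $\varrho_k$ is the $k$-point correlation function. $\omega$ is permanental with kernel $K(x,y)$ if, for every $k\in\mathbb{N}$, $\varrho_k$ exists and $\varrho_k(x_1,\dots,x_k)=\operatorname{per}\bigl(K(x_i,x_j)\bigr)_{1\le i,j\le k}$, where $\operatorname{per}(M)=\sum_{\sigma\in S_k}\prod_{i}M_{i\sigma(i)}$ is the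 permanent. For kernels of the form considered here, a permanental point process exists and is unique in distribution; this is "the associated" process. $\lambda^d$ is Lebesgue measure on $\mathbb{R}^d$, and $F\,\lambda^d$ is the measure with density $F$. Fourier transform of functions: $\widehat f(y)=\int_{\mathbb{R}^d}f(x)e^{-2\pi i xy}\,dx$ for $f\in L^1(\mathbb{R}^d)$. For a locally finite measure $\omega$, with $\widetilde\omega(A):=\omega(-A)$ and $B_n$ the open ball of radius $n$ around $0$, the autocorrelation measure is the vague limit $\gamma:=\lim_{n\to\infty}\frac{\omega|_{B_n}\ast\widetilde{\omega|_{B_n}}}{\lambda^d(B_n)}$, if it exists. The diffraction measure is the Fourier transform $\widehat\gamma$ of $\gamma$, i.e. the unique translation-bounded measure with $\int f\,d\widehat\gamma=\int\widehat f\,d\gamma$ for all Schwartz functions $f$ (translation-bounded: $\sup_x\mu(x+B)<\infty$ for every bounded Borel $B$). For a point process these notions are applied to its realisations. *)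

theory Defs
  imports "HOL-Probability.Probability" "HOL-Combinatorics.Permutations"
begin

section \<open>Point processes\<close>

definition locally_finite_measure :: "(real ^ 'n) measure \<Rightarrow> bool" where
  "locally_finite_measure \<mu> \<longleftrightarrow>
     sets \<mu> = sets borel \<and> (\<forall>A\<in>sets borel. bounded A \<longrightarrow> emeasure \<mu> A < \<infinity>)"

definition point_configuration :: "(real ^ 'n) measure \<Rightarrow> bool" where
  "point_configuration \<mu> \<longleftrightarrow>
     locally_finite_measure \<mu> \<and> (\<forall>A\<in>sets borel. emeasure \<mu> A \<in> range ennreal_of_enat)"

text \<open>The sigma-algebra on the space of configurations is the one generated by the evaluations
  \<open>\<mu> \<mapsto> \<mu> A\<close>, as for \<^const>\<open>subprob_algebra\<close>.\<close>

definition configuration_space :: "(real ^ 'n) measure measure" where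
  "configuration_space =
     (SUP A \<in> sets borel. vimage_algebra (Collect point_configuration) (\<lambda>\<mu>. emeasure \<mu> A) borel)"

definition point_process :: "'w measure \<Rightarrow> ('w \<Rightarrow> (real ^ 'n) measure) \<Rightarrow> bool" where
  "point_process M \<omega> \<longleftrightarrow> prob_space M \<and> \<omega> \<in> measurable M configuration_space"

text \<open>A canonical index set \<open>I\<close> for writing a configuration as \<open>\<Sum>i\<in>I. \<delta>(x\<^sub>i)\<close>: an atom \<open>x\<close> of mass
  \<open>m\<close> contributes the indices \<open>(x, 0), \<dots>, (x, m - 1)\<close>, and \<open>x\<^sub>i = fst i\<close>.\<close>

definition configuration_points :: "(real ^ 'n) measure \<Rightarrow> ((real ^ 'n) \<times> nat) set" where
  "configuration_points \<mu> = {(x, j). of_nat j < emeasure \<mu> {x}}"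

text \<open>\<open>(\<real>\<^sup>d)\<^sup>k\<close> is rendered as the product space over the index set \<open>{..<k}\<close>. The image of a counting
  measure under a map is the sum of the Dirac measures at the values of the map.\<close>

definition factorial_power :: "nat \<Rightarrow> (real ^ 'n) measure \<Rightarrow> (nat \<Rightarrow> real ^ 'n) measure" where
  "factorial_power k \<mu> =
     distr (count_space {t \<in> {..<k} \<rightarrow>\<^sub>E configuration_points \<mu>. inj_on t {..<k}})
       (Pi\<^sub>M {..<k} (\<lambda>_. borel)) (\<lambda>t. \<lambda>i\<in>{..<k}. fst (t i))"

definition factorial_moment ::
    "'w measure \<Rightarrow> ('w \<Rightarrow> (real ^ 'n) measure) \<Rightarrow> nat \<Rightarrow> (nat \<Rightarrow> real ^ 'n) set \<Rightarrow> ennreal" where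
  "factorial_moment M \<omega> k B = (\<integral>\<^sup>+ w. emeasure (factorial_power k (\<omega> w)) B \<partial>M)"

definition correlation_function ::
    "'w measure \<Rightarrow> ('w \<Rightarrow> (real ^ 'n) measure) \<Rightarrow> nat \<Rightarrow> ((nat \<Rightarrow> real ^ 'n) \<Rightarrow> real) \<Rightarrow> bool" where
  "correlation_function M \<omega> k \<rho> \<longleftrightarrow>
     (\<forall>A\<in>sets borel. bounded A \<longrightarrow> (\<integral>\<^sup>+ w. emeasure (\<omega> w) A ^ k \<partial>M) < \<infinity>) \<and>
     \<rho> \<in> borel_measurable (Pi\<^sub>M {..<k} (\<lambda>_. lborel)) \<and>
     (\<forall>x. 0 \<le> \<rho> x) \<and>
     (\<forall>B\<in>sets (Pi\<^sub>M {..<k} (\<lambda>_. borel)).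
        factorial_moment M \<omega> k B = emeasure (density (Pi\<^sub>M {..<k} (\<lambda>_. lborel)) (\<lambda>x. ennreal (\<rho> x))) B)"

definition permanent :: "nat \<Rightarrow> (nat \<Rightarrow> nat \<Rightarrow> complex) \<Rightarrow> complex" where
  "permanent k A = (\<Sum>\<sigma> | \<sigma> permutes {..<k}. \<Prod>i<k. A i (\<sigma> i))"

text \<open>A density is determined only up to null sets, so the permanent formula is required almost
  everywhere; it includes that the permanents are almost everywhere real and nonnegative.\<close>

definition permanental ::
    "'w measure \<Rightarrow> ('w \<Rightarrow> (real ^ 'n) measure) \<Rightarrow> (real ^ 'n \<Rightarrow> real ^ 'n \<Rightarrow> complex) \<Rightarrow> bool" where
  "permanental M \<omega> \<kappa> \<longleftrightarrow>
     point_process M \<omega> \<and>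
     (\<forall>k\<ge>1. \<exists>\<rho>. correlation_function M \<omega> k \<rho> \<and>
        (AE x in Pi\<^sub>M {..<k} (\<lambda>_. lborel).
           complex_of_real (\<rho> x) = permanent k (\<lambda>i j. \<kappa> (x i) (x j))))"


section \<open>Fourier transform and Schwartz functions\<close>

definition fourier_transform :: "(real ^ 'n \<Rightarrow> complex) \<Rightarrow> real ^ 'n \<Rightarrow> complex" where
  "fourier_transform f y =
     (LINT x|lborel. f x * exp (- (2 * complex_of_real pi * \<i> * complex_of_real (x \<bullet> y))))"

definition partial_derivative :: "'n \<Rightarrow> (real ^ 'n \<Rightarrow> complex) \<Rightarrow> real ^ 'n \<Rightarrow> complex" where
  "partial_derivative i f x = frechet_derivative f (at x) (axis i 1)"

text \<open>Smoothness is expressed by differentiability of all iterated partial derivatives, the list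
  \<open>is\<close> running over all finite sequences of coordinate directions.\<close>

definition schwartz :: "(real ^ 'n \<Rightarrow> complex) \<Rightarrow> bool" where
  "schwartz f \<longleftrightarrow>
     (\<forall>is. (\<forall>x. foldr partial_derivative is f differentiable (at x)) \<and>
        (\<forall>N::nat. bounded (range (\<lambda>x. norm x ^ N *\<^sub>R foldr partial_derivative is f x))))"

definition translation_bounded :: "(real ^ 'n) measure \<Rightarrow> bool" where
  "translation_bounded \<mu> \<longleftrightarrow>
     (\<forall>B\<in>sets borel. bounded B \<longrightarrow> (SUP x. emeasure \<mu> ((\<lambda>b. x + b) ` B)) < \<infinity>)"

text \<open>Integrability is stated explicitly, because the Bochner integral of a function that is not
  integrable is \<open>0\<close>.\<close>

definition fourier_dual :: "(real ^ 'n) measure \<Rightarrow> (real ^ 'n) measure \<Rightarrow> bool" where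
  "fourier_dual \<gamma> \<nu> \<longleftrightarrow>
     sets \<nu> = sets borel \<and> translation_bounded \<nu> \<and>
     (\<forall>f. schwartz f \<longrightarrow>
        integrable \<nu> f \<and> integrable \<gamma> (fourier_transform f) \<and>
        integral\<^sup>L \<nu> f = integral\<^sup>L \<gamma> (fourier_transform f))"

definition is_fourier_measure :: "(real ^ 'n) measure \<Rightarrow> (real ^ 'n) measure \<Rightarrow> bool" where
  "is_fourier_measure \<gamma> \<nu> \<longleftrightarrow> fourier_dual \<gamma> \<nu> \<and> (\<forall>\<nu>'. fourier_dual \<gamma> \<nu>' \<longrightarrow> \<nu>' = \<nu>)"


section \<open>Autocorrelation and diffraction\<close>

definition vague_limit :: "(nat \<Rightarrow> (real ^ 'n) measure) \<Rightarrow> (real ^ 'n) measure \<Rightarrow> bool" where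
  "vague_limit \<mu>s \<mu> \<longleftrightarrow>
     locally_finite_measure \<mu> \<and>
     (\<forall>f :: real ^ 'n \<Rightarrow> real. continuous_on UNIV f \<longrightarrow> compact (closure {x. f x \<noteq> 0}) \<longrightarrow>
        (\<lambda>n. integral\<^sup>L (\<mu>s n) f) \<longlonglongrightarrow> integral\<^sup>L \<mu> f)"

text \<open>The restriction \<open>A \<mapsto> \<mu> (A \<inter> B)\<close>, still as a measure on the whole space.\<close>

definition restricted_to :: "(real ^ 'n) measure \<Rightarrow> (real ^ 'n) set \<Rightarrow> (real ^ 'n) measure" where
  "restricted_to \<mu> B = density \<mu> (indicator B)"

definition reflected :: "(real ^ 'n) measure \<Rightarrow> (real ^ 'n) measure" where
  "reflected \<mu> = distr \<mu> borel uminus"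

definition autocorrelation :: "(real ^ 'n) measure \<Rightarrow> (real ^ 'n) measure \<Rightarrow> bool" where
  "autocorrelation \<mu> \<gamma> \<longleftrightarrow>
     vague_limit
       (\<lambda>n. scale_measure (inverse (emeasure lborel (ball (0 :: real ^ 'n) (real n))))
          (restricted_to \<mu> (ball 0 (real n)) \<star> reflected (restricted_to \<mu> (ball 0 (real n))))) \<gamma>"

definition diffraction :: "(real ^ 'n) measure \<Rightarrow> (real ^ 'n) measure \<Rightarrow> bool" where
  "diffraction \<mu> \<nu> \<longleftrightarrow> (\<exists>\<gamma>. autocorrelation \<mu> \<gamma> \<and> is_fourier_measure \<gamma> \<nu>)"

text \<open>The sum of two measures with the same measurable sets.\<close>

definition add_measure :: "'a measure \<Rightarrow> 'a measure \<Rightarrow> 'a measure" where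
  "add_measure \<mu> \<nu> = measure_of (space \<mu>) (sets \<mu>) (\<lambda>A. emeasure \<mu> A + emeasure \<nu> A)"

definition fun_convolution :: "(real ^ 'n \<Rightarrow> real) \<Rightarrow> (real ^ 'n \<Rightarrow> real) \<Rightarrow> real ^ 'n \<Rightarrow> real" where
  "fun_convolution f g x = (LINT y|lborel. f y * g (x - y))"

end

theory Submission
  imports Defs "HOL-Probability.Sinc_Integral" "HOL-Complex_Analysis.Conformal_Mappings"
begin

text \<open>The number of pairs of points with first point in a unit cube and difference in a bounded set \<open>D\<close> is a
  stationary field on \<open>\<int>\<^sup>d\<close>, and \<open>\<rho>\<^sub>2(x, y) = 1 + \<bar>K(x - y)\<bar>\<^sup>2\<close> gives its mean. Stationarity follows from
  translation invariance of the correlation functions: these determine the probability generating functions of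
  counts near 1, hence by analytic continuation the void probabilities, and a simple point process is determined
  by its void probabilities (Renyi). As \<open>K\<close> vanishes at infinity (Riemann--Lebesgue), the permanent of a distant pair
  of tuples almost splits, so the field is asymptotically uncorrelated. Hence its averages over large balls converge
  in \<open>L\<^sup>2\<close>, and a maximal inequality (Vitali covering) upgrades this to almost sure convergence. Countably many
  dyadic cells \<open>D\<close> suffice for vague convergence.

  On the Fourier side, \<open>\<bar>K\<bar>\<^sup>2\<close> is the transform of \<open>\<phi> \<star> \<phi>\<^sub>-\<close>, while \<open>\<delta>\<^sub>0\<close> and \<open>\<lambda>\<close> are dual to each other by Fourier
  inversion. Uniqueness holds because Gaussians of all widths and centres, multiplied by a fixed Gaussian to
  make the measure finite, are Schwartz functions and determine it by convolution smoothing.\<close>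

section \<open>Gaussians and Fourier inversion\<close>

text \<open>Only the factorial moments of the process are given. The bound k! on the k-point
  intensity makes the expansion of E[(1 - s)^N] in factorial moments converge for s below the
  reciprocal of the volume, while the void probability sits at s = 1; this gap forces the analytic
  continuation. The Riemann--Lebesgue lemma gives decay of K without a rate, so the variances of the
  averages tend to zero with no summable bound, and Borel--Cantelli along a subsequence has nothing
  to work with. The maximal inequality replaces it: it controls all radii at once by an expectation
  that can be made small. Variances call for upper bounds on correlations, so it is enough that
  permutations mixing two distant tuples contribute little to the permanent. The pairs of a point
  with itself are the source of \<delta>_0, with weight equal to the intensity K(0) = 1. The
  approximants count pairs with both points in a ball, the field counts pairs by their first point;
  the two differ by a bounded change of radius, invisible after division by the volume.\<close>

interpretation lborel_product: product_sigma_finite "\<lambda>_. lborel :: 'a::euclidean_space measure"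
  by standard

section \<open>Lebesgue measure on Cartesian space as a product over coordinates\<close>

lemma Basis_cart_eq: "(Basis :: (real ^ 'n) set) = range (\<lambda>i. axis i 1)"
  by (auto simp: Basis_vec_def)

lemma prod_Basis_cart: "(\<Prod>b\<in>Basis. f ((x :: real ^ 'n) \<bullet> b)) = (\<Prod>i\<in>UNIV. f (x $ i))"
  unfolding Basis_cart_eq
  by (subst prod.reindex) (auto simp: inj_on_def axis_eq_axis inner_axis)

lemma measurable_vec_lambda_PiM [measurable]:
  "(\<lambda>f. \<chi> i. f i) \<in> measurable (Pi\<^sub>M UNIV (\<lambda>_::'n::finite. lborel :: real measure)) borel"
proof -
  have "(\<lambda>f. (\<chi> i. f i) \<bullet> b) \<in> borel_measurable (Pi\<^sub>M UNIV (\<lambda>_::'n::finite. lborel :: real measure))"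
    if b: "b \<in> Basis" for b :: "real ^ 'n"
  proof -
    obtain j where "b = axis j 1" using b unfolding Basis_cart_eq by blast
    moreover have "(\<lambda>f. f j) \<in> borel_measurable (Pi\<^sub>M UNIV (\<lambda>_::'n::finite. lborel :: real measure))"
      using measurable_component_singleton[of j UNIV "\<lambda>_::'n. lborel :: real measure"] by simp
    ultimately show ?thesis by (simp add: inner_axis)
  qed
  then show ?thesis
    by (intro borel_measurable_euclidean_space[THEN iffD2]) auto
qed

text \<open>Boxes determine Lebesgue measure, and on boxes both sides are products of side lengths.
  Integrals of functions that factor over the coordinates thereby become products of one-dimensional
  integrals.\<close>

lemma lborel_vec_eq:
  "(lborel :: (real ^ 'n) measure) = distr (Pi\<^sub>M UNIV (\<lambda>_. lborel)) borel (\<lambda>f. \<chi> i. f i)"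
proof (rule lborel_eqI)
  fix l u :: "real ^ 'n" assume le: "\<And>b. b \<in> Basis \<Longrightarrow> l \<bullet> b \<le> u \<bullet> b"
  have le': "l $ i \<le> u $ i" for i
    using le[of "axis i 1"] by (auto simp: Basis_vec_def inner_axis)
  have "(\<lambda>f. \<chi> i. f i) -` box l u \<inter> space (Pi\<^sub>M UNIV (\<lambda>_. lborel)) = Pi\<^sub>E UNIV (\<lambda>i. {l $ i <..< u $ i})"
    by (auto simp: mem_box_cart space_PiM PiE_def Pi_def)
  then have "emeasure (distr (Pi\<^sub>M UNIV (\<lambda>_. lborel)) borel (\<lambda>f. \<chi> i. f i)) (box l u)
     = (\<Prod>i\<in>UNIV. ennreal (u $ i - l $ i))"
    by (subst emeasure_distr) (auto simp: lborel_product.emeasure_PiM le')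
  also have "\<dots> = (\<Prod>b\<in>Basis. (u - l) \<bullet> b)"
    by (subst prod_Basis_cart) (simp add: prod_ennreal le')
  finally show "emeasure (distr (Pi\<^sub>M UNIV (\<lambda>_. lborel)) borel (\<lambda>f. \<chi> i. f i)) (box l u) = (\<Prod>b\<in>Basis. (u - l) \<bullet> b)" .
qed simp

lemma
  fixes f :: "'n::finite \<Rightarrow> real \<Rightarrow> 'b::{real_normed_field,banach,second_countable_topology}"
  assumes "\<And>i. integrable lborel (f i)"
  shows integrable_prod_cart: "integrable lborel (\<lambda>x :: real ^ 'n. \<Prod>i\<in>UNIV. f i (x $ i))"
    and integral_prod_cart: "(LINT x|lborel. (\<Prod>i\<in>UNIV. f i ((x :: real ^ 'n) $ i))) = (\<Prod>i\<in>UNIV. LINT t|lborel. f i t)"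
proof -
  have fm [measurable]: "f i \<in> borel_measurable borel" for i
    using borel_measurable_integrable[OF assms, of i] by simp
  have m: "(\<lambda>x :: real ^ 'n. \<Prod>i\<in>UNIV. f i (x $ i)) \<in> borel_measurable borel"
    by measurable
  let ?P = "Pi\<^sub>M UNIV (\<lambda>_::'n. lborel :: real measure)"
  have "integrable ?P (\<lambda>x. \<Prod>i\<in>UNIV. f i (x i))"
    by (rule lborel_product.product_integrable_prod[OF finite assms])
  then show "integrable lborel (\<lambda>x :: real ^ 'n. \<Prod>i\<in>UNIV. f i (x $ i))"
    unfolding lborel_vec_eq integrable_distr_eq[OF measurable_vec_lambda_PiM m] by simp
  have "(LINT x|?P. (\<Prod>i\<in>UNIV. f i (x i))) = (\<Prod>i\<in>UNIV. LINT t|lborel. f i t)"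
    by (rule lborel_product.product_integral_prod[OF finite assms])
  then show "(LINT x|lborel. (\<Prod>i\<in>UNIV. f i ((x :: real ^ 'n) $ i))) = (\<Prod>i\<in>UNIV. LINT t|lborel. f i t)"
    unfolding lborel_vec_eq integral_distr[OF measurable_vec_lambda_PiM m] by simp
qed

text \<open>The parameter \<open>s\<close> is an inverse width. The factor \<open>pi\<close> makes
  \<open>gauss 1\<close> its own Fourier transform with integral 1, so
  \<open>s ^ CARD('n) * gauss s\<close> is an approximate identity as \<open>s\<close>
  grows.\<close>

definition gauss :: "real \<Rightarrow> real ^ 'n \<Rightarrow> real" where
  "gauss s x = exp (- (pi * s\<^sup>2 * (norm x)\<^sup>2))"

lemma gauss_prod: "gauss s (x :: real ^ 'n) = (\<Prod>i\<in>UNIV. exp (- (pi * s\<^sup>2 * (x $ i)\<^sup>2)))"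
proof -
  have "(norm x)\<^sup>2 = (\<Sum>i\<in>UNIV. (x $ i)\<^sup>2)"
    by (simp add: norm_vec_def L2_set_def sum_nonneg)
  then show ?thesis
    by (simp add: gauss_def exp_sum sum_distrib_left sum_negf[symmetric])
qed

lemma gauss_measurable [measurable]: "gauss s \<in> borel_measurable borel"
  unfolding gauss_def by measurable

lemma gauss_nonneg [simp]: "0 \<le> gauss s x" and gauss_le_1: "gauss s x \<le> 1"
  by (auto simp: gauss_def)

lemma gauss_scale: "gauss s (r *\<^sub>R x) = gauss (s * r) x"
  by (simp add: gauss_def power_mult_distrib mult.assoc)

lemma gaussian_integral_1d:
  fixes y :: real
  shows "integrable lborel (\<lambda>x. exp (- (pi * x\<^sup>2)))"
    and "(LINT x|lborel. complex_of_real (exp (- (pi * x\<^sup>2))) * exp (- (2 * complex_of_real pi * \<i> * complex_of_real (x * y))))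
      = complex_of_real (exp (- (pi * y\<^sup>2)))"
proof -
  \<comment> \<open>Substituting \<open>c * x\<close> in the standard normal density produces
    exp(-pi x^2), and evaluating its characteristic function at \<open>- c * y\<close> gives the
    phase -c^2 x y = -2 pi x y.\<close>
  define c where "c = sqrt (2 * pi)"
  have c: "c > 0" "c\<^sup>2 = 2 * pi" by (auto simp: c_def)
  have e: "std_normal_density (0 + c * x) = exp (- (pi * x\<^sup>2)) / c" for x
    by (simp add: std_normal_density_def c_def[symmetric] power_mult_distrib c)
  have "integrable lborel (\<lambda>x. std_normal_density (0 + c * x))"
    using c by (intro lborel_integrable_real_affine) (auto intro: integrable_normal_density)
  then have "integrable lborel (\<lambda>x. c * (exp (- (pi * x\<^sup>2)) / c))"
    unfolding e by (rule integrable_mult_right)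
  then show "integrable lborel (\<lambda>x. exp (- (pi * x\<^sup>2)))" using c by simp
  have "complex_of_real (exp (- ((- c * y)\<^sup>2) / 2)) = char std_normal_distribution (- c * y)"
    by (simp add: char_std_normal_distribution)
  also have "\<dots> = (LINT x|lborel. std_normal_density x *\<^sub>R exp (\<i> * complex_of_real (- c * y * x)))"
    unfolding char_def by (subst integral_density) (auto simp: normal_density_nonneg)
  also have "\<dots> = \<bar>c\<bar> *\<^sub>R (LINT x|lborel. std_normal_density (0 + c * x) *\<^sub>R exp (\<i> * complex_of_real (- c * y * (0 + c * x))))"
    using c by (subst lborel_integral_real_affine[of c _ 0]) auto
  also have "\<dots> = (LINT x|lborel. c *\<^sub>R (exp (- (pi * x\<^sup>2)) / c) *\<^sub>R exp (\<i> * complex_of_real (- c * y * (0 + c * x))))"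
    unfolding e using c by (simp only: abs_of_pos integral_scaleR_right)
  also have "\<dots> = (LINT x|lborel. complex_of_real (exp (- (pi * x\<^sup>2))) * exp (- (2 * complex_of_real pi * \<i> * complex_of_real (x * y))))"
  proof (intro Bochner_Integration.integral_cong refl)
    fix x
    have cc: "complex_of_real c * complex_of_real c = complex_of_real (2 * pi)"
      using c(2) by (simp add: power2_eq_square flip: of_real_mult)
    have "\<i> * complex_of_real (- c * y * (0 + c * x)) = - (\<i> * (complex_of_real c * complex_of_real c) * complex_of_real (x * y))"
      by (simp add: algebra_simps)
    also have "\<dots> = - (2 * complex_of_real pi * \<i> * complex_of_real (x * y))"
      unfolding cc by simp
    finally have ee: "\<i> * complex_of_real (- c * y * (0 + c * x)) = - (2 * complex_of_real pi * \<i> * complex_of_real (x * y))" .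
    have "c *\<^sub>R (a / c) *\<^sub>R z = complex_of_real a * z" for a and z :: complex
      using c by (simp add: scaleR_conv_of_real)
    then show "c *\<^sub>R (exp (- (pi * x\<^sup>2)) / c) *\<^sub>R exp (\<i> * complex_of_real (- c * y * (0 + c * x))) =
      complex_of_real (exp (- (pi * x\<^sup>2))) * exp (- (2 * complex_of_real pi * \<i> * complex_of_real (x * y)))"
      by (simp only: ee)
  qed
  finally show "(LINT x|lborel. complex_of_real (exp (- (pi * x\<^sup>2))) * exp (- (2 * complex_of_real pi * \<i> * complex_of_real (x * y))))
      = complex_of_real (exp (- (pi * y\<^sup>2)))"
    using c by (simp add: power_mult_distrib)
qed

text \<open>One substitution rule that serves translations (\<open>c = 1\<close>), reflections
  (\<open>c = - 1\<close>) and dilations alike.\<close>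

lemma
  fixes f :: "real ^ 'n \<Rightarrow> 'b::{banach,second_countable_topology}"
  assumes "c \<noteq> 0"
  shows integrable_affine_cart: "integrable lborel f \<Longrightarrow> integrable lborel (\<lambda>x. f (t + c *\<^sub>R x))"
    and integral_affine_cart: "f \<in> borel_measurable borel \<Longrightarrow>
      (LINT x|lborel. f x) = \<bar>c\<bar> ^ CARD('n) *\<^sub>R (LINT x|lborel. f (t + c *\<^sub>R x))"
proof -
  have l: "lborel = density (distr lborel borel (\<lambda>x :: real ^ 'n. t + c *\<^sub>R x)) (\<lambda>_. ennreal (\<bar>c\<bar> ^ CARD('n)))"
    using lborel_affine[OF assms, of t] by simp
  show "integrable lborel (\<lambda>x. f (t + c *\<^sub>R x))" if f: "integrable lborel f"
  proof -
    have [measurable]: "f \<in> borel_measurable borel" using f by (simp add: borel_measurable_integrable)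
    have "integrable (distr lborel borel (\<lambda>x :: real ^ 'n. t + c *\<^sub>R x)) (\<lambda>x. \<bar>c\<bar> ^ CARD('n) *\<^sub>R f x)"
      using f by (subst (asm) l, subst (asm) integrable_density) auto
    then have "integrable lborel (\<lambda>x. \<bar>c\<bar> ^ CARD('n) *\<^sub>R f (t + c *\<^sub>R x))"
      by (subst (asm) integrable_distr_eq) auto
    from integrable_scaleR_right[OF this, of "inverse (\<bar>c\<bar> ^ CARD('n))"] show ?thesis
      using assms by simp
  qed
  assume [measurable]: "f \<in> borel_measurable borel"
  have "(LINT x|lborel. f x) = (LINT x|distr lborel borel (\<lambda>x :: real ^ 'n. t + c *\<^sub>R x). \<bar>c\<bar> ^ CARD('n) *\<^sub>R f x)"
    by (subst l, subst integral_density) auto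
  also have "\<dots> = (LINT x|lborel. \<bar>c\<bar> ^ CARD('n) *\<^sub>R f (t + c *\<^sub>R x))"
    by (subst integral_distr) auto
  finally show "(LINT x|lborel. f x) = \<bar>c\<bar> ^ CARD('n) *\<^sub>R (LINT x|lborel. f (t + c *\<^sub>R x))"
    by simp
qed

lemma integrable_gauss_1: "integrable lborel (gauss 1 :: real ^ 'n \<Rightarrow> real)"
proof -
  have "integrable lborel (\<lambda>x :: real ^ 'n. \<Prod>i\<in>UNIV. exp (- (pi * (x $ i)\<^sup>2)))"
    by (rule integrable_prod_cart) (rule gaussian_integral_1d)
  then show ?thesis by (simp add: gauss_prod[abs_def])
qed

lemma integrable_gauss: "s \<noteq> 0 \<Longrightarrow> integrable lborel (gauss s :: real ^ 'n \<Rightarrow> real)"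
  using integrable_affine_cart[OF _ integrable_gauss_1[where 'n='n], of s 0] by (simp add: gauss_scale)

lemma fourier_transform_gauss_1:
  "fourier_transform (\<lambda>x :: real ^ 'n. complex_of_real (gauss 1 x)) y = complex_of_real (gauss 1 y)"
proof -
  have "fourier_transform (\<lambda>x :: real ^ 'n. complex_of_real (gauss 1 x)) y =
    (LINT x|lborel. (\<Prod>i\<in>UNIV. complex_of_real (exp (- (pi * (x $ i)\<^sup>2))) * exp (- (2 * complex_of_real pi * \<i> * complex_of_real (x $ i * y $ i)))))"
    unfolding fourier_transform_def
  proof (intro Bochner_Integration.integral_cong refl)
    fix x :: "real ^ 'n"
    have "exp (- (2 * complex_of_real pi * \<i> * complex_of_real (x \<bullet> y))) =
      (\<Prod>i\<in>UNIV. exp (- (2 * complex_of_real pi * \<i> * complex_of_real (x $ i * y $ i))))"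
      by (simp add: exp_sum[symmetric] inner_vec_def sum_distrib_left sum_negf)
    then show "complex_of_real (gauss 1 x) * exp (- (2 * complex_of_real pi * \<i> * complex_of_real (x \<bullet> y))) =
      (\<Prod>i\<in>UNIV. complex_of_real (exp (- (pi * (x $ i)\<^sup>2))) * exp (- (2 * complex_of_real pi * \<i> * complex_of_real (x $ i * y $ i))))"
      by (simp add: gauss_prod prod.distrib)
  qed
  also have "\<dots> = (\<Prod>i\<in>UNIV. complex_of_real (exp (- (pi * (y $ i)\<^sup>2))))"
  proof (subst integral_prod_cart[where f="\<lambda>i t. complex_of_real (exp (- (pi * t\<^sup>2))) * exp (- (2 * complex_of_real pi * \<i> * complex_of_real (t * y $ i)))"])
    fix i
    show "integrable lborel (\<lambda>t. complex_of_real (exp (- (pi * t\<^sup>2))) * exp (- (2 * complex_of_real pi * \<i> * complex_of_real (t * y $ i))))"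
      by (rule Bochner_Integration.integrable_bound[OF gaussian_integral_1d(1)]) (auto simp: norm_mult)
  qed (simp only: gaussian_integral_1d(2))
  also have "\<dots> = complex_of_real (gauss 1 y)" by (simp add: gauss_prod)
  finally show ?thesis .
qed

lemma fourier_transform_gauss:
  assumes "s > 0"
  shows "fourier_transform (\<lambda>x :: real ^ 'n. complex_of_real (gauss (1 / s) x)) y = complex_of_real (s ^ CARD('n) * gauss s y)"
proof -
  have "fourier_transform (\<lambda>x :: real ^ 'n. complex_of_real (gauss (1 / s) x)) y
     = \<bar>s\<bar> ^ CARD('n) *\<^sub>R (LINT x|lborel. complex_of_real (gauss (1 / s) (0 + s *\<^sub>R x)) * exp (- (2 * complex_of_real pi * \<i> * complex_of_real ((0 + s *\<^sub>R x) \<bullet> y))))"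
    unfolding fourier_transform_def
    using assms by (intro integral_affine_cart) auto
  also have "\<dots> = s ^ CARD('n) *\<^sub>R fourier_transform (\<lambda>x :: real ^ 'n. complex_of_real (gauss 1 x)) (s *\<^sub>R y)"
    unfolding fourier_transform_def using assms
    by (simp only: gauss_scale abs_of_pos inner_scaleR_left inner_scaleR_right add_0_left) simp
  also have "\<dots> = complex_of_real (s ^ CARD('n) * gauss s y)"
    unfolding fourier_transform_gauss_1 gauss_scale by (simp add: scaleR_conv_of_real)
  finally show ?thesis .
qed

lemma integral_gauss_1: "(LINT x|lborel. gauss 1 (x :: real ^ 'n)) = 1"
proof -
  have "complex_of_real (LINT x|lborel. gauss 1 (x :: real ^ 'n)) = fourier_transform (\<lambda>x :: real ^ 'n. complex_of_real (gauss 1 x)) 0"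
    by (simp add: fourier_transform_def)
  also have "\<dots> = 1" by (simp add: fourier_transform_gauss_1) (simp add: gauss_def)
  finally show ?thesis by (simp only: of_real_eq_1_iff)
qed

text \<open>The substitution u = x + v / s trades a kernel that concentrates with \<open>s\<close>
  for the fixed weight \<open>gauss 1\<close>, which then serves as the dominating function when
  \<open>s\<close> tends to infinity.\<close>

lemma gauss_smoothing_eq:
  fixes h :: "real ^ 'n \<Rightarrow> 'b::{banach,second_countable_topology}"
  assumes [measurable]: "h \<in> borel_measurable borel" and s: "s > 0"
  shows "(LINT u|lborel. (s ^ CARD('n) * gauss s (u - x)) *\<^sub>R h u) = (LINT v|lborel. gauss 1 v *\<^sub>R h (x + (1 / s) *\<^sub>R v))"
proof -
  have "(LINT u|lborel. (s ^ CARD('n) * gauss s (u - x)) *\<^sub>R h u) =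
    \<bar>1 / s\<bar> ^ CARD('n) *\<^sub>R (LINT v|lborel. (s ^ CARD('n) * gauss s ((x + (1 / s) *\<^sub>R v) - x)) *\<^sub>R h (x + (1 / s) *\<^sub>R v))"
    using s by (intro integral_affine_cart) auto
  also have "\<dots> = (LINT v|lborel. \<bar>1 / s\<bar> ^ CARD('n) *\<^sub>R (s ^ CARD('n) * gauss s ((x + (1 / s) *\<^sub>R v) - x)) *\<^sub>R h (x + (1 / s) *\<^sub>R v))"
    by (simp only: integral_scaleR_right)
  also have "\<dots> = (LINT v|lborel. gauss 1 v *\<^sub>R h (x + (1 / s) *\<^sub>R v))"
    using s by (intro Bochner_Integration.integral_cong refl) (simp add: gauss_scale power_divide)
  finally show ?thesis .
qed

lemma gauss_smoothing_tendsto: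
  fixes h :: "real ^ 'n \<Rightarrow> 'b::{banach,second_countable_topology}"
  assumes [measurable]: "h \<in> borel_measurable borel" and c: "isCont h x" and B: "\<And>u. norm (h u) \<le> B"
  shows "(\<lambda>k. LINT v|lborel. gauss 1 v *\<^sub>R h (x + (1 / real (Suc k)) *\<^sub>R v)) \<longlonglongrightarrow> h x"
proof -
  have w: "integrable lborel (\<lambda>v :: real ^ 'n. gauss 1 v * B)"
    using integrable_gauss_1[where 'n='n] by simp
  have lim: "AE v in lborel. (\<lambda>k. gauss 1 v *\<^sub>R h (x + (1 / real (Suc k)) *\<^sub>R v)) \<longlonglongrightarrow> gauss 1 v *\<^sub>R h x"
  proof (intro AE_I2 tendsto_scaleR tendsto_const)
    fix v
    have "(\<lambda>k. x + (1 / real (Suc k)) *\<^sub>R v) \<longlonglongrightarrow> x + 0 *\<^sub>R v"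
      by (intro tendsto_intros LIMSEQ_Suc[OF lim_inverse_n'])
    then show "(\<lambda>k. h (x + (1 / real (Suc k)) *\<^sub>R v)) \<longlonglongrightarrow> h x"
      using c by (intro isCont_tendsto_compose[OF c]) auto
  qed
  have bd: "AE v in lborel. norm (gauss 1 v *\<^sub>R h (x + (1 / real (Suc k)) *\<^sub>R v)) \<le> gauss 1 v * B" for k
    using B by (intro AE_I2) (auto intro!: mult_left_mono)
  have "(\<lambda>k. LINT v|lborel. gauss 1 v *\<^sub>R h (x + (1 / real (Suc k)) *\<^sub>R v)) \<longlonglongrightarrow> (LINT v|lborel. gauss 1 (v :: real ^ 'n) *\<^sub>R h x)"
    by (rule integral_dominated_convergence[OF _ _ w lim bd]) measurable
  moreover have "(LINT v|lborel. gauss 1 (v :: real ^ 'n) *\<^sub>R h x) = h x"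
    using integrable_gauss_1[where 'n='n] by (simp add: integral_gauss_1)
  ultimately show ?thesis by simp
qed

lemma norm_exp_fourier [simp]: "cmod (exp (- (2 * complex_of_real pi * \<i> * complex_of_real t))) = 1"
  by (simp add: norm_exp_eq_Re)

lemma fourier_transform_measurable [measurable]:
  assumes [measurable]: "f \<in> borel_measurable borel"
  shows "fourier_transform f \<in> borel_measurable borel"
  unfolding fourier_transform_def[abs_def] by measurable

lemma integrable_fourier_integrand:
  assumes "integrable lborel f"
  shows "integrable lborel (\<lambda>x. f x * exp (- (2 * complex_of_real pi * \<i> * complex_of_real (x \<bullet> y))))"
  using assms borel_measurable_integrable[OF assms]
  by (intro Bochner_Integration.integrable_bound[OF integrable_norm[OF assms]]) (auto simp: norm_mult)

lemma norm_fourier_transform_le: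
  "cmod (fourier_transform f y) \<le> (LINT x|lborel. cmod (f x))"
proof -
  have "cmod (fourier_transform f y) \<le> (LINT x|lborel. cmod (f x * exp (- (2 * complex_of_real pi * \<i> * complex_of_real (x \<bullet> y)))))"
    unfolding fourier_transform_def by (rule integral_norm_bound)
  then show ?thesis by (simp add: norm_mult)
qed

lemma exp_fourier_add:
  "exp (- (2 * complex_of_real pi * \<i> * complex_of_real (s + t))) =
    exp (- (2 * complex_of_real pi * \<i> * complex_of_real s)) * exp (- (2 * complex_of_real pi * \<i> * complex_of_real t))"
  by (simp add: exp_add[symmetric] ring_distribs)

text \<open>Damp the outer integral by the wide Gaussian \<open>gauss (1 / s)\<close> and exchange
  the integrals. The transform of the damping factor is the approximate identity
  \<open>s ^ CARD('n) * gauss s\<close> centred at -x, so the damped integral tends to f(-x); by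
  integrability of the transform it also tends to the undamped integral.\<close>

lemma fourier_inversion:
  fixes f :: "real ^ 'n \<Rightarrow> complex"
  assumes f: "integrable lborel f" and c: "continuous_on UNIV f" and B: "\<And>x. cmod (f x) \<le> B"
    and fh: "integrable lborel (fourier_transform f)"
  shows "fourier_transform (fourier_transform f) x = f (- x)"
proof -
  let ?e = "\<lambda>u y :: real ^ 'n. exp (- (2 * complex_of_real pi * \<i> * complex_of_real (u \<bullet> y)))"
  have fm [measurable]: "f \<in> borel_measurable borel" using c by (rule borel_measurable_continuous_onI)
  have eq: "(LINT y|lborel. fourier_transform f y * ?e y x * complex_of_real (gauss (1 / s) y)) =
      (LINT v|lborel. gauss 1 v *\<^sub>R f (- x + (1 / s) *\<^sub>R v))" if s: "s > 0" for s
  proof -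
    let ?g = "\<lambda>u y. f u * (?e (u + x) y * complex_of_real (gauss (1 / s) y))"
    \<comment> \<open>The Gaussian factor is what makes the double integrand absolutely integrable,
      so that Fubini applies.\<close>
    have int: "integrable (lborel \<Otimes>\<^sub>M lborel) (\<lambda>(u, y). ?g u y)"
    proof (rule lborel_pair.Fubini_integrable)
      show "integrable lborel (\<lambda>u. LINT y|lborel. norm (case (u, y) of (u, y) \<Rightarrow> ?g u y))"
        using f by (simp add: norm_mult)
      show "AE u in lborel. integrable lborel (\<lambda>y. case (u, y) of (u, y) \<Rightarrow> ?g u y)"
        using integrable_gauss[of "1 / s"] s
        by (auto intro!: AE_I2 integrable_mult_right Bochner_Integration.integrable_bound[OF integrable_gauss[of "1 / s"]] simp: norm_mult)
    qed measurable
    have "(LINT y|lborel. fourier_transform f y * ?e y x * complex_of_real (gauss (1 / s) y)) =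
      (LINT y|lborel. LINT u|lborel. ?g u y)"
    proof (intro Bochner_Integration.integral_cong refl)
      fix y :: "real ^ 'n"
      have "?e (u + x) y = ?e u y * ?e y x" for u
        unfolding inner_add_left exp_fourier_add by (simp add: inner_commute)
      then have "(LINT u|lborel. ?g u y) = (LINT u|lborel. f u * ?e u y * (?e y x * complex_of_real (gauss (1 / s) y)))"
        by (simp only: mult.assoc)
      also have "\<dots> = fourier_transform f y * (?e y x * complex_of_real (gauss (1 / s) y))"
        unfolding fourier_transform_def by (rule integral_mult_left_zero)
      finally show "fourier_transform f y * ?e y x * complex_of_real (gauss (1 / s) y) = (LINT u|lborel. ?g u y)"
        by (simp only: mult.assoc)
    qed
    also have "\<dots> = (LINT u|lborel. LINT y|lborel. ?g u y)"
      by (rule lborel_pair.Fubini_integral[OF int])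
    also have "\<dots> = (LINT u|lborel. f u * fourier_transform (\<lambda>y. complex_of_real (gauss (1 / s) y)) (u + x))"
      unfolding fourier_transform_def
      by (intro Bochner_Integration.integral_cong refl) (simp add: mult.commute inner_commute)
    also have "\<dots> = (LINT u|lborel. (s ^ CARD('n) * gauss s (u - (- x))) *\<^sub>R f u)"
      using s by (simp add: fourier_transform_gauss scaleR_conv_of_real mult.commute)
    also have "\<dots> = (LINT v|lborel. gauss 1 v *\<^sub>R f (- x + (1 / s) *\<^sub>R v))"
      by (rule gauss_smoothing_eq) (use s in auto)
    finally show ?thesis .
  qed
  have "(\<lambda>k. LINT y|lborel. fourier_transform f y * ?e y x * complex_of_real (gauss (1 / real (Suc k)) y))
     \<longlonglongrightarrow> (LINT y|lborel. fourier_transform f y * ?e y x)"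
  proof (rule integral_dominated_convergence[where w="\<lambda>y. cmod (fourier_transform f y)"])
    show "integrable lborel (\<lambda>y. cmod (fourier_transform f y))" using fh by simp
    show "AE y in lborel. (\<lambda>k. fourier_transform f y * ?e y x * complex_of_real (gauss (1 / real (Suc k)) y)) \<longlonglongrightarrow> fourier_transform f y * ?e y x"
    proof (intro AE_I2)
      fix y :: "real ^ 'n"
      have "(\<lambda>k. exp (- (pi * (1 / real (Suc k))\<^sup>2 * (norm y)\<^sup>2))) \<longlonglongrightarrow> exp (- (pi * 0\<^sup>2 * (norm y)\<^sup>2))"
        by (intro tendsto_intros LIMSEQ_Suc[OF lim_inverse_n'])
      then have "(\<lambda>k. gauss (1 / real (Suc k)) y) \<longlonglongrightarrow> 1" by (simp add: gauss_def)
      then have "(\<lambda>k. fourier_transform f y * ?e y x * complex_of_real (gauss (1 / real (Suc k)) y)) \<longlonglongrightarrow> fourier_transform f y * ?e y x * of_real 1"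
        by (intro tendsto_intros)
      then show "(\<lambda>k. fourier_transform f y * ?e y x * complex_of_real (gauss (1 / real (Suc k)) y)) \<longlonglongrightarrow> fourier_transform f y * ?e y x"
        by simp
    qed
    show "AE y in lborel. cmod (fourier_transform f y * ?e y x * complex_of_real (gauss (1 / real (Suc k)) y)) \<le> cmod (fourier_transform f y)" for k
      by (intro AE_I2) (simp add: norm_mult mult_left_le gauss_le_1)
  qed measurable
  then have 1: "(\<lambda>k. LINT v|lborel. gauss 1 v *\<^sub>R f (- x + (1 / real (Suc k)) *\<^sub>R v)) \<longlonglongrightarrow> fourier_transform (fourier_transform f) x"
    unfolding fourier_transform_def[of "fourier_transform f"] by (subst (asm) eq) auto
  have "(\<lambda>k. LINT v|lborel. gauss 1 v *\<^sub>R f (- x + (1 / real (Suc k)) *\<^sub>R v)) \<longlonglongrightarrow> f (- x)"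
    by (rule gauss_smoothing_tendsto[OF _ _ B]) (use c in \<open>auto simp: continuous_on_eq_continuous_at\<close>)
  with 1 show ?thesis by (rule LIMSEQ_unique)
qed

section \<open>Schwartz functions\<close>

text \<open>A product over coordinates instead of a power of the norm: integrability reduces to
  dimension one, and the reciprocal at 2 pi y is exactly the Fourier multiplier of the product of
  the operators 1 - d_i^2.\<close>

definition decay_weight :: "real ^ 'n \<Rightarrow> real" where
  "decay_weight x = (\<Prod>i\<in>UNIV. inverse (1 + (x $ i)\<^sup>2))"

lemma integrable_decay_weight: "integrable lborel (decay_weight :: real ^ 'n \<Rightarrow> real)"
proof -
  have "integrable lborel (\<lambda>t::real. inverse (1 + t\<^sup>2))"
    using integrable_inverse_1_plus_square by (simp add: set_integrable_def)
  then show ?thesis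
    unfolding decay_weight_def by (rule integrable_prod_cart)
qed

lemma decay_weight_pos: "0 < decay_weight x"
  unfolding decay_weight_def by (intro prod_pos) (auto simp: add_pos_nonneg)

text \<open>Lets one integrable function dominate all difference quotients with step at most 1. Each
  coordinate loses a factor 3: from x^2 \<le> 2 (x + u)^2 + 2 u^2, which is (x + 2 u)^2 \<ge> 0, and
  u^2 \<le> 1.\<close>

lemma decay_weight_shift:
  fixes x :: "real ^ 'n"
  assumes "\<bar>t\<bar> \<le> 1"
  shows "decay_weight (x + t *\<^sub>R axis i 1) \<le> 3 ^ CARD('n) * decay_weight x"
proof -
  have "inverse (1 + ((x + t *\<^sub>R axis i 1) $ j)\<^sup>2) \<le> 3 * inverse (1 + (x $ j)\<^sup>2)" for j
  proof -
    define u where "u = (x + t *\<^sub>R axis i 1) $ j - x $ j"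
    have "\<bar>u\<bar> \<le> 1" using assms by (auto simp: u_def axis_def)
    then have u2: "u\<^sup>2 \<le> 1" by (simp add: abs_square_le_1)
    have e: "(x + t *\<^sub>R axis i 1) $ j = x $ j + u" by (simp add: u_def)
    have "(x $ j)\<^sup>2 \<le> 2 * (x $ j + u)\<^sup>2 + 2 * u\<^sup>2"
      using zero_le_power2[of "x $ j + 2 * u"] by (simp add: power2_eq_square algebra_simps)
    moreover have "1 + a \<le> 3 * (1 + v)" if "a \<le> 2 * v + 2 * w" "w \<le> 1" "0 \<le> v" for a v w :: real
      using that by simp
    ultimately have "1 + (x $ j)\<^sup>2 \<le> 3 * (1 + (x $ j + u)\<^sup>2)"
      using u2 zero_le_power2[of "x $ j + u"] by blast
    then show ?thesis
      unfolding e by (simp add: field_simps add_pos_nonneg)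
  qed
  then have "decay_weight (x + t *\<^sub>R axis i 1) \<le> (\<Prod>j\<in>UNIV. 3 * inverse (1 + (x $ j)\<^sup>2))"
    unfolding decay_weight_def by (intro prod_mono) auto
  also have "\<dots> = 3 ^ CARD('n) * decay_weight x"
    by (simp add: decay_weight_def prod.distrib)
  finally show ?thesis .
qed

lemma schwartz_differentiable: "schwartz f \<Longrightarrow> f differentiable (at x)"
  unfolding schwartz_def by (drule spec[of _ "[]"]) simp

lemma schwartz_partial_derivative: "schwartz f \<Longrightarrow> schwartz (partial_derivative i f)"
  unfolding schwartz_def
proof (intro allI)
  fix "is"
  assume "\<forall>is. (\<forall>x. foldr partial_derivative is f differentiable at x) \<and>
             (\<forall>N. bounded (range (\<lambda>x. norm x ^ N *\<^sub>R foldr partial_derivative is f x)))"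
  \<comment> \<open>\<open>foldr\<close> applies the last list entry first, so appending
    \<open>i\<close> makes it the innermost derivative.\<close>
  from spec[OF this, of "is @ [i]"]
  show "(\<forall>x. foldr partial_derivative is (partial_derivative i f) differentiable at x) \<and>
             (\<forall>N. bounded (range (\<lambda>x. norm x ^ N *\<^sub>R foldr partial_derivative is (partial_derivative i f) x)))"
    by simp
qed

lemma schwartz_continuous: "schwartz f \<Longrightarrow> continuous_on UNIV f"
  by (intro differentiable_imp_continuous_on) (auto simp: differentiable_on_def dest: schwartz_differentiable intro: differentiable_at_withinI)

lemma schwartz_measurable: "schwartz f \<Longrightarrow> f \<in> borel_measurable borel"
  by (intro borel_measurable_continuous_onI schwartz_continuous)

lemma partial_derivative_diff:
  assumes "f differentiable (at x)" "g differentiable (at x)"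
  shows "partial_derivative i (\<lambda>x. f x - c * g x) x = partial_derivative i f x - c * partial_derivative i g x"
proof -
  have f: "(f has_derivative frechet_derivative f (at x)) (at x)"
   and g: "(g has_derivative frechet_derivative g (at x)) (at x)"
    using assms frechet_derivative_works by blast+
  have "((\<lambda>x. f x - c * g x) has_derivative (\<lambda>h. frechet_derivative f (at x) h - c * frechet_derivative g (at x) h)) (at x)"
    by (intro has_derivative_diff has_derivative_mult_right f g)
  from frechet_derivative_at[OF this] show ?thesis
    by (simp add: partial_derivative_def fun_eq_iff)
qed

lemma schwartz_diff:
  assumes f: "schwartz f" and g: "schwartz g"
  shows "schwartz (\<lambda>x. f x - c * g x)"
proof -
  have eq: "foldr partial_derivative is (\<lambda>x. f x - c * g x) =
      (\<lambda>x. foldr partial_derivative is f x - c * foldr partial_derivative is g x)" for "is"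
  proof (induction "is")
    case (Cons i "is")
    have d: "foldr partial_derivative is f differentiable (at x)" "foldr partial_derivative is g differentiable (at x)" for x
      using f g by (auto simp: schwartz_def)
    show ?case
      unfolding foldr_Cons o_apply Cons by (intro ext partial_derivative_diff d)
  qed simp
  show ?thesis
    unfolding schwartz_def eq
  proof (intro allI conjI)
    fix "is" x
    show "(\<lambda>x. foldr partial_derivative is f x - c * foldr partial_derivative is g x) differentiable at x"
      using f g by (intro differentiable_diff differentiable_mult) (auto simp: schwartz_def)
  next
    fix "is" and N :: nat
    have bf: "bounded (range (\<lambda>x. norm x ^ N *\<^sub>R foldr partial_derivative is f x))"
     and bg: "bounded (range (\<lambda>x. norm x ^ N *\<^sub>R foldr partial_derivative is g x))"
      using f g by (auto simp: schwartz_def)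
    obtain a where a: "\<And>x. cmod (norm x ^ N *\<^sub>R foldr partial_derivative is f x) \<le> a"
      using bf by (auto simp: bounded_iff)
    obtain b where b: "\<And>x. cmod (norm x ^ N *\<^sub>R foldr partial_derivative is g x) \<le> b"
      using bg by (auto simp: bounded_iff)
    show "bounded (range (\<lambda>x. norm x ^ N *\<^sub>R (foldr partial_derivative is f x - c * foldr partial_derivative is g x)))"
      unfolding bounded_iff
    proof (intro exI[of _ "a + cmod c * b"] ballI, elim rangeE)
      fix z x
      assume z: "z = norm x ^ N *\<^sub>R (foldr partial_derivative is f x - c * foldr partial_derivative is g x)"
      have "z = norm x ^ N *\<^sub>R foldr partial_derivative is f x - c * (norm x ^ N *\<^sub>R foldr partial_derivative is g x)"
        unfolding z by (simp add: scaleR_diff_right)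
      also have "cmod \<dots> \<le> cmod (norm x ^ N *\<^sub>R foldr partial_derivative is f x) + cmod (c * (norm x ^ N *\<^sub>R foldr partial_derivative is g x))"
        by (rule norm_triangle_ineq4)
      also have "\<dots> \<le> a + cmod c * b"
        unfolding norm_mult[of c] by (intro add_mono mult_left_mono a b) auto
      finally show "cmod z \<le> a + cmod c * b" .
    qed
  qed
qed

lemma inverse_decay_weight_le:
  fixes x :: "real ^ 'n"
  shows "inverse (decay_weight x) \<le> 2 ^ CARD('n) * (1 + norm x ^ (2 * CARD('n)))"
proof -
  have "inverse (decay_weight x) = (\<Prod>i\<in>UNIV. 1 + (x $ i)\<^sup>2)"
    by (simp add: decay_weight_def prod_inversef[symmetric])
  also have "\<dots> \<le> (\<Prod>i\<in>(UNIV::'n set). 1 + (norm x)\<^sup>2)"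
    using component_le_norm_cart[of x] by (intro prod_mono) (auto simp: abs_le_square_iff[symmetric])
  also have "\<dots> = (1 + (norm x)\<^sup>2) ^ CARD('n)" by simp
  also have "\<dots> \<le> (2 * max 1 ((norm x)\<^sup>2)) ^ CARD('n)"
    by (intro power_mono) auto
  also have "\<dots> = 2 ^ CARD('n) * max 1 ((norm x)\<^sup>2) ^ CARD('n)" by (simp add: power_mult_distrib)
  also have "max 1 ((norm x)\<^sup>2) ^ CARD('n) \<le> 1 + norm x ^ (2 * CARD('n))"
    by (auto simp: max_def power_mult)
  finally show ?thesis by simp
qed

text \<open>The reciprocal of the weight is a polynomial of degree twice the dimension, so the
  seminorms with exponents 0 and \<open>2 * CARD('n)\<close> give the bound.\<close>

lemma schwartz_decay:
  fixes f :: "real ^ 'n \<Rightarrow> complex"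
  assumes "schwartz f"
  shows "\<exists>C. \<forall>x. cmod (f x) \<le> C * decay_weight x"
proof -
  have b: "bounded (range (\<lambda>x. norm x ^ N *\<^sub>R f x))" for N
    using spec[OF assms[unfolded schwartz_def], of "[]"] by simp
  obtain a where a: "\<And>x. cmod (norm x ^ 0 *\<^sub>R f x) \<le> a"
    using b[of 0] unfolding bounded_iff by blast
  obtain b where b: "\<And>x. cmod (norm x ^ (2 * CARD('n)) *\<^sub>R f x) \<le> b"
    using b[of "2 * CARD('n)"] unfolding bounded_iff by blast
  have "cmod (f x) \<le> (2 ^ CARD('n) * (a + b)) * decay_weight x" for x
  proof -
    have "cmod (f x) * inverse (decay_weight x) \<le> cmod (f x) * (2 ^ CARD('n) * (1 + norm x ^ (2 * CARD('n))))"
      by (intro mult_left_mono inverse_decay_weight_le) auto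
    also have "\<dots> = 2 ^ CARD('n) * (cmod (norm x ^ 0 *\<^sub>R f x) + cmod (norm x ^ (2 * CARD('n)) *\<^sub>R f x))"
      by (simp add: algebra_simps)
    also have "\<dots> \<le> 2 ^ CARD('n) * (a + b)"
      using a[of x] b[of x] by (intro mult_left_mono add_mono) auto
    finally show ?thesis
      using decay_weight_pos[of x] by (simp add: field_simps)
  qed
  then show ?thesis by blast
qed

lemma schwartz_integrable:
  assumes "schwartz f"
  shows "integrable lborel f"
proof -
  obtain C where C: "\<And>x. cmod (f x) \<le> C * decay_weight x" using schwartz_decay[OF assms] by blast
  have "integrable lborel (\<lambda>x. C * decay_weight x)"
    by (intro integrable_mult_right integrable_decay_weight)
  then show ?thesis
    by (rule Bochner_Integration.integrable_bound)
      (use schwartz_measurable[OF assms] C in \<open>auto intro: order_trans[OF _ abs_ge_self]\<close>)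
qed

lemma schwartz_bounded:
  assumes "schwartz f"
  shows "\<exists>B. \<forall>x. cmod (f x) \<le> B"
proof -
  have "bounded (range (\<lambda>x. norm x ^ 0 *\<^sub>R f x))"
    using spec[OF assms[unfolded schwartz_def], of "[]"] unfolding foldr_Nil id_apply by blast
  then show ?thesis unfolding bounded_iff by auto
qed

section \<open>Differentiation and decay on the Fourier side\<close>

lemma has_vector_derivative_partial:
  assumes "f differentiable (at (x + t *\<^sub>R axis i 1))"
  shows "((\<lambda>t. f (x + t *\<^sub>R axis i 1)) has_vector_derivative partial_derivative i f (x + t *\<^sub>R axis i 1)) (at t within S)"
proof -
  let ?D = "frechet_derivative f (at (x + t *\<^sub>R axis i 1))"
  have f: "(f has_derivative ?D) (at (x + t *\<^sub>R axis i 1))"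
    using assms frechet_derivative_works by blast
  have g: "((\<lambda>t. x + t *\<^sub>R axis i (1::real)) has_derivative (\<lambda>h. h *\<^sub>R axis i 1)) (at t within S)"
    by (auto intro!: derivative_eq_intros)
  have "((\<lambda>t. f (x + t *\<^sub>R axis i 1)) has_derivative (\<lambda>h. ?D (h *\<^sub>R axis i 1))) (at t within S)"
    by (rule has_derivative_compose[OF g f])
  moreover have "?D (h *\<^sub>R axis i 1) = h *\<^sub>R partial_derivative i f (x + t *\<^sub>R axis i 1)" for h
    using linear_frechet_derivative[OF assms] by (simp add: partial_derivative_def linear_cmul)
  ultimately show ?thesis by (simp add: has_vector_derivative_def)
qed

lemma difference_quotient_LIMSEQ:
  fixes \<phi> :: "real \<Rightarrow> complex"
  assumes d: "(\<phi> has_vector_derivative d) (at 0)" and h: "h \<longlonglongrightarrow> 0" "\<And>k. h k \<noteq> 0"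
  shows "(\<lambda>k. (\<phi> (h k) - \<phi> 0) / complex_of_real (h k)) \<longlonglongrightarrow> d"
proof -
  have "((\<lambda>t. norm (\<phi> (0 + t) - \<phi> 0 - t *\<^sub>R d) / norm t) \<longlongrightarrow> 0) (at 0)"
    using d unfolding has_vector_derivative_def has_derivative_at by blast
  moreover have "filterlim h (at 0) sequentially"
    using h by (simp add: filterlim_at)
  ultimately have "(\<lambda>k. norm (\<phi> (0 + h k) - \<phi> 0 - h k *\<^sub>R d) / norm (h k)) \<longlonglongrightarrow> 0"
    by (rule filterlim_compose)
  moreover have "norm (\<phi> (0 + h k) - \<phi> 0 - h k *\<^sub>R d) / norm (h k) = norm ((\<phi> (h k) - \<phi> 0) / complex_of_real (h k) - d)" for k
  proof -
    have "(\<phi> (h k) - \<phi> 0) / complex_of_real (h k) - d = (\<phi> (0 + h k) - \<phi> 0 - h k *\<^sub>R d) / complex_of_real (h k)"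
      using h(2)[of k] by (simp add: scaleR_conv_of_real field_simps)
    then show ?thesis by (simp add: norm_divide)
  qed
  ultimately have "(\<lambda>k. (\<phi> (h k) - \<phi> 0) / complex_of_real (h k) - d) \<longlonglongrightarrow> 0"
    by (simp add: tendsto_norm_zero_iff)
  then show ?thesis by (rule LIM_zero_cancel)
qed

text \<open>Translation by \<open>h\<close> along axis \<open>i\<close> multiplies the transform by
  exp(2 pi i h y_i). The transform of a difference quotient is therefore the transform of f times
  the difference quotient of this phase; letting \<open>h\<close> tend to 0 on both sides replaces
  an integration by parts.\<close>

lemma fourier_transform_partial_derivative:
  fixes f :: "real ^ 'n \<Rightarrow> complex"
  assumes f: "schwartz f"
  shows "fourier_transform (partial_derivative i f) y = 2 * complex_of_real pi * \<i> * complex_of_real (y $ i) * fourier_transform f y"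
proof -
  let ?e = "\<lambda>x :: real ^ 'n. exp (- (2 * complex_of_real pi * \<i> * complex_of_real (x \<bullet> y)))"
  let ?g = "partial_derivative i f"
  define h where "h k = 1 / real (Suc k)" for k
  have h: "0 < h k" "h k \<le> 1" for k by (auto simp: h_def)
  have h0: "h \<longlonglongrightarrow> 0" unfolding h_def by (rule LIMSEQ_Suc[OF lim_inverse_n'])
  let ?q = "\<lambda>k x. (f (x + h k *\<^sub>R axis i 1) - f x) / complex_of_real (h k)"
  have g: "schwartz ?g" using f by (rule schwartz_partial_derivative)
  have [measurable]: "f \<in> borel_measurable borel" "?g \<in> borel_measurable borel"
    using f g by (auto intro: schwartz_measurable)
  obtain C where C: "\<And>x. cmod (?g x) \<le> C * decay_weight x" using schwartz_decay[OF g] by blast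
  have C0: "0 \<le> C" using order_trans[OF norm_ge_zero C[of 0]] decay_weight_pos[of "0 :: real ^ 'n"]
    by (simp add: zero_le_mult_iff)
  \<comment> \<open>Mean value inequality on the segment from x to x + h e_i; steps of length at
    most 1 stay within the range of \<open>decay_weight_shift\<close>.\<close>
  have q_bound: "cmod (?q k x) \<le> C * (3 ^ CARD('n) * decay_weight x)" for k x
  proof -
    have "cmod (f (x + h k *\<^sub>R axis i 1) - f (x + 0 *\<^sub>R axis i 1)) \<le> C * (3 ^ CARD('n) * decay_weight x) * norm (h k - 0)"
    proof (rule differentiable_bound[where S="{0..1}"])
      fix t :: real assume t: "t \<in> {0..1}"
      show "((\<lambda>t. f (x + t *\<^sub>R axis i 1)) has_derivative (\<lambda>s. s *\<^sub>R ?g (x + t *\<^sub>R axis i 1))) (at t within {0..1})"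
        using has_vector_derivative_partial[OF schwartz_differentiable[OF f]]
        unfolding has_vector_derivative_def .
      have "norm (s *\<^sub>R ?g (x + t *\<^sub>R axis i 1)) \<le> C * (3 ^ CARD('n) * decay_weight x) * norm s" for s
      proof -
        have "cmod (?g (x + t *\<^sub>R axis i 1)) \<le> C * decay_weight (x + t *\<^sub>R axis i 1)" by (rule C)
        also have "\<dots> \<le> C * (3 ^ CARD('n) * decay_weight x)"
          using t by (intro mult_left_mono decay_weight_shift C0) auto
        finally have "\<bar>s\<bar> * cmod (?g (x + t *\<^sub>R axis i 1)) \<le> \<bar>s\<bar> * (C * (3 ^ CARD('n) * decay_weight x))"
          by (intro mult_left_mono) auto
        then show ?thesis by (simp add: mult.commute)
      qed
      then show "onorm (\<lambda>s. s *\<^sub>R ?g (x + t *\<^sub>R axis i 1)) \<le> C * (3 ^ CARD('n) * decay_weight x)"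
        by (rule onorm_le)
    qed (use h[of k] in \<open>auto intro: less_imp_le\<close>)
    then show ?thesis using h[of k] by (simp add: norm_divide divide_le_eq)
  qed
  have q_lim: "(\<lambda>k. ?q k x) \<longlonglongrightarrow> ?g x" for x
  proof -
    have "((\<lambda>t. f (x + t *\<^sub>R axis i 1)) has_vector_derivative ?g (x + 0 *\<^sub>R axis i 1)) (at 0)"
      using schwartz_differentiable[OF f] by (intro has_vector_derivative_partial)
    from difference_quotient_LIMSEQ[OF this h0] show ?thesis using h(1) by (simp add: less_imp_neq[symmetric])
  qed
  have w: "integrable lborel (\<lambda>x. C * (3 ^ CARD('n) * decay_weight x) :: real)"
    by (intro integrable_mult_right integrable_decay_weight)
  have bd: "AE x in lborel. cmod (?q k x * ?e x) \<le> C * (3 ^ CARD('n) * decay_weight x)" for k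
    using q_bound by (intro AE_I2) (simp only: norm_mult norm_exp_fourier mult_1_right)
  have lm: "AE x in lborel. (\<lambda>k. ?q k x * ?e x) \<longlonglongrightarrow> ?g x * ?e x"
    by (intro AE_I2 tendsto_mult q_lim tendsto_const)
  have lim1: "(\<lambda>k. LINT x|lborel. ?q k x * ?e x) \<longlonglongrightarrow> fourier_transform ?g y"
    unfolding fourier_transform_def[of ?g]
    by (rule integral_dominated_convergence[OF _ _ w lm bd]) measurable
  have fe: "integrable lborel (\<lambda>x. f x * ?e x)"
    by (rule integrable_fourier_integrand[OF schwartz_integrable[OF f]])
  have eq: "(LINT x|lborel. ?q k x * ?e x) =
      fourier_transform f y * ((exp (- (2 * complex_of_real pi * \<i> * complex_of_real (- h k * y $ i))) - 1) / complex_of_real (h k))" for k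
  proof -
    let ?c = "exp (- (2 * complex_of_real pi * \<i> * complex_of_real (- h k * y $ i)))"
    have e: "?e x = ?c * ?e (h k *\<^sub>R axis i 1 + 1 *\<^sub>R x)" for x
      unfolding exp_fourier_add[symmetric]
      by (simp add: inner_add_left inner_axis' algebra_simps)
    have fe': "integrable lborel (\<lambda>x. f (h k *\<^sub>R axis i 1 + 1 *\<^sub>R x) * ?e (h k *\<^sub>R axis i 1 + 1 *\<^sub>R x))"
      by (rule integrable_affine_cart[OF _ fe]) simp
    have sh: "fourier_transform f y = (LINT x|lborel. f (h k *\<^sub>R axis i 1 + 1 *\<^sub>R x) * ?e (h k *\<^sub>R axis i 1 + 1 *\<^sub>R x))"
      unfolding fourier_transform_def
      by (subst integral_affine_cart[of 1 _ "h k *\<^sub>R axis i 1"]) auto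
    have "(LINT x|lborel. ?q k x * ?e x) =
      (LINT x|lborel. (f (h k *\<^sub>R axis i 1 + 1 *\<^sub>R x) * ?e (h k *\<^sub>R axis i 1 + 1 *\<^sub>R x)) * (?c / complex_of_real (h k)) - (f x * ?e x) * (1 / complex_of_real (h k)))"
    proof (intro Bochner_Integration.integral_cong refl)
      fix x
      show "?q k x * ?e x = (f (h k *\<^sub>R axis i 1 + 1 *\<^sub>R x) * ?e (h k *\<^sub>R axis i 1 + 1 *\<^sub>R x)) * (?c / complex_of_real (h k)) - (f x * ?e x) * (1 / complex_of_real (h k))"
        using e[of x] by (simp add: diff_divide_distrib left_diff_distrib add.commute) 
    qed
    also have "\<dots> = fourier_transform f y * (?c / complex_of_real (h k)) - fourier_transform f y * (1 / complex_of_real (h k))"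
      by (subst Bochner_Integration.integral_diff)
        (use fe fe' in \<open>simp_all only: integrable_mult_left integral_mult_left_zero sh[symmetric] fourier_transform_def[symmetric]\<close>)
    finally show ?thesis by (simp add: algebra_simps diff_divide_distrib)
  qed
  let ?a = "2 * complex_of_real pi * \<i> * complex_of_real (y $ i)"
  have "((\<lambda>t. exp (t *\<^sub>R ?a)) has_vector_derivative exp (0 *\<^sub>R ?a) * ?a) (at 0)"
    by (rule exp_scaleR_has_vector_derivative_right)
  then have d: "((\<lambda>t. exp (t *\<^sub>R ?a)) has_vector_derivative ?a) (at 0)" by simp
  have hn: "h k \<noteq> 0" for k using h(1)[of k] by simp
  have ea: "exp (- (2 * complex_of_real pi * \<i> * complex_of_real (- h k * y $ i))) = exp (h k *\<^sub>R ?a)" for k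
    by (simp add: scaleR_conv_of_real mult_ac)
  have lim2: "(\<lambda>k. (exp (- (2 * complex_of_real pi * \<i> * complex_of_real (- h k * y $ i))) - 1) / complex_of_real (h k)) \<longlonglongrightarrow> ?a"
    using difference_quotient_LIMSEQ[OF d h0 hn] unfolding ea by simp
  have "(\<lambda>k. LINT x|lborel. ?q k x * ?e x) \<longlonglongrightarrow> fourier_transform f y * (2 * complex_of_real pi * \<i> * complex_of_real (y $ i))"
    unfolding eq by (intro tendsto_mult lim2 tendsto_const)
  from LIMSEQ_unique[OF lim1 this] show ?thesis by (simp add: mult.commute)
qed

text \<open>The function \<open>g\<close> arises from \<open>f\<close> by applying 1 - d_i^2 for
  each i in \<open>I\<close>, one coordinate at a time.\<close>

lemma schwartz_fourier_weight:
  fixes f :: "real ^ 'n \<Rightarrow> complex"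
  assumes f: "schwartz f"
  shows "\<exists>g. schwartz g \<and> (\<forall>y. fourier_transform g y = (\<Prod>i\<in>I. complex_of_real (1 + (2 * pi * y $ i)\<^sup>2)) * fourier_transform f y)"
  using finite[of I]
proof (induction I rule: finite_induct)
  case empty
  show ?case using f by (intro exI[of _ f]) simp
next
  case (insert i I)
  then obtain g where g: "schwartz g" "\<And>y. fourier_transform g y = (\<Prod>i\<in>I. complex_of_real (1 + (2 * pi * y $ i)\<^sup>2)) * fourier_transform f y"
    by blast
  let ?g = "\<lambda>x. g x - 1 * partial_derivative i (partial_derivative i g) x"
  have d: "schwartz (partial_derivative i g)" "schwartz (partial_derivative i (partial_derivative i g))"
    using g(1) by (auto intro: schwartz_partial_derivative)
  have "fourier_transform ?g y = (\<Prod>i\<in>insert i I. complex_of_real (1 + (2 * pi * y $ i)\<^sup>2)) * fourier_transform f y" for y :: "real ^ 'n"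
  proof -
    have "fourier_transform ?g y = fourier_transform g y - fourier_transform (partial_derivative i (partial_derivative i g)) y"
      unfolding fourier_transform_def
      by (simp add: left_diff_distrib Bochner_Integration.integral_diff integrable_fourier_integrand schwartz_integrable g(1) d(2))
    also have "\<dots> = complex_of_real (1 + (2 * pi * y $ i)\<^sup>2) * fourier_transform g y"
      by (simp add: fourier_transform_partial_derivative g(1) d(1) power2_eq_square algebra_simps)
    finally show ?thesis
      using insert(1,2) g(2) by (simp add: mult.assoc)
  qed
  then show ?case using schwartz_diff[OF g(1) d(2), of 1] by blast
qed

text \<open>With all coordinates in \<open>I\<close> the transform of \<open>g\<close> is bounded by
  the integral of its modulus; dividing by the multiplier leaves a constant times
  \<open>decay_weight\<close> at 2 pi y, which is integrable.\<close>

lemma schwartz_fourier_integrable: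
  fixes f :: "real ^ 'n \<Rightarrow> complex"
  assumes f: "schwartz f"
  shows "integrable lborel (fourier_transform f)"
proof -
  obtain g where g: "schwartz g" "\<And>y. fourier_transform g y = (\<Prod>i\<in>UNIV. complex_of_real (1 + (2 * pi * y $ i)\<^sup>2)) * fourier_transform f y"
    using schwartz_fourier_weight[OF f, of UNIV] by blast
  have [measurable]: "f \<in> borel_measurable borel" using f by (rule schwartz_measurable)
  define A where "A = (LINT x|lborel. cmod (g x))"
  have w: "integrable lborel (\<lambda>y :: real ^ 'n. A * decay_weight (0 + (2 * pi) *\<^sub>R y))"
    by (intro integrable_mult_right integrable_affine_cart integrable_decay_weight) simp
  show ?thesis
  proof (rule Bochner_Integration.integrable_bound[OF w])
    show "AE y in lborel. norm (fourier_transform f y) \<le> norm (A * decay_weight (0 + (2 * pi) *\<^sub>R y))"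
    proof (intro AE_I2)
      fix y :: "real ^ 'n"
      have d: "decay_weight (0 + (2 * pi) *\<^sub>R y) > 0" by (rule decay_weight_pos)
      have n: "norm (\<Prod>i\<in>UNIV. complex_of_real (1 + (2 * pi * y $ i)\<^sup>2)) = inverse (decay_weight (0 + (2 * pi) *\<^sub>R y))"
        by (simp add: decay_weight_def prod_inversef[symmetric] norm_mult power_mult_distrib flip: of_real_prod of_real_add of_real_mult of_real_power)
          (simp add: prod_nonneg)
      have "norm (fourier_transform g y) \<le> A" unfolding A_def by (rule norm_fourier_transform_le)
      then have "inverse (decay_weight (0 + (2 * pi) *\<^sub>R y)) * cmod (fourier_transform f y) \<le> A"
        unfolding g(2) norm_mult n .
      then have "cmod (fourier_transform f y) \<le> A * decay_weight (0 + (2 * pi) *\<^sub>R y)"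
        using d by (simp add: field_simps)
      then show "norm (fourier_transform f y) \<le> norm (A * decay_weight (0 + (2 * pi) *\<^sub>R y))"
        by (rule order_trans) simp
    qed
  qed measurable
qed

section \<open>Measures are determined by Schwartz functions\<close>

text \<open>Closed under partial derivatives, so that Gaussians are seen to be Schwartz functions by induction.\<close>

inductive_set poly_gauss :: "real \<Rightarrow> real ^ 'n \<Rightarrow> (real ^ 'n \<Rightarrow> complex) set"
  for a :: real and b :: "real ^ 'n" where
  base: "(\<lambda>x. complex_of_real (exp (b \<bullet> x - a * (x \<bullet> x)))) \<in> poly_gauss a b"
| add: "f \<in> poly_gauss a b \<Longrightarrow> g \<in> poly_gauss a b \<Longrightarrow> (\<lambda>x. f x + g x) \<in> poly_gauss a b"
| scale: "f \<in> poly_gauss a b \<Longrightarrow> (\<lambda>x. c * f x) \<in> poly_gauss a b"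
| coord: "f \<in> poly_gauss a b \<Longrightarrow> (\<lambda>x. complex_of_real (x $ i) * f x) \<in> poly_gauss a b"

lemma poly_gauss_derivative:
  assumes "f \<in> poly_gauss a b"
  shows "\<exists>D. (\<forall>x. (f has_derivative D x) (at x)) \<and> (\<forall>j. (\<lambda>x. D x (axis j 1)) \<in> poly_gauss a b)"
  using assms
proof induction
  case base
  let ?E = "\<lambda>x. complex_of_real (exp (b \<bullet> x - a * (x \<bullet> x)))"
  let ?D = "\<lambda>x h. complex_of_real (exp (b \<bullet> x - a * (x \<bullet> x)) * (b \<bullet> h - a * (2 * (x \<bullet> h))))"
  have "(?E has_derivative ?D x) (at x)" for x
    by (rule has_derivative_of_real, rule derivative_eq_intros)
      (auto intro!: derivative_eq_intros simp: inner_commute)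
  moreover have "(\<lambda>x. ?D x (axis j 1)) \<in> poly_gauss a b" for j
  proof -
    have eq: "(\<lambda>x. ?D x (axis j 1)) = (\<lambda>x. complex_of_real (b $ j) * ?E x + complex_of_real (- 2 * a) * (complex_of_real (x $ j) * ?E x))"
      by (simp add: inner_axis algebra_simps)
    show ?thesis unfolding eq
      by (intro poly_gauss.intros)
  qed
  ultimately show ?case by (intro exI[of _ ?D] conjI allI)
next
  case (add f g)
  then obtain D D' where D: "\<And>x. (f has_derivative D x) (at x)" "\<And>j. (\<lambda>x. D x (axis j 1)) \<in> poly_gauss a b"
    "\<And>x. (g has_derivative D' x) (at x)" "\<And>j. (\<lambda>x. D' x (axis j 1)) \<in> poly_gauss a b" by blast
  show ?case
    by (intro exI[of _ "\<lambda>x h. D x h + D' x h"] conjI allI has_derivative_add poly_gauss.add D)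
next
  case (scale f c)
  then obtain D where D: "\<And>x. (f has_derivative D x) (at x)" "\<And>j. (\<lambda>x. D x (axis j 1)) \<in> poly_gauss a b" by blast
  show ?case
    by (intro exI[of _ "\<lambda>x h. c * D x h"] conjI allI has_derivative_mult_right poly_gauss.scale D)
next
  case (coord f i)
  then obtain D where D: "\<And>x. (f has_derivative D x) (at x)" "\<And>j. (\<lambda>x. D x (axis j 1)) \<in> poly_gauss a b" by blast
  let ?D = "\<lambda>x h. complex_of_real (x $ i) * D x h + complex_of_real (h $ i) * f x"
  have "((\<lambda>x. complex_of_real (x $ i) * f x) has_derivative ?D x) (at x)" for x
    by (intro has_derivative_mult has_derivative_of_real D bounded_linear_imp_has_derivative bounded_linear_vec_nth)
  moreover have "(\<lambda>x. ?D x (axis j 1)) \<in> poly_gauss a b" for j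
    by (intro poly_gauss.add poly_gauss.coord poly_gauss.scale D coord)
  ultimately show ?case by (intro exI[of _ ?D] conjI allI)
qed

text \<open>One term of the exponential series gives r^N \<le> N! exp r; completing the square
  bounds the remaining exponent.\<close>

lemma pow_gauss_bound:
  fixes r a \<beta> :: real
  assumes "0 < a" "0 \<le> r"
  shows "r ^ N * exp (\<beta> * r - a * r\<^sup>2) \<le> fact N * exp ((\<beta> + 1)\<^sup>2 / (4 * a))"
proof -
  have "r ^ N / fact N \<le> exp r"
  proof -
    have "(\<Sum>n\<in>{N}. r ^ n /\<^sub>R fact n) \<le> (\<Sum>n. r ^ n /\<^sub>R fact n)"
      using assms by (intro sum_le_suminf summable_exp_generic) auto
    then show ?thesis by (simp add: exp_def divide_inverse mult.commute)
  qed
  then have "r ^ N \<le> fact N * exp r" by (simp add: field_simps)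
  then have "r ^ N * exp (\<beta> * r - a * r\<^sup>2) \<le> fact N * exp r * exp (\<beta> * r - a * r\<^sup>2)"
    by (intro mult_right_mono) auto
  also have "\<dots> = fact N * exp ((\<beta> + 1) * r - a * r\<^sup>2)"
    by (simp add: exp_add[symmetric] algebra_simps)
  also have "\<dots> \<le> fact N * exp ((\<beta> + 1)\<^sup>2 / (4 * a))"
  proof -
    have "0 \<le> (\<beta> + 1 - 2 * a * r)\<^sup>2 / (4 * a)" using assms by simp
    also have "\<dots> = (\<beta> + 1)\<^sup>2 / (4 * a) - ((\<beta> + 1) * r - a * r\<^sup>2)"
      using assms by (simp add: field_simps power2_eq_square)
    finally show ?thesis by simp
  qed
  finally show ?thesis .
qed

lemma poly_gauss_bounded:
  assumes "f \<in> poly_gauss a b" "0 < a"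
  shows "\<exists>B. \<forall>x. norm x ^ N * cmod (f x) \<le> B"
  using assms(1)
proof (induction arbitrary: N)
  case base
  have "norm x ^ N * cmod (complex_of_real (exp (b \<bullet> x - a * (x \<bullet> x)))) \<le> fact N * exp ((norm b + 1)\<^sup>2 / (4 * a))" for x
  proof -
    have "norm x ^ N * exp (b \<bullet> x - a * (x \<bullet> x)) \<le> norm x ^ N * exp (norm b * norm x - a * (norm x)\<^sup>2)"
      using norm_cauchy_schwarz[of b x] by (intro mult_left_mono) (auto simp: power2_norm_eq_inner)
    also have "\<dots> \<le> fact N * exp ((norm b + 1)\<^sup>2 / (4 * a))"
      using assms(2) by (intro pow_gauss_bound) auto
    finally show ?thesis by simp
  qed
  then show ?case by blast
next
  case (add f g)
  then obtain B B' where B: "\<And>x. norm x ^ N * cmod (f x) \<le> B" "\<And>x. norm x ^ N * cmod (g x) \<le> B'" by metis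
  have "norm x ^ N * cmod (f x + g x) \<le> B + B'" for x
  proof -
    have "norm x ^ N * cmod (f x + g x) \<le> norm x ^ N * (cmod (f x) + cmod (g x))"
      by (intro mult_left_mono norm_triangle_ineq) auto
    then show ?thesis using B(1)[of x] B(2)[of x] by (simp add: distrib_left)
  qed
  then show ?case by blast
next
  case (scale f c)
  then obtain B where B: "\<And>x. norm x ^ N * cmod (f x) \<le> B" by metis
  have "norm x ^ N * cmod (c * f x) \<le> cmod c * B" for x
    using mult_left_mono[OF B[of x], of "cmod c"] by (simp add: norm_mult mult_ac)
  then show ?case by blast
next
  case (coord f i)
  then obtain B where B: "\<And>x. norm x ^ Suc N * cmod (f x) \<le> B" by metis
  have "norm x ^ N * cmod (complex_of_real (x $ i) * f x) \<le> B" for x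
  proof -
    have "norm x ^ N * cmod (complex_of_real (x $ i) * f x) \<le> norm x ^ N * (norm x * cmod (f x))"
      using component_le_norm_cart[of x i] by (simp add: norm_mult mult_left_mono mult_right_mono)
    also have "\<dots> \<le> B" using B[of x] by (simp add: mult_ac)
    finally show ?thesis .
  qed
  then show ?case by blast
qed

lemma poly_gauss_schwartz:
  assumes f: "f \<in> poly_gauss a b" and a: "0 < a"
  shows "schwartz f"
proof -
  have pd: "partial_derivative j g \<in> poly_gauss a b" and d: "g differentiable (at x)"
    if g: "g \<in> poly_gauss a b" for g j x
  proof -
    obtain D where D: "\<And>x. (g has_derivative D x) (at x)" "\<And>j. (\<lambda>x. D x (axis j 1)) \<in> poly_gauss a b"
      using poly_gauss_derivative[OF g] by blast
    have "partial_derivative j g = (\<lambda>x. D x (axis j 1))"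
      using frechet_derivative_at[OF D(1)] by (simp add: partial_derivative_def fun_eq_iff)
    then show "partial_derivative j g \<in> poly_gauss a b" using D(2) by simp
    show "g differentiable (at x)" using D(1) by (rule differentiableI)
  qed
  have mem: "foldr partial_derivative is f \<in> poly_gauss a b" for "is"
    by (induction "is") (auto intro: f pd)
  have "bounded (range (\<lambda>x. norm x ^ N *\<^sub>R foldr partial_derivative is f x))" for "is" N
    using poly_gauss_bounded[OF mem a, of N "is"] unfolding bounded_iff by auto
  then show ?thesis unfolding schwartz_def using d[OF mem] by blast
qed

text \<open>The indicator of an open set is the pointwise limit of min(1, k * distance to the
  complement), and open sets form a generator closed under intersection.\<close>

lemma finite_measure_eq_open:
  fixes M N :: "(real ^ 'n) measure"
  assumes "finite_measure M" "finite_measure N" "sets M = sets borel" "sets N = sets borel"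
    and eq: "\<And>h. continuous_on UNIV h \<Longrightarrow> (\<And>x. \<bar>h x\<bar> \<le> 1) \<Longrightarrow> integral\<^sup>L M h = (integral\<^sup>L N h :: real)"
  shows "M = N"
proof -
  have op: "emeasure M U = emeasure N U" if U: "open U" for U
  proof -
    obtain h :: "nat \<Rightarrow> real ^ 'n \<Rightarrow> real" where h: "\<And>k. continuous_on UNIV (h k)" "\<And>k x. \<bar>h k x\<bar> \<le> 1" "\<And>x. (\<lambda>k. h k x) \<longlonglongrightarrow> indicator U x"
    \<comment> \<open>\<open>infdist\<close> to the empty set is 0 by convention, so the distance
      formula fails for the whole space.\<close>
    proof (cases "U = UNIV")
      case True
      show ?thesis by (rule that[of "\<lambda>_ _. 1"]) (auto simp: True)
    next
      case False
      have cl: "closed (- U)" "- U \<noteq> {}" using U False by auto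
      define h where "h k x = min 1 (real k * infdist x (- U))" for k x
      show ?thesis
      proof (rule that[of h])
        show "continuous_on UNIV (h k)" for k
          unfolding h_def by (intro continuous_intros)
        show "\<bar>h k x\<bar> \<le> 1" for k x
          using infdist_nonneg[of x "- U"] by (simp add: h_def)
        fix x
        show "(\<lambda>k. h k x) \<longlonglongrightarrow> indicator U x"
        proof (cases "x \<in> U")
          case True
          then have p: "infdist x (- U) > 0"
            using in_closed_iff_infdist_zero[OF cl, of x] infdist_nonneg[of x "- U"] by auto
          obtain m :: nat where m: "1 / infdist x (- U) < real m" using reals_Archimedean2 by blast
          have "\<forall>\<^sub>F k in sequentially. h k x = 1"
            using eventually_ge_at_top[of m]
          proof eventually_elim
            case (elim k)
            then have "1 / infdist x (- U) < real k" using m by linarith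
            then have "1 < real k * infdist x (- U)" using p by (simp add: field_simps)
            then show ?case by (simp add: h_def)
          qed
          then show ?thesis using True by (simp add: tendsto_eventually)
        next
          case False
          then have "h k x = 0" for k by (simp add: h_def)
          then show ?thesis using False by simp
        qed
      qed
    qed
    have lim: "(\<lambda>k. integral\<^sup>L L (h k)) \<longlonglongrightarrow> measure L U" if L: "finite_measure L" "sets L = sets borel" for L
    proof -
      interpret L: finite_measure L by fact
      have m: "f \<in> borel_measurable L \<longleftrightarrow> f \<in> borel_measurable borel" for f :: "real ^ 'n \<Rightarrow> real"
        using L(2) by (simp cong: measurable_cong_sets)
      have U: "U \<in> sets L" using \<open>open U\<close> L(2) by simp
      have "(\<lambda>k. integral\<^sup>L L (h k)) \<longlonglongrightarrow> (\<integral>x. indicator U x \<partial>L)"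
      proof (rule integral_dominated_convergence[where w="\<lambda>_. 1"])
        show "h k \<in> borel_measurable L" for k
          unfolding m by (rule borel_measurable_continuous_onI[OF h(1)])
      qed (use h U in auto)
      then show ?thesis using U by simp
    qed
    have "measure M U = measure N U"
      using LIMSEQ_unique[OF lim[OF assms(1,3)]] lim[OF assms(2,4)] eq[OF h(1,2)] by simp
    then show ?thesis
      using assms(1,2) by (simp add: finite_measure.emeasure_eq_measure)
  qed
  show ?thesis
  proof (rule measure_eqI_generator_eq[where E="{U. open U}" and \<Omega>=UNIV and A="\<lambda>_. UNIV"])
    show "Int_stable {U :: (real ^ 'n) set. open U}" by (auto simp: Int_stable_def)
    show "sets M = sigma_sets UNIV {U. open U}" "sets N = sigma_sets UNIV {U. open U}"
      using assms by (simp_all add: borel_def)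
    show "emeasure M UNIV \<noteq> \<infinity>" for i :: nat
      using assms(1) by (simp add: finite_measure.emeasure_finite)
  qed (use op in auto)
qed

text \<open>Fubini moves the Gaussian smoothing of a bounded continuous h onto the measure, where it
  becomes a Gaussian integral with moving centre, equal for both measures by assumption. As the
  width shrinks the smoothed functions tend to h boundedly.\<close>

lemma finite_measure_eq_gauss:
  fixes M N :: "(real ^ 'n) measure"
  assumes M: "finite_measure M" "sets M = sets borel" and N: "finite_measure N" "sets N = sets borel"
    and eq: "\<And>s c. 0 < s \<Longrightarrow> (\<integral>x. gauss s (c - x) \<partial>M) = (\<integral>x. gauss s (c - x) \<partial>N)"
  shows "M = N"
proof (rule finite_measure_eq_open[OF M(1) N(1) M(2) N(2)])
  fix h :: "real ^ 'n \<Rightarrow> real"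
  assume c: "continuous_on UNIV h" and b: "\<And>x. \<bar>h x\<bar> \<le> 1"
  have hm [measurable]: "h \<in> borel_measurable borel" using c by (rule borel_measurable_continuous_onI)
  let ?F = "\<lambda>k x. LINT v|lborel. gauss 1 v *\<^sub>R h (x + (1 / real (Suc k)) *\<^sub>R v)"
  have lim: "(\<lambda>k. integral\<^sup>L L (?F k)) \<longlonglongrightarrow> integral\<^sup>L L h"
    and fub: "integral\<^sup>L L (?F k) = (LINT u|lborel. (real (Suc k) ^ CARD('n) * h u) * (\<integral>x. gauss (real (Suc k)) (u - x) \<partial>L))"
    if L: "finite_measure L" "sets L = sets borel" for L k
  proof -
    interpret L: finite_measure L by fact
    have mL: "f \<in> borel_measurable L \<longleftrightarrow> f \<in> borel_measurable borel" for f :: "real ^ 'n \<Rightarrow> real"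
      using L(2) by (simp cong: measurable_cong_sets)
    have F1: "\<bar>?F k x\<bar> \<le> 1" for k x
    proof -
      have "\<bar>?F k x\<bar> \<le> (LINT v|lborel. norm (gauss 1 v *\<^sub>R h (x + (1 / real (Suc k)) *\<^sub>R v)))"
        unfolding real_norm_def[symmetric] by (rule integral_norm_bound)
      also have "\<dots> \<le> (LINT v|lborel. gauss 1 (v :: real ^ 'n))"
        using integrable_gauss_1[where 'n='n] b
        by (intro integral_mono_AE') (auto simp: abs_mult mult_left_le)
      finally show ?thesis by (simp add: integral_gauss_1)
    qed
    show "(\<lambda>k. integral\<^sup>L L (?F k)) \<longlonglongrightarrow> integral\<^sup>L L h"
    proof (rule integral_dominated_convergence[where w="\<lambda>_. 1"])
      show "AE x in L. (\<lambda>k. ?F k x) \<longlonglongrightarrow> h x"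
        using c b by (intro AE_I2 gauss_smoothing_tendsto[where B=1] hm) (auto simp: continuous_on_eq_continuous_at)
      show "AE x in L. norm (?F k x) \<le> 1" for k using F1[where k=k] by auto
    qed (auto simp: mL)
    interpret P: pair_sigma_finite L lborel by (rule pair_sigma_finite.intro) (auto intro: L.sigma_finite_measure_axioms lborel.sigma_finite_measure_axioms)
    let ?s = "real (Suc k)"
    have ms: "sets (L \<Otimes>\<^sub>M lborel) = sets (borel \<Otimes>\<^sub>M borel)"
      by (intro sets_pair_measure_cong) (auto simp: L)
    have mm: "(\<lambda>(x, u). (?s ^ CARD('n) * gauss ?s (u - x)) * h u) \<in> borel_measurable (L \<Otimes>\<^sub>M lborel)"
      unfolding measurable_cong_sets[OF ms refl] by measurable
    have ga: "integrable lborel (\<lambda>u. gauss ?s (u - x))" for x :: "real ^ 'n"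
      using integrable_affine_cart[of 1 "gauss ?s" "- x"] integrable_gauss[of ?s, where 'n='n] by (simp add: algebra_simps)
    have gi: "(LINT u|lborel. gauss ?s (u - x)) = (LINT u|lborel. gauss ?s (u :: real ^ 'n))" for x :: "real ^ 'n"
      using integral_affine_cart[of 1 "gauss ?s" "- x", symmetric] by simp
    have int1: "integrable lborel (\<lambda>u. (?s ^ CARD('n) * gauss ?s (u - x)) * h u)" for x
      by (rule Bochner_Integration.integrable_bound[OF integrable_mult_right[OF ga[of x], of "?s ^ CARD('n)"]])
        (use b in \<open>auto intro!: AE_I2 simp: abs_mult mult_left_le\<close>)
    have int: "integrable (L \<Otimes>\<^sub>M lborel) (\<lambda>(x, u). (?s ^ CARD('n) * gauss ?s (u - x)) * h u)"
    proof (rule P.Fubini_integrable[OF mm])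
      show "AE x in L. integrable lborel (\<lambda>u. case (x, u) of (x, u) \<Rightarrow> (?s ^ CARD('n) * gauss ?s (u - x)) * h u)"
        using int1 by simp
      have "(LINT u|lborel. norm ((?s ^ CARD('n) * gauss ?s (u - x)) * h u)) \<le> ?s ^ CARD('n) * (LINT u|lborel. gauss ?s (u :: real ^ 'n))" for x
      proof -
        have "(LINT u|lborel. norm ((?s ^ CARD('n) * gauss ?s (u - x)) * h u)) \<le> (LINT u|lborel. ?s ^ CARD('n) * gauss ?s (u - x))"
          using ga[of x] b by (intro integral_mono_AE') (auto simp: abs_mult mult_left_le)
        then show ?thesis unfolding integral_mult_right_zero gi .
      qed
      then show "integrable L (\<lambda>x. LINT u|lborel. norm (case (x, u) of (x, u) \<Rightarrow> (?s ^ CARD('n) * gauss ?s (u - x)) * h u))"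
        by (intro L.integrable_const_bound[where B="?s ^ CARD('n) * (LINT u|lborel. gauss ?s (u :: real ^ 'n))"])
          (auto simp: mL)
    qed
    have "integral\<^sup>L L (?F k) = (LINT x|L. LINT u|lborel. (?s ^ CARD('n) * gauss ?s (u - x)) * h u)"
    proof (rule Bochner_Integration.integral_cong[OF refl])
      fix x
      have "0 < ?s" by simp
      from gauss_smoothing_eq[OF hm this, of x, symmetric]
      show "?F k x = (LINT u|lborel. (?s ^ CARD('n) * gauss ?s (u - x)) * h u)"
        unfolding real_scaleR_def .
    qed
    also have "\<dots> = (LINT u|lborel. LINT x|L. (?s ^ CARD('n) * gauss ?s (u - x)) * h u)"
      by (rule P.Fubini_integral[OF int, symmetric])
    also have "\<dots> = (LINT u|lborel. (?s ^ CARD('n) * h u) * (\<integral>x. gauss ?s (u - x) \<partial>L))"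
      by (simp add: mult_ac flip: integral_mult_right_zero)
    finally show "integral\<^sup>L L (?F k) = (LINT u|lborel. (?s ^ CARD('n) * h u) * (\<integral>x. gauss ?s (u - x) \<partial>L))" .
  qed
  have "integral\<^sup>L M (?F k) = integral\<^sup>L N (?F k)" for k
    unfolding fub[OF M] fub[OF N] by (subst eq) auto
  then show "integral\<^sup>L M h = integral\<^sup>L N h"
    using LIMSEQ_unique[OF lim[OF M]] lim[OF N] by simp
qed

lemma measure_eq_schwartz:
  fixes M N :: "(real ^ 'n) measure"
  assumes M: "sets M = sets borel" "\<And>f. schwartz f \<Longrightarrow> integrable M f"
    and N: "sets N = sets borel" "\<And>f. schwartz f \<Longrightarrow> integrable N f"
    and eq: "\<And>f. schwartz f \<Longrightarrow> integral\<^sup>L M f = integral\<^sup>L N f"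
  shows "M = N"
proof -
  let ?W = "\<lambda>L. density L (\<lambda>x. ennreal (gauss 1 (x :: real ^ 'n)))"
  \<comment> \<open>Expanding |c - x|^2 splits off the constant \<open>gauss s c\<close> and leaves
    an exponential with linear coefficient 2 pi s^2 c and quadratic coefficient pi + pi s^2, that
    is, the base case of \<open>poly_gauss\<close>.\<close>
  have sch: "schwartz (\<lambda>x :: real ^ 'n. complex_of_real (gauss 1 x * gauss s (c - x)))" for s c
  proof -
    have "(\<lambda>x. complex_of_real (gauss s c) * complex_of_real (exp (((2 * pi * s\<^sup>2) *\<^sub>R c) \<bullet> x - (pi + pi * s\<^sup>2) * (x \<bullet> x))))
       \<in> poly_gauss (pi + pi * s\<^sup>2) ((2 * pi * s\<^sup>2) *\<^sub>R c)"
      by (intro poly_gauss.intros)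
    moreover have "complex_of_real (gauss 1 x * gauss s (c - x)) = 
      complex_of_real (gauss s c) * complex_of_real (exp (((2 * pi * s\<^sup>2) *\<^sub>R c) \<bullet> x - (pi + pi * s\<^sup>2) * (x \<bullet> x)))" for x
      by (simp add: gauss_def power2_norm_eq_inner inner_diff_left inner_diff_right inner_commute algebra_simps flip: of_real_mult exp_add)
    ultimately show ?thesis
      by (simp add: poly_gauss_schwartz add_pos_nonneg)
  qed
  have sch1: "schwartz (\<lambda>x :: real ^ 'n. complex_of_real (gauss 1 x))"
    using sch[of 0 0] by (simp add: gauss_def)
  have fin: "finite_measure (?W L)" and dens: "(\<integral>x. gauss s (c - x) \<partial>?W L) = Re (integral\<^sup>L L (\<lambda>x. complex_of_real (gauss 1 x * gauss s (c - x))))"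
    if L: "sets L = sets borel" "\<And>f. schwartz f \<Longrightarrow> integrable L f" for L s c
  proof -
    have mL: "f \<in> borel_measurable L \<longleftrightarrow> f \<in> borel_measurable borel" for f :: "real ^ 'n \<Rightarrow> real"
      using L(1) by (simp cong: measurable_cong_sets)
    have gm: "(\<lambda>x. gauss 1 x) \<in> borel_measurable L" "(\<lambda>x. gauss s (c - x)) \<in> borel_measurable L"
      unfolding mL by measurable
    have "integrable L (\<lambda>x. complex_of_real (gauss 1 x))" by (rule L(2)[OF sch1])
    then have "integrable L (gauss 1)" by (simp add: complex_of_real_integrable_eq)
    then have "(\<integral>\<^sup>+ x. ennreal (gauss 1 x) \<partial>L) < \<infinity>"
      by (simp add: integrable_iff_bounded)
    then show "finite_measure (?W L)"
      using gm by (intro finite_measureI) (simp add: emeasure_density cong: nn_integral_cong)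
    show "(\<integral>x. gauss s (c - x) \<partial>?W L) = Re (integral\<^sup>L L (\<lambda>x. complex_of_real (gauss 1 x * gauss s (c - x))))"
      using gm by (subst integral_density) (simp_all only: integral_complex_of_real Re_complex_of_real real_scaleR_def gauss_nonneg AE_I2)
  qed
  have "?W M = ?W N"
    by (rule finite_measure_eq_gauss) (use fin[OF M] fin[OF N] dens[OF M] dens[OF N] M(1) N(1) eq[OF sch] in auto)
  \<comment> \<open>\<open>gauss 1\<close> vanishes nowhere, so the weighting can be undone by the
    reciprocal density.\<close>
  moreover have "density (?W L) (\<lambda>x. ennreal (1 / gauss 1 x)) = L" if L: "sets L = sets borel" for L
  proof -
    have gm: "(\<lambda>x. gauss 1 x) \<in> borel_measurable L" "(\<lambda>x. 1 / gauss 1 x) \<in> borel_measurable L"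
      using L by (simp_all cong: measurable_cong_sets)
    have "ennreal (gauss 1 x) * ennreal (1 / gauss 1 x) = 1" for x :: "real ^ 'n"
      by (simp add: gauss_def flip: ennreal_mult)
    then show ?thesis
      using gm by (subst density_density_eq) (auto simp: density_1)
  qed
  ultimately show ?thesis using M(1) N(1) by metis
qed

section \<open>The Riemann--Lebesgue lemma\<close>

lemma
  assumes "sets \<nu> = sets \<mu>"
  shows sets_add_measure: "sets (add_measure \<mu> \<nu>) = sets \<mu>"
    and space_add_measure: "space (add_measure \<mu> \<nu>) = space \<mu>"
    and emeasure_add_measure: "A \<in> sets \<mu> \<Longrightarrow> emeasure (add_measure \<mu> \<nu>) A = emeasure \<mu> A + emeasure \<nu> A"
proof -
  show "sets (add_measure \<mu> \<nu>) = sets \<mu>" "space (add_measure \<mu> \<nu>) = space \<mu>"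
    by (simp_all add: add_measure_def)
  show "emeasure (add_measure \<mu> \<nu>) A = emeasure \<mu> A + emeasure \<nu> A" if A: "A \<in> sets \<mu>"
  proof (rule emeasure_measure_of[OF add_measure_def sets.space_closed])
    show "positive (sets (add_measure \<mu> \<nu>)) (\<lambda>A. emeasure \<mu> A + emeasure \<nu> A)"
      by (simp add: positive_def)
    show "countably_additive (sets (add_measure \<mu> \<nu>)) (\<lambda>A. emeasure \<mu> A + emeasure \<nu> A)"
    proof (rule countably_additiveI)
      fix F :: "nat \<Rightarrow> 'a set"
      assume F: "range F \<subseteq> sets (add_measure \<mu> \<nu>)" "disjoint_family F" "(\<Union>i. F i) \<in> sets (add_measure \<mu> \<nu>)"
      have "range F \<subseteq> sets \<mu>" "range F \<subseteq> sets \<nu>" using F assms by (simp_all add: add_measure_def)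
      then show "(\<Sum>i. emeasure \<mu> (F i) + emeasure \<nu> (F i)) = emeasure \<mu> (\<Union>i. F i) + emeasure \<nu> (\<Union>i. F i)"
        using F(2) by (simp add: suminf_add[symmetric] suminf_emeasure summableI)
    qed
    show "A \<in> sets (add_measure \<mu> \<nu>)" using A by (simp add: add_measure_def)
  qed
qed

lemma nn_integral_add_measure:
  assumes s: "sets \<nu> = sets \<mu>" and f: "f \<in> borel_measurable \<mu>"
  shows "(\<integral>\<^sup>+x. f x \<partial>add_measure \<mu> \<nu>) = (\<integral>\<^sup>+x. f x \<partial>\<mu>) + (\<integral>\<^sup>+x. f x \<partial>\<nu>)"
proof -
  have m: "g \<in> borel_measurable (add_measure \<mu> \<nu>) \<longleftrightarrow> g \<in> borel_measurable \<mu>" "g \<in> borel_measurable \<nu> \<longleftrightarrow> g \<in> borel_measurable \<mu>" for g :: "'a \<Rightarrow> ennreal"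
    using s by (simp_all add: sets_add_measure cong: measurable_cong_sets)
  show ?thesis
    using f
  proof (induction rule: borel_measurable_induct)
    case (cong f g)
    then show ?case
      using sets_eq_imp_space_eq[OF s] space_add_measure[OF s]
      by (metis (no_types, lifting) nn_integral_cong)
  next
    case (set A)
    then show ?case using s by (simp add: sets_add_measure emeasure_add_measure)
  next
    case (mult u c)
    then show ?case by (simp add: nn_integral_cmult m distrib_left)
  next
    case (add u v)
    then show ?case by (simp add: nn_integral_add m)
  next
    case (seq U)
    have "(\<integral>\<^sup>+x. (SUP i. U i x) \<partial>L) = (SUP i. \<integral>\<^sup>+x. U i x \<partial>L)" if "\<And>i. U i \<in> borel_measurable L" for L
      using \<open>incseq U\<close> that by (intro nn_integral_monotone_convergence_SUP)
    then have e: "(\<integral>\<^sup>+x. (SUP i. U i x) \<partial>\<mu>) = (SUP i. \<integral>\<^sup>+x. U i x \<partial>\<mu>)"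
      "(\<integral>\<^sup>+x. (SUP i. U i x) \<partial>\<nu>) = (SUP i. \<integral>\<^sup>+x. U i x \<partial>\<nu>)"
      "(\<integral>\<^sup>+x. (SUP i. U i x) \<partial>add_measure \<mu> \<nu>) = (SUP i. \<integral>\<^sup>+x. U i x \<partial>add_measure \<mu> \<nu>)"
      using seq(1) m by auto
    have "(SUP i. (\<integral>\<^sup>+x. U i x \<partial>\<mu>) + (\<integral>\<^sup>+x. U i x \<partial>\<nu>)) = (SUP i. \<integral>\<^sup>+x. U i x \<partial>\<mu>) + (SUP i. \<integral>\<^sup>+x. U i x \<partial>\<nu>)"
      using \<open>incseq U\<close> by (intro ennreal_SUP_add) (auto simp: incseq_def le_fun_def intro!: nn_integral_mono)
    then show ?case
      unfolding SUP_apply e seq.IH .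
  qed
qed

lemma
  fixes f :: "'a \<Rightarrow> real"
  assumes s: "sets \<nu> = sets \<mu>" and f: "integrable \<mu> f" "integrable \<nu> f"
  shows integrable_add_measure_real: "integrable (add_measure \<mu> \<nu>) f"
    and integral_add_measure_real: "integral\<^sup>L (add_measure \<mu> \<nu>) f = integral\<^sup>L \<mu> f + integral\<^sup>L \<nu> f"
proof -
  have fm: "f \<in> borel_measurable \<mu>" using f by auto
  have m: "f \<in> borel_measurable (add_measure \<mu> \<nu>)"
    using s fm by (simp add: sets_add_measure cong: measurable_cong_sets)
  note ni = nn_integral_add_measure[OF s]
  show i: "integrable (add_measure \<mu> \<nu>) f"
    using f m fm by (simp add: integrable_iff_bounded ni)
  have fin: "(\<integral>\<^sup>+x. ennreal (f x) \<partial>\<mu>) < \<infinity>" "(\<integral>\<^sup>+x. ennreal (- f x) \<partial>\<mu>) < \<infinity>"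
    "(\<integral>\<^sup>+x. ennreal (f x) \<partial>\<nu>) < \<infinity>" "(\<integral>\<^sup>+x. ennreal (- f x) \<partial>\<nu>) < \<infinity>"
    using f by (auto elim: integrableE simp: real_integrable_def less_top[symmetric])
  show "integral\<^sup>L (add_measure \<mu> \<nu>) f = integral\<^sup>L \<mu> f + integral\<^sup>L \<nu> f"
    using fm fin by (simp add: real_lebesgue_integral_def[OF i] real_lebesgue_integral_def[OF f(1)] real_lebesgue_integral_def[OF f(2)]
      ni enn2real_plus)
qed

lemma
  fixes f :: "'a \<Rightarrow> complex"
  assumes s: "sets \<nu> = sets \<mu>" and f: "integrable \<mu> f" "integrable \<nu> f"
  shows integrable_add_measure: "integrable (add_measure \<mu> \<nu>) f"
    and integral_add_measure: "integral\<^sup>L (add_measure \<mu> \<nu>) f = integral\<^sup>L \<mu> f + integral\<^sup>L \<nu> f"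
proof -
  have ri: "integrable \<mu> (\<lambda>x. Re (f x))" "integrable \<nu> (\<lambda>x. Re (f x))" "integrable \<mu> (\<lambda>x. Im (f x))" "integrable \<nu> (\<lambda>x. Im (f x))"
    using f by auto
  show i: "integrable (add_measure \<mu> \<nu>) f"
  proof -
    have "integrable (add_measure \<mu> \<nu>) (\<lambda>x. complex_of_real (Re (f x)) + \<i> * complex_of_real (Im (f x)))"
      using integrable_add_measure_real[OF s ri(1,2)] integrable_add_measure_real[OF s ri(3,4)]
      by (intro Bochner_Integration.integrable_add integrable_mult_right integrable_of_real)
    then show ?thesis by (simp add: complex_eq[symmetric])
  qed
  show "integral\<^sup>L (add_measure \<mu> \<nu>) f = integral\<^sup>L \<mu> f + integral\<^sup>L \<nu> f"
    using integral_add_measure_real[OF s ri(1,2)] integral_add_measure_real[OF s ri(3,4)] i f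
    by (simp add: complex_eq_iff integral_Re integral_Im)
qed

section \<open>The multiplication formula and transforms that vanish at infinity\<close>

lemma fourier_multiplication_formula:
  fixes f g :: "real ^ 'n \<Rightarrow> complex"
  assumes f: "integrable lborel f" and g: "integrable lborel g"
  shows "(LINT y|lborel. fourier_transform f y * g y) = (LINT x|lborel. f x * fourier_transform g x)"
proof -
  let ?e = "\<lambda>t. exp (- (2 * complex_of_real pi * \<i> * complex_of_real t))"
  have [measurable]: "f \<in> borel_measurable borel" "g \<in> borel_measurable borel"
    using borel_measurable_integrable[OF f] borel_measurable_integrable[OF g] by simp_all
  have int: "integrable (lborel \<Otimes>\<^sub>M lborel) (\<lambda>(x, y). f x * g y * ?e (x \<bullet> y))"
  proof (rule lborel_pair.Fubini_integrable)
    show "integrable lborel (\<lambda>x. LINT y|lborel. norm (case (x, y) of (x, y) \<Rightarrow> f x * g y * ?e (x \<bullet> y)))"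
      using f by (simp add: norm_mult)
    show "AE x in lborel. integrable lborel (\<lambda>y. case (x, y) of (x, y) \<Rightarrow> f x * g y * ?e (x \<bullet> y))"
      using integrable_fourier_integrand[OF g] by (auto simp: mult.assoc inner_commute)
  qed measurable
  have "(LINT y|lborel. fourier_transform f y * g y) = (LINT y|lborel. LINT x|lborel. f x * g y * ?e (x \<bullet> y))"
    unfolding fourier_transform_def by (simp add: mult_ac flip: integral_mult_right_zero)
  also have "\<dots> = (LINT x|lborel. LINT y|lborel. f x * g y * ?e (x \<bullet> y))"
    by (rule lborel_pair.Fubini_integral[OF int])
  also have "\<dots> = (LINT x|lborel. f x * fourier_transform g x)"
    unfolding fourier_transform_def by (simp add: mult.assoc inner_commute flip: integral_mult_right_zero)
  finally show ?thesis .
qed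

definition fourier_vanishes :: "(real ^ 'n \<Rightarrow> complex) \<Rightarrow> bool" where
  "fourier_vanishes f \<longleftrightarrow> (\<forall>\<epsilon>>0. \<exists>R. \<forall>y. R \<le> norm y \<longrightarrow> cmod (fourier_transform f y) \<le> \<epsilon>)"

lemma fourier_transform_diff:
  assumes "integrable lborel f" "integrable lborel g"
  shows "fourier_transform (\<lambda>x. f x - g x) y = fourier_transform f y - fourier_transform g y"
  using assms unfolding fourier_transform_def
  by (simp add: left_diff_distrib Bochner_Integration.integral_diff integrable_fourier_integrand)

lemma fourier_transform_add:
  assumes "integrable lborel f" "integrable lborel g"
  shows "fourier_transform (\<lambda>x. f x + g x) y = fourier_transform f y + fourier_transform g y"
  using assms unfolding fourier_transform_def
  by (simp add: distrib_right Bochner_Integration.integral_add integrable_fourier_integrand)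

text \<open>The supremum of a transform is at most the integral of the modulus of the function, so
  vanishing at infinity survives limits in the mean. All later extensions of the class of functions
  pass through this closure.\<close>

lemma fourier_vanishes_approx:
  assumes f: "integrable lborel f"
    and ap: "\<And>\<delta>. 0 < \<delta> \<Longrightarrow> \<exists>g. integrable lborel g \<and> fourier_vanishes g \<and> (LINT x|lborel. cmod (f x - g x)) \<le> \<delta>"
  shows "fourier_vanishes f"
  unfolding fourier_vanishes_def
proof (intro allI impI)
  fix \<epsilon> :: real assume "0 < \<epsilon>"
  then have e: "0 < \<epsilon> / 2" by simp
  obtain g where g: "integrable lborel g" "fourier_vanishes g" "(LINT x|lborel. cmod (f x - g x)) \<le> \<epsilon> / 2"
    using ap[OF e] by blast
  obtain R where R: "\<And>y. R \<le> norm y \<Longrightarrow> cmod (fourier_transform g y) \<le> \<epsilon> / 2"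
    using g(2) e unfolding fourier_vanishes_def by blast
  have "cmod (fourier_transform f y) \<le> \<epsilon>" if "R \<le> norm y" for y
  proof -
    have "cmod (fourier_transform f y - fourier_transform g y) \<le> \<epsilon> / 2"
      using norm_fourier_transform_le[of "\<lambda>x. f x - g x" y] g(3) fourier_transform_diff[OF f g(1)] by simp
    then show ?thesis
      using R[OF that] norm_triangle_sub[of "fourier_transform f y" "fourier_transform g y"] by linarith
  qed
  then show "\<exists>R. \<forall>y. R \<le> norm y \<longrightarrow> cmod (fourier_transform f y) \<le> \<epsilon>" by blast
qed

lemma fourier_vanishes_add:
  assumes "integrable lborel f" "integrable lborel g" "fourier_vanishes f" "fourier_vanishes g"
  shows "fourier_vanishes (\<lambda>x. f x + g x)"
  unfolding fourier_vanishes_def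
proof (intro allI impI)
  fix \<epsilon> :: real assume "0 < \<epsilon>"
  then have e: "0 < \<epsilon> / 2" by simp
  obtain R R' where R: "\<And>y. R \<le> norm y \<Longrightarrow> cmod (fourier_transform f y) \<le> \<epsilon> / 2"
    "\<And>y. R' \<le> norm y \<Longrightarrow> cmod (fourier_transform g y) \<le> \<epsilon> / 2"
    using assms(3,4) e unfolding fourier_vanishes_def by metis
  have "cmod (fourier_transform (\<lambda>x. f x + g x) y) \<le> \<epsilon>" if "max R R' \<le> norm y" for y
    using R(1)[of y] R(2)[of y] that norm_triangle_ineq[of "fourier_transform f y" "fourier_transform g y"]
    unfolding fourier_transform_add[OF assms(1,2)] by linarith
  then show "\<exists>R. \<forall>y. R \<le> norm y \<longrightarrow> cmod (fourier_transform (\<lambda>x. f x + g x) y) \<le> \<epsilon>" by blast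
qed

lemma fourier_vanishes_mult:
  assumes "fourier_vanishes f"
  shows "fourier_vanishes (\<lambda>x. c * f x)"
  unfolding fourier_vanishes_def
proof (intro allI impI)
  fix \<epsilon> :: real assume "0 < \<epsilon>"
  then have e: "0 < \<epsilon> / (cmod c + 1)" by (simp add: add_nonneg_pos)
  obtain R where R: "\<And>y. R \<le> norm y \<Longrightarrow> cmod (fourier_transform f y) \<le> \<epsilon> / (cmod c + 1)"
    using assms e unfolding fourier_vanishes_def by metis
  have ft: "fourier_transform (\<lambda>x. c * f x) y = c * fourier_transform f y" for y
    unfolding fourier_transform_def by (simp add: mult.assoc)
  have "cmod (fourier_transform (\<lambda>x. c * f x) y) \<le> \<epsilon>" if "R \<le> norm y" for y
  proof -
    have "cmod (fourier_transform (\<lambda>x. c * f x) y) \<le> cmod c * (\<epsilon> / (cmod c + 1))"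
      unfolding ft norm_mult by (intro mult_left_mono R that) auto
    also have "\<dots> \<le> (cmod c + 1) * (\<epsilon> / (cmod c + 1))"
      using e by (intro mult_right_mono) auto
    also have "\<dots> = \<epsilon>" by (simp add: add_nonneg_eq_0_iff)
    finally show ?thesis .
  qed
  then show "\<exists>R. \<forall>y. R \<le> norm y \<longrightarrow> cmod (fourier_transform (\<lambda>x. c * f x) y) \<le> \<epsilon>" by blast
qed

text \<open>The antiderivative has modulus 1 / (2 pi |y|) at each endpoint, whatever the length of
  the interval.\<close>

lemma interval_fourier_bound:
  fixes a b y :: real
  assumes "y \<noteq> 0"
  shows "cmod (LINT t|lborel. complex_of_real (indicator {a..b} t) * exp (- (2 * complex_of_real pi * \<i> * complex_of_real (t * y)))) \<le> 1 / (pi * \<bar>y\<bar>)"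
proof (cases "a \<le> b")
  case True
  let ?e = "\<lambda>t. exp (- (2 * complex_of_real pi * \<i> * complex_of_real (t * y)))"
  let ?A = "- (2 * complex_of_real pi * \<i> * complex_of_real y)"
  have A: "?A \<noteq> 0" "cmod ?A = 2 * pi * \<bar>y\<bar>" using assms by (auto simp: norm_mult)
  have e: "?e t = exp (t *\<^sub>R ?A)" for t by (simp add: scaleR_conv_of_real mult_ac)
  have d: "((\<lambda>t. exp (t *\<^sub>R ?A) / ?A) has_vector_derivative exp (t *\<^sub>R ?A)) (at t within S)" for t S
    using has_vector_derivative_divide[OF exp_scaleR_has_vector_derivative_right[of ?A t S], of ?A] A(1) by simp
  have "(LINT t|lborel. indicator {a..b} t *\<^sub>R exp (t *\<^sub>R ?A)) = exp (b *\<^sub>R ?A) / ?A - exp (a *\<^sub>R ?A) / ?A"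
    by (rule integral_FTC_Icc[OF True d]) (auto intro!: continuous_intros)
  then have "(LINT t|lborel. complex_of_real (indicator {a..b} t) * ?e t) = (?e b - ?e a) / ?A"
    unfolding e by (simp add: scaleR_conv_of_real diff_divide_distrib)
  also have "cmod \<dots> \<le> 2 / (2 * pi * \<bar>y\<bar>)"
    unfolding norm_divide A(2)
    using norm_triangle_ineq4[of "?e b" "?e a"] by (intro divide_right_mono) auto
  finally show ?thesis by simp
next
  case False
  then show ?thesis by simp
qed

lemma fourier_transform_cbox:
  fixes a b :: "real ^ 'n"
  shows "fourier_transform (\<lambda>x. complex_of_real (indicator (cbox a b) x)) y =
    (\<Prod>i\<in>UNIV. LINT t|lborel. complex_of_real (indicator {a $ i..b $ i} t) * exp (- (2 * complex_of_real pi * \<i> * complex_of_real (t * y $ i))))"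
proof -
  have int: "integrable lborel (\<lambda>t. complex_of_real (indicator {a $ i..b $ i} t) * exp (- (2 * complex_of_real pi * \<i> * complex_of_real (t * y $ i))))" for i
  proof (rule Bochner_Integration.integrable_bound)
    show "integrable lborel (indicator {a $ i..b $ i} :: real \<Rightarrow> real)"
      by (intro integrable_real_indicator) (auto simp: emeasure_lborel_Icc_eq)
  qed (auto simp: norm_mult)
  have "fourier_transform (\<lambda>x. complex_of_real (indicator (cbox a b) x)) y =
     (LINT x|lborel. (\<Prod>i\<in>UNIV. complex_of_real (indicator {a $ i..b $ i} (x $ i)) * exp (- (2 * complex_of_real pi * \<i> * complex_of_real (x $ i * y $ i)))))"
    unfolding fourier_transform_def
  proof (intro Bochner_Integration.integral_cong refl)
    fix x :: "real ^ 'n"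
    have "exp (- (2 * complex_of_real pi * \<i> * complex_of_real (x \<bullet> y))) =
      (\<Prod>i\<in>UNIV. exp (- (2 * complex_of_real pi * \<i> * complex_of_real (x $ i * y $ i))))"
      by (simp add: exp_sum[symmetric] inner_vec_def sum_distrib_left sum_negf)
    moreover have "(indicator (cbox a b) x :: real) = (\<Prod>i\<in>UNIV. indicator {a $ i..b $ i} (x $ i))"
    proof (cases "x \<in> cbox a b")
      case True
      then show ?thesis by (simp add: mem_box_cart)
    next
      case False
      then obtain i where "x $ i \<notin> {a $ i..b $ i}" by (auto simp: mem_box_cart)
      then have "\<exists>i\<in>UNIV. (indicator {a $ i..b $ i} (x $ i) :: real) = 0" by (intro bexI[of _ i]) auto
      then have "(\<Prod>i\<in>UNIV. indicator {a $ i..b $ i} (x $ i)) = (0::real)" by (intro prod_zero) auto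
      then show ?thesis using False by simp
    qed
    ultimately show "complex_of_real (indicator (cbox a b) x) * exp (- (2 * complex_of_real pi * \<i> * complex_of_real (x \<bullet> y))) =
      (\<Prod>i\<in>UNIV. complex_of_real (indicator {a $ i..b $ i} (x $ i)) * exp (- (2 * complex_of_real pi * \<i> * complex_of_real (x $ i * y $ i))))"
      by (simp only: of_real_prod prod.distrib)
  qed
  also have "\<dots> = (\<Prod>i\<in>UNIV. LINT t|lborel. complex_of_real (indicator {a $ i..b $ i} t) * exp (- (2 * complex_of_real pi * \<i> * complex_of_real (t * y $ i))))"
    by (rule integral_prod_cart[OF int])
  finally show ?thesis .
qed

text \<open>The transform factors over coordinates. Some coordinate of y has modulus at least |y| /
  d, and its factor is small by \<open>interval_fourier_bound\<close>; the other factors are bounded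
  by the side lengths.\<close>

lemma fourier_vanishes_cbox:
  fixes a b :: "real ^ 'n"
  shows "fourier_vanishes (\<lambda>x. complex_of_real (indicator (cbox a b) x))"
  unfolding fourier_vanishes_def
proof (intro allI impI)
  fix \<epsilon> :: real assume \<epsilon>: "0 < \<epsilon>"
  let ?d = "real CARD('n)"
  \<comment> \<open>Bounds every side length, and is at least 1 so that the product over the
    remaining d - 1 coordinates is at most L^d.\<close>
  define L where "L = 1 + (\<Sum>i\<in>UNIV. \<bar>b $ i - a $ i\<bar>)"
  have L1: "1 \<le> L" and Li: "\<bar>b $ i - a $ i\<bar> \<le> L" for i
  proof -
    show "1 \<le> L" unfolding L_def by (simp add: sum_nonneg)
    have "\<bar>b $ i - a $ i\<bar> \<le> (\<Sum>i\<in>UNIV. \<bar>b $ i - a $ i\<bar>)" by (rule member_le_sum) auto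
    then show "\<bar>b $ i - a $ i\<bar> \<le> L" unfolding L_def by linarith
  qed
  let ?I = "\<lambda>y i. LINT t|lborel. complex_of_real (indicator {a $ i..b $ i} t) * exp (- (2 * complex_of_real pi * \<i> * complex_of_real (t * (y :: real ^ 'n) $ i)))"
  have I1: "cmod (?I y i) \<le> L" for y i
  proof -
    have "cmod (?I y i) \<le> (LINT t|lborel. cmod (complex_of_real (indicator {a $ i..b $ i} t) * exp (- (2 * complex_of_real pi * \<i> * complex_of_real (t * y $ i)))))"
      by (rule integral_norm_bound)
    also have "\<dots> = measure lborel {a $ i..b $ i}" by (simp add: norm_mult)
    also have "\<dots> \<le> L" using Li[of i] L1 by (cases "a $ i \<le> b $ i") auto
    finally show ?thesis .
  qed
  \<comment> \<open>Solves d L^d / (pi R) \<le> \<epsilon>; the summand 1 keeps \<open>R\<close>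
    positive in any case.\<close>
  define R where "R = ?d * L ^ CARD('n) / (pi * \<epsilon>) + 1"
  have "cmod (fourier_transform (\<lambda>x. complex_of_real (indicator (cbox a b) x)) y) \<le> \<epsilon>" if y: "R \<le> norm y" for y
  proof -
    have R0: "0 < R" unfolding R_def using \<epsilon> L1 by (intro add_nonneg_pos) auto
    have "\<exists>i. norm y \<le> ?d * \<bar>y $ i\<bar>"
    proof (rule ccontr)
      assume "\<not> ?thesis"
      then have "(\<Sum>i\<in>(UNIV :: 'n set). ?d * \<bar>y $ i\<bar>) < (\<Sum>i\<in>(UNIV :: 'n set). norm y)"
        by (intro sum_strict_mono) (auto simp: not_le)
      also have "\<dots> \<le> ?d * (\<Sum>i\<in>UNIV. \<bar>y $ i\<bar>)"
        using norm_le_l1_cart[of y] by (simp add: mult_left_mono)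
      finally show False by (simp add: sum_distrib_left)
    qed
    then obtain i where i: "norm y \<le> ?d * \<bar>y $ i\<bar>" by blast
    have yi: "R / ?d \<le> \<bar>y $ i\<bar>" using order_trans[OF y i] by (simp add: divide_le_eq mult.commute)
    moreover have Rd: "0 < R / ?d" using R0 by (intro divide_pos_pos) (auto simp: card_gt_0_iff)
    ultimately have yi0: "y $ i \<noteq> 0" by linarith
    have "cmod (fourier_transform (\<lambda>x. complex_of_real (indicator (cbox a b) x)) y) = cmod (?I y i) * (\<Prod>j\<in>UNIV - {i}. cmod (?I y j))"
      unfolding fourier_transform_cbox prod_norm[symmetric] by (rule prod.remove) auto
    also have "\<dots> \<le> 1 / (pi * \<bar>y $ i\<bar>) * (\<Prod>j\<in>UNIV - {i}. L)"
      using I1 by (intro mult_mono interval_fourier_bound yi0 prod_mono) (auto intro: prod_nonneg)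
    also have "\<dots> \<le> 1 / (pi * (R / ?d)) * L ^ CARD('n)"
    proof (rule mult_mono)
      show "1 / (pi * \<bar>y $ i\<bar>) \<le> 1 / (pi * (R / ?d))"
        using yi yi0 Rd by (intro divide_left_mono mult_left_mono mult_pos_pos) (auto simp del: zero_less_divide_iff)
      show "(\<Prod>j\<in>UNIV - {i}. L) \<le> L ^ CARD('n)"
        using L1 by (simp add: power_increasing)
    qed (use R0 L1 in \<open>auto intro: prod_nonneg\<close>)
    also have "1 / (pi * (R / ?d)) * L ^ CARD('n) = (?d * L ^ CARD('n) / pi) / R" using R0 by simp
    also have "\<dots> \<le> \<epsilon>"
    proof -
      have "?d * L ^ CARD('n) / pi \<le> \<epsilon> * R"
        using \<epsilon> unfolding R_def by (simp add: field_simps)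
      then show ?thesis by (simp only: pos_divide_le_eq[OF R0])
    qed
    finally show ?thesis .
  qed
  then show "\<exists>R. \<forall>y. R \<le> norm y \<longrightarrow> cmod (fourier_transform (\<lambda>x. complex_of_real (indicator (cbox a b) x)) y) \<le> \<epsilon>" by blast
qed


lemma integrable_indicator_complex:
  "A \<in> sets lborel \<Longrightarrow> emeasure lborel A < \<infinity> \<Longrightarrow> integrable lborel (\<lambda>x. complex_of_real (indicator A x))"
  by (intro integrable_of_real integrable_real_indicator)

lemma norm_indicator_diff_integral:
  assumes "A \<in> sets lborel" "B \<in> sets lborel" "B \<subseteq> A" "emeasure lborel A < \<infinity>"
  shows "(LINT x|lborel. cmod (complex_of_real (indicator A x) - complex_of_real (indicator B x))) = measure lborel (A - B)"
proof -
  have "(LINT x|lborel. cmod (complex_of_real (indicator A x) - complex_of_real (indicator B x))) = (LINT x|lborel. indicator (A - B) x)"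
    using assms(3) by (intro Bochner_Integration.integral_cong) (auto simp: indicator_def)
  then show ?thesis using assms by simp
qed

lemma borel_eq_cbox_cart: "borel = sigma UNIV (range (\<lambda>(a, b). cbox a b :: (real ^ 'n) set))"
  using borel_eq_atLeastAtMost[where 'a="real ^ 'n"] by (simp add: cbox_interval)

text \<open>Dynkin induction from boxes. Intersecting with a fixed box keeps complements of finite
  measure, so that they are differences of integrable indicators; countable disjoint unions are
  limits in the mean of finite ones.\<close>

lemma fourier_vanishes_indicator_bounded:
  fixes A :: "(real ^ 'n) set" and l u :: "real ^ 'n"
  assumes "A \<in> sets borel"
  shows "fourier_vanishes (\<lambda>x. complex_of_real (indicator (A \<inter> cbox l u) x))"
proof -
  let ?C = "cbox l u"
  have fin: "emeasure lborel (B \<inter> ?C) < \<infinity>" for B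
    using emeasure_mono[of "B \<inter> ?C" ?C lborel] emeasure_lborel_cbox_finite[of l u] by (auto intro: le_less_trans)
  have int: "integrable lborel (\<lambda>x. complex_of_real (indicator (B \<inter> ?C) x))" if "B \<in> sets borel" for B
    using fin that by (intro integrable_indicator_complex) auto
  have "Int_stable (range (\<lambda>(a, b). cbox a b :: (real ^ 'n) set))"
    by (auto simp: Int_stable_def Int_interval)
  moreover have "range (\<lambda>(a, b). cbox a b :: (real ^ 'n) set) \<subseteq> Pow UNIV" by auto
  moreover have "A \<in> sigma_sets UNIV (range (\<lambda>(a, b). cbox a b :: (real ^ 'n) set))"
    using assms by (simp add: borel_eq_cbox_cart)
  ultimately show ?thesis
  proof (induction rule: sigma_sets_induct_disjoint)
    case (basic A)
    then obtain a b where "A = cbox a b" by auto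
    then have "A \<inter> ?C = cbox (\<chi> i. max (a $ i) (l $ i)) (\<chi> i. min (b $ i) (u $ i))"
      by (simp add: Int_interval_cart interval_cbox_cart)
    then show ?case by (simp only: fourier_vanishes_cbox)
  next
    case empty
    have "fourier_vanishes (\<lambda>x. 0 * complex_of_real (indicator ?C x))"
      by (intro fourier_vanishes_mult fourier_vanishes_cbox)
    then show ?case by simp
  next
    case (compl A)
    have A: "A \<in> sets borel" using compl(1) by (simp add: borel_eq_cbox_cart)
    have "fourier_vanishes (\<lambda>x. complex_of_real (indicator (UNIV \<inter> ?C) x) + (- 1) * complex_of_real (indicator (A \<inter> ?C) x))"
      using A by (intro fourier_vanishes_add fourier_vanishes_mult compl int integrable_mult_right)
        (auto simp: fourier_vanishes_cbox)
    moreover have "complex_of_real (indicator (UNIV \<inter> ?C) x) + (- 1) * complex_of_real (indicator (A \<inter> ?C) x) =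
      complex_of_real (indicator ((UNIV - A) \<inter> ?C) x)" for x
      by (auto simp: indicator_def)
    ultimately show ?case by simp
  next
    case (union A)
    have A: "A i \<in> sets borel" for i using union(2) by (auto simp: borel_eq_cbox_cart)
    define B where "B N = (\<Union>i<N. A i)" for N
    have Bm: "B N \<in> sets borel" for N unfolding B_def using A by auto
    have v: "fourier_vanishes (\<lambda>x. complex_of_real (indicator (B N \<inter> ?C) x))" for N
    proof (induction N)
      case 0
      have "fourier_vanishes (\<lambda>x. 0 * complex_of_real (indicator ?C x))"
        by (intro fourier_vanishes_mult fourier_vanishes_cbox)
      then show ?case by (simp add: B_def)
    next
      case (Suc N)
      have "fourier_vanishes (\<lambda>x. complex_of_real (indicator (B N \<inter> ?C) x) + complex_of_real (indicator (A N \<inter> ?C) x))"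
        by (intro fourier_vanishes_add Suc union int Bm A)
      moreover have "A N \<inter> B N = {}"
        using disjoint_family_onD[OF union(1), of N] by (fastforce simp: B_def)
      then have "complex_of_real (indicator (B N \<inter> ?C) x) + complex_of_real (indicator (A N \<inter> ?C) x) =
        complex_of_real (indicator (B (Suc N) \<inter> ?C) x)" for x
        by (auto simp: indicator_def B_def lessThan_Suc)
      ultimately show ?case by simp
    qed
    have UN: "(\<Union>i. A i) \<in> sets borel" using A by auto
    show ?case
    proof (rule fourier_vanishes_approx[OF int[OF UN]])
      fix \<delta> :: real assume \<delta>: "0 < \<delta>"
      have "(\<lambda>N. measure lborel (((\<Union>i. A i) - B N) \<inter> ?C)) \<longlonglongrightarrow> measure lborel (\<Inter>N. ((\<Union>i. A i) - B N) \<inter> ?C)"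
      proof (rule Lim_measure_decseq)
        show "range (\<lambda>N. ((\<Union>i. A i) - B N) \<inter> ?C) \<subseteq> sets lborel" using UN Bm by auto
        show "decseq (\<lambda>N. ((\<Union>i. A i) - B N) \<inter> ?C)" unfolding B_def decseq_def by fastforce
        show "emeasure lborel (((\<Union>i. A i) - B N) \<inter> ?C) \<noteq> \<infinity>" for N using fin[of "(\<Union>i. A i) - B N"] by simp
      qed
      moreover have "(\<Inter>N. ((\<Union>i. A i) - B N) \<inter> ?C) = {}"
        unfolding B_def by auto
      ultimately have "(\<lambda>N. measure lborel (((\<Union>i. A i) - B N) \<inter> ?C)) \<longlonglongrightarrow> 0" by simp
      then have "\<forall>\<^sub>F N in sequentially. measure lborel (((\<Union>i. A i) - B N) \<inter> ?C) < \<delta>"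
        using \<delta> by (rule order_tendstoD)
      then obtain N where N: "measure lborel (((\<Union>i. A i) - B N) \<inter> ?C) < \<delta>"
        unfolding eventually_sequentially by blast
      have "(LINT x|lborel. cmod (complex_of_real (indicator ((\<Union>i. A i) \<inter> ?C) x) - complex_of_real (indicator (B N \<inter> ?C) x)))
         = measure lborel ((\<Union>i. A i) \<inter> ?C - B N \<inter> ?C)"
        using UN Bm fin by (intro norm_indicator_diff_integral) (auto simp: B_def)
      also have "(\<Union>i. A i) \<inter> ?C - B N \<inter> ?C = ((\<Union>i. A i) - B N) \<inter> ?C" by auto
      finally show "\<exists>g. integrable lborel g \<and> fourier_vanishes g \<and>
          (LINT x|lborel. cmod (complex_of_real (indicator ((\<Union>i. A i) \<inter> ?C) x) - g x)) \<le> \<delta>"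
        using N v[of N] int[OF Bm[of N]] by (intro exI[of _ "\<lambda>x. complex_of_real (indicator (B N \<inter> ?C) x)"]) simp
    qed
  qed
qed

lemma fourier_vanishes_indicator:
  fixes A :: "(real ^ 'n) set"
  assumes A: "A \<in> sets borel" "emeasure lborel A < \<infinity>"
  shows "fourier_vanishes (\<lambda>x. complex_of_real (indicator A x))"
proof (rule fourier_vanishes_approx[OF integrable_indicator_complex])
  show "A \<in> sets lborel" using A by simp
  fix \<delta> :: real assume \<delta>: "0 < \<delta>"
  define C :: "nat \<Rightarrow> (real ^ 'n) set" where "C N = cbox (- (real N *\<^sub>R One)) (real N *\<^sub>R One)" for N
  have Cmem: "x \<in> C N" if "norm x \<le> real N" for x N
  proof -
    have "\<bar>x \<bullet> b\<bar> \<le> real N" if "b \<in> Basis" for b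
      using Basis_le_norm[OF that, of x] \<open>norm x \<le> real N\<close> by linarith
    then show ?thesis by (force simp: C_def mem_box abs_le_iff)
  qed
  have "(\<lambda>N. measure lborel (A - C N)) \<longlonglongrightarrow> measure lborel (\<Inter>N. A - C N)"
  proof (rule Lim_measure_decseq)
    show "range (\<lambda>N. A - C N) \<subseteq> sets lborel" using A by (auto simp: C_def)
    show "decseq (\<lambda>N. A - C N)"
      unfolding decseq_def
    proof (intro allI impI Diff_mono subset_refl)
      fix m n :: nat assume "m \<le> n"
      then show "C m \<subseteq> C n" unfolding C_def by (intro subset_box_imp(1)) auto
    qed
    show "emeasure lborel (A - C N) \<noteq> \<infinity>" for N
      using emeasure_mono[of "A - C N" A lborel] A by (auto simp: top_unique)
  qed
  moreover have "(\<Inter>N. A - C N) = {}"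
  proof -
    have "\<exists>N. x \<in> C N" for x
      using real_arch_simple[of "norm x"] Cmem by blast
    then show ?thesis by blast
  qed
  ultimately have "(\<lambda>N. measure lborel (A - C N)) \<longlonglongrightarrow> 0" by (simp only: measure_empty)
  then have "\<forall>\<^sub>F N in sequentially. measure lborel (A - C N) < \<delta>"
    using \<delta> by (rule order_tendstoD)
  then obtain N where N: "measure lborel (A - C N) < \<delta>" unfolding eventually_sequentially by blast
  have fin: "emeasure lborel (A \<inter> C N) < \<infinity>"
    using emeasure_mono[of "A \<inter> C N" A lborel] A by (auto intro: le_less_trans)
  have "(LINT x|lborel. cmod (complex_of_real (indicator A x) - complex_of_real (indicator (A \<inter> C N) x))) = measure lborel (A - A \<inter> C N)"
    using A by (intro norm_indicator_diff_integral) (auto simp: C_def)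
  also have "A - A \<inter> C N = A - C N" by auto
  finally show "\<exists>g. integrable lborel g \<and> fourier_vanishes g \<and> (LINT x|lborel. cmod (complex_of_real (indicator A x) - g x)) \<le> \<delta>"
    using N fourier_vanishes_indicator_bounded[OF A(1), of "- (real N *\<^sub>R One)" "real N *\<^sub>R One"]
      integrable_indicator_complex[of "A \<inter> C N"] fin A
    by (intro exI[of _ "\<lambda>x. complex_of_real (indicator (A \<inter> C N) x)"]) (auto simp: C_def)
qed (use A in auto)

theorem riemann_lebesgue:
  fixes f :: "real ^ 'n \<Rightarrow> complex"
  assumes "integrable lborel f"
  shows "fourier_vanishes f"
  using assms
proof (induction rule: integrable_induct)
  case (base A c)
  then have "fourier_vanishes (\<lambda>x. c * complex_of_real (indicator A x))"
    by (intro fourier_vanishes_mult fourier_vanishes_indicator) auto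
  then show ?case by (simp add: scaleR_conv_of_real mult.commute)
next
  case (add f g)
  then show ?case by (intro fourier_vanishes_add)
next
  case (lim f s)
  show ?case
  proof (rule fourier_vanishes_approx[OF lim.hyps(4)])
    fix \<delta> :: real assume \<delta>: "0 < \<delta>"
    have "(\<lambda>i. LINT x|lborel. cmod (f x - s i x)) \<longlonglongrightarrow> (LINT x|(lborel :: (real ^ 'n) measure). 0)"
    \<comment> \<open>The approximating simple functions satisfy |s_i| \<le> 2 |f|, hence |f - s_i|
      \<le> 3 |f|.\<close>
    proof (rule integral_dominated_convergence[where w="\<lambda>x. 3 * cmod (f x)"])
      show "integrable lborel (\<lambda>x. 3 * cmod (f x))" using lim by simp
      show "(\<lambda>x. cmod (f x - s i x)) \<in> borel_measurable lborel" for i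
        using lim by (auto intro!: borel_measurable_norm borel_measurable_diff)
      show "AE x in lborel. (\<lambda>i. cmod (f x - s i x)) \<longlonglongrightarrow> 0"
      proof (intro AE_I2)
        fix x :: "real ^ 'n" assume "x \<in> space lborel"
        then have "(\<lambda>i. s i x) \<longlonglongrightarrow> f x" by (rule lim)
        then have "(\<lambda>i. f x - s i x) \<longlonglongrightarrow> f x - f x" by (intro tendsto_intros)
        then show "(\<lambda>i. cmod (f x - s i x)) \<longlonglongrightarrow> 0" by (simp add: tendsto_norm_zero)
      qed
      show "AE x in lborel. norm (cmod (f x - s i x)) \<le> 3 * cmod (f x)" for i
      proof (intro AE_I2)
        fix x :: "real ^ 'n" assume "x \<in> space lborel"
        then have "norm (s i x) \<le> 2 * norm (f x)" by (rule lim)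
        then show "norm (cmod (f x - s i x)) \<le> 3 * cmod (f x)"
          using norm_triangle_ineq4[of "f x" "s i x"] by simp
      qed
    qed simp
    then have "\<forall>\<^sub>F i in sequentially. (LINT x|lborel. cmod (f x - s i x)) < \<delta>"
      using \<delta> by (intro order_tendstoD) auto
    then obtain i where "(LINT x|lborel. cmod (f x - s i x)) < \<delta>"
      unfolding eventually_sequentially by blast
    then show "\<exists>g. integrable lborel g \<and> fourier_vanishes g \<and> (LINT x|lborel. cmod (f x - g x)) \<le> \<delta>"
      using lim by (intro exI[of _ "s i"]) auto
  qed
qed

section \<open>The Fourier transform of the limit measure\<close>

lemma integrable_return_borel:
  fixes g :: "'a::topological_space \<Rightarrow> 'b::{banach,second_countable_topology}"
  assumes "g \<in> borel_measurable borel"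
  shows "integrable (return borel x) g"
  using assms by (intro integrableI_bounded) (auto simp: nn_integral_return)

locale density_kernel =
  fixes \<phi> :: "real ^ 'n \<Rightarrow> real" and K :: "real ^ 'n \<Rightarrow> complex"
  assumes \<phi>_measurable [measurable]: "\<phi> \<in> borel_measurable borel"
    and \<phi>_nonneg: "\<And>x. 0 \<le> \<phi> x"
    and \<phi>_prob: "(\<integral>\<^sup>+ x. ennreal (\<phi> x) \<partial>lborel) = 1"
    and K_eq: "K = fourier_transform (\<lambda>x. complex_of_real (\<phi> x))"
begin

lemma \<phi>_integrable: "integrable lborel \<phi>"
  using \<phi>_nonneg \<phi>_prob by (intro integrableI_nonneg) auto

lemma \<phi>_integral: "(LINT x|lborel. \<phi> x) = 1"
  using \<phi>_nonneg \<phi>_prob by (subst integral_eq_nn_integral) auto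

lemma K_measurable [measurable]: "K \<in> borel_measurable borel"
  unfolding K_eq by (rule fourier_transform_measurable) measurable

lemma norm_K_le_1: "cmod (K x) \<le> 1"
  using norm_fourier_transform_le[of "\<lambda>x. complex_of_real (\<phi> x)" x] \<phi>_nonneg
  by (simp add: K_eq \<phi>_integral)

lemma K_0: "K 0 = 1"
  by (simp add: K_eq fourier_transform_def \<phi>_integral)

lemma K_uminus: "K (- x) = cnj (K x)"
  unfolding K_eq fourier_transform_def by (simp add: exp_cnj flip: Bochner_Integration.integral_cnj)

lemma K_vanishes: "0 < \<epsilon> \<Longrightarrow> \<exists>R. \<forall>x. R \<le> norm x \<longrightarrow> cmod (K x) \<le> \<epsilon>"
  using riemann_lebesgue[of "\<lambda>x. complex_of_real (\<phi> x)"] \<phi>_integrable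
  unfolding fourier_vanishes_def K_eq by simp

definition pair_density :: "real ^ 'n \<Rightarrow> real" where
  "pair_density = fun_convolution \<phi> (\<lambda>y. \<phi> (- y))"

lemma pair_density_eq: "pair_density x = (LINT u|lborel. \<phi> u * \<phi> (u - x))"
  by (simp add: pair_density_def fun_convolution_def)

lemma \<phi>_shift: "integrable lborel (\<lambda>x. \<phi> (u - x))" "(LINT x|lborel. \<phi> (u - x)) = 1"
  using integrable_affine_cart[of "- 1" \<phi> u] integral_affine_cart[of "- 1" \<phi> u] \<phi>_integrable \<phi>_integral
  by simp_all

lemma pair_integrable: "integrable (lborel \<Otimes>\<^sub>M lborel) (\<lambda>(x, u). \<phi> u * \<phi> (u - x))"
proof -
  have "integrable (lborel \<Otimes>\<^sub>M lborel) (\<lambda>(u, x). \<phi> u * \<phi> (u - x))"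
  proof (rule lborel_pair.Fubini_integrable)
    show "integrable lborel (\<lambda>u. LINT x|lborel. norm (case (u, x) of (u, x) \<Rightarrow> \<phi> u * \<phi> (u - x)))"
      using \<phi>_nonneg \<phi>_integrable by (simp add: abs_mult \<phi>_shift)
    show "AE u in lborel. integrable lborel (\<lambda>x. case (u, x) of (u, x) \<Rightarrow> \<phi> u * \<phi> (u - x))"
      using \<phi>_shift by auto
  qed measurable
  then show ?thesis
    by (subst (asm) lborel_pair.integrable_product_swap_iff[symmetric]) (simp add: case_prod_beta)
qed

lemma pair_density_nonneg: "0 \<le> pair_density x"
  unfolding pair_density_eq using \<phi>_nonneg by (intro Bochner_Integration.integral_nonneg) auto

lemma pair_density_integrable: "integrable lborel pair_density"
  unfolding pair_density_eq[abs_def]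
  using lborel_pair.integrable_fst[OF pair_integrable] by simp

lemma pair_density_measurable [measurable]: "pair_density \<in> borel_measurable borel"
  using borel_measurable_integrable[OF pair_density_integrable] by simp

lemma pair_density_uminus: "pair_density (- x) = pair_density x"
proof -
  have "pair_density (- x) = (LINT u|lborel. \<phi> (- x + 1 *\<^sub>R u) * \<phi> (- x + 1 *\<^sub>R u - (- x)))"
    unfolding pair_density_eq
    using integral_affine_cart[of 1 "\<lambda>u. \<phi> u * \<phi> (u - (- x))" "- x"] by simp
  then show ?thesis by (simp add: pair_density_eq mult.commute)
qed

text \<open>The substitution x -> u - x separates the double integral: the phases at u and at -x
  give K(y) and its complex conjugate.\<close>

lemma fourier_pair_density:
  "fourier_transform (\<lambda>x. complex_of_real (pair_density x)) y = complex_of_real ((cmod (K y))\<^sup>2)"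
proof -
  let ?e = "\<lambda>t. exp (- (2 * complex_of_real pi * \<i> * complex_of_real t))"
  let ?g = "\<lambda>x u. complex_of_real (\<phi> u * \<phi> (u - x)) * ?e (x \<bullet> y)"
  have int: "integrable (lborel \<Otimes>\<^sub>M lborel) (\<lambda>(x, u). ?g x u)"
    by (rule Bochner_Integration.integrable_bound[OF pair_integrable]) (auto simp: norm_mult)
  have "fourier_transform (\<lambda>x. complex_of_real (pair_density x)) y = (LINT x|lborel. LINT u|lborel. ?g x u)"
    unfolding fourier_transform_def pair_density_eq by (simp flip: integral_complex_of_real integral_mult_left_zero)
  also have "\<dots> = (LINT u|lborel. LINT x|lborel. ?g x u)"
    by (rule lborel_pair.Fubini_integral[OF int, symmetric])
  also have "\<dots> = (LINT u|lborel. complex_of_real (\<phi> u) * ?e (u \<bullet> y) * cnj (K y))"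
  proof (intro Bochner_Integration.integral_cong refl)
    fix u :: "real ^ 'n"
    have "(LINT x|lborel. ?g x u) = (LINT x|lborel. ?g (u + (- 1) *\<^sub>R x) u)"
      using integral_affine_cart[of "- 1" "\<lambda>x. ?g x u" u] by simp
    also have "\<dots> = (LINT x|lborel. complex_of_real (\<phi> u) * ?e (u \<bullet> y) * cnj (complex_of_real (\<phi> x) * ?e (x \<bullet> y)))"
    proof (intro Bochner_Integration.integral_cong refl)
      fix x :: "real ^ 'n"
      have "?e ((u + (- 1) *\<^sub>R x) \<bullet> y) = ?e (u \<bullet> y) * ?e (- (x \<bullet> y))"
        unfolding exp_fourier_add[symmetric] by (simp add: inner_diff_left)
      moreover have "?e (- (x \<bullet> y)) = cnj (?e (x \<bullet> y))" by (simp add: exp_cnj)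
      ultimately show "?g (u + (- 1) *\<^sub>R x) u = complex_of_real (\<phi> u) * ?e (u \<bullet> y) * cnj (complex_of_real (\<phi> x) * ?e (x \<bullet> y))"
        by simp
    qed
    also have "\<dots> = complex_of_real (\<phi> u) * ?e (u \<bullet> y) * cnj (K y)"
      unfolding K_eq fourier_transform_def by (simp only: integral_mult_right_zero Bochner_Integration.integral_cnj)
    finally show "(LINT x|lborel. ?g x u) = complex_of_real (\<phi> u) * ?e (u \<bullet> y) * cnj (K y)" .
  qed
  also have "\<dots> = K y * cnj (K y)"
    unfolding integral_mult_left_zero by (simp add: K_eq fourier_transform_def)
  also have "\<dots> = complex_of_real ((cmod (K y))\<^sup>2)"
    by (simp add: complex_norm_square[symmetric])
  finally show ?thesis .
qed

definition autocorrelation_limit :: "(real ^ 'n) measure" where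
  "autocorrelation_limit = add_measure (return borel 0) (density lborel (\<lambda>x. ennreal (1 + (cmod (K x))\<^sup>2)))"

definition diffraction_limit :: "(real ^ 'n) measure" where
  "diffraction_limit = add_measure (return borel 0) (density lborel (\<lambda>x. ennreal (1 + pair_density x)))"

text \<open>Uniformly in the translate, the atom contributes at most 1, the Lebesgue part the volume
  of a ball of fixed radius, and the part with density \<open>pair_density\<close> at most its total
  integral.\<close>

lemma translation_bounded_diffraction_limit: "translation_bounded diffraction_limit"
  unfolding translation_bounded_def
proof (intro ballI impI)
  fix B :: "(real ^ 'n) set" assume B: "B \<in> sets borel" "bounded B"
  obtain r where r: "B \<subseteq> ball 0 r" using B(2) by (metis bounded_subset_ballD)
  let ?d = "density lborel (\<lambda>x :: real ^ 'n. ennreal (1 + pair_density x))"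
  let ?C = "1 + (emeasure lborel (ball (0 :: real ^ 'n) r) + ennreal (LINT x|lborel. pair_density x))"
  have "emeasure diffraction_limit ((\<lambda>b. x + b) ` B) \<le> ?C" for x
  proof -
    have "emeasure diffraction_limit ((\<lambda>b. x + b) ` B) \<le> emeasure diffraction_limit (ball x r)"
      unfolding diffraction_limit_def using r by (intro emeasure_mono) (auto simp: sets_add_measure dist_norm)
    also have "\<dots> = emeasure (return borel 0) (ball x r) + emeasure ?d (ball x r)"
      unfolding diffraction_limit_def by (intro emeasure_add_measure) auto
    also have "emeasure (return borel 0) (ball x r) \<le> 1"
      by (simp add: indicator_def)
    also have "emeasure ?d (ball x r) = (\<integral>\<^sup>+ z. indicator (ball x r) z + ennreal (pair_density z) * indicator (ball x r) z \<partial>lborel)"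
      using pair_density_nonneg by (subst emeasure_density) (auto intro!: nn_integral_cong simp: indicator_def)
    also have "\<dots> = emeasure lborel (ball x r) + (\<integral>\<^sup>+ z. ennreal (pair_density z) * indicator (ball x r) z \<partial>lborel)"
    proof -
      have [measurable]: "ball x r \<in> sets borel" by simp
      have m: "(\<lambda>z. indicator (ball x r) z :: ennreal) \<in> borel_measurable lborel"
        "(\<lambda>z. ennreal (pair_density z) * indicator (ball x r) z) \<in> borel_measurable lborel"
        by measurable
      show ?thesis unfolding nn_integral_add[OF m] by simp
    qed
    also have "(\<integral>\<^sup>+ z. ennreal (pair_density z) * indicator (ball x r) z \<partial>lborel) \<le> (\<integral>\<^sup>+ z. ennreal (pair_density z) \<partial>lborel)"
      by (intro nn_integral_mono) (auto simp: indicator_def)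
    also have "\<dots> = ennreal (LINT x|lborel. pair_density x)"
      using pair_density_integrable pair_density_nonneg by (intro nn_integral_eq_integral) auto
    also have "emeasure lborel (ball x r) = emeasure lborel (ball (0 :: real ^ 'n) r)"
    proof (cases "0 \<le> r")
      case False
      then have "ball x r = {}" "ball (0 :: real ^ 'n) r = {}" by auto
      then show ?thesis by (simp only:)
    qed (simp add: emeasure_ball)
    finally show ?thesis by (simp add: add_mono)
  qed
  then have "(SUP x. emeasure diffraction_limit ((\<lambda>b. x + b) ` B)) \<le> ?C" by (intro SUP_least)
  also have "?C < \<infinity>" using emeasure_lborel_ball_finite[of "0 :: real ^ 'n" r] by (simp add: less_top)
  finally show "(SUP x. emeasure diffraction_limit ((\<lambda>b. x + b) ` B)) < \<infinity>" .
qed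

lemma sets_limits [simp]: "sets autocorrelation_limit = sets borel" "sets diffraction_limit = sets borel"
  by (simp_all add: autocorrelation_limit_def diffraction_limit_def sets_add_measure)

lemma
  assumes g: "integrable lborel g" and [measurable]: "g \<in> borel_measurable borel"
  shows integrable_autocorrelation_limit: "integrable autocorrelation_limit g"
    and integral_autocorrelation_limit: "integral\<^sup>L autocorrelation_limit g = g 0 + (LINT x|lborel. g x) + (LINT x|lborel. complex_of_real ((cmod (K x))\<^sup>2) * g x)"
proof -
  let ?d = "density lborel (\<lambda>x. ennreal (1 + (cmod (K x))\<^sup>2))"
  have Kg: "integrable lborel (\<lambda>x. complex_of_real ((cmod (K x))\<^sup>2) * g x)"
    using norm_K_le_1 by (intro Bochner_Integration.integrable_bound[OF g])
      (auto intro!: AE_I2 mult_left_le_one_le simp: norm_mult norm_power abs_square_le_1 power_le_one)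
  have eq: "(1 + (cmod (K x))\<^sup>2) *\<^sub>R g x = g x + complex_of_real ((cmod (K x))\<^sup>2) * g x" for x
    by (simp add: scaleR_conv_of_real distrib_right)
  have d: "integrable ?d g" "integral\<^sup>L ?d g = (LINT x|lborel. g x) + (LINT x|lborel. complex_of_real ((cmod (K x))\<^sup>2) * g x)"
  proof -
    show "integrable ?d g"
      by (subst integrable_density) (use g Kg in \<open>auto simp: eq add_nonneg_nonneg\<close>)
    show "integral\<^sup>L ?d g = (LINT x|lborel. g x) + (LINT x|lborel. complex_of_real ((cmod (K x))\<^sup>2) * g x)"
      by (subst integral_density) (use g Kg in \<open>auto simp: eq add_nonneg_nonneg\<close>)
  qed
  have r: "integrable (return borel 0) g" "integral\<^sup>L (return borel 0) g = g 0"
    by (auto simp: integrable_return_borel integral_return)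
  show "integrable autocorrelation_limit g"
    unfolding autocorrelation_limit_def using d r by (intro integrable_add_measure) auto
  show "integral\<^sup>L autocorrelation_limit g = g 0 + (LINT x|lborel. g x) + (LINT x|lborel. complex_of_real ((cmod (K x))\<^sup>2) * g x)"
    unfolding autocorrelation_limit_def using d r by (subst integral_add_measure) auto
qed

lemma
  assumes g: "integrable lborel g" and [measurable]: "g \<in> borel_measurable borel" and B: "\<And>x. cmod (g x) \<le> B"
  shows integrable_diffraction_limit: "integrable diffraction_limit g"
    and integral_diffraction_limit: "integral\<^sup>L diffraction_limit g = g 0 + (LINT x|lborel. g x) + (LINT x|lborel. complex_of_real (pair_density x) * g x)"
proof -
  let ?d = "density lborel (\<lambda>x. ennreal (1 + pair_density x))"
  have pg: "integrable lborel (\<lambda>x. complex_of_real (pair_density x) * g x)"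
  proof (rule Bochner_Integration.integrable_bound)
    show "integrable lborel (\<lambda>x. B * pair_density x)" using pair_density_integrable by simp
    show "AE x in lborel. cmod (complex_of_real (pair_density x) * g x) \<le> norm (B * pair_density x)"
    proof (intro AE_I2)
      fix x
      have "cmod (complex_of_real (pair_density x) * g x) \<le> pair_density x * B"
        using B[of x] pair_density_nonneg[of x] by (simp add: norm_mult mult_left_mono)
      then show "cmod (complex_of_real (pair_density x) * g x) \<le> norm (B * pair_density x)" by (simp add: mult.commute)
    qed
  qed measurable
  have eq: "(1 + pair_density x) *\<^sub>R g x = g x + complex_of_real (pair_density x) * g x" for x
    by (simp add: scaleR_conv_of_real distrib_right)
  have d: "integrable ?d g" "integral\<^sup>L ?d g = (LINT x|lborel. g x) + (LINT x|lborel. complex_of_real (pair_density x) * g x)"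
  proof -
    show "integrable ?d g"
      by (subst integrable_density) (use g pg in \<open>auto simp: eq add_nonneg_nonneg pair_density_nonneg\<close>)
    show "integral\<^sup>L ?d g = (LINT x|lborel. g x) + (LINT x|lborel. complex_of_real (pair_density x) * g x)"
      by (subst integral_density) (use g pg in \<open>auto simp: eq add_nonneg_nonneg pair_density_nonneg\<close>)
  qed
  have r: "integrable (return borel 0) g" "integral\<^sup>L (return borel 0) g = g 0"
    by (auto simp: integrable_return_borel integral_return)
  show "integrable diffraction_limit g"
    unfolding diffraction_limit_def using d r by (intro integrable_add_measure) auto
  show "integral\<^sup>L diffraction_limit g = g 0 + (LINT x|lborel. g x) + (LINT x|lborel. complex_of_real (pair_density x) * g x)"
    unfolding diffraction_limit_def using d r by (subst integral_add_measure) auto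
qed

text \<open>Three pairings are matched. The value of the transform at 0 is the integral of f, its
  integral is f(0) by inversion, and the multiplication formula moves |K|^2, the transform of
  \<open>pair_density\<close>, onto f; the reflection coming from the double transform is absorbed
  because \<open>pair_density\<close> is even.\<close>

lemma fourier_dual_limits: "fourier_dual autocorrelation_limit diffraction_limit"
  unfolding fourier_dual_def
proof (intro conjI allI impI)
  fix f :: "real ^ 'n \<Rightarrow> complex" assume f: "schwartz f"
  obtain B where B: "\<And>x. cmod (f x) \<le> B" using schwartz_bounded[OF f] by blast
  have fi: "integrable lborel f" and fm: "f \<in> borel_measurable borel"
    using f by (auto intro: schwartz_integrable schwartz_measurable)
  have hi: "integrable lborel (fourier_transform f)" and hm: "fourier_transform f \<in> borel_measurable borel"
    using f fm by (auto intro: schwartz_fourier_integrable fourier_transform_measurable)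
  have inv: "fourier_transform (fourier_transform f) x = f (- x)" for x
    by (rule fourier_inversion[OF fi schwartz_continuous[OF f] B hi])
  show "integrable diffraction_limit f" by (rule integrable_diffraction_limit[OF fi fm B])
  show "integrable autocorrelation_limit (fourier_transform f)" by (rule integrable_autocorrelation_limit[OF hi hm])
  have 1: "fourier_transform f 0 = (LINT x|lborel. f x)" by (simp add: fourier_transform_def)
  have 2: "(LINT x|lborel. fourier_transform f x) = f 0"
    using inv[of 0] by (simp add: fourier_transform_def)
  have "(LINT x|lborel. complex_of_real ((cmod (K x))\<^sup>2) * fourier_transform f x)
     = (LINT x|lborel. complex_of_real (pair_density x) * fourier_transform (fourier_transform f) x)"
    unfolding fourier_pair_density[symmetric]
    by (rule fourier_multiplication_formula[OF integrable_of_real[OF pair_density_integrable] hi])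
  also have "\<dots> = (LINT x|lborel. complex_of_real (pair_density (0 + (- 1) *\<^sub>R x)) * f (0 + (- 1) *\<^sub>R x))"
    by (simp add: inv pair_density_uminus)
  also have "\<dots> = (LINT x|lborel. complex_of_real (pair_density x) * f x)"
    using integral_affine_cart[of "- 1" "\<lambda>x. complex_of_real (pair_density x) * f x" 0] fm by simp
  finally show "integral\<^sup>L diffraction_limit f = integral\<^sup>L autocorrelation_limit (fourier_transform f)"
    unfolding integral_diffraction_limit[OF fi fm B] integral_autocorrelation_limit[OF hi hm] by (simp add: 1 2)
qed (use translation_bounded_diffraction_limit in auto)

theorem is_fourier_measure_limits: "is_fourier_measure autocorrelation_limit diffraction_limit"
  unfolding is_fourier_measure_def
proof (intro conjI allI impI fourier_dual_limits)
  fix \<nu>' assume "fourier_dual autocorrelation_limit \<nu>'"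
  with fourier_dual_limits show "\<nu>' = diffraction_limit"
    unfolding fourier_dual_def by (intro measure_eq_schwartz) auto
qed

end

section \<open>Lattice points and a maximal inequality\<close>

definition lattice :: "(real ^ 'n) set" where
  "lattice = {x. \<forall>i. x $ i \<in> \<int>}"

text \<open>Half open in every coordinate, so that the cubes at lattice points tile the space
  without overlap.\<close>

definition lattice_cube :: "real ^ 'n \<Rightarrow> (real ^ 'n) set" where
  "lattice_cube b = {x. \<forall>i. b $ i \<le> x $ i \<and> x $ i < b $ i + 1}"

definition floor_vec :: "real ^ 'n \<Rightarrow> real ^ 'n" where
  "floor_vec x = (\<chi> i. of_int \<lfloor>x $ i\<rfloor>)"

definition lattice_ball :: "real \<Rightarrow> (real ^ 'n) set" where
  "lattice_ball r = lattice \<inter> ball 0 r"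

text \<open>The dimension enters through a type argument, as the radius alone does not determine it.
  For negative radii the value is 0.\<close>

definition ball_vol :: "'n::finite itself \<Rightarrow> real \<Rightarrow> real" where
  "ball_vol T r = measure lborel (ball (0 :: real ^ 'n) r)"

lemma floor_vec_in_lattice [simp]: "floor_vec x \<in> lattice"
  by (simp add: floor_vec_def lattice_def)

lemma in_lattice_cube_iff: "b \<in> lattice \<Longrightarrow> x \<in> lattice_cube b \<longleftrightarrow> floor_vec x = b"
proof
  assume b: "b \<in> lattice" and x: "x \<in> lattice_cube b"
  show "floor_vec x = b"
    unfolding vec_eq_iff
  proof
    fix i
    obtain k :: int where k: "b $ i = of_int k"
      using b by (auto simp: lattice_def Ints_def)
    show "floor_vec x $ i = b $ i"
    proof -
      have "b $ i \<le> x $ i" "x $ i < b $ i + 1" using x by (auto simp: lattice_cube_def)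
      then have "\<lfloor>x $ i\<rfloor> = k" using k by linarith
      then show ?thesis using k by (simp add: floor_vec_def)
    qed
  qed
next
  assume "floor_vec x = b"
  then show "x \<in> lattice_cube b"
    by (auto simp: floor_vec_def lattice_cube_def)
qed

lemma mem_lattice_cube_floor_vec: "x \<in> lattice_cube (floor_vec x)"
  by (simp add: in_lattice_cube_iff)

lemma lattice_add: "b \<in> lattice \<Longrightarrow> c \<in> lattice \<Longrightarrow> b + c \<in> lattice"
  and lattice_diff: "b \<in> lattice \<Longrightarrow> c \<in> lattice \<Longrightarrow> b - c \<in> lattice"
  and zero_in_lattice [simp]: "0 \<in> lattice"
  and lattice_uminus: "b \<in> lattice \<Longrightarrow> - b \<in> lattice"
  by (auto simp: lattice_def)

lemma norm_diff_lattice_cube: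
  fixes x :: "real ^ 'n"
  assumes "x \<in> lattice_cube b"
  shows "norm (x - b) \<le> real CARD('n)"
proof -
  have "norm (x - b) \<le> (\<Sum>i\<in>UNIV. \<bar>(x - b) $ i\<bar>)"
    by (rule norm_le_l1_cart)
  also have "\<dots> \<le> (\<Sum>i\<in>(UNIV::'n set). 1)"
    using assms by (intro sum_mono) (auto simp: lattice_cube_def abs_le_iff algebra_simps less_imp_le)
  finally show ?thesis by simp
qed

lemma lattice_cube_translate: "x \<in> lattice_cube (b + c) \<longleftrightarrow> x - b \<in> lattice_cube c"
  by (auto simp: lattice_cube_def algebra_simps)

lemma lattice_cube_measurable [measurable]: "lattice_cube b \<in> sets borel"
  unfolding lattice_cube_def by measurable

lemma emeasure_lattice_cube: "emeasure lborel (lattice_cube (b :: real ^ 'n)) = 1"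
proof (rule antisym)
  let ?u = "b + (\<chi> i. 1)"
  have e: "(\<Prod>i\<in>Basis. (?u - b) \<bullet> i) = 1"
    by (intro prod.neutral) (auto simp: Basis_vec_def inner_axis)
  have le: "\<And>i. i \<in> Basis \<Longrightarrow> b \<bullet> i \<le> ?u \<bullet> i"
    by (auto simp: Basis_vec_def inner_axis)
  have "emeasure lborel (lattice_cube b) \<le> emeasure lborel (cbox b ?u)"
    by (intro emeasure_mono) (auto simp: lattice_cube_def mem_box_cart less_imp_le)
  also have "\<dots> = 1"
    by (subst emeasure_lborel_cbox[OF le]) (use e in auto)
  finally show "emeasure lborel (lattice_cube b) \<le> 1" .
  have "1 = emeasure lborel (box b ?u)"
    by (subst emeasure_lborel_box[OF le]) (use e in auto)
  also have "\<dots> \<le> emeasure lborel (lattice_cube b)"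
    by (intro emeasure_mono) (auto simp: lattice_cube_def mem_box_cart less_imp_le)
  finally show "1 \<le> emeasure lborel (lattice_cube b)" .
qed

lemma emeasure_UN_lattice_cube:
  fixes S :: "(real ^ 'n) set"
  assumes "finite S" "S \<subseteq> lattice"
  shows "emeasure lborel (\<Union>b\<in>S. lattice_cube b) = of_nat (card S)"
proof -
  have "disjoint_family_on lattice_cube S"
    using assms by (auto simp: disjoint_family_on_def in_lattice_cube_iff subset_iff)
  then have "emeasure lborel (\<Union>b\<in>S. lattice_cube b) = (\<Sum>b\<in>S. emeasure lborel (lattice_cube b))"
    using assms by (intro sum_emeasure[symmetric]) auto
  then show ?thesis
    by (simp add: emeasure_lattice_cube)
qed

lemma emeasure_ball_ball_vol:
  "emeasure lborel (ball (c :: real ^ 'n) r) = ennreal (ball_vol TYPE('n) r)"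
proof (cases "r \<ge> 0")
  case True
  then show ?thesis
    by (simp add: ball_vol_def emeasure_ball content_ball)
next
  case False
  then have "ball c r = {}" "ball (0 :: real ^ 'n) r = {}" by auto
  then show ?thesis by (simp only: ball_vol_def) simp
qed

lemma ball_vol_eq: "r \<ge> 0 \<Longrightarrow> ball_vol TYPE('n::finite) r = unit_ball_vol (real CARD('n)) * r ^ CARD('n)"
  by (simp add: ball_vol_def content_ball)

lemma ball_vol_nonneg [simp]: "0 \<le> ball_vol T r"
  by (simp add: ball_vol_def)

lemma ball_vol_pos: "0 < r \<Longrightarrow> 0 < ball_vol TYPE('n::finite) r"
  by (simp add: ball_vol_eq)

lemma ball_vol_mult: "0 \<le> r \<Longrightarrow> 0 \<le> c \<Longrightarrow>
  ball_vol TYPE('n::finite) (c * r) = c ^ CARD('n) * ball_vol TYPE('n) r"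
  by (simp add: ball_vol_eq power_mult_distrib)

lemma ball_vol_mono: "r \<le> s \<Longrightarrow> ball_vol TYPE('n::finite) r \<le> ball_vol TYPE('n) s"
  unfolding ball_vol_def
  by (intro measure_mono_fmeasurable) (auto simp: subset_ball fmeasurable_def emeasure_ball_ball_vol)

text \<open>Unit cubes at the points of S are disjoint and reach at most d beyond the ball, so
  comparing volumes bounds their number. It is phrased for finite subsets because the finiteness of
  the lattice points in a ball is deduced from it.\<close>

lemma card_lattice_subset_ball:
  fixes S :: "(real ^ 'n) set"
  assumes "finite S" "S \<subseteq> lattice" "S \<subseteq> ball c r"
  shows "real (card S) \<le> ball_vol TYPE('n) (r + real CARD('n))"
proof -
  have "ennreal (real (card S)) = emeasure lborel (\<Union>b\<in>S. lattice_cube b)"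
    using emeasure_UN_lattice_cube[OF assms(1,2)] by (simp add: ennreal_of_nat_eq_real_of_nat)
  also have "\<dots> \<le> emeasure lborel (ball c (r + real CARD('n)))"
  proof (intro emeasure_mono subsetI)
    fix x assume "x \<in> (\<Union>b\<in>S. lattice_cube b)"
    then obtain b where b: "b \<in> S" "x \<in> lattice_cube b" by auto
    have "dist c x \<le> dist c b + dist b x" by (rule dist_triangle)
    also have "dist b x \<le> real CARD('n)"
      using norm_diff_lattice_cube[OF b(2)] by (simp add: dist_norm norm_minus_commute)
    also have "dist c b < r" using b assms by auto
    finally show "x \<in> ball c (r + real CARD('n))" by simp
  qed auto
  finally show ?thesis
    by (simp add: emeasure_ball_ball_vol)
qed

lemma finite_lattice_Int_ball [simp]: "finite (lattice \<inter> ball (c :: real ^ 'n) r)"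
proof -
  obtain k :: nat where k: "ball_vol TYPE('n) (r + real CARD('n)) \<le> real k"
    using real_arch_simple by blast
  have "finite (lattice \<inter> ball c r) \<and> card (lattice \<inter> ball c r) \<le> k"
  proof (rule finite_if_finite_subsets_card_bdd)
    fix G assume "G \<subseteq> lattice \<inter> ball c r" "finite G"
    then have "real (card G) \<le> real k"
      using card_lattice_subset_ball[of G c r] k by auto
    then show "card G \<le> k" by simp
  qed
  then show ?thesis ..
qed

lemma finite_lattice_ball [simp]: "finite (lattice_ball r)"
  unfolding lattice_ball_def by (rule finite_lattice_Int_ball)

lemma lattice_ball_subset: "lattice_ball r \<subseteq> lattice"
  by (auto simp: lattice_ball_def)

lemma lattice_Int_ball_eq:
  assumes "b \<in> lattice"
  shows "lattice \<inter> ball b r = (\<lambda>c. b + c) ` lattice_ball r"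
proof (intro set_eqI iffI)
  fix x assume "x \<in> lattice \<inter> ball b r"
  then have "x - b \<in> lattice_ball r" "x = b + (x - b)"
    using assms by (auto simp: lattice_ball_def lattice_diff dist_norm norm_minus_commute)
  then show "x \<in> (\<lambda>c. b + c) ` lattice_ball r" by blast
qed (use assms in \<open>auto simp: lattice_ball_def lattice_add dist_norm\<close>)

lemma card_lattice_Int_ball: "b \<in> lattice \<Longrightarrow> card (lattice \<inter> ball (b :: real ^ 'n) r) = card (lattice_ball r :: (real ^ 'n) set)"
  by (simp add: lattice_Int_ball_eq card_image)

lemma sum_lattice_Int_ball:
  "b \<in> lattice \<Longrightarrow> sum y (lattice \<inter> ball b r) = (\<Sum>c\<in>lattice_ball r. y (b + c))"
  by (subst lattice_Int_ball_eq) (simp_all add: sum.reindex)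

lemma card_lattice_ball_le:
  "real (card (lattice_ball r :: (real ^ 'n) set)) \<le> ball_vol TYPE('n) (r + real CARD('n))"
  by (rule card_lattice_subset_ball[of _ 0]) (auto simp: lattice_ball_def finite_lattice_Int_ball)

text \<open>The opposite volume comparison: the cubes at the lattice points of the ball cover the
  ball whose radius is smaller by d.\<close>

lemma card_lattice_ball_ge:
  "ball_vol TYPE('n) (r - real CARD('n)) \<le> real (card (lattice_ball r :: (real ^ 'n) set))"
proof -
  have "ennreal (ball_vol TYPE('n) (r - real CARD('n))) = emeasure lborel (ball (0 :: real ^ 'n) (r - real CARD('n)))"
    by (simp add: emeasure_ball_ball_vol)
  also have "\<dots> \<le> emeasure lborel (\<Union>b\<in>(lattice_ball r :: (real ^ 'n) set). lattice_cube b)"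
  proof (intro emeasure_mono subsetI)
    fix x :: "real ^ 'n" assume x: "x \<in> ball 0 (r - real CARD('n))"
    have "norm (floor_vec x) \<le> norm x + norm (x - floor_vec x)"
      using norm_triangle_ineq4[of x "x - floor_vec x"] by simp
    then have "floor_vec x \<in> lattice_ball r"
      using x norm_diff_lattice_cube[OF mem_lattice_cube_floor_vec[of x]]
      by (auto simp: lattice_ball_def)
    then show "x \<in> (\<Union>b\<in>lattice_ball r. lattice_cube b)"
      using mem_lattice_cube_floor_vec[of x] by blast
  qed auto
  also have "\<dots> = ennreal (real (card (lattice_ball r :: (real ^ 'n) set)))"
    by (simp add: emeasure_UN_lattice_cube lattice_ball_subset ennreal_of_nat_eq_real_of_nat)
  finally show ?thesis by simp
qed

lemma countable_lattice [simp]: "countable (lattice :: (real ^ 'n) set)"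
proof -
  have "(lattice :: (real ^ 'n) set) = (\<Union>k::nat. lattice_ball (real k))"
  proof (intro set_eqI iffI)
    fix x :: "real ^ 'n" assume "x \<in> lattice"
    moreover obtain k :: nat where "norm x < real k" using reals_Archimedean2 by blast
    ultimately show "x \<in> (\<Union>k::nat. lattice_ball (real k))" by (auto simp: lattice_ball_def)
  qed (auto simp: lattice_ball_def)
  then show ?thesis by (metis countable_UN countable_finite finite_lattice_ball uncountable_def countableI_type)
qed

lemma ball_vol_ratio_tendsto:
  "(\<lambda>n. ball_vol TYPE('n::finite) (real n + s) / ball_vol TYPE('n) (real n)) \<longlonglongrightarrow> 1"
proof -
  have "(\<lambda>n. 1 + s / real n) \<longlonglongrightarrow> 1 + 0"
    by (intro tendsto_add tendsto_const lim_const_over_n)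
  then have "(\<lambda>n. (1 + s / real n) ^ CARD('n)) \<longlonglongrightarrow> (1 + 0) ^ CARD('n)"
    by (intro tendsto_power)
  then have "(\<lambda>n. (1 + s / real n) ^ CARD('n)) \<longlonglongrightarrow> 1" by simp
  then show ?thesis
  proof (rule Lim_transform_eventually)
    obtain k :: nat where k: "real k > \<bar>s\<bar>" using reals_Archimedean2 by blast
    show "\<forall>\<^sub>F n in sequentially. (1 + s / real n) ^ CARD('n) =
      ball_vol TYPE('n) (real n + s) / ball_vol TYPE('n) (real n)"
      using eventually_ge_at_top[of k]
    proof eventually_elim
      case (elim n)
      then have "real n > \<bar>s\<bar>" using k by linarith
      then have n: "real n > 0" "real n + s \<ge> 0" by linarith+
      have "unit_ball_vol (real CARD('n)) \<noteq> 0" using unit_ball_vol_pos[of "real CARD('n)"] by linarith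
      then show ?case
        using n by (simp add: ball_vol_eq power_divide[symmetric] add_divide_distrib)
    qed
  qed
qed

lemma card_lattice_ball_ratio_tendsto:
  "(\<lambda>n. real (card (lattice_ball (real n + s) :: (real ^ 'n) set)) / ball_vol TYPE('n) (real n)) \<longlonglongrightarrow> 1"
proof (rule tendsto_sandwich)
  show "(\<lambda>n. ball_vol TYPE('n) (real n + (s - real CARD('n))) / ball_vol TYPE('n) (real n)) \<longlonglongrightarrow> 1"
    "(\<lambda>n. ball_vol TYPE('n) (real n + (s + real CARD('n))) / ball_vol TYPE('n) (real n)) \<longlonglongrightarrow> 1"
    by (rule ball_vol_ratio_tendsto)+
  show "\<forall>\<^sub>F n in sequentially. ball_vol TYPE('n) (real n + (s - real CARD('n))) / ball_vol TYPE('n) (real n)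
     \<le> real (card (lattice_ball (real n + s) :: (real ^ 'n) set)) / ball_vol TYPE('n) (real n)"
    using card_lattice_ball_ge[where 'n='n]
    by (intro always_eventually allI divide_right_mono) (auto simp: algebra_simps)
  show "\<forall>\<^sub>F n in sequentially. real (card (lattice_ball (real n + s) :: (real ^ 'n) set)) / ball_vol TYPE('n) (real n)
      \<le> ball_vol TYPE('n) (real n + (s + real CARD('n))) / ball_vol TYPE('n) (real n)"
    using card_lattice_ball_le[where 'n='n, of "real _ + s"]
    by (intro always_eventually allI divide_right_mono) (auto simp: add.assoc)
qed

text \<open>The joint laws over the whole lattice are compared, because the maximal inequality and
  the deviation field involve sums of many shifted values at once.\<close>

definition stationary_field :: "'w measure \<Rightarrow> (real ^ 'n \<Rightarrow> 'w \<Rightarrow> real) \<Rightarrow> bool" where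
  "stationary_field M X \<longleftrightarrow>
     (\<forall>b\<in>lattice. X b \<in> borel_measurable M) \<and>
     (\<forall>b\<in>lattice. distr M (Pi\<^sub>M lattice (\<lambda>_. borel)) (\<lambda>w. \<lambda>c\<in>lattice. X (b + c) w) =
                  distr M (Pi\<^sub>M lattice (\<lambda>_. borel)) (\<lambda>w. \<lambda>c\<in>lattice. X c w))"

lemma stationary_fieldD_measurable: "stationary_field M X \<Longrightarrow> b \<in> lattice \<Longrightarrow> X b \<in> borel_measurable M"
  by (auto simp: stationary_field_def)

lemma stationary_field_distr:
  assumes "stationary_field M X" "b \<in> lattice" "G \<in> measurable (Pi\<^sub>M lattice (\<lambda>_. borel)) N"
  shows "distr M N (\<lambda>w. G (\<lambda>c\<in>lattice. X (b + c) w)) = distr M N (\<lambda>w. G (\<lambda>c\<in>lattice. X c w))"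
proof -
  have m: "(\<lambda>w. \<lambda>c\<in>lattice. X (b + c) w) \<in> measurable M (Pi\<^sub>M lattice (\<lambda>_. borel))"
    if "b \<in> lattice" for b
    using assms(1) that by (intro measurable_restrict) (auto simp: stationary_field_def lattice_add)
  have m0: "(\<lambda>w. \<lambda>c\<in>lattice. X c w) \<in> measurable M (Pi\<^sub>M lattice (\<lambda>_. borel))"
    using m[of 0] by simp
  have "distr M N (\<lambda>w. G (\<lambda>c\<in>lattice. X (b + c) w)) =
        distr (distr M (Pi\<^sub>M lattice (\<lambda>_. borel)) (\<lambda>w. \<lambda>c\<in>lattice. X (b + c) w)) N G"
    by (subst distr_distr[OF assms(3) m]) (auto simp: o_def assms)
  also have "\<dots> = distr (distr M (Pi\<^sub>M lattice (\<lambda>_. borel)) (\<lambda>w. \<lambda>c\<in>lattice. X c w)) N G"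
    using assms by (simp add: stationary_field_def)
  also have "\<dots> = distr M N (\<lambda>w. G (\<lambda>c\<in>lattice. X c w))"
    by (subst distr_distr[OF assms(3) m0]) (auto simp: o_def)
  finally show ?thesis .
qed

lemma stationary_field_prob:
  assumes X: "stationary_field M X" and b: "b \<in> lattice"
    and P: "{f \<in> space (Pi\<^sub>M lattice (\<lambda>_. borel)). P f} \<in> sets (Pi\<^sub>M lattice (\<lambda>_. borel))"
    and Q: "\<And>b w. b \<in> lattice \<Longrightarrow> w \<in> space M \<Longrightarrow> Q b w \<longleftrightarrow> P (\<lambda>c\<in>lattice. X (b + c) w)"
  shows "{w\<in>space M. Q b w} \<in> sets M" "measure M {w\<in>space M. Q b w} = measure M {w\<in>space M. Q 0 w}"
proof -
  let ?F = "Pi\<^sub>M lattice (\<lambda>_. borel :: real measure)"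
  have m: "(\<lambda>w. \<lambda>c\<in>lattice. X (b + c) w) \<in> measurable M ?F"
    if "b \<in> lattice" for b
    using assms(1) that by (intro measurable_restrict) (auto simp: stationary_field_def lattice_add)
  have e: "{w\<in>space M. Q b w} = (\<lambda>w. \<lambda>c\<in>lattice. X (b + c) w) -` {f \<in> space ?F. P f} \<inter> space M"
    if "b \<in> lattice" for b
    using Q[OF that] measurable_space[OF m[OF that]] by auto
  show "{w\<in>space M. Q b w} \<in> sets M"
    unfolding e[OF b] by (rule measurable_sets[OF m[OF b] P])
  have "measure M {w\<in>space M. Q b w} = measure (distr M ?F (\<lambda>w. \<lambda>c\<in>lattice. X (b + c) w)) {f \<in> space ?F. P f}"
    unfolding e[OF b] by (rule measure_distr[symmetric, OF m[OF b] P])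
  also have "\<dots> = measure (distr M ?F (\<lambda>w. \<lambda>c\<in>lattice. X (0 + c) w)) {f \<in> space ?F. P f}"
    using assms by (simp add: stationary_field_def)
  also have "\<dots> = measure M {w\<in>space M. Q 0 w}"
    unfolding e[OF zero_in_lattice] by (rule measure_distr[OF m[OF zero_in_lattice] P])
  finally show "measure M {w\<in>space M. Q b w} = measure M {w\<in>space M. Q 0 w}" .
qed

lemma stationary_field_distr1:
  assumes X: "stationary_field M X" and b: "b \<in> lattice"
  shows "distr M borel (X b) = distr M borel (X 0)"
  using stationary_field_distr[OF X b, of "\<lambda>f. f 0" borel] by simp

lemma stationary_field_integral:
  fixes g :: "real \<Rightarrow> real"
  assumes X: "stationary_field M X" and b: "b \<in> lattice" and g: "g \<in> borel_measurable borel"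
  shows "(\<integral>w. g (X b w) \<partial>M) = (\<integral>w. g (X 0 w) \<partial>M)"
    "integrable M (\<lambda>w. g (X 0 w)) \<Longrightarrow> integrable M (\<lambda>w. g (X b w))"
proof -
  have m: "X b \<in> borel_measurable M" "X 0 \<in> borel_measurable M"
    using X b by (auto simp: stationary_field_def)
  show "(\<integral>w. g (X b w) \<partial>M) = (\<integral>w. g (X 0 w) \<partial>M)"
    using integral_distr[OF m(1) g] integral_distr[OF m(2) g] stationary_field_distr1[OF X b] by simp
  show "integrable M (\<lambda>w. g (X 0 w)) \<Longrightarrow> integrable M (\<lambda>w. g (X b w))"
    using integrable_distr_eq[OF m(1) g] integrable_distr_eq[OF m(2) g] stationary_field_distr1[OF X b] by simp
qed


text \<open>The first factor is the loss in Vitali's covering lemma (dilation by 5, plus \<open>d\<close> for the passage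
  from lattice points to volumes).\<close>

definition maximal_constant :: "'n::finite itself \<Rightarrow> real" where
  "maximal_constant T = (5 + real CARD('n)) ^ CARD('n) * (2 + 2 * real CARD('n)) ^ CARD('n)"

lemma maximal_constant_pos: "0 < maximal_constant TYPE('n::finite)"
  by (simp add: maximal_constant_def)

text \<open>A deterministic form of the maximal inequality. Every point b of S has a radius at which
  the sum around b exceeds t times the volume. Vitali's lemma selects disjoint balls whose dilates
  by 5 cover S; the number of lattice points in a dilate is at most a constant times the volume of
  the ball, and disjointness lets the local sums be added up inside one large ball.\<close>

lemma maximal_counting:
  fixes y :: "real ^ 'n \<Rightarrow> real" and r t :: real and N :: nat
  assumes y: "\<And>c. c \<in> lattice \<Longrightarrow> 0 \<le> y c" and t: "0 < t" and N: "1 \<le> N"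
  defines "S \<equiv> {b \<in> lattice_ball r. \<exists>n\<in>{1..N}. t * ball_vol TYPE('n) (real n) < (\<Sum>c\<in>lattice_ball (real n). y (b + c))}"
  shows "t * real (card S) \<le> (5 + real CARD('n)) ^ CARD('n) * (\<Sum>c\<in>lattice_ball (r + real N). y c)"
proof -
  let ?d = "real CARD('n)"
  have fS: "finite S" and SL: "S \<subseteq> lattice" "S \<subseteq> lattice_ball r"
    by (auto simp: S_def lattice_ball_def intro: finite_subset[OF _ finite_lattice_ball])
  have "\<forall>b\<in>S. \<exists>n\<in>{1..N}. t * ball_vol TYPE('n) (real n) < (\<Sum>c\<in>lattice_ball (real n). y (b + c))"
    by (auto simp: S_def)
  then obtain n where n: "\<And>b. b \<in> S \<Longrightarrow> n b \<in> {1..N}"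
    "\<And>b. b \<in> S \<Longrightarrow> t * ball_vol TYPE('n) (real (n b)) < (\<Sum>c\<in>lattice_ball (real (n b)). y (b + c))"
    by metis
  have nN: "0 < real (n b) \<and> real (n b) \<le> real N" if "b \<in> S" for b using n(1)[OF that] by auto
  \<comment> \<open>Positivity and boundedness of the radii by \<open>N\<close> are the hypotheses
    of the covering lemma. Each point of S is the centre of its own ball and so lies in one of the
    dilated balls.\<close>
  obtain C where "countable C" and C: "C \<subseteq> S"
     "pairwise (\<lambda>i j. disjnt (cball i (real (n i))) (cball j (real (n j)))) C"
     "\<And>i. i \<in> S \<Longrightarrow> \<exists>j. j \<in> C \<and> \<not> disjnt (cball i (real (n i))) (cball j (real (n j))) \<and>
                        cball i (real (n i)) \<subseteq> ball j (5 * real (n j))"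
    by (rule Vitali_covering_lemma_cballs_balls[of S "\<lambda>b. real (n b)" "real N" "\<lambda>b. b", OF nN]) (assumption | rule that)+
  have fC: "finite C" using C(1) fS by (rule finite_subset)
  have cover: "S \<subseteq> (\<Union>j\<in>C. lattice \<inter> ball j (5 * real (n j)))"
  proof
    fix b assume b: "b \<in> S"
    obtain j where "j \<in> C" "cball b (real (n b)) \<subseteq> ball j (5 * real (n j))" using C(3)[OF b] by blast
    moreover have "b \<in> cball b (real (n b))" by simp
    ultimately show "b \<in> (\<Union>j\<in>C. lattice \<inter> ball j (5 * real (n j)))"
      using b SL(1) by blast
  qed
  have card_le: "real (card (lattice \<inter> ball j (5 * real (n j)))) \<le> (5 + ?d) ^ CARD('n) * ball_vol TYPE('n) (real (n j))"
    if "j \<in> C" for j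
  proof -
    have n1: "1 \<le> real (n j)" using n(1)[of j] C(1) that by auto
    have "real (card (lattice \<inter> ball j (5 * real (n j)))) \<le> ball_vol TYPE('n) (5 * real (n j) + ?d)"
      by (rule card_lattice_subset_ball) (auto simp: finite_lattice_Int_ball)
    also have "\<dots> \<le> ball_vol TYPE('n) ((5 + ?d) * real (n j))"
      using mult_left_mono[OF n1, of ?d] by (intro ball_vol_mono) (simp add: algebra_simps)
    also have "\<dots> = (5 + ?d) ^ CARD('n) * ball_vol TYPE('n) (real (n j))"
      by (rule ball_vol_mult) auto
    finally show ?thesis .
  qed
  have "real (card S) \<le> real (card (\<Union>j\<in>C. lattice \<inter> ball j (5 * real (n j))))"
    using cover fC by (intro of_nat_mono card_mono finite_UN_I finite_lattice_Int_ball)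
  also have "\<dots> \<le> real (\<Sum>j\<in>C. card (lattice \<inter> ball j (5 * real (n j))))"
    using fC by (intro of_nat_mono card_UN_le)
  also have "\<dots> \<le> (\<Sum>j\<in>C. (5 + ?d) ^ CARD('n) * ball_vol TYPE('n) (real (n j)))"
    using card_le by (simp add: sum_mono)
  finally have "t * real (card S) \<le> t * (\<Sum>j\<in>C. (5 + ?d) ^ CARD('n) * ball_vol TYPE('n) (real (n j)))"
    using t by (intro mult_left_mono) auto
  also have "\<dots> = (5 + ?d) ^ CARD('n) * (\<Sum>j\<in>C. t * ball_vol TYPE('n) (real (n j)))"
    by (simp add: sum_distrib_left mult.left_commute)
  also have "\<dots> \<le> (5 + ?d) ^ CARD('n) * (\<Sum>j\<in>C. \<Sum>c\<in>lattice_ball (real (n j)). y (j + c))"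
    using n(2) C(1) by (intro mult_left_mono sum_mono) (auto intro: less_imp_le)
  also have "(\<Sum>j\<in>C. \<Sum>c\<in>lattice_ball (real (n j)). y (j + c)) = (\<Sum>j\<in>C. sum y (lattice \<inter> ball j (real (n j))))"
    using C(1) SL(1) by (intro sum.cong sum_lattice_Int_ball[symmetric] refl) auto
  also have "\<dots> = sum y (\<Union>j\<in>C. lattice \<inter> ball j (real (n j)))"
  proof (rule sum.UNION_disjoint[symmetric])
    show "\<forall>i\<in>C. \<forall>j\<in>C. i \<noteq> j \<longrightarrow> (lattice \<inter> ball i (real (n i))) \<inter> (lattice \<inter> ball j (real (n j))) = {}"
    proof (intro ballI impI)
      fix i j assume "i \<in> C" "j \<in> C" "i \<noteq> j"
      then have "cball i (real (n i)) \<inter> cball j (real (n j)) = {}"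
        using C(2) by (simp add: pairwise_def disjnt_def)
      then show "(lattice \<inter> ball i (real (n i))) \<inter> (lattice \<inter> ball j (real (n j))) = {}"
        using ball_subset_cball[of i "real (n i)"] ball_subset_cball[of j "real (n j)"] by blast
    qed
  qed (use fC in \<open>auto simp: finite_lattice_Int_ball\<close>)
  also have "\<dots> \<le> sum y (lattice_ball (r + real N))"
  proof (rule sum_mono2)
    show "(\<Union>j\<in>C. lattice \<inter> ball j (real (n j))) \<subseteq> lattice_ball (r + real N)"
    proof
      fix x assume "x \<in> (\<Union>j\<in>C. lattice \<inter> ball j (real (n j)))"
      then obtain j where j: "j \<in> C" "x \<in> lattice" "dist j x < real (n j)" by auto
      have "norm j < r" "real (n j) \<le> real N"
        using j(1) C(1) SL(2) n(1)[of j] by (auto simp: lattice_ball_def)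
      moreover have "norm x \<le> norm j + dist j x"
        by (metis dist_norm norm_minus_commute norm_triangle_sub)
      ultimately show "x \<in> lattice_ball (r + real N)"
        using j by (auto simp: lattice_ball_def)
    qed
  qed (use y in \<open>auto simp: lattice_ball_def\<close>)
  finally show ?thesis by simp
qed

text \<open>Transference: integrate the counting bound for all centres in a ball of radius r. By
  stationarity every centre is bad with the same probability and every field value has the same
  mean, so after dividing by the number of centres only the ratio of two lattice counts
  remains.\<close>

lemma maximal_inequality_finite:
  fixes Y :: "real ^ 'n \<Rightarrow> 'w \<Rightarrow> real"
  assumes "prob_space M" and Y: "stationary_field M Y" and nn: "\<And>b w. b \<in> lattice \<Longrightarrow> w \<in> space M \<Longrightarrow> 0 \<le> Y b w"
    and int: "integrable M (Y 0)" and t: "0 < t"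
  shows "{w\<in>space M. \<exists>n\<in>{1..N}. t * ball_vol TYPE('n) (real n) < (\<Sum>c\<in>lattice_ball (real n). Y c w)} \<in> sets M" (is "?E \<in> _")
    and "measure M {w\<in>space M. \<exists>n\<in>{1..N}. t * ball_vol TYPE('n) (real n) < (\<Sum>c\<in>lattice_ball (real n). Y c w)}
      \<le> maximal_constant TYPE('n) * (\<integral>w. Y 0 w \<partial>M) / t"
proof -
  interpret prob_space M by fact
  let ?d = "real CARD('n)" and ?F = "Pi\<^sub>M lattice (\<lambda>_. borel :: real measure)"
  define Q where "Q b w \<longleftrightarrow> (\<exists>n\<in>{1..N}. t * ball_vol TYPE('n) (real n) < (\<Sum>c\<in>lattice_ball (real n). Y (b + c) w))" for b w
  have [measurable]: "(\<lambda>f. f c) \<in> borel_measurable ?F" if "c \<in> lattice_ball r" for c r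
    using that lattice_ball_subset by (intro measurable_component_singleton) auto
  define P where "P f \<longleftrightarrow> (\<exists>n\<in>{1..N}. t * ball_vol TYPE('n) (real n) < (\<Sum>c\<in>lattice_ball (real n). f c))"
    for f :: "real ^ 'n \<Rightarrow> real"
  have P: "{f \<in> space ?F. P f} \<in> sets ?F"
    unfolding P_def by measurable
  have QP: "Q b w \<longleftrightarrow> P (\<lambda>c\<in>lattice. Y (b + c) w)" for b w
    unfolding Q_def P_def
    by (intro bex_cong refl arg_cong2[where f="(<)"] sum.cong) (auto simp: lattice_ball_def)
  have Qm: "{w\<in>space M. Q b w} \<in> sets M" if "b \<in> lattice" for b
    by (rule stationary_field_prob(1)[where X=Y and P=P and Q=Q, OF Y that P QP])
  have Qp: "measure M {w\<in>space M. Q b w} = measure M {w\<in>space M. Q 0 w}" if "b \<in> lattice" for b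
    by (rule stationary_field_prob(2)[where X=Y and P=P and Q=Q, OF Y that P QP])
  show E: "?E \<in> sets M" using Qm[of 0] by (simp add: Q_def)
  show "measure M ?E \<le> maximal_constant TYPE('n) * (\<integral>w. Y 0 w \<partial>M) / t"
  proof (cases "N = 0")
    case True
    have "0 \<le> (\<integral>w. Y 0 w \<partial>M)" using nn by (intro integral_nonneg_AE) auto
    then show ?thesis using True t maximal_constant_pos[where 'n='n] by simp
  next
    case False
    \<comment> \<open>The summand d makes the number of centres at least the volume of the ball of
      radius N, by \<open>card_lattice_ball_ge\<close>.\<close>
    define r where "r = real N + ?d"
    have N1: "1 \<le> real N" using False by simp
    have Yint: "integrable M (Y c)" "(\<integral>w. Y c w \<partial>M) = (\<integral>w. Y 0 w \<partial>M)" if "c \<in> lattice" for c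
      using stationary_field_integral[OF Y that, of "\<lambda>x. x"] int by auto
    have "t * (\<Sum>b\<in>lattice_ball r. indicator {w\<in>space M. Q b w} w)
        \<le> (5 + ?d) ^ CARD('n) * (\<Sum>c\<in>lattice_ball (r + real N). Y c w)" if w: "w \<in> space M" for w
    proof -
      have "(\<Sum>b\<in>lattice_ball r. indicator {w\<in>space M. Q b w} w) = real (card {b \<in> lattice_ball r. Q b w})"
        using w by (simp add: indicator_def sum.If_cases Int_def)
      then show ?thesis
        using maximal_counting[of "\<lambda>c. Y c w" t N r] nn[OF _ w] t False by (simp add: Q_def)
    qed
    then have "(\<integral>w. t * (\<Sum>b\<in>lattice_ball r. indicator {w\<in>space M. Q b w} w) \<partial>M)
        \<le> (\<integral>w. (5 + ?d) ^ CARD('n) * (\<Sum>c\<in>lattice_ball (r + real N). Y c w) \<partial>M)"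
      using Yint(1) Qm
      by (intro integral_mono integrable_mult_right integrable_sum integrable_real_indicator)
        (auto simp: lattice_ball_def emeasure_eq_measure)
    also have "(\<integral>w. t * (\<Sum>b\<in>lattice_ball r. indicator {w\<in>space M. Q b w} w) \<partial>M)
       = t * (\<Sum>b\<in>lattice_ball r. measure M {w\<in>space M. Q b w})"
      using Qm by (simp add: lattice_ball_def emeasure_eq_measure)
    also have "(\<Sum>b\<in>lattice_ball r. measure M {w\<in>space M. Q b w}) = (\<Sum>b\<in>(lattice_ball r :: (real ^ 'n) set). measure M ?E)"
      using Qp by (intro sum.cong) (auto simp: lattice_ball_def Q_def)
    also have "(\<integral>w. (5 + ?d) ^ CARD('n) * (\<Sum>c\<in>lattice_ball (r + real N). Y c w) \<partial>M)
       = (5 + ?d) ^ CARD('n) * (\<Sum>c\<in>lattice_ball (r + real N). \<integral>w. Y c w \<partial>M)"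
      using Yint(1) by (simp add: lattice_ball_def)
    also have "(\<Sum>c\<in>lattice_ball (r + real N). \<integral>w. Y c w \<partial>M) = (\<Sum>c\<in>(lattice_ball (r + real N) :: (real ^ 'n) set). \<integral>w. Y 0 w \<partial>M)"
      by (intro sum.cong refl Yint(2)) (auto simp: lattice_ball_def)
    finally have main: "t * (real (card (lattice_ball r :: (real ^ 'n) set)) * measure M ?E)
      \<le> (5 + ?d) ^ CARD('n) * (real (card (lattice_ball (r + real N) :: (real ^ 'n) set)) * (\<integral>w. Y 0 w \<partial>M))"
      by simp
    have nnY: "0 \<le> (\<integral>w. Y 0 w \<partial>M)" using nn by (intro integral_nonneg_AE) auto
    have v: "ball_vol TYPE('n) (real N) > 0" using N1 by (intro ball_vol_pos) auto
    have "real (card (lattice_ball (r + real N) :: (real ^ 'n) set)) \<le> ball_vol TYPE('n) (r + real N + ?d)"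
      by (rule card_lattice_ball_le)
    \<comment> \<open>Here r + N + d = 2 N + 2 d, which is at most (2 + 2 d) N because N \<ge> 1;
      this yields the second factor of \<open>maximal_constant\<close>.\<close>
    also have "\<dots> \<le> ball_vol TYPE('n) ((2 + 2 * ?d) * real N)"
      using mult_left_mono[OF N1, of ?d] by (intro ball_vol_mono) (simp add: r_def algebra_simps)
    also have "\<dots> = (2 + 2 * ?d) ^ CARD('n) * ball_vol TYPE('n) (real N)"
      by (rule ball_vol_mult) auto
    finally have up: "real (card (lattice_ball (r + real N) :: (real ^ 'n) set)) \<le> (2 + 2 * ?d) ^ CARD('n) * ball_vol TYPE('n) (real N)" .
    have lo: "ball_vol TYPE('n) (real N) \<le> real (card (lattice_ball r :: (real ^ 'n) set))"
      using card_lattice_ball_ge[where 'n='n, of r] by (simp add: r_def)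
    have "t * (ball_vol TYPE('n) (real N) * measure M ?E) \<le> t * (real (card (lattice_ball r :: (real ^ 'n) set)) * measure M ?E)"
      using lo t by (intro mult_left_mono mult_right_mono) auto
    also note main
    also have "(5 + ?d) ^ CARD('n) * (real (card (lattice_ball (r + real N) :: (real ^ 'n) set)) * (\<integral>w. Y 0 w \<partial>M))
       \<le> (5 + ?d) ^ CARD('n) * ((2 + 2 * ?d) ^ CARD('n) * ball_vol TYPE('n) (real N) * (\<integral>w. Y 0 w \<partial>M))"
      using up nnY by (intro mult_left_mono mult_right_mono) auto
    finally have "ball_vol TYPE('n) (real N) * (t * measure M ?E) \<le> ball_vol TYPE('n) (real N) * (maximal_constant TYPE('n) * (\<integral>w. Y 0 w \<partial>M))"
      by (simp add: maximal_constant_def mult_ac)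
    then have "t * measure M ?E \<le> maximal_constant TYPE('n) * (\<integral>w. Y 0 w \<partial>M)"
      using v by simp
    then show ?thesis using t by (simp add: field_simps)
  qed
qed

lemma maximal_inequality:
  fixes Y :: "real ^ 'n \<Rightarrow> 'w \<Rightarrow> real"
  assumes "prob_space M" and Y: "stationary_field M Y" and nn: "\<And>b w. b \<in> lattice \<Longrightarrow> w \<in> space M \<Longrightarrow> 0 \<le> Y b w"
    and int: "integrable M (Y 0)" and t: "0 < t"
  shows "{w\<in>space M. \<exists>n\<ge>1. t * ball_vol TYPE('n) (real n) < (\<Sum>c\<in>lattice_ball (real n). Y c w)} \<in> sets M" (is "?E \<in> _")
    and "measure M {w\<in>space M. \<exists>n\<ge>1. t * ball_vol TYPE('n) (real n) < (\<Sum>c\<in>lattice_ball (real n). Y c w)}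
      \<le> maximal_constant TYPE('n) * (\<integral>w. Y 0 w \<partial>M) / t"
proof -
  interpret prob_space M by fact
  let ?A = "\<lambda>N. {w\<in>space M. \<exists>n\<in>{1..N}. t * ball_vol TYPE('n) (real n) < (\<Sum>c\<in>lattice_ball (real n). Y c w)}"
  note fin = maximal_inequality_finite[OF assms]
  have eq: "?E = (\<Union>N. ?A N)"
  proof (intro set_eqI iffI)
    fix w assume "w \<in> ?E"
    then obtain n where "w \<in> space M" "1 \<le> n" "t * ball_vol TYPE('n) (real n) < (\<Sum>c\<in>lattice_ball (real n). Y c w)"
      by blast
    then have "w \<in> ?A n" by (auto intro!: bexI[of _ n])
    then show "w \<in> (\<Union>N. ?A N)" by blast
  qed auto
  show "?E \<in> sets M" unfolding eq using fin(1) by (intro sets.countable_UN) auto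
  have "(\<lambda>N. measure M (?A N)) \<longlonglongrightarrow> measure M (\<Union>N. ?A N)"
    using fin(1) by (intro finite_Lim_measure_incseq) (auto simp: incseq_def)
  then show "measure M ?E \<le> maximal_constant TYPE('n) * (\<integral>w. Y 0 w \<partial>M) / t"
    unfolding eq using fin(2) by (intro LIMSEQ_le_const2) auto
qed

section \<open>An ergodic theorem for mixing fields on the lattice\<close>

lemma card_lattice_ball_at_top:
  "filterlim (\<lambda>n. real (card (lattice_ball (real n) :: (real ^ 'n) set))) at_top sequentially"
proof -
  have "filterlim (\<lambda>n. unit_ball_vol (real CARD('n)) * (real n - real CARD('n)) ^ CARD('n)) at_top sequentially"
  proof (rule filterlim_tendsto_pos_mult_at_top[OF tendsto_const])
    show "0 < unit_ball_vol (real CARD('n))" by simp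
    have "filterlim (\<lambda>n. real n - real CARD('n)) at_top sequentially"
      using filterlim_tendsto_add_at_top[OF tendsto_const[of "- real CARD('n)"] filterlim_real_sequentially]
      by simp
    then show "filterlim (\<lambda>n. (real n - real CARD('n)) ^ CARD('n)) at_top sequentially"
      by (intro filterlim_pow_at_top) auto
  qed
  then show ?thesis
  proof (rule filterlim_at_top_mono)
    show "\<forall>\<^sub>F n in sequentially. unit_ball_vol (real CARD('n)) * (real n - real CARD('n)) ^ CARD('n)
        \<le> real (card (lattice_ball (real n) :: (real ^ 'n) set))"
      using eventually_ge_at_top[of "CARD('n)"]
    proof eventually_elim
      case (elim n)
      then show ?case
        using card_lattice_ball_ge[where 'n='n, of "real n"] by (simp add: ball_vol_eq)
    qed
  qed
qed

definition lattice_avg :: "(real ^ 'n \<Rightarrow> real) \<Rightarrow> nat \<Rightarrow> real" where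
  "lattice_avg f m = (\<Sum>c\<in>lattice_ball (real m). f c) / real (card (lattice_ball (real m) :: (real ^ 'n) set))"

text \<open>The deviations are obtained from the field by one map \<open>G\<close> of configurations
  on the lattice that commutes with shifts, so equality of laws is carried over.\<close>

lemma stationary_field_deviation:
  fixes X :: "real ^ 'n \<Rightarrow> 'w \<Rightarrow> real"
  assumes X: "stationary_field M X"
  shows "stationary_field M (\<lambda>b w. \<bar>lattice_avg (\<lambda>c. X (b + c) w) m - \<mu>\<bar>)"
  unfolding stationary_field_def
proof (intro conjI ballI)
  let ?F = "Pi\<^sub>M lattice (\<lambda>_. borel :: real measure)"
  fix b :: "real ^ 'n" assume b: "b \<in> lattice"
  have [measurable]: "X (b + c) \<in> borel_measurable M" if "c \<in> lattice_ball (real m)" for c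
    using X b that by (auto simp: stationary_field_def lattice_ball_def lattice_add)
  show "(\<lambda>w. \<bar>lattice_avg (\<lambda>c. X (b + c) w) m - \<mu>\<bar>) \<in> borel_measurable M"
    unfolding lattice_avg_def by measurable
  define G where "G f = (\<lambda>e\<in>lattice. \<bar>lattice_avg (\<lambda>c. f (e + c)) m - \<mu>\<bar>)" for f :: "real ^ 'n \<Rightarrow> real"
  have G: "G \<in> measurable ?F ?F"
    unfolding G_def
  proof (intro measurable_restrict)
    fix e :: "real ^ 'n" assume e: "e \<in> lattice"
    have [measurable]: "(\<lambda>f. f (e + c)) \<in> borel_measurable ?F" if "c \<in> lattice_ball (real m)" for c
      using that e by (intro measurable_component_singleton lattice_add) (auto simp: lattice_ball_def)
    show "(\<lambda>f. \<bar>lattice_avg (\<lambda>c. f (e + c)) m - \<mu>\<bar>) \<in> borel_measurable ?F"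
      unfolding lattice_avg_def by measurable
  qed
  have e: "G (\<lambda>c\<in>lattice. X (b + c) w) = (\<lambda>c\<in>lattice. \<bar>lattice_avg (\<lambda>c'. X (b + c + c') w) m - \<mu>\<bar>)" for b w
    unfolding G_def lattice_avg_def
    by (intro restrict_ext arg_cong[where f=abs] arg_cong2[where f="(-)"] arg_cong2[where f="(/)"] sum.cong)
      (auto simp: lattice_ball_def lattice_add add.assoc)
  show "distr M ?F (\<lambda>w. \<lambda>c\<in>lattice. \<bar>lattice_avg (\<lambda>c'. X (b + c + c') w) m - \<mu>\<bar>)
    = distr M ?F (\<lambda>w. \<lambda>c\<in>lattice. \<bar>lattice_avg (\<lambda>c'. X (c + c') w) m - \<mu>\<bar>)"
    using stationary_field_distr[OF X b G] e[of b] e[of 0] by (simp add: G_def lattice_avg_def)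
qed

text \<open>Mixing is a one-sided bound, since the variance of an average has only to be bounded
  from above. Nonnegativity allows sums over nested balls to be compared.\<close>

locale mixing_field = prob_space M for M :: "'w measure" +
  fixes X :: "real ^ 'n \<Rightarrow> 'w \<Rightarrow> real" and \<mu> :: real
  assumes stationary: "stationary_field M X"
    and nonneg: "\<And>b w. b \<in> lattice \<Longrightarrow> w \<in> space M \<Longrightarrow> 0 \<le> X b w"
    and square: "integrable M (\<lambda>w. (X 0 w)\<^sup>2)"
    and mean: "(\<integral>w. X 0 w \<partial>M) = \<mu>"
    and mixing: "\<And>\<epsilon>. 0 < \<epsilon> \<Longrightarrow> \<exists>R. \<forall>b\<in>lattice. \<forall>c\<in>lattice. R \<le> dist b c \<longrightarrow> (\<integral>w. X b w * X c w \<partial>M) \<le> \<mu>\<^sup>2 + \<epsilon>"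
begin

lemma X_measurable: "b \<in> lattice \<Longrightarrow> X b \<in> borel_measurable M"
  using stationary by (rule stationary_fieldD_measurable)

lemma
  assumes "b \<in> lattice"
  shows X_square_integrable: "integrable M (\<lambda>w. (X b w)\<^sup>2)"
    and X_second_moment: "(\<integral>w. (X b w)\<^sup>2 \<partial>M) = (\<integral>w. (X 0 w)\<^sup>2 \<partial>M)"
    and X_integrable: "integrable M (X b)"
    and X_mean: "(\<integral>w. X b w \<partial>M) = \<mu>"
proof -
  show *: "integrable M (\<lambda>w. (X b w)\<^sup>2)" "(\<integral>w. (X b w)\<^sup>2 \<partial>M) = (\<integral>w. (X 0 w)\<^sup>2 \<partial>M)"
    using stationary_field_integral[OF stationary assms, of "\<lambda>x. x\<^sup>2"] square by auto
  show "integrable M (X b)"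
    using X_measurable[OF assms] *(1) by (rule square_integrable_imp_integrable)
  show "(\<integral>w. X b w \<partial>M) = \<mu>"
    using stationary_field_integral(1)[OF stationary assms, of "\<lambda>x. x"] mean by simp
qed

lemma X_prod_integrable:
  assumes "b \<in> lattice" "c \<in> lattice"
  shows "integrable M (\<lambda>w. X b w * X c w)"
    and "(\<integral>w. X b w * X c w \<partial>M) \<le> (\<integral>w. (X 0 w)\<^sup>2 \<partial>M)"
proof -
  have b: "\<bar>x * y\<bar> \<le> (x\<^sup>2 + y\<^sup>2) / 2" for x y :: real
    using sum_squares_bound[of "\<bar>x\<bar>" "\<bar>y\<bar>"] by (simp add: abs_mult)
  have i2: "integrable M (\<lambda>w. ((X b w)\<^sup>2 + (X c w)\<^sup>2) / 2)"
    using assms by (intro integrable_divide Bochner_Integration.integrable_add X_square_integrable)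
  show i: "integrable M (\<lambda>w. X b w * X c w)"
  proof (rule Bochner_Integration.integrable_bound[OF i2])
    show "(\<lambda>w. X b w * X c w) \<in> borel_measurable M" using X_measurable assms by measurable
    show "AE w in M. norm (X b w * X c w) \<le> norm (((X b w)\<^sup>2 + (X c w)\<^sup>2) / 2)"
      using order_trans[OF b abs_ge_self] by (intro AE_I2) (simp only: real_norm_def)
  qed
  have "(\<integral>w. X b w * X c w \<partial>M) \<le> (\<integral>w. ((X b w)\<^sup>2 + (X c w)\<^sup>2) / 2 \<partial>M)"
    by (rule integral_mono[OF i i2]) (rule abs_le_D1[OF b])
  also have "\<dots> = (\<integral>w. (X 0 w)\<^sup>2 \<partial>M)"
    using assms X_square_integrable X_second_moment[OF assms(1)] X_second_moment[OF assms(2)] by simp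
  finally show "(\<integral>w. X b w * X c w \<partial>M) \<le> (\<integral>w. (X 0 w)\<^sup>2 \<partial>M)" .
qed

definition deviation :: "nat \<Rightarrow> real ^ 'n \<Rightarrow> 'w \<Rightarrow> real" where
  "deviation m b w = \<bar>lattice_avg (\<lambda>c. X (b + c) w) m - \<mu>\<bar>"

text \<open>Expand the square into a double sum. Pairs at distance at least R are covered by mixing;
  for each b at most \<open>card (lattice_ball R)\<close> points are closer, and there the second
  moment of one value serves as the bound.\<close>

lemma lattice_avg_second_moment:
  assumes R: "\<And>b c. b \<in> lattice \<Longrightarrow> c \<in> lattice \<Longrightarrow> R \<le> dist b c \<Longrightarrow> (\<integral>w. X b w * X c w \<partial>M) \<le> \<mu>\<^sup>2 + \<epsilon>"
    and ne: "lattice_ball (real m) \<noteq> ({} :: (real ^ 'n) set)" and \<epsilon>: "0 \<le> \<epsilon>"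
  shows "integrable M (\<lambda>w. (lattice_avg (\<lambda>c. X c w) m - \<mu>)\<^sup>2)"
    and "(\<integral>w. (lattice_avg (\<lambda>c. X c w) m - \<mu>)\<^sup>2 \<partial>M) \<le> 
      \<epsilon> + (\<integral>w. (X 0 w)\<^sup>2 \<partial>M) * real (card (lattice_ball R :: (real ^ 'n) set)) / real (card (lattice_ball (real m) :: (real ^ 'n) set))"
proof -
  let ?B = "lattice_ball (real m) :: (real ^ 'n) set" and ?s = "\<integral>w. (X 0 w)\<^sup>2 \<partial>M"
  let ?N = "real (card ?B)"
  have N: "?N > 0" using ne by (simp add: card_gt_0_iff)
  have BL: "b \<in> lattice" if "b \<in> ?B" for b using that by (auto simp: lattice_ball_def)
  have s: "0 \<le> ?s" by simp
  define Z where "Z w = lattice_avg (\<lambda>c. X c w) m" for w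
  have Z2: "(Z w)\<^sup>2 = (\<Sum>b\<in>?B. \<Sum>c\<in>?B. X b w * X c w) / ?N\<^sup>2" for w
    by (simp add: Z_def lattice_avg_def power_divide power2_eq_square sum_product)
  have Zi: "integrable M Z" "(\<integral>w. Z w \<partial>M) = \<mu>"
    unfolding Z_def lattice_avg_def using BL X_integrable N by (auto simp: X_mean)
  have Z2i: "integrable M (\<lambda>w. (Z w)\<^sup>2)" unfolding Z2
    using BL X_prod_integrable(1) by (intro integrable_divide integrable_sum) auto
  have ex: "(Z w - \<mu>)\<^sup>2 = (Z w)\<^sup>2 - 2 * \<mu> * Z w + \<mu>\<^sup>2" for w by (simp add: power2_diff algebra_simps)
  show "integrable M (\<lambda>w. (lattice_avg (\<lambda>c. X c w) m - \<mu>)\<^sup>2)"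
    unfolding Z_def[symmetric] ex using Zi Z2i by auto
  have "(\<integral>w. (Z w - \<mu>)\<^sup>2 \<partial>M) = (\<integral>w. (Z w)\<^sup>2 \<partial>M) - \<mu>\<^sup>2"
    unfolding ex using Zi Z2i by (simp add: prob_space power2_eq_square)
  also have "(\<integral>w. (Z w)\<^sup>2 \<partial>M) = (\<Sum>b\<in>?B. \<Sum>c\<in>?B. (\<integral>w. X b w * X c w \<partial>M)) / ?N\<^sup>2"
    unfolding Z2 using BL X_prod_integrable(1) by simp
  also have "\<dots> \<le> (\<Sum>b\<in>?B. ?N * (\<mu>\<^sup>2 + \<epsilon>) + real (card (lattice_ball R :: (real ^ 'n) set)) * ?s) / ?N\<^sup>2"
  proof (intro divide_right_mono sum_mono)
    fix b assume b: "b \<in> ?B"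
    have "(\<Sum>c\<in>?B. (\<integral>w. X b w * X c w \<partial>M)) \<le> (\<Sum>c\<in>?B. (\<mu>\<^sup>2 + \<epsilon>) + (if c \<in> ball b R then ?s else 0))"
      using R[OF BL[OF b] BL] X_prod_integrable(2)[OF BL[OF b] BL] \<epsilon>
      by (intro sum_mono) (auto intro: add_increasing)
    also have "\<dots> = ?N * (\<mu>\<^sup>2 + \<epsilon>) + real (card (?B \<inter> ball b R)) * ?s"
      by (simp add: sum.distrib sum.If_cases Int_def)
    also have "\<dots> \<le> ?N * (\<mu>\<^sup>2 + \<epsilon>) + real (card (lattice_ball R :: (real ^ 'n) set)) * ?s"
      unfolding card_lattice_Int_ball[OF BL[OF b], of R, symmetric] using s
      by (intro add_left_mono mult_right_mono of_nat_mono card_mono finite_lattice_Int_ball)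
        (auto simp: lattice_ball_def)
    finally show "(\<Sum>c\<in>?B. (\<integral>w. X b w * X c w \<partial>M)) \<le> ?N * (\<mu>\<^sup>2 + \<epsilon>) + real (card (lattice_ball R :: (real ^ 'n) set)) * ?s" .
  qed auto
  also have "\<dots> = \<mu>\<^sup>2 + \<epsilon> + ?s * real (card (lattice_ball R :: (real ^ 'n) set)) / ?N"
  proof -
    have "p * (p * a + q * s') / p\<^sup>2 = a + s' * q / p" if "p \<noteq> 0" for p a q s' :: real
      using that by (simp add: field_simps power2_eq_square)
    from this[of ?N "\<mu>\<^sup>2 + \<epsilon>" "real (card (lattice_ball R :: (real ^ 'n) set))" ?s] show ?thesis using N ne by simp
  qed
  finally show "(\<integral>w. (lattice_avg (\<lambda>c. X c w) m - \<mu>)\<^sup>2 \<partial>M) \<le> 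
      \<epsilon> + ?s * real (card (lattice_ball R :: (real ^ 'n) set)) / ?N"
    by (simp add: Z_def)
qed

lemma deviation_arbitrarily_small:
  assumes "0 < \<epsilon>"
  shows "\<exists>m. lattice_ball (real m) \<noteq> ({} :: (real ^ 'n) set) \<and> integrable M (deviation m 0) \<and> (\<integral>w. deviation m 0 w \<partial>M) \<le> \<epsilon>"
proof -
  let ?s = "\<integral>w. (X 0 w)\<^sup>2 \<partial>M"
  obtain R where R: "\<And>b c. b \<in> lattice \<Longrightarrow> c \<in> lattice \<Longrightarrow> R \<le> dist b c \<Longrightarrow> (\<integral>w. X b w * X c w \<partial>M) \<le> \<mu>\<^sup>2 + \<epsilon>\<^sup>2 / 2"
    using mixing[of "\<epsilon>\<^sup>2 / 2"] assms by auto
  have "(\<lambda>m. ?s * real (card (lattice_ball R :: (real ^ 'n) set)) / real (card (lattice_ball (real m) :: (real ^ 'n) set))) \<longlonglongrightarrow> 0"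
    by (intro tendsto_divide_0[OF tendsto_const] filterlim_at_top_imp_at_infinity card_lattice_ball_at_top)
  then have "\<forall>\<^sub>F m in sequentially. ?s * real (card (lattice_ball R :: (real ^ 'n) set)) / real (card (lattice_ball (real m) :: (real ^ 'n) set)) < \<epsilon>\<^sup>2 / 2"
    using assms by (intro order_tendstoD) auto
  then obtain m where m: "1 \<le> m" "?s * real (card (lattice_ball R :: (real ^ 'n) set)) / real (card (lattice_ball (real m) :: (real ^ 'n) set)) < \<epsilon>\<^sup>2 / 2"
    by (metis (no_types, lifting) eventually_sequentially le_add1 le_add2)
  have ne: "lattice_ball (real m) \<noteq> ({} :: (real ^ 'n) set)"
  proof -
    have "(0 :: real ^ 'n) \<in> lattice_ball (real m)" using m(1) by (simp add: lattice_ball_def)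
    then show ?thesis by blast
  qed
  define Z where "Z w = lattice_avg (\<lambda>c. X c w) m - \<mu>" for w
  have i: "integrable M (\<lambda>w. (Z w)\<^sup>2)"
    unfolding Z_def by (rule lattice_avg_second_moment(1)[OF _ ne, where R=R and \<epsilon>="\<epsilon>\<^sup>2 / 2"]) (use R in auto)
  have "(\<integral>w. (Z w)\<^sup>2 \<partial>M) \<le> \<epsilon>\<^sup>2 / 2 + ?s * real (card (lattice_ball R :: (real ^ 'n) set)) / real (card (lattice_ball (real m) :: (real ^ 'n) set))"
    unfolding Z_def by (rule lattice_avg_second_moment(2)[OF _ ne, where R=R and \<epsilon>="\<epsilon>\<^sup>2 / 2"]) (use R in auto)
  then have le: "(\<integral>w. (Z w)\<^sup>2 \<partial>M) \<le> \<epsilon>\<^sup>2"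
    using m(2) by linarith
  \<comment> \<open>Passes from the second moment to the first absolute moment: this is (|x| -
    \<epsilon>)^2 \<ge> 0 divided by 2 \<epsilon>, and it turns the bound \<epsilon>^2 into
    \<epsilon>.\<close>
  have b: "\<bar>x\<bar> \<le> (x\<^sup>2 / \<epsilon> + \<epsilon>) / 2" for x
  proof -
    have "0 \<le> (\<bar>x\<bar> - \<epsilon>)\<^sup>2 / \<epsilon>" using assms by simp
    also have "\<dots> = x\<^sup>2 / \<epsilon> + \<epsilon> - 2 * \<bar>x\<bar>" using assms by (simp add: power2_diff field_simps power2_eq_square)
    finally show ?thesis by simp
  qed
  have d: "deviation m 0 = (\<lambda>w. \<bar>Z w\<bar>)" by (auto simp: deviation_def Z_def)
  have Zm: "Z \<in> borel_measurable M"
    unfolding Z_def lattice_avg_def using X_measurable by (auto simp: lattice_ball_def)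
  have ii: "integrable M (\<lambda>w. ((Z w)\<^sup>2 / \<epsilon> + \<epsilon>) / 2)" using i by auto
  have i2: "integrable M (deviation m 0)"
    unfolding d
  proof (rule Bochner_Integration.integrable_bound[OF ii])
    show "AE w in M. norm \<bar>Z w\<bar> \<le> norm (((Z w)\<^sup>2 / \<epsilon> + \<epsilon>) / 2)"
      using order_trans[OF b abs_ge_self] by (intro AE_I2) (simp only: real_norm_def abs_idempotent)
  qed (use Zm in measurable)
  have "(\<integral>w. deviation m 0 w \<partial>M) \<le> (\<integral>w. ((Z w)\<^sup>2 / \<epsilon> + \<epsilon>) / 2 \<partial>M)"
    using i2 ii unfolding d by (rule integral_mono) (rule b)
  also have "\<dots> = ((\<integral>w. (Z w)\<^sup>2 \<partial>M) / \<epsilon> + \<epsilon>) / 2"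
    using i by (simp add: prob_space)
  also have "\<dots> \<le> (\<epsilon>\<^sup>2 / \<epsilon> + \<epsilon>) / 2"
    using le assms by (intro divide_right_mono add_right_mono) auto
  also have "\<dots> = \<epsilon>" using assms by (simp add: power2_eq_square)
  finally show ?thesis using ne i2 by blast
qed

text \<open>Pathwise comparison of the sum of the field with the sum \<open>V\<close> of its local
  averages over radius m. A shift by a vector of norm below m maps the ball of radius k into that of
  radius k + m, and the image of the latter covers the former, so by nonnegativity the two sums
  interlace with a change of radius by m.\<close>

lemma lattice_sum_bounds:
  assumes w: "w \<in> space M" and m: "lattice_ball (real m) \<noteq> ({} :: (real ^ 'n) set)" and t: "0 < t"
    and good: "\<And>n. 1 \<le> n \<Longrightarrow> (\<Sum>c\<in>lattice_ball (real n). deviation m c w) \<le> t * ball_vol TYPE('n) (real n)"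
    and n: "1 \<le> n"
  shows "(\<Sum>c\<in>lattice_ball (real n). X c w)
      \<le> \<mu> * real (card (lattice_ball (real (n + m)) :: (real ^ 'n) set)) + t * ball_vol TYPE('n) (real (n + m))"
    and "\<mu> * real (card (lattice_ball (real n) :: (real ^ 'n) set)) - t * ball_vol TYPE('n) (real n)
      \<le> (\<Sum>c\<in>lattice_ball (real (n + m)). X c w)"
proof -
  let ?B = "\<lambda>k. lattice_ball (real k) :: (real ^ 'n) set"
  have N: "real (card (?B m)) > 0" using m by (simp add: card_gt_0_iff)
  define V where "V k = (\<Sum>b\<in>?B k. lattice_avg (\<lambda>c. X (b + c) w) m)" for k
  have V: "\<bar>V k - \<mu> * real (card (?B k))\<bar> \<le> t * ball_vol TYPE('n) (real k)" if "1 \<le> k" for k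
  proof -
    have "V k - \<mu> * real (card (?B k)) = (\<Sum>b\<in>?B k. lattice_avg (\<lambda>c. X (b + c) w) m - \<mu>)"
      by (simp add: V_def sum_subtractf)
    also have "\<bar>\<dots>\<bar> \<le> (\<Sum>b\<in>?B k. deviation m b w)"
      unfolding deviation_def by (rule sum_abs)
    finally show ?thesis using good[OF that] by simp
  qed
  have V_eq: "V k = (\<Sum>c\<in>?B m. \<Sum>b\<in>?B k. X (b + c) w) / real (card (?B m))" for k
    unfolding V_def lattice_avg_def by (subst sum.swap) (simp add: sum_divide_distrib)
  have le: "(\<Sum>b\<in>?B k. X (b + c) w) \<le> (\<Sum>b\<in>?B (k + m). X b w)"
    and ge: "(\<Sum>b\<in>?B k. X b w) \<le> (\<Sum>b\<in>?B (k + m). X (b + c) w)" if c: "c \<in> ?B m" for k c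
  proof -
    have cl: "c \<in> lattice" "norm c < real m" using c by (auto simp: lattice_ball_def)
    have "(\<Sum>b\<in>?B k. X (b + c) w) = sum (\<lambda>b. X b w) ((\<lambda>b. b + c) ` ?B k)"
      by (subst sum.reindex) (auto simp: inj_on_def)
    also have "\<dots> \<le> (\<Sum>b\<in>?B (k + m). X b w)"
    proof (rule sum_mono2)
      show "(\<lambda>b. b + c) ` ?B k \<subseteq> ?B (k + m)"
      proof
        fix x assume "x \<in> (\<lambda>b. b + c) ` ?B k"
        then obtain b where "x = b + c" "b \<in> lattice" "norm b < real k" by (auto simp: lattice_ball_def)
        then show "x \<in> ?B (k + m)"
          using cl norm_triangle_ineq[of b c] by (simp add: lattice_ball_def lattice_add)
      qed
    qed (use nonneg[OF _ w] in \<open>auto simp: lattice_ball_def\<close>)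
    finally show "(\<Sum>b\<in>?B k. X (b + c) w) \<le> (\<Sum>b\<in>?B (k + m). X b w)" .
    have "(\<Sum>b\<in>?B k. X b w) \<le> sum (\<lambda>b. X b w) ((\<lambda>b. b + c) ` ?B (k + m))"
    proof (rule sum_mono2)
      show "?B k \<subseteq> (\<lambda>b. b + c) ` ?B (k + m)"
      proof
        fix b assume "b \<in> ?B k"
        then have "b - c \<in> ?B (k + m)"
          using cl norm_triangle_ineq4[of b c] by (simp add: lattice_ball_def lattice_diff)
        then show "b \<in> (\<lambda>b. b + c) ` ?B (k + m)" by (intro image_eqI[of _ _ "b - c"]) auto
      qed
    qed (use nonneg[OF _ w] cl in \<open>auto simp: lattice_ball_def lattice_add\<close>)
    also have "\<dots> = (\<Sum>b\<in>?B (k + m). X (b + c) w)"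
      by (subst sum.reindex) (auto simp: inj_on_def)
    finally show "(\<Sum>b\<in>?B k. X b w) \<le> (\<Sum>b\<in>?B (k + m). X (b + c) w)" .
  qed
  have "V n \<le> (\<Sum>c\<in>?B m. \<Sum>b\<in>?B (n + m). X b w) / real (card (?B m))"
    unfolding V_eq using le by (intro divide_right_mono sum_mono) auto
  also have "\<dots> = (\<Sum>b\<in>?B (n + m). X b w)" using N m by simp
  finally show "\<mu> * real (card (?B n)) - t * ball_vol TYPE('n) (real n) \<le> (\<Sum>c\<in>?B (n + m). X c w)"
    using V[OF n] by linarith
  have "(\<Sum>b\<in>?B n. X b w) = (\<Sum>c\<in>?B m. \<Sum>b\<in>?B n. X b w) / real (card (?B m))"
    using N m by simp
  also have "\<dots> \<le> V (n + m)"
    unfolding V_eq using ge by (intro divide_right_mono sum_mono) auto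
  finally show "(\<Sum>c\<in>?B n. X c w) \<le> \<mu> * real (card (?B (n + m))) + t * ball_vol TYPE('n) (real (n + m))"
    using V[of "n + m"] n by linarith
qed

lemma eventually_close:
  assumes w: "w \<in> space M" and m: "lattice_ball (real m) \<noteq> ({} :: (real ^ 'n) set)" and t: "0 < t"
    and good: "\<And>n. 1 \<le> n \<Longrightarrow> (\<Sum>c\<in>lattice_ball (real n). deviation m c w) \<le> t * ball_vol TYPE('n) (real n)"
  shows "\<forall>\<^sub>F n in sequentially. \<bar>(\<Sum>c\<in>lattice_ball (real n). X c w) / ball_vol TYPE('n) (real n) - \<mu>\<bar> \<le> 2 * t"
proof -
  let ?U = "\<lambda>n. \<Sum>c\<in>lattice_ball (real n). X c w" and ?v = "\<lambda>n. ball_vol TYPE('n) (real n)"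
    and ?N = "\<lambda>n. real (card (lattice_ball (real n) :: (real ^ 'n) set))"
  have lb1: "?U k \<le> \<mu> * ?N (k + m) + t * ?v (k + m)" if "1 \<le> k" for k
    by (rule lattice_sum_bounds(1)[OF w m t _ that]) (rule good)
  have lb2: "\<mu> * ?N k - t * ?v k \<le> ?U (k + m)" if "1 \<le> k" for k
    by (rule lattice_sum_bounds(2)[OF w m t _ that]) (rule good)
  \<comment> \<open>The two bounds tend to \<mu> + t and \<mu> - t; the doubled tolerance leaves
    room for the ratios of counts and volumes to settle.\<close>
  have "(\<lambda>n. \<mu> * (?N (n + m) / ?v n) + t * (?v (n + m) / ?v n)) \<longlonglongrightarrow> \<mu> * 1 + t * 1"
    using card_lattice_ball_ratio_tendsto[where 'n='n, of "real m"] ball_vol_ratio_tendsto[where 'n='n, of "real m"]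
    by (intro tendsto_intros) auto
  then have up: "\<forall>\<^sub>F n in sequentially. \<mu> * (?N (n + m) / ?v n) + t * (?v (n + m) / ?v n) < \<mu> + 2 * t"
    using t by (intro order_tendstoD) auto
  \<comment> \<open>The lower bound concerns the sum over radius n + m, so it is normalised by the
    volume at n + m, and the index is shifted back afterwards.\<close>
  have "(\<lambda>n. \<mu> * (?N n / ?v n / (?v (n + m) / ?v n)) - t / (?v (n + m) / ?v n)) \<longlonglongrightarrow> \<mu> * (1 / 1) - t / 1"
    using card_lattice_ball_ratio_tendsto[where 'n='n, of 0] ball_vol_ratio_tendsto[where 'n='n, of "real m"]
    by (intro tendsto_intros) auto
  then have "\<forall>\<^sub>F n in sequentially. \<mu> - 2 * t < \<mu> * (?N n / ?v n / (?v (n + m) / ?v n)) - t / (?v (n + m) / ?v n)"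
    using t by (intro order_tendstoD) auto
  then have "\<forall>\<^sub>F n in sequentially. \<mu> - 2 * t < ?U (n + m) / ?v (n + m)"
    using eventually_ge_at_top[of 1]
  proof eventually_elim
    case (elim n)
    have v: "?v n > 0" "?v (n + m) > 0" using elim by (auto intro!: ball_vol_pos)
    have "\<mu> * (?N n / ?v n / (?v (n + m) / ?v n)) - t / (?v (n + m) / ?v n) = (\<mu> * ?N n - t * ?v n) / ?v (n + m)"
      using v by (simp add: field_simps)
    also have "\<dots> \<le> ?U (n + m) / ?v (n + m)"
      using lb2[OF elim(2)] by (intro divide_right_mono) auto
    finally show ?case using elim by linarith
  qed
  then have lo: "\<forall>\<^sub>F n in sequentially. \<mu> - 2 * t < ?U n / ?v n"
    by (rule eventually_sequentially_seg[THEN iffD1])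
  show ?thesis
    using up lo eventually_ge_at_top[of 1]
  proof eventually_elim
    case (elim n)
    have "?U n / ?v n \<le> (\<mu> * ?N (n + m) + t * ?v (n + m)) / ?v n"
      using lb1[OF elim(3)] by (intro divide_right_mono) auto
    also have "\<dots> = \<mu> * (?N (n + m) / ?v n) + t * (?v (n + m) / ?v n)"
      by (simp add: add_divide_distrib)
    finally show ?case using elim by (simp add: abs_le_iff)
  qed
qed

text \<open>For fixed t, outside the maximal event for \<open>deviation m\<close> the averages are
  eventually within 2 t of \<mu>. The failure event does not depend on m, while the probability of
  the maximal event can be made arbitrarily small by the choice of m, so failure has probability
  0.\<close>

theorem lattice_ergodic:
  "AE w in M. (\<lambda>n. (\<Sum>c\<in>lattice_ball (real n). X c w) / ball_vol TYPE('n) (real n)) \<longlonglongrightarrow> \<mu>"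
proof -
  let ?A = "\<lambda>n w. (\<Sum>c\<in>lattice_ball (real n). X c w) / ball_vol TYPE('n) (real n)"
  have Am: "?A n \<in> borel_measurable M" for n
    using X_measurable by (auto simp: lattice_ball_def)
  have ae: "AE w in M. \<forall>\<^sub>F n in sequentially. \<bar>?A n w - \<mu>\<bar> \<le> 2 * t" if t: "0 < t" for t
  proof (rule AE_I')
    let ?bad = "{w \<in> space M. \<not> (\<forall>\<^sub>F n in sequentially. \<bar>?A n w - \<mu>\<bar> \<le> 2 * t)}"
    have bad: "?bad \<in> sets M"
      unfolding eventually_sequentially using Am by measurable
    have "measure M ?bad \<le> \<delta>" if \<delta>: "0 < \<delta>" for \<delta>
    proof -
      let ?C = "maximal_constant TYPE('n)"
      \<comment> \<open>The target mean t \<delta> / C is what the maximal inequality at level t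
        converts into the probability \<delta>.\<close>
      obtain m where m: "lattice_ball (real m) \<noteq> ({} :: (real ^ 'n) set)" "integrable M (deviation m 0)"
        "(\<integral>w. deviation m 0 w \<partial>M) \<le> t * \<delta> / ?C"
        using deviation_arbitrarily_small[of "t * \<delta> / ?C"] t \<delta> maximal_constant_pos[where 'n='n] by auto
      have dev: "stationary_field M (deviation m)"
        using stationary_field_deviation[OF stationary, of m \<mu>] by (simp add: deviation_def[abs_def])
      have dnn: "0 \<le> deviation m b w" for b w by (simp add: deviation_def)
      note mi = maximal_inequality[OF prob_space_axioms dev dnn m(2) t]
      have "measure M ?bad \<le> measure M {w\<in>space M. \<exists>n\<ge>1. t * ball_vol TYPE('n) (real n) < (\<Sum>c\<in>lattice_ball (real n). deviation m c w)}"
      proof (rule finite_measure_mono[OF _ mi(1)])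
        show "?bad \<subseteq> {w\<in>space M. \<exists>n\<ge>1. t * ball_vol TYPE('n) (real n) < (\<Sum>c\<in>lattice_ball (real n). deviation m c w)}"
        proof
          fix w assume w: "w \<in> ?bad"
          show "w \<in> {w\<in>space M. \<exists>n\<ge>1. t * ball_vol TYPE('n) (real n) < (\<Sum>c\<in>lattice_ball (real n). deviation m c w)}"
          proof (rule ccontr)
            assume "\<not> ?thesis"
            then have good: "(\<Sum>c\<in>lattice_ball (real n). deviation m c w) \<le> t * ball_vol TYPE('n) (real n)" if "1 \<le> n" for n
              using w that by (simp add: not_less)
            have "\<forall>\<^sub>F n in sequentially. \<bar>?A n w - \<mu>\<bar> \<le> 2 * t"
            proof (rule eventually_close[OF _ m(1) t])
              show "w \<in> space M" using w by blast
            qed (rule good)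
            then show False using w by blast
          qed
        qed
      qed
      also have "\<dots> \<le> ?C * (\<integral>w. deviation m 0 w \<partial>M) / t" by (rule mi(2))
      also have "\<dots> \<le> ?C * (t * \<delta> / ?C) / t"
        using m(3) t maximal_constant_pos[where 'n='n] by (intro divide_right_mono mult_left_mono) auto
      also have "\<dots> = \<delta>" using t maximal_constant_pos[where 'n='n] by simp
      finally show ?thesis .
    qed
    then have "measure M ?bad \<le> 0" by (rule field_le_epsilon[of _ 0, simplified])
    then show "?bad \<in> null_sets M"
      using bad measure_nonneg[of M ?bad] by (auto simp: null_sets_def emeasure_eq_measure)
  qed auto
  have "AE w in M. \<forall>k::nat. \<forall>\<^sub>F n in sequentially. \<bar>?A n w - \<mu>\<bar> \<le> 2 * (1 / real (Suc k))"
    unfolding AE_all_countable by (intro allI ae) simp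
  then show ?thesis
  proof eventually_elim
    case (elim w)
    show ?case
      unfolding tendsto_iff dist_real_def
    proof (intro allI impI)
      fix e :: real assume "0 < e"
      then obtain k :: nat where "1 / real (Suc k) < e / 2"
        using nat_approx_posE[of "e / 2"] by auto
      then have "2 * (1 / real (Suc k)) < e" by linarith
      then show "\<forall>\<^sub>F n in sequentially. \<bar>?A n w - \<mu>\<bar> < e"
        by (intro eventually_mono[OF spec[OF elim, of k]]) linarith
    qed
  qed
qed

end

section \<open>Point configurations\<close>

lemma space_configuration_space: "space configuration_space = Collect point_configuration"
  by (auto simp: configuration_space_def space_Sup_eq_UN)

lemma emeasure_measurable_configuration_space [measurable (raw)]:
  "A \<in> sets borel \<Longrightarrow> (\<lambda>\<mu>. emeasure \<mu> A) \<in> borel_measurable configuration_space"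
  by (auto intro!: measurable_Sup1 measurable_vimage_algebra1 simp: configuration_space_def)

lemma measurable_into_configuration_space:
  assumes "\<And>x. x \<in> space M \<Longrightarrow> point_configuration (f x)"
    and "\<And>A. A \<in> sets borel \<Longrightarrow> (\<lambda>x. emeasure (f x) A) \<in> borel_measurable M"
  shows "f \<in> measurable M configuration_space"
  using assms by (auto intro!: measurable_Sup2 measurable_vimage_algebra2 simp: configuration_space_def)

lemma sets_point_configuration: "point_configuration \<mu> \<Longrightarrow> sets \<mu> = sets borel"
  by (simp add: point_configuration_def locally_finite_measure_def)

lemma space_point_configuration: "point_configuration \<mu> \<Longrightarrow> space \<mu> = UNIV"
  using sets_eq_imp_space_eq[OF sets_point_configuration] by simp

lemma emeasure_point_configuration_bounded:
  assumes "point_configuration \<mu>" "A \<in> sets borel" "bounded A"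
  shows "\<exists>n::nat. emeasure \<mu> A = of_nat n"
proof -
  obtain e where e: "emeasure \<mu> A = ennreal_of_enat e"
    using assms by (auto simp: point_configuration_def)
  moreover have "emeasure \<mu> A < \<infinity>"
    using assms by (auto simp: point_configuration_def locally_finite_measure_def)
  ultimately show ?thesis by (cases e) auto
qed

text \<open>The masses of shrinking balls are natural numbers and tend to the mass of {x}. Once such
  a mass is below that of {x} plus 1, it equals it and the punctured ball is null.\<close>

lemma point_configuration_isolated:
  assumes \<mu>: "point_configuration (\<mu> :: (real ^ 'n) measure)"
  shows "\<exists>U. open U \<and> x \<in> U \<and> emeasure \<mu> (U - {x}) = 0"
proof -
  let ?B = "\<lambda>k. ball x (1 / real (Suc k))"
  have s: "A \<in> sets \<mu> \<longleftrightarrow> A \<in> sets borel" for A using sets_point_configuration[OF \<mu>] by simp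
  have fin: "emeasure \<mu> A \<noteq> \<infinity>" if "A \<in> sets borel" "bounded A" for A
    using \<mu> that by (auto simp: point_configuration_def locally_finite_measure_def)
  have "(\<Inter>k. ?B k) = {x}"
  proof (intro set_eqI iffI)
    fix y assume y: "y \<in> (\<Inter>k. ?B k)"
    show "y \<in> {x}"
    proof (rule ccontr)
      assume "y \<notin> {x}"
      then have "0 < dist x y" by auto
      then obtain k where "1 / real (Suc k) < dist x y" using nat_approx_posE by blast
      moreover have "dist x y < 1 / real (Suc k)" using y by auto
      ultimately show False by simp
    qed
  qed auto
  moreover have "(\<lambda>k. emeasure \<mu> (?B k)) \<longlonglongrightarrow> emeasure \<mu> (\<Inter>k. ?B k)"
  proof (rule Lim_emeasure_decseq)
    show "decseq ?B"
      unfolding decseq_def by (intro allI impI subset_ball divide_left_mono) auto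
    show "range ?B \<subseteq> sets \<mu>" using s borel_open[OF open_ball] by blast
    show "emeasure \<mu> (?B k) \<noteq> \<infinity>" for k by (rule fin) auto
  qed
  ultimately have lim: "(\<lambda>k. emeasure \<mu> (?B k)) \<longlonglongrightarrow> emeasure \<mu> {x}" by simp
  obtain n :: nat where n: "emeasure \<mu> {x} = of_nat n"
    using emeasure_point_configuration_bounded[OF \<mu>, of "{x}"] by auto
  have "emeasure \<mu> {x} < of_nat (Suc n)" unfolding n by simp
  then have "\<forall>\<^sub>F k in sequentially. emeasure \<mu> (?B k) < of_nat (Suc n)"
    by (rule order_tendstoD(2)[OF lim])
  then obtain k where k: "emeasure \<mu> (?B k) < of_nat (Suc n)" unfolding eventually_sequentially by blast
  obtain m :: nat where m: "emeasure \<mu> (?B k) = of_nat m"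
    using emeasure_point_configuration_bounded[OF \<mu>, of "?B k"] by auto
  have "m \<le> n" using k unfolding m by (simp del: of_nat_Suc)
  have "emeasure \<mu> (?B k - {x}) = emeasure \<mu> (?B k) - emeasure \<mu> {x}"
    using s fin by (intro emeasure_Diff) auto
  also have "\<dots> = 0" using \<open>m \<le> n\<close> unfolding m n by (simp add: diff_eq_0_iff_ennreal ennreal_of_nat_eq_real_of_nat)
  finally show ?thesis by (intro exI[of _ "?B k"]) simp
qed

text \<open>The neighbourhoods of \<open>point_configuration_isolated\<close> cover the space; a
  countable subcover leaves mass only at its countably many centres.\<close>

lemma point_configuration_countable_support:
  assumes \<mu>: "point_configuration (\<mu> :: (real ^ 'n) measure)"
  shows "\<exists>C. countable C \<and> emeasure \<mu> (- C) = 0"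
proof -
  obtain U where U: "\<And>x. open (U x)" "\<And>x. x \<in> U x" "\<And>x. emeasure \<mu> (U x - {x}) = 0"
    using point_configuration_isolated[OF \<mu>] by metis
  obtain F where F: "F \<subseteq> range U" "countable F" "\<Union>F = \<Union>(range U)"
    using Lindelof[of "range U"] U(1) by blast
  obtain C where C: "countable C" "F = U ` C"
    using F(1,2) by (metis countable_subset_image subset_UNIV)
  have "- C \<subseteq> (\<Union>x\<in>C. U x - {x})"
  proof
    fix y assume y: "y \<in> - C"
    have "y \<in> \<Union>F" unfolding F(3) using U(2) by blast
    then show "y \<in> (\<Union>x\<in>C. U x - {x})" using y C(2) by auto
  qed
  moreover have "(\<Union>x\<in>C. U x - {x}) \<in> null_sets \<mu>"
    using U C(1) sets_point_configuration[OF \<mu>] by (intro null_sets_UN') (auto simp: null_sets_def)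
  ultimately have "emeasure \<mu> (- C) = 0"
    by (metis emeasure_eq_0 null_setsD1 null_setsD2)
  with C(1) show ?thesis by blast
qed

lemma emeasure_atom_count:
  assumes \<mu>: "point_configuration (\<mu> :: (real ^ 'n) measure)"
  shows "emeasure (count_space UNIV) ({x} \<times> {j :: nat. of_nat j < emeasure \<mu> {x}}) = emeasure \<mu> {x}"
proof -
  obtain n :: nat where n: "emeasure \<mu> {x} = of_nat n"
    using emeasure_point_configuration_bounded[OF \<mu>, of "{x}"] by auto
  have "{j :: nat. of_nat j < emeasure \<mu> {x}} = {..<n}" unfolding n by auto
  then show ?thesis unfolding n by (simp add: emeasure_count_space)
qed

text \<open>Justifies the index set \<open>configuration_points\<close>: an integer-valued locally
  finite measure is purely atomic, so it is the image of counting measure on the indices under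
  \<open>fst\<close>.\<close>

theorem emeasure_point_configuration:
  assumes \<mu>: "point_configuration (\<mu> :: (real ^ 'n) measure)" and A: "A \<in> sets borel"
  shows "emeasure \<mu> A = emeasure (count_space UNIV) {p \<in> configuration_points \<mu>. fst p \<in> A}"
proof -
  obtain C where C: "countable C" "emeasure \<mu> (- C) = 0"
    using point_configuration_countable_support[OF \<mu>] by blast
  have s: "A \<in> sets \<mu> \<longleftrightarrow> A \<in> sets borel" for A using sets_point_configuration[OF \<mu>] by simp
  have Cb: "C \<in> sets borel" by (rule sets.countable[OF _ C(1)]) simp
  have Cs: "C \<in> sets borel" "A \<inter> C \<in> sets borel" "- C \<in> sets borel" "countable (A \<inter> C)"
    by (fact Cb, rule sets.Int[OF A Cb], rule borel_comp[OF Cb], rule countable_Int2[OF C(1)])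
  have "emeasure \<mu> A = emeasure \<mu> (A \<inter> C)"
  proof (rule emeasure_eq_AE)
    have "- C \<in> null_sets \<mu>" using C Cs s by (auto simp: null_sets_def)
    then have "AE x in \<mu>. x \<notin> - C" by (rule AE_not_in)
    then show "AE x in \<mu>. x \<in> A \<longleftrightarrow> x \<in> A \<inter> C" by eventually_elim auto
  qed (use A Cs s in auto)
  also have "\<dots> = emeasure \<mu> (\<Union>x\<in>A \<inter> C. {x})" by simp
  also have "\<dots> = (\<integral>\<^sup>+x. emeasure \<mu> {x} \<partial>count_space (A \<inter> C))"
    using Cs s by (intro emeasure_UN_countable) (auto simp: disjoint_family_on_def)
  also have "\<dots> = (\<integral>\<^sup>+x. emeasure (count_space UNIV) ({x} \<times> {j :: nat. of_nat j < emeasure \<mu> {x}}) \<partial>count_space (A \<inter> C))"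
    by (simp add: emeasure_atom_count[OF \<mu>])
  also have "\<dots> = emeasure (count_space UNIV) (\<Union>x\<in>A \<inter> C. {x} \<times> {j :: nat. of_nat j < emeasure \<mu> {x}})"
    using Cs by (intro emeasure_UN_countable[symmetric]) (auto simp: disjoint_family_on_def)
  also have "(\<Union>x\<in>A \<inter> C. {x} \<times> {j :: nat. of_nat j < emeasure \<mu> {x}}) = {p \<in> configuration_points \<mu>. fst p \<in> A}"
  proof -
    have "x \<in> C" if "of_nat j < emeasure \<mu> {x}" for x and j :: nat
    proof (rule ccontr)
      assume "x \<notin> C"
      then have "emeasure \<mu> {x} \<le> emeasure \<mu> (- C)" using Cs s by (intro emeasure_mono) auto
      then show False using C(2) that by simp
    qed
    then show ?thesis by (auto simp: configuration_points_def)
  qed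
  finally show ?thesis .
qed

definition points_in :: "(real ^ 'n) measure \<Rightarrow> (real ^ 'n) set \<Rightarrow> ((real ^ 'n) \<times> nat) set" where
  "points_in \<mu> A = {p \<in> configuration_points \<mu>. fst p \<in> A}"

lemma
  assumes \<mu>: "point_configuration (\<mu> :: (real ^ 'n) measure)" and A: "A \<in> sets borel" "bounded A"
  shows finite_points_in: "finite (points_in \<mu> A)"
    and emeasure_eq_card_points_in: "emeasure \<mu> A = of_nat (card (points_in \<mu> A))"
proof -
  have e: "emeasure \<mu> A = emeasure (count_space UNIV) (points_in \<mu> A)"
    unfolding points_in_def by (rule emeasure_point_configuration[OF \<mu> A(1)])
  have "emeasure \<mu> A \<noteq> \<infinity>"
    using emeasure_point_configuration_bounded[OF \<mu> A] by auto
  then show "finite (points_in \<mu> A)" unfolding e by (auto simp: emeasure_count_space split: if_splits)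
  then show "emeasure \<mu> A = of_nat (card (points_in \<mu> A))" unfolding e by simp
qed

text \<open>Distinctness is demanded of the indices and not of the positions: two indices over one
  multiple atom may occur together. This is the set counted by
  \<open>factorial_power\<close>.\<close>

definition factorial_tuples :: "nat \<Rightarrow> (real ^ 'n) measure \<Rightarrow> (nat \<Rightarrow> real ^ 'n) set \<Rightarrow> (nat \<Rightarrow> (real ^ 'n) \<times> nat) set" where
  "factorial_tuples k \<mu> B = {t \<in> {..<k} \<rightarrow>\<^sub>E configuration_points \<mu>. inj_on t {..<k} \<and> (\<lambda>i\<in>{..<k}. fst (t i)) \<in> B}"

lemma emeasure_factorial_power:
  assumes "B \<in> sets (Pi\<^sub>M {..<k} (\<lambda>_. borel))"
  shows "emeasure (factorial_power k \<mu>) B = emeasure (count_space UNIV) (factorial_tuples k \<mu> B)"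
proof -
  let ?T = "{t \<in> {..<k} \<rightarrow>\<^sub>E configuration_points \<mu>. inj_on t {..<k}}"
  have m: "(\<lambda>t. \<lambda>i\<in>{..<k}. fst (t i)) \<in> measurable (count_space ?T) (Pi\<^sub>M {..<k} (\<lambda>_. borel))"
    by (auto simp: measurable_count_space_eq1 space_PiM)
  have "emeasure (factorial_power k \<mu>) B = emeasure (count_space ?T) ((\<lambda>t. \<lambda>i\<in>{..<k}. fst (t i)) -` B \<inter> ?T)"
    unfolding factorial_power_def using emeasure_distr[OF m assms] by simp
  also have "(\<lambda>t. \<lambda>i\<in>{..<k}. fst (t i)) -` B \<inter> ?T = factorial_tuples k \<mu> B"
    by (auto simp: factorial_tuples_def)
  also have "emeasure (count_space ?T) (factorial_tuples k \<mu> B) = emeasure (count_space UNIV) (factorial_tuples k \<mu> B)"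
    by (subst (1 2) emeasure_count_space) (auto simp: factorial_tuples_def)
  finally show ?thesis .
qed

lemma factorial_tuples_subset_PiE:
  assumes "B \<subseteq> Pi\<^sub>E {..<k} (\<lambda>_. A)"
  shows "factorial_tuples k \<mu> B \<subseteq> {..<k} \<rightarrow>\<^sub>E points_in \<mu> A"
proof
  fix t assume t: "t \<in> factorial_tuples k \<mu> B"
  then have "(\<lambda>i\<in>{..<k}. fst (t i)) \<in> B" by (simp add: factorial_tuples_def)
  then have r: "(\<lambda>i\<in>{..<k}. fst (t i)) \<in> Pi\<^sub>E {..<k} (\<lambda>_. A)" using assms by (rule rev_subsetD)
  have "fst (t i) \<in> A" if "i < k" for i using PiE_mem[OF r, of i] that by simp
  then show "t \<in> {..<k} \<rightarrow>\<^sub>E points_in \<mu> A"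
    using t by (auto simp: factorial_tuples_def points_in_def PiE_iff)
qed

lemma finite_factorial_tuples:
  assumes "point_configuration \<mu>" "A \<in> sets borel" "bounded A" "B \<subseteq> Pi\<^sub>E {..<k} (\<lambda>_. A)"
  shows "finite (factorial_tuples k \<mu> B)"
  by (rule finite_subset[OF factorial_tuples_subset_PiE[OF assms(4)]])
    (intro finite_PiE finite_points_in assms, auto)

lemma factorial_tuples_PiE:
  "factorial_tuples k \<mu> (Pi\<^sub>E {..<k} (\<lambda>_. A)) = {t \<in> {..<k} \<rightarrow>\<^sub>E points_in \<mu> A. inj_on t {..<k}}"
proof
  show "factorial_tuples k \<mu> (Pi\<^sub>E {..<k} (\<lambda>_. A)) \<subseteq> {t \<in> {..<k} \<rightarrow>\<^sub>E points_in \<mu> A. inj_on t {..<k}}"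
    using factorial_tuples_subset_PiE[of "Pi\<^sub>E {..<k} (\<lambda>_. A)" k A \<mu>] by (auto simp: factorial_tuples_def)
  show "{t \<in> {..<k} \<rightarrow>\<^sub>E points_in \<mu> A. inj_on t {..<k}} \<subseteq> factorial_tuples k \<mu> (Pi\<^sub>E {..<k} (\<lambda>_. A))"
    by (auto simp: factorial_tuples_def points_in_def PiE_iff)
qed

lemma prod_falling: "(\<Prod>i = 0..<k. n - i) = fact k * (n choose k)"
proof (induction k)
  case (Suc k)
  have "Suc k * (n choose Suc k) = (n - k) * (n choose k)"
    using binomial_absorption[of k n] binomial_absorb_comp[of n k] by simp
  then have "fact (Suc k) * (n choose Suc k) = fact k * ((n - k) * (n choose k))"
    by (simp add: mult.assoc mult.left_commute del: mult_Suc)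
  then show ?case using Suc by (simp add: mult_ac del: fact_Suc)
qed simp

lemma card_factorial_tuples_PiE:
  assumes "point_configuration \<mu>" "A \<in> sets borel" "bounded A"
  shows "card (factorial_tuples k \<mu> (Pi\<^sub>E {..<k} (\<lambda>_. A))) = fact k * (card (points_in \<mu> A) choose k)"
  unfolding factorial_tuples_PiE
  by (subst card_inj_on_subset_funcset) (use finite_points_in[OF assms] in \<open>auto simp: prod_falling\<close>)

section \<open>Translation of configurations\<close>

definition translate_config :: "real ^ 'n \<Rightarrow> (real ^ 'n) measure \<Rightarrow> (real ^ 'n) measure" where
  "translate_config a \<mu> = distr \<mu> borel (\<lambda>x. x + a)"

lemma emeasure_translate_config:
  assumes \<mu>: "point_configuration (\<mu> :: (real ^ 'n) measure)" and A: "A \<in> sets borel"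
  shows "emeasure (translate_config a \<mu>) A = emeasure \<mu> ((\<lambda>x. x - a) ` A)"
proof -
  have "(\<lambda>x. x + a) \<in> measurable \<mu> borel"
    unfolding measurable_cong_sets[OF sets_point_configuration[OF \<mu>] refl] by measurable
  then have "emeasure (translate_config a \<mu>) A = emeasure \<mu> ((\<lambda>x. x + a) -` A \<inter> space \<mu>)"
    unfolding translate_config_def using A by (rule emeasure_distr)
  also have "(\<lambda>x. x + a) -` A \<inter> space \<mu> = (\<lambda>x. x - a) ` A"
    by (force simp: space_point_configuration[OF \<mu>])
  finally show ?thesis .
qed

lemma borel_translate: "A \<in> sets borel \<Longrightarrow> (\<lambda>x. x - a) ` A \<in> sets (borel :: (real ^ 'n) measure)"
proof -
  assume A: "A \<in> sets (borel :: (real ^ 'n) measure)"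
  have "(\<lambda>x. x + a) -` A \<inter> space (borel :: (real ^ 'n) measure) \<in> sets borel"
    by (rule measurable_sets[OF _ A]) measurable
  also have "(\<lambda>x. x + a) -` A \<inter> space (borel :: (real ^ 'n) measure) = (\<lambda>x. x - a) ` A" by force
  finally show ?thesis .
qed

lemma bounded_translate: "bounded A \<Longrightarrow> bounded ((\<lambda>x. x - a) ` (A :: (real ^ 'n) set))"
  using bounded_translation[of A "- a"] by simp

lemma point_configuration_translate:
  assumes \<mu>: "point_configuration (\<mu> :: (real ^ 'n) measure)"
  shows "point_configuration (translate_config a \<mu>)"
  unfolding point_configuration_def locally_finite_measure_def
proof (intro conjI ballI impI)
  show "sets (translate_config a \<mu>) = sets borel" by (simp add: translate_config_def)
  fix A :: "(real ^ 'n) set" assume A: "A \<in> sets borel"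
  show "emeasure (translate_config a \<mu>) A \<in> range ennreal_of_enat"
    unfolding emeasure_translate_config[OF \<mu> A] using \<mu> borel_translate[OF A] by (auto simp: point_configuration_def)
  show "emeasure (translate_config a \<mu>) A < \<infinity>" if "bounded A"
    unfolding emeasure_translate_config[OF \<mu> A] using \<mu> borel_translate[OF A] bounded_translate[OF that]
    by (auto simp: point_configuration_def locally_finite_measure_def)
qed

lemma translate_config_measurable:
  "translate_config a \<in> measurable (configuration_space :: (real ^ 'n) measure measure) configuration_space"
proof (rule measurable_into_configuration_space)
  fix A :: "(real ^ 'n) set" assume A: "A \<in> sets borel"
  show "(\<lambda>\<mu>. emeasure (translate_config a \<mu>) A) \<in> borel_measurable configuration_space"
    by (subst measurable_cong[OF emeasure_translate_config[OF _ A]])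
      (use borel_translate[OF A] in \<open>auto simp: space_configuration_space\<close>)
qed (simp add: space_configuration_space point_configuration_translate)

lemma configuration_points_translate:
  assumes \<mu>: "point_configuration (\<mu> :: (real ^ 'n) measure)"
  shows "configuration_points (translate_config a \<mu>) = (\<lambda>p. (fst p + a, snd p)) ` configuration_points \<mu>"
proof -
  have "emeasure (translate_config a \<mu>) {x} = emeasure \<mu> {x - a}" for x
    by (subst emeasure_translate_config[OF \<mu>]) auto
  then have "configuration_points (translate_config a \<mu>) = {(x, j). (x - a, j) \<in> configuration_points \<mu>}"
    by (simp add: configuration_points_def)
  also have "\<dots> = (\<lambda>p. (fst p + a, snd p)) ` configuration_points \<mu>"
  proof (intro set_eqI iffI)
    fix p assume "p \<in> {(x, j). (x - a, j) \<in> configuration_points \<mu>}"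
    then show "p \<in> (\<lambda>p. (fst p + a, snd p)) ` configuration_points \<mu>"
      by (intro image_eqI[of _ _ "(fst p - a, snd p)"]) auto
  qed auto
  finally show ?thesis .
qed

lemma card_factorial_tuples_translate:
  assumes \<mu>: "point_configuration (\<mu> :: (real ^ 'n) measure)"
  shows "card (factorial_tuples k (translate_config a \<mu>) B) = card (factorial_tuples k \<mu> {x. (\<lambda>i\<in>{..<k}. x i + a) \<in> B})"
proof -
  let ?s = "\<lambda>p :: (real ^ 'n) \<times> nat. (fst p + a, snd p)" and ?u = "\<lambda>p :: (real ^ 'n) \<times> nat. (fst p - a, snd p)"
  let ?f = "\<lambda>t. \<lambda>i\<in>{..<k}. ?s (t i)" and ?g = "\<lambda>t. \<lambda>i\<in>{..<k}. ?u (t i)"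
  have su: "?s (?u p) = p" "?u (?s p) = p" for p by auto
  have inj: "inj ?s" "inj ?u" by (auto simp: inj_on_def)
  let ?L = "factorial_tuples k (translate_config a \<mu>) B" and ?R = "factorial_tuples k \<mu> {x. (\<lambda>i\<in>{..<k}. x i + a) \<in> B}"
  have "bij_betw ?f ?R ?L"
  proof (rule bij_betw_byWitness[where f'="?g"])
    show "\<forall>t\<in>?R. ?g (?f t) = t"
      by (auto simp: factorial_tuples_def PiE_iff extensional_def fun_eq_iff)
    show "\<forall>t\<in>?L. ?f (?g t) = t"
      by (auto simp: factorial_tuples_def PiE_iff extensional_def fun_eq_iff)
    show "?f ` ?R \<subseteq> ?L"
    proof (rule image_subsetI)
      fix t assume t: "t \<in> ?R"
      have "(\<lambda>i\<in>{..<k}. fst (?f t i)) = (\<lambda>i\<in>{..<k}. (\<lambda>i\<in>{..<k}. fst (t i)) i + a)"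
        by (auto simp: fun_eq_iff)
      moreover have "inj_on (?f t) {..<k}"
        using t by (auto simp: factorial_tuples_def inj_on_def prod_eq_iff)
      moreover have "?f t \<in> {..<k} \<rightarrow>\<^sub>E configuration_points (translate_config a \<mu>)"
        using t by (auto simp: factorial_tuples_def configuration_points_translate[OF \<mu>] PiE_iff)
      ultimately show "?f t \<in> ?L"
        using t by (simp only: factorial_tuples_def mem_Collect_eq)
    qed
    show "?g ` ?L \<subseteq> ?R"
    proof (rule image_subsetI)
      fix t assume t: "t \<in> ?L"
      have "(\<lambda>i\<in>{..<k}. (\<lambda>i\<in>{..<k}. fst (?g t i)) i + a) = (\<lambda>i\<in>{..<k}. fst (t i))"
        by (auto simp: fun_eq_iff)
      moreover have "inj_on (?g t) {..<k}"
        using t by (auto simp: factorial_tuples_def inj_on_def prod_eq_iff)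
      moreover have "?u (t i) \<in> configuration_points \<mu>" if "i < k" for i
      proof -
        have "t i \<in> ?s ` configuration_points \<mu>"
          using t that by (auto simp: factorial_tuples_def configuration_points_translate[OF \<mu>] PiE_iff)
        then show ?thesis using su(2) by (metis (no_types, lifting) imageE)
      qed
      then have "?g t \<in> {..<k} \<rightarrow>\<^sub>E configuration_points \<mu>"
        by (auto simp: PiE_iff)
      ultimately show "?g t \<in> ?R"
        using t by (simp only: factorial_tuples_def mem_Collect_eq)
    qed
  qed
  then show ?thesis by (simp add: bij_betw_same_card)
qed

section \<open>Permanents and products of factorial powers\<close>

text \<open>Used in two ways: with \<open>f\<close> the identity it is translation invariance of
  Lebesgue measure on k-tuples, and with \<open>f i = i + k\<close> it moves the second half of a
  2k-tuple onto the standard index set.\<close>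

lemma distr_PiM_reindex_shift:
  fixes c :: "real ^ 'n"
  assumes f: "bij_betw f I J" and fin: "finite I" "finite J"
  shows "distr (Pi\<^sub>M J (\<lambda>_. lborel)) (Pi\<^sub>M I (\<lambda>_. borel)) (\<lambda>y. \<lambda>i\<in>I. y (f i) - c) = Pi\<^sub>M I (\<lambda>_. lborel)"
proof (rule lborel_product.PiM_eqI[OF fin(1)])
  let ?T = "\<lambda>y. \<lambda>i\<in>I. y (f i) - c"
  have "sets (Pi\<^sub>M I (\<lambda>_. borel :: (real ^ 'n) measure)) = sets (Pi\<^sub>M I (\<lambda>_. lborel))"
    by (intro sets_PiM_cong) auto
  then show "sets (distr (Pi\<^sub>M J (\<lambda>_. lborel)) (Pi\<^sub>M I (\<lambda>_. borel)) ?T) = sets (Pi\<^sub>M I (\<lambda>_. lborel))" by simp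
  have T: "?T \<in> measurable (Pi\<^sub>M J (\<lambda>_. lborel)) (Pi\<^sub>M I (\<lambda>_. borel))"
  proof (rule measurable_restrict)
    fix i assume "i \<in> I"
    then have "f i \<in> J" using f by (auto simp: bij_betw_def)
    then have [measurable]: "(\<lambda>y. y (f i)) \<in> borel_measurable (Pi\<^sub>M J (\<lambda>_. lborel))"
      using measurable_component_singleton[of "f i" J "\<lambda>_. lborel"] by simp
    show "(\<lambda>y. y (f i) - c) \<in> measurable (Pi\<^sub>M J (\<lambda>_. lborel)) borel" by measurable
  qed
  fix A :: "_ \<Rightarrow> (real ^ 'n) set" assume A: "\<And>i. i \<in> I \<Longrightarrow> A i \<in> sets lborel"
  let ?g = "the_inv_into I f"
  have g: "\<And>i. i \<in> I \<Longrightarrow> ?g (f i) = i" "\<And>j. j \<in> J \<Longrightarrow> ?g j \<in> I" "\<And>j. j \<in> J \<Longrightarrow> f (?g j) = j"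
    using f by (auto simp: bij_betw_def the_inv_into_f_f the_inv_into_into f_the_inv_into_f)
  let ?A = "\<lambda>j. (\<lambda>x. - c + 1 *\<^sub>R x) -` A (?g j)"
  have Am: "?A j \<in> sets lborel" if "j \<in> J" for j
    using A[OF g(2)[OF that]] measurable_sets[of "\<lambda>x. - c + 1 *\<^sub>R x" borel borel "A (?g j)"] by simp
  have Ae: "emeasure lborel (?A j) = emeasure lborel (A (?g j))" if "j \<in> J" for j
  proof -
    have "emeasure lborel (A (?g j)) = emeasure (density (distr lborel borel (\<lambda>x. - c + 1 *\<^sub>R x)) (\<lambda>_. ennreal (\<bar>1\<bar> ^ DIM(real ^ 'n)))) (A (?g j))"
      using lborel_affine[of 1 "- c"] by simp
    also have "\<dots> = emeasure (distr lborel borel (\<lambda>x. - c + 1 *\<^sub>R x)) (A (?g j))"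
      by (simp add: density_1)
    also have "\<dots> = emeasure lborel (?A j)"
      using A[OF g(2)[OF that]] by (subst emeasure_distr) auto
    finally show ?thesis by simp
  qed
  have "?T -` Pi\<^sub>E I A \<inter> space (Pi\<^sub>M J (\<lambda>_. lborel :: (real ^ 'n) measure)) = Pi\<^sub>E J ?A"
  proof (intro set_eqI iffI)
    fix y assume y: "y \<in> ?T -` Pi\<^sub>E I A \<inter> space (Pi\<^sub>M J (\<lambda>_. lborel :: (real ^ 'n) measure))"
    have "- c + 1 *\<^sub>R y j \<in> A (?g j)" if "j \<in> J" for j
    proof -
      have "?T y (?g j) \<in> A (?g j)" using y g(2)[OF that] by (auto simp: PiE_iff)
      then show ?thesis using g(2,3)[OF that] by simp
    qed
    then show "y \<in> Pi\<^sub>E J ?A" using y by (auto simp: space_PiM PiE_iff)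
  next
    fix y assume y: "y \<in> Pi\<^sub>E J ?A"
    have "y (f i) - c \<in> A i" if "i \<in> I" for i
    proof -
      have "f i \<in> J" using f that by (auto simp: bij_betw_def)
      then show ?thesis using y g(1)[OF that] by (auto simp: PiE_iff)
    qed
    then show "y \<in> ?T -` Pi\<^sub>E I A \<inter> space (Pi\<^sub>M J (\<lambda>_. lborel :: (real ^ 'n) measure))"
      using y by (auto simp: space_PiM PiE_iff)
  qed
  then have "emeasure (distr (Pi\<^sub>M J (\<lambda>_. lborel)) (Pi\<^sub>M I (\<lambda>_. borel)) ?T) (Pi\<^sub>E I A) = emeasure (Pi\<^sub>M J (\<lambda>_. lborel)) (Pi\<^sub>E J ?A)"
    using A T fin by (subst emeasure_distr) (auto intro!: sets_PiM_I_finite)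
  also have "\<dots> = (\<Prod>j\<in>J. emeasure lborel (?A j))"
    using Am fin by (intro lborel_product.emeasure_PiM) auto
  also have "\<dots> = (\<Prod>j\<in>J. emeasure lborel (A (?g j)))"
    using Ae by (intro prod.cong) auto
  also have "\<dots> = (\<Prod>i\<in>I. emeasure lborel (A i))"
    by (subst prod.reindex_bij_betw[OF f, symmetric]) (use g in \<open>auto intro!: prod.cong\<close>)
  finally show "emeasure (distr (Pi\<^sub>M J (\<lambda>_. lborel)) (Pi\<^sub>M I (\<lambda>_. borel)) ?T) (Pi\<^sub>E I A) = (\<Prod>i\<in>I. emeasure lborel (A i))" .
qed

lemma sets_PiM_lborel: "sets (Pi\<^sub>M I (\<lambda>_. lborel :: (real ^ 'n) measure)) = sets (Pi\<^sub>M I (\<lambda>_. borel))"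
  by (intro sets_PiM_cong) auto

lemma nn_integral_reindex_shift:
  fixes c :: "real ^ 'n"
  assumes f: "bij_betw f I J" and fin: "finite I" "finite J"
    and G: "G \<in> borel_measurable (Pi\<^sub>M I (\<lambda>_. borel))"
  shows "(\<integral>\<^sup>+y. G (\<lambda>i\<in>I. y (f i) - c) \<partial>Pi\<^sub>M J (\<lambda>_. lborel)) = (\<integral>\<^sup>+x. G x \<partial>Pi\<^sub>M I (\<lambda>_. lborel))"
proof -
  have T: "(\<lambda>y. \<lambda>i\<in>I. y (f i) - c) \<in> measurable (Pi\<^sub>M J (\<lambda>_. lborel)) (Pi\<^sub>M I (\<lambda>_. borel))"
  proof (rule measurable_restrict)
    fix i assume "i \<in> I"
    then have "f i \<in> J" using f by (auto simp: bij_betw_def)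
    then have [measurable]: "(\<lambda>y. y (f i)) \<in> borel_measurable (Pi\<^sub>M J (\<lambda>_. lborel))"
      using measurable_component_singleton[of "f i" J "\<lambda>_. lborel"] by simp
    show "(\<lambda>y. y (f i) - c) \<in> measurable (Pi\<^sub>M J (\<lambda>_. lborel)) borel" by measurable
  qed
  show ?thesis
    unfolding distr_PiM_reindex_shift[OF f fin, of c, symmetric]
    by (rule nn_integral_distr[OF T, symmetric]) (use G in simp)
qed

lemma shift_measurable:
  fixes c :: "real ^ 'n"
  assumes "\<And>i. i \<in> I \<Longrightarrow> f i \<in> J"
  shows "(\<lambda>y. \<lambda>i\<in>I. y (f i) - c) \<in> measurable (Pi\<^sub>M J (\<lambda>_. borel)) (Pi\<^sub>M I (\<lambda>_. borel))"
proof (rule measurable_restrict)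
  fix i assume "i \<in> I"
  then have [measurable]: "(\<lambda>y. y (f i)) \<in> borel_measurable (Pi\<^sub>M J (\<lambda>_. borel :: (real ^ 'n) measure))"
    using assms by (intro measurable_component_singleton)
  show "(\<lambda>y. y (f i) - c) \<in> measurable (Pi\<^sub>M J (\<lambda>_. borel)) borel" by measurable
qed

text \<open>Both halves are recentred, at b and at c, so the result no longer depends on the
  centres. It yields the square of the mean as the leading term of the correlation of two distant
  counts.\<close>

lemma nn_integral_product_split:
  fixes b c :: "real ^ 'n" and k :: nat
  assumes G: "G \<in> borel_measurable (Pi\<^sub>M {..<k} (\<lambda>_. borel))" and H: "H \<in> borel_measurable (Pi\<^sub>M {..<k} (\<lambda>_. borel))"
  shows "(\<integral>\<^sup>+x. G (\<lambda>i\<in>{..<k}. x i - b) * H (\<lambda>i\<in>{..<k}. x (i + k) - c) \<partial>Pi\<^sub>M {..<k + k} (\<lambda>_. lborel))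
    = (\<integral>\<^sup>+x. G x \<partial>Pi\<^sub>M {..<k} (\<lambda>_. lborel)) * (\<integral>\<^sup>+x. H x \<partial>Pi\<^sub>M {..<k} (\<lambda>_. lborel))"
proof -
  let ?I = "{..<k}" and ?J = "{k..<k + k}"
  have U: "{..<k + k} = ?I \<union> ?J" by auto
  have G1: "(\<lambda>x. G (\<lambda>i\<in>?I. x i - b)) \<in> borel_measurable (Pi\<^sub>M J (\<lambda>_. borel))" if "?I \<subseteq> J" for J
    by (rule measurable_compose[OF shift_measurable G]) (use that in auto)
  have H1: "(\<lambda>x. H (\<lambda>i\<in>?I. x (i + k) - c)) \<in> borel_measurable (Pi\<^sub>M J (\<lambda>_. borel))" if "?J \<subseteq> J" for J
    by (rule measurable_compose[OF shift_measurable H]) (use that in auto)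
  have mc: "f \<in> borel_measurable (Pi\<^sub>M J (\<lambda>_. lborel :: (real ^ 'n) measure)) \<longleftrightarrow> f \<in> borel_measurable (Pi\<^sub>M J (\<lambda>_. borel))"
    for f :: "_ \<Rightarrow> ennreal" and J :: "nat set"
    by (rule arg_cong[where f="\<lambda>S. f \<in> S"], rule measurable_cong_sets[OF sets_PiM_lborel refl])
  have m: "(\<lambda>x. G (\<lambda>i\<in>?I. x i - b) * H (\<lambda>i\<in>?I. x (i + k) - c)) \<in> borel_measurable (Pi\<^sub>M (?I \<union> ?J) (\<lambda>_. lborel))"
    unfolding mc by (intro borel_measurable_times_ennreal G1 H1) auto
  have "(\<integral>\<^sup>+x. G (\<lambda>i\<in>?I. x i - b) * H (\<lambda>i\<in>?I. x (i + k) - c) \<partial>Pi\<^sub>M {..<k + k} (\<lambda>_. lborel))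
    = (\<integral>\<^sup>+x. \<integral>\<^sup>+y. G (\<lambda>i\<in>?I. merge ?I ?J (x, y) i - b) * H (\<lambda>i\<in>?I. merge ?I ?J (x, y) (i + k) - c) \<partial>Pi\<^sub>M ?J (\<lambda>_. lborel) \<partial>Pi\<^sub>M ?I (\<lambda>_. lborel))"
    unfolding U by (rule lborel_product.product_nn_integral_fold[OF _ _ _ m]) auto
  also have "\<dots> = (\<integral>\<^sup>+x. \<integral>\<^sup>+y. G (\<lambda>i\<in>?I. x i - b) * H (\<lambda>i\<in>?I. y (i + k) - c) \<partial>Pi\<^sub>M ?J (\<lambda>_. lborel) \<partial>Pi\<^sub>M ?I (\<lambda>_. lborel))"
  proof (intro nn_integral_cong arg_cong2[where f="(*)"])
    fix x y
    show "G (\<lambda>i\<in>?I. merge ?I ?J (x, y) i - b) = G (\<lambda>i\<in>?I. x i - b)"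
      by (intro arg_cong[where f=G]) (auto simp: merge_def)
    show "H (\<lambda>i\<in>?I. merge ?I ?J (x, y) (i + k) - c) = H (\<lambda>i\<in>?I. y (i + k) - c)"
      by (intro arg_cong[where f=H]) (auto simp: merge_def)
  qed
  also have "\<dots> = (\<integral>\<^sup>+x. G (\<lambda>i\<in>?I. x i - b) * (\<integral>\<^sup>+y. H (\<lambda>i\<in>?I. y (i + k) - c) \<partial>Pi\<^sub>M ?J (\<lambda>_. lborel)) \<partial>Pi\<^sub>M ?I (\<lambda>_. lborel))"
    using H1[of ?J] by (intro nn_integral_cong nn_integral_cmult) (simp add: mc)
  also have "\<dots> = (\<integral>\<^sup>+x. G (\<lambda>i\<in>?I. x i - b) \<partial>Pi\<^sub>M ?I (\<lambda>_. lborel)) * (\<integral>\<^sup>+y. H (\<lambda>i\<in>?I. y (i + k) - c) \<partial>Pi\<^sub>M ?J (\<lambda>_. lborel))"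
    using G1[of ?I] by (intro nn_integral_multc) (simp add: mc)
  also have "(\<integral>\<^sup>+y. H (\<lambda>i\<in>?I. y (i + k) - c) \<partial>Pi\<^sub>M ?J (\<lambda>_. lborel)) = (\<integral>\<^sup>+x. H x \<partial>Pi\<^sub>M ?I (\<lambda>_. lborel))"
  proof (rule nn_integral_reindex_shift[OF _ _ _ H])
    show "bij_betw (\<lambda>i. i + k) ?I ?J"
      by (rule bij_betw_byWitness[where f'="\<lambda>i. i - k"]) auto
  qed auto
  also have "(\<integral>\<^sup>+x. G (\<lambda>i\<in>?I. x i - b) \<partial>Pi\<^sub>M ?I (\<lambda>_. lborel)) = (\<integral>\<^sup>+x. G x \<partial>Pi\<^sub>M ?I (\<lambda>_. lborel))"
    using nn_integral_reindex_shift[OF _ _ _ G, of "\<lambda>i. i" ?I b] by (simp add: bij_betw_def)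
  finally show ?thesis .
qed

section \<open>Permanents of block matrices\<close>

lemma norm_permanent_le:
  assumes "\<And>i j. i < k \<Longrightarrow> j < k \<Longrightarrow> cmod (A i j) \<le> 1"
  shows "cmod (permanent k A) \<le> fact k"
proof -
  have "cmod (permanent k A) \<le> (\<Sum>\<sigma> | \<sigma> permutes {..<k}. cmod (\<Prod>i<k. A i (\<sigma> i)))"
    unfolding permanent_def by (rule norm_sum)
  also have "\<dots> \<le> (\<Sum>\<sigma> | \<sigma> permutes {..<k}. 1)"
  proof (intro sum_mono)
    fix \<sigma> assume "\<sigma> \<in> {\<sigma>. \<sigma> permutes {..<k}}"
    then have "\<sigma> i < k" if "i < k" for i using permutes_in_image[of \<sigma> "{..<k}" i] that by simp
    then show "cmod (\<Prod>i<k. A i (\<sigma> i)) \<le> 1"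
      unfolding prod_norm[symmetric] using assms by (intro prod_le_1) auto
  qed
  also have "\<dots> = fact k" by (simp add: card_permutations)
  finally show ?thesis .
qed

text \<open>A permutation that preserves the first block also preserves the second, hence is glued
  from two permutations of \<open>{..<k}\<close>, the second one conjugated by the shift by
  k.\<close>

lemma permanent_block:
  "(\<Sum>\<sigma> | \<sigma> permutes {..<k + k} \<and> \<sigma> ` {..<k} = {..<k}. \<Prod>i<k + k. A i (\<sigma> i))
    = permanent k A * permanent k (\<lambda>i j. A (i + k) (j + k))"
proof -
  let ?S = "{\<sigma>. \<sigma> permutes {..<k + k} \<and> \<sigma> ` {..<k} = {..<k}}" and ?P = "{\<sigma>. \<sigma> permutes {..<k}}"
  let ?J = "\<lambda>(p, q) i. if i < k then p i else q (i - k) + (k :: nat)"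
  let ?L = "\<lambda>\<sigma> :: nat \<Rightarrow> nat. (\<lambda>i. if i < k then \<sigma> i else i, \<lambda>i. if i < k then \<sigma> (i + k) - k else i)"
  have lt: "p i < k \<longleftrightarrow> i < k" if "p permutes {..<k}" for p :: "nat \<Rightarrow> nat" and i
    using permutes_in_image[OF that, of i] by simp
  have split: "(\<Prod>i<k + k. g i) = (\<Prod>i<k. g i) * (\<Prod>i<k. g (i + k))" for g :: "nat \<Rightarrow> complex"
  proof -
    have "(\<Prod>i<k + k. g i) = (\<Prod>i\<in>{..<k} \<union> {0 + k..<k + k}. g i)"
      by (rule prod.cong) auto
    also have "\<dots> = (\<Prod>i<k. g i) * (\<Prod>i\<in>{0 + k..<k + k}. g i)"
      by (rule prod.union_disjoint) auto
    also have "(\<Prod>i\<in>{0 + k..<k + k}. g i) = (\<Prod>i\<in>{0..<k}. g (i + k))"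
      by (rule prod.shift_bounds_nat_ivl)
    finally show ?thesis by (simp add: lessThan_atLeast0)
  qed
  have "permanent k A * permanent k (\<lambda>i j. A (i + k) (j + k)) =
    (\<Sum>(p, q)\<in>?P \<times> ?P. (\<Prod>i<k. A i (p i)) * (\<Prod>i<k. A (i + k) (q i + k)))"
    unfolding permanent_def by (simp add: sum_product sum.cartesian_product)
  also have "\<dots> = (\<Sum>\<sigma>\<in>?S. \<Prod>i<k + k. A i (\<sigma> i))"
  proof (rule sum.reindex_bij_witness[where i="?L" and j="?J"])
    fix a assume "a \<in> ?P \<times> ?P"
    then obtain p q where a: "a = (p, q)" and p: "p permutes {..<k}" and q: "q permutes {..<k}" by auto
    have pf: "p i = i" if "\<not> i < k" for i using p that by (auto simp: permutes_def)
    have qf: "q i = i" if "\<not> i < k" for i using q that by (auto simp: permutes_def)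
    show "?L (?J a) = a"
      using lt[OF p] pf qf by (auto simp: a fun_eq_iff)
    show "?J a \<in> ?S"
    proof -
      have "bij_betw (?J a) {..<k + k} {..<k + k}"
      proof (rule bij_betw_byWitness[where f'="?J (inv p, inv q)"])
        have ip: "inv p permutes {..<k}" "inv q permutes {..<k}" using p q by (auto intro: permutes_inv)
        show "\<forall>x\<in>{..<k + k}. ?J (inv p, inv q) (?J a x) = x"
          using lt[OF p] permutes_inverses[OF p] permutes_inverses[OF q] by (auto simp: a)
        show "\<forall>x\<in>{..<k + k}. ?J a (?J (inv p, inv q) x) = x"
          using lt[OF ip(1)] permutes_inverses[OF p] permutes_inverses[OF q] by (auto simp: a)
        have J_bound: "?J (p', q') ` {..<k + k} \<subseteq> {..<k + k}" if "p' permutes {..<k}" "q' permutes {..<k}" for p' q'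
        proof (rule image_subsetI)
          fix x assume "x \<in> {..<k + k}"
          then show "?J (p', q') x \<in> {..<k + k}"
            using lt[OF that(1), of x] lt[OF that(2), of "x - k"] by (cases "x < k") auto
        qed
        show "?J a ` {..<k + k} \<subseteq> {..<k + k}" unfolding a by (rule J_bound[OF p q])
        show "?J (inv p, inv q) ` {..<k + k} \<subseteq> {..<k + k}" by (rule J_bound[OF ip])
      qed
      moreover have "?J a x = x" if "x \<notin> {..<k + k}" for x
        using that qf by (auto simp: a)
      ultimately have "?J a permutes {..<k + k}" by (rule bij_imp_permutes)
      moreover have "?J a ` {..<k} = p ` {..<k}" by (auto simp: a)
      ultimately show ?thesis using permutes_image[OF p] by simp
    qed
    show "(\<Prod>i<k + k. A i (?J a i)) = (case a of (p, q) \<Rightarrow> (\<Prod>i<k. A i (p i)) * (\<Prod>i<k. A (i + k) (q i + k)))"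
      unfolding split by (simp add: a)
  next
    fix \<sigma> assume "\<sigma> \<in> ?S"
    then have \<sigma>: "\<sigma> permutes {..<k + k}" and im: "\<sigma> ` {..<k} = {..<k}" by auto
    have sf: "\<sigma> i = i" if "\<not> i < k + k" for i using \<sigma> that by (auto simp: permutes_def)
    have inj: "\<sigma> i = \<sigma> j \<longleftrightarrow> i = j" for i j using permutes_inj[OF \<sigma>] by (auto simp: inj_eq)
    have l: "\<sigma> i < k \<longleftrightarrow> i < k" for i
    proof
      assume "\<sigma> i < k"
      then obtain j where "j < k" "\<sigma> i = \<sigma> j" using im by (metis imageE lessThan_iff)
      then show "i < k" using inj by simp
    qed (use im in auto)
    have l2: "\<sigma> i < k + k \<longleftrightarrow> i < k + k" for i using permutes_in_image[OF \<sigma>, of i] by simp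
    show "?J (?L \<sigma>) = \<sigma>"
    proof
      fix i
      have "\<not> \<sigma> i < k" if "\<not> i < k" using l that by simp
      then show "?J (?L \<sigma>) i = \<sigma> i" using sf[of i] by auto
    qed
    have "(\<lambda>i. if i < k then \<sigma> i else i) permutes {..<k}"
    proof (rule bij_imp_permutes)
      show "bij_betw (\<lambda>i. if i < k then \<sigma> i else i) {..<k} {..<k}"
        using im inj by (auto simp: bij_betw_def inj_on_def)
    qed auto
    moreover have "(\<lambda>i. if i < k then \<sigma> (i + k) - k else i) permutes {..<k}"
    proof (rule bij_imp_permutes)
      have ge: "k \<le> \<sigma> (i + k)" for i using l[of "i + k"] by simp
      have "inj_on (\<lambda>i. if i < k then \<sigma> (i + k) - k else i) {..<k}"
      proof (rule inj_onI)
        fix x y assume xy: "x \<in> {..<k}" "y \<in> {..<k}" "(if x < k then \<sigma> (x + k) - k else x) = (if y < k then \<sigma> (y + k) - k else y)"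
        then have "\<sigma> (x + k) = \<sigma> (y + k)" using ge[of x] ge[of y] by simp
        then show "x = y" using inj by simp
      qed
      moreover have "(\<lambda>i. if i < k then \<sigma> (i + k) - k else i) ` {..<k} \<subseteq> {..<k}"
      proof (rule image_subsetI)
        fix x assume "x \<in> {..<k}"
        then show "(if x < k then \<sigma> (x + k) - k else x) \<in> {..<k}" using l2[of "x + k"] ge[of x] by auto
      qed
      ultimately show "bij_betw (\<lambda>i. if i < k then \<sigma> (i + k) - k else i) {..<k} {..<k}"
        unfolding bij_betw_def using endo_inj_surj[OF finite_lessThan] by blast
    qed auto
    ultimately show "?L \<sigma> \<in> ?P \<times> ?P" by simp
  qed
  finally show ?thesis ..
qed

text \<open>Permutations preserving the blocks give the product of the two smaller permanents. Every
  other permutation picks at least one entry from the upper right block, of modulus at most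
  \<epsilon>, while its remaining entries have modulus at most 1.\<close>

lemma norm_permanent_block_le:
  assumes A: "\<And>i j. i < k + k \<Longrightarrow> j < k + k \<Longrightarrow> cmod (A i j) \<le> 1"
    and e: "\<And>i j. i < k \<Longrightarrow> j < k \<Longrightarrow> cmod (A i (j + k)) \<le> \<epsilon>" and "0 \<le> \<epsilon>"
  shows "cmod (permanent (k + k) A) \<le> cmod (permanent k A) * cmod (permanent k (\<lambda>i j. A (i + k) (j + k))) + fact (k + k) * \<epsilon>"
proof -
  let ?T = "{\<sigma>. \<sigma> permutes {..<k + k}}" and ?S = "{\<sigma>. \<sigma> permutes {..<k + k} \<and> \<sigma> ` {..<k} = {..<k}}"
  let ?f = "\<lambda>\<sigma>. \<Prod>i<k + k. A i (\<sigma> i)"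
  have fin: "finite ?T" by (simp add: finite_permutations)
  have "permanent (k + k) A = sum ?f ?S + sum ?f (?T - ?S)"
    unfolding permanent_def using fin by (subst sum.subset_diff[of ?S]) (auto simp: add.commute)
  then have "cmod (permanent (k + k) A) \<le> cmod (sum ?f ?S) + cmod (sum ?f (?T - ?S))"
    by (simp add: norm_triangle_ineq)
  also have "sum ?f ?S = permanent k A * permanent k (\<lambda>i j. A (i + k) (j + k))"
    by (rule permanent_block)
  also have "cmod (sum ?f (?T - ?S)) \<le> (\<Sum>\<sigma>\<in>?T - ?S. \<epsilon>)"
  proof (rule order_trans[OF norm_sum sum_mono])
    fix \<sigma> assume s: "\<sigma> \<in> ?T - ?S"
    then have \<sigma>: "\<sigma> permutes {..<k + k}" by simp
    have l2: "\<sigma> i < k + k" if "i < k + k" for i using permutes_in_image[OF \<sigma>, of i] that by simp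
    \<comment> \<open>If no index left the first block, injectivity on a finite set would make the
      image all of the first block.\<close>
    have "\<exists>i<k. k \<le> \<sigma> i"
    proof (rule ccontr)
      assume "\<not> ?thesis"
      then have "\<sigma> ` {..<k} \<subseteq> {..<k}" by (auto simp: not_le)
      moreover have "inj_on \<sigma> {..<k}" using permutes_inj[OF \<sigma>] by (rule inj_on_subset) simp
      ultimately have "\<sigma> ` {..<k} = {..<k}" by (intro endo_inj_surj) auto
      then show False using s by auto
    qed
    then obtain i where i: "i < k" "k \<le> \<sigma> i" by blast
    have "cmod (?f \<sigma>) = cmod (A i (\<sigma> i)) * (\<Prod>j\<in>{..<k + k} - {i}. cmod (A j (\<sigma> j)))"
      unfolding prod_norm[symmetric] using i by (intro prod.remove) auto
    also have "\<dots> \<le> \<epsilon> * 1"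
    proof (rule mult_mono)
      have "\<sigma> i = (\<sigma> i - k) + k" "\<sigma> i - k < k" using i l2[of i] by auto
      then show "cmod (A i (\<sigma> i)) \<le> \<epsilon>" using e[OF i(1), of "\<sigma> i - k"] by simp
      show "(\<Prod>j\<in>{..<k + k} - {i}. cmod (A j (\<sigma> j))) \<le> 1"
        using A l2 by (intro prod_le_1) auto
    qed (use \<open>0 \<le> \<epsilon>\<close> in \<open>auto intro: prod_nonneg\<close>)
    finally show "cmod (?f \<sigma>) \<le> \<epsilon>" by simp
  qed
  also have "(\<Sum>\<sigma>\<in>?T - ?S. \<epsilon>) \<le> (\<Sum>\<sigma>\<in>?T. \<epsilon>)"
    using fin \<open>0 \<le> \<epsilon>\<close> by (intro sum_mono2) auto
  also have "\<dots> = fact (k + k) * \<epsilon>" by (simp add: card_permutations)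
  finally show ?thesis by (simp add: norm_mult)
qed

text \<open>Concatenation of tuples is injective, and disjointness of \<open>A\<close> and
  \<open>A'\<close> keeps the indices of the two halves distinct.\<close>

lemma card_factorial_tuples_mult_le:
  fixes \<mu> :: "(real ^ 'n) measure"
  assumes \<mu>: "point_configuration \<mu>" and A: "A \<in> sets borel" "bounded A" "B \<subseteq> Pi\<^sub>E {..<k} (\<lambda>_. A)"
    and A': "A' \<in> sets borel" "bounded A'" "B' \<subseteq> Pi\<^sub>E {..<k} (\<lambda>_. A')" and disj: "A \<inter> A' = {}"
  shows "card (factorial_tuples k \<mu> B) * card (factorial_tuples k \<mu> B') \<le>
    card (factorial_tuples (k + k) \<mu> {x \<in> {..<k + k} \<rightarrow>\<^sub>E UNIV. (\<lambda>i\<in>{..<k}. x i) \<in> B \<and> (\<lambda>i\<in>{..<k}. x (i + k)) \<in> B'})"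
    (is "_ \<le> card ?R")
proof -
  let ?L = "factorial_tuples k \<mu> B" and ?L' = "factorial_tuples k \<mu> B'"
  let ?f = "\<lambda>(t, t'). \<lambda>i\<in>{..<k + k}. if i < k then t i else t' (i - k)"
  have inj: "inj_on ?f (?L \<times> ?L')"
  proof (rule inj_onI, clarify)
    fix t t' u u' assume m: "t \<in> ?L" "t' \<in> ?L'" "u \<in> ?L" "u' \<in> ?L'"
      and eq: "(\<lambda>i\<in>{..<k + k}. if i < k then t i else t' (i - k)) = (\<lambda>i\<in>{..<k + k}. if i < k then u i else u' (i - k))"
    have ext: "t \<in> extensional {..<k}" "t' \<in> extensional {..<k}" "u \<in> extensional {..<k}" "u' \<in> extensional {..<k}"
      using m by (auto simp: factorial_tuples_def PiE_iff)
    have "t i = u i" if "i < k" for i using fun_cong[OF eq, of i] that by simp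
    moreover have "t' i = u' i" if "i < k" for i using fun_cong[OF eq, of "i + k"] that by simp
    ultimately show "t = u \<and> t' = u'" using ext by (auto intro!: extensionalityI[where A="{..<k}"])
  qed
  have im: "?f ` (?L \<times> ?L') \<subseteq> ?R"
  proof (rule image_subsetI, clarify)
    fix t t' assume t: "t \<in> ?L" and t': "t' \<in> ?L'"
    have ta: "t \<in> {..<k} \<rightarrow>\<^sub>E points_in \<mu> A" using factorial_tuples_subset_PiE[OF A(3)] t by blast
    have ta': "t' \<in> {..<k} \<rightarrow>\<^sub>E points_in \<mu> A'" using factorial_tuples_subset_PiE[OF A'(3)] t' by blast
    have ne: "t i \<noteq> t' j" if "i < k" "j < k" for i j
      using PiE_mem[OF ta, of i] PiE_mem[OF ta', of j] that disj by (auto simp: points_in_def)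
    let ?t = "\<lambda>i\<in>{..<k + k}. if i < k then t i else t' (i - k)"
    have "?t \<in> {..<k + k} \<rightarrow>\<^sub>E configuration_points \<mu>"
      using ta ta' by (auto simp: PiE_iff points_in_def)
    moreover have "inj_on ?t {..<k + k}"
    proof (rule inj_onI)
      fix i j assume ij: "i \<in> {..<k + k}" "j \<in> {..<k + k}" "?t i = ?t j"
      have it: "inj_on t {..<k}" "inj_on t' {..<k}" using t t' by (auto simp: factorial_tuples_def)
      consider "i < k" "j < k" | "i < k" "\<not> j < k" | "\<not> i < k" "j < k" | "\<not> i < k" "\<not> j < k" by blast
      then show "i = j"
      proof cases
        case 1 then show ?thesis using ij it(1) by (auto simp: inj_on_def)
      next
        case 2 then show ?thesis using ij ne[of i "j - k"] by auto
      next
        case 3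
        then have "t' (i - k) = t j" "i - k < k" using ij by auto
        then show ?thesis using ne[of j "i - k"] 3 by simp
      next
        case 4
        then have "t' (i - k) = t' (j - k)" "i - k < k" "j - k < k" using ij by auto
        then have "i - k = j - k" using it(2) by (auto simp: inj_on_def)
        then show ?thesis using 4 by simp
      qed
    qed
    moreover have "(\<lambda>i\<in>{..<k}. (\<lambda>i\<in>{..<k + k}. fst (?t i)) i) = (\<lambda>i\<in>{..<k}. fst (t i))"
      by (auto simp: fun_eq_iff)
    moreover have "(\<lambda>i\<in>{..<k}. (\<lambda>i\<in>{..<k + k}. fst (?t i)) (i + k)) = (\<lambda>i\<in>{..<k}. fst (t' i))"
      by (auto simp: fun_eq_iff)
    moreover have "(\<lambda>i\<in>{..<k}. fst (t i)) \<in> B" "(\<lambda>i\<in>{..<k}. fst (t' i)) \<in> B'"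
      using t t' by (auto simp: factorial_tuples_def)
    moreover have "(\<lambda>i\<in>{..<k + k}. fst (?t i)) \<in> {..<k + k} \<rightarrow>\<^sub>E UNIV" by auto
    ultimately show "?t \<in> ?R"
      unfolding factorial_tuples_def mem_Collect_eq by (simp only: simp_thms)
  qed
  have fin: "finite ?R"
  proof (rule finite_factorial_tuples[OF \<mu>])
    show "A \<union> A' \<in> sets borel" "bounded (A \<union> A')" using A A' by auto
    show "{x \<in> {..<k + k} \<rightarrow>\<^sub>E UNIV. (\<lambda>i\<in>{..<k}. x i) \<in> B \<and> (\<lambda>i\<in>{..<k}. x (i + k)) \<in> B'} \<subseteq> Pi\<^sub>E {..<k + k} (\<lambda>_. A \<union> A')"
    proof
      fix x assume x: "x \<in> {x \<in> {..<k + k} \<rightarrow>\<^sub>E UNIV. (\<lambda>i\<in>{..<k}. x i) \<in> B \<and> (\<lambda>i\<in>{..<k}. x (i + k)) \<in> B'}"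
      have 1: "(\<lambda>i\<in>{..<k}. x i) \<in> Pi\<^sub>E {..<k} (\<lambda>_. A)" "(\<lambda>i\<in>{..<k}. x (i + k)) \<in> Pi\<^sub>E {..<k} (\<lambda>_. A')"
        using x A(3) A'(3) by blast+
      have "x i \<in> A \<union> A'" if "i < k + k" for i
      proof (cases "i < k")
        case True
        then show ?thesis using PiE_mem[OF 1(1), of i] by simp
      next
        case False
        then show ?thesis using PiE_mem[OF 1(2), of "i - k"] that by simp
      qed
      then show "x \<in> Pi\<^sub>E {..<k + k} (\<lambda>_. A \<union> A')" using x by (auto simp: PiE_iff)
    qed
  qed
  have "card ?L * card ?L' = card (?L \<times> ?L')" by (simp add: card_cartesian_product)
  also have "\<dots> \<le> card ?R" by (rule card_inj_on_le[OF inj im fin])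
  finally show ?thesis .
qed

section \<open>Factorial moments\<close>

text \<open>The binomial theorem expands (1 - s)^N into a sum that is finite at each sample point.
  The condition \<open>s * L < 1\<close> makes the expectations of the absolute terms a convergent
  geometric majorant, which permits termwise integration.\<close>

lemma expectation_power_eq_factorial_series:
  fixes N :: "'w \<Rightarrow> nat"
  assumes "prob_space M" and N: "N \<in> measurable M (count_space UNIV)"
    and b: "\<And>k. (\<integral>\<^sup>+ w. of_nat (N w choose k) \<partial>M) \<le> ennreal (L ^ k)"
    and s: "0 \<le> s" "s * L < 1" "0 \<le> L"
  shows "(\<integral>w. (1 - s) ^ N w \<partial>M) = (\<Sum>k. (- s) ^ k * enn2real (\<integral>\<^sup>+ w. of_nat (N w choose k) \<partial>M))"
proof -
  interpret prob_space M by fact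
  let ?f = "\<lambda>k w. (- s) ^ k * real (N w choose k)"
  have Nm [measurable]: "(\<lambda>w. real (N w choose k)) \<in> borel_measurable M" for k
    using measurable_compose[OF N, of "\<lambda>n. real (n choose k)" borel] by simp
  have en: "(\<integral>\<^sup>+ w. of_nat (N w choose k) \<partial>M) = (\<integral>\<^sup>+ w. ennreal (real (N w choose k)) \<partial>M)" for k
    by (simp add: ennreal_of_nat_eq_real_of_nat)
  have int: "integrable M (\<lambda>w. real (N w choose k))" for k
    using b[of k] unfolding en by (intro integrableI_nonneg) (auto intro: le_less_trans)
  have I: "(\<integral>w. real (N w choose k) \<partial>M) = enn2real (\<integral>\<^sup>+ w. of_nat (N w choose k) \<partial>M)" for k
    unfolding en by (rule integral_eq_nn_integral) auto
  have Ile: "(\<integral>w. real (N w choose k) \<partial>M) \<le> L ^ k" for k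
    unfolding I using b[of k] s(3) by (intro enn2real_leI) auto
  have fin: "finite {k. ?f k w \<noteq> 0}" for w
    by (rule finite_subset[of _ "{..N w}"]) (auto simp: not_le binomial_eq_0 intro: ccontr)
  have fe: "(\<Sum>k. ?f k w) = (1 - s) ^ N w" for w
  proof -
    have "(\<Sum>k. ?f k w) = (\<Sum>k\<le>N w. ?f k w)"
      by (rule suminf_finite) (auto simp: not_le binomial_eq_0)
    also have "\<dots> = (- s + 1) ^ N w"
      unfolding binomial_ring by (simp add: mult_ac)
    finally show ?thesis by simp
  qed
  have "(\<integral>w. (\<Sum>k. ?f k w) \<partial>M) = (\<Sum>k. \<integral>w. ?f k w \<partial>M)"
  proof (rule integral_suminf)
    show "integrable M (?f k)" for k using int by simp
    show "AE w in M. summable (\<lambda>k. norm (?f k w))"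
      using fin by (intro AE_I2 summable_finite[OF fin]) auto
    have "norm (\<integral>w. norm (?f k w) \<partial>M) \<le> (s * L) ^ k" for k
    proof -
      have "(\<integral>w. norm (?f k w) \<partial>M) = s ^ k * (\<integral>w. real (N w choose k) \<partial>M)"
        using s(1) by (simp add: abs_mult power_abs)
      also have "\<dots> \<le> s ^ k * L ^ k" using s Ile by (intro mult_left_mono) auto
      finally show ?thesis by (simp add: power_mult_distrib)
    qed
    then show "summable (\<lambda>k. \<integral>w. norm (?f k w) \<partial>M)"
      using s by (intro summable_comparison_test'[OF summable_geometric[of "s * L"]]) (auto simp: abs_mult)
  qed
  then show ?thesis unfolding fe by (simp add: I)
qed

text \<open>In contrast to the factorial expansion this one holds on all of [0, 1). Its coefficients
  are bounded by 1, so it defines a holomorphic function on the unit disc whose value at 0 is the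
  probability sought.\<close>

lemma expectation_power_eq_probability_series:
  fixes N :: "'w \<Rightarrow> nat"
  assumes "prob_space M" and N: "N \<in> measurable M (count_space UNIV)" and z: "0 \<le> z" "z < 1"
  shows "(\<integral>w. z ^ N w \<partial>M) = (\<Sum>n. z ^ n * measure M {w \<in> space M. N w = n})"
proof -
  interpret prob_space M by fact
  let ?f = "\<lambda>n w. z ^ n * indicator {w \<in> space M. N w = n} w"
  have Em: "{w \<in> space M. N w = n} \<in> sets M" for n
    using measurable_sets[OF N, of "{n}"] by (simp add: vimage_def Int_def conj_commute)
  have fe: "(\<Sum>n. ?f n w) = z ^ N w" if "w \<in> space M" for w
  proof -
    have "(\<Sum>n. ?f n w) = (\<Sum>n\<in>{N w}. ?f n w)" by (rule suminf_finite) auto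
    then show ?thesis using that by simp
  qed
  have "(\<integral>w. (\<Sum>n. ?f n w) \<partial>M) = (\<Sum>n. \<integral>w. ?f n w \<partial>M)"
  proof (rule integral_suminf)
    show "integrable M (?f n)" for n using Em by (simp add: emeasure_eq_measure)
    show "AE w in M. summable (\<lambda>n. norm (?f n w))"
    proof (rule AE_I2)
      fix w
      show "summable (\<lambda>n. norm (?f n w))" by (rule summable_finite[of "{N w}"]) auto
    qed
    show "summable (\<lambda>n. \<integral>w. norm (?f n w) \<partial>M)"
    proof (rule summable_comparison_test'[OF summable_geometric[of z]])
      show "norm (\<integral>w. norm (?f n w) \<partial>M) \<le> z ^ n" for n
        using z Em by (simp add: abs_mult mult_left_le)
    qed (use z in simp)
  qed
  moreover have "(\<integral>w. (\<Sum>n. ?f n w) \<partial>M) = (\<integral>w. z ^ N w \<partial>M)"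
    using fe by (intro Bochner_Integration.integral_cong) auto
  ultimately show ?thesis using Em by simp
qed

text \<open>Near \<open>z = 1\<close> the probability generating function is given by the factorial moments; the
  identity theorem on the unit disc transports this information to \<open>z = 0\<close>.\<close>

lemma zero_probability_from_factorial_moments:
  fixes N N' :: "'w \<Rightarrow> nat"
  assumes M: "prob_space M" and N: "N \<in> measurable M (count_space UNIV)" "N' \<in> measurable M (count_space UNIV)"
    and b: "\<And>k. (\<integral>\<^sup>+ w. of_nat (N w choose k) \<partial>M) \<le> ennreal (L ^ k)" and L: "0 \<le> L"
    and eq: "\<And>k. (\<integral>\<^sup>+ w. of_nat (N w choose k) \<partial>M) = (\<integral>\<^sup>+ w. of_nat (N' w choose k) \<partial>M)"
  shows "measure M {w \<in> space M. N w = 0} = measure M {w \<in> space M. N' w = 0}"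
proof -
  interpret prob_space M by (rule M)
  \<comment> \<open>The function f below is the difference of the two generating functions;
    \<open>f 0\<close> is the difference of the two zero probabilities.\<close>
  define D where "D n = measure M {w \<in> space M. N w = n} - measure M {w \<in> space M. N' w = n}" for n
  define f where "f z = (\<Sum>n. complex_of_real (D n) * z ^ n)" for z
  \<comment> \<open>For 0 \<le> s < \<delta> this gives s (L + 1) < 1, hence s L < 1; the summand 1
    also covers L = 0 and keeps 1 - s nonnegative.\<close>
  define \<delta> where "\<delta> = 1 / (L + 1)"
  have \<delta>: "0 < \<delta>" "\<delta> \<le> 1" "\<And>s. 0 \<le> s \<Longrightarrow> s < \<delta> \<Longrightarrow> s * L < 1"
  proof -
    show "0 < \<delta>" "\<delta> \<le> 1" unfolding \<delta>_def using L by auto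
    fix s assume "0 \<le> s" "s < \<delta>"
    then have "s * (L + 1) < 1" unfolding \<delta>_def using L by (simp add: field_simps)
    then show "s * L < 1" using \<open>0 \<le> s\<close> by (simp add: distrib_left)
  qed
  have Dn: "\<bar>D n\<bar> \<le> 1" for n
    unfolding D_def using prob_le_1[of "{w \<in> space M. N w = n}"] prob_le_1[of "{w \<in> space M. N' w = n}"]
      measure_nonneg[of M "{w \<in> space M. N w = n}"] measure_nonneg[of M "{w \<in> space M. N' w = n}"] by linarith
  have sm: "summable (\<lambda>n. complex_of_real (D n) * z ^ n)" if "cmod z < 1" for z
  proof (rule summable_comparison_test'[OF summable_geometric[of "cmod z"]])
    show "norm (complex_of_real (D n) * z ^ n) \<le> cmod z ^ n" for n
      using Dn[of n] by (simp add: norm_mult norm_power mult_left_le_one_le)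
  qed (use that in simp)
  have hol: "f holomorphic_on ball 0 1"
    by (rule power_series_holomorphic[where a="\<lambda>n. complex_of_real (D n)"])
      (use summable_sums[OF sm] in \<open>simp add: f_def\<close>)
  have zero: "f (complex_of_real (1 - s)) = 0" if s: "0 < s" "s < \<delta>" for s
  proof -
    let ?z = "1 - s"
    have z: "0 \<le> ?z" "?z < 1" using s \<delta> by auto
    have "(\<integral>w. ?z ^ N w \<partial>M) = (\<integral>w. ?z ^ N' w \<partial>M)"
      using expectation_power_eq_factorial_series[OF M N(1) b, of s] expectation_power_eq_factorial_series[OF M N(2), of L s]
        b s \<delta>(3)[of s] L by (simp add: eq)
    then have e: "(\<Sum>n. ?z ^ n * measure M {w \<in> space M. N w = n}) = (\<Sum>n. ?z ^ n * measure M {w \<in> space M. N' w = n})"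
      using expectation_power_eq_probability_series[OF M N(1) z] expectation_power_eq_probability_series[OF M N(2) z] by simp
    have su: "summable (\<lambda>n. ?z ^ n * measure M {w \<in> space M. N w = n})" for N :: "'w \<Rightarrow> nat"
    proof (rule summable_comparison_test'[OF summable_geometric[of ?z]])
      show "norm (?z ^ n * measure M {w \<in> space M. N w = n}) \<le> ?z ^ n" for n
        using z by (simp add: abs_mult mult_left_le)
    qed (use z in simp)
    have "(\<Sum>n. D n * ?z ^ n) = 0"
      using suminf_diff[OF su[of N] su[of N']] e by (simp add: D_def algebra_simps)
    moreover have "f (complex_of_real ?z) = complex_of_real (\<Sum>n. D n * ?z ^ n)"
    proof -
      have "summable (\<lambda>n. D n * ?z ^ n)"
        using summable_diff[OF su[of N] su[of N']] by (simp add: D_def algebra_simps)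
      then show ?thesis unfolding f_def by (subst suminf_of_real) (auto simp: of_real_mult of_real_power)
    qed
    ultimately show ?thesis by simp
  qed
  have "f 0 = 0"
  proof (rule analytic_continuation[OF hol])
    \<comment> \<open>The zeros known so far fill a real interval ending at 1, which is on the
      boundary of the disc. Its midpoint lies inside and is a limit point, as the identity theorem
      requires.\<close>
    let ?U = "complex_of_real ` {1 - \<delta><..<1}"
    show "?U \<subseteq> ball 0 1" using \<delta> by auto
    show "complex_of_real (1 - \<delta> / 2) \<in> ball 0 1"
      unfolding mem_ball dist_0_norm norm_of_real using \<delta>(1,2) by auto
    show "complex_of_real (1 - \<delta> / 2) islimpt ?U"
    proof (rule islimptI)
      fix T assume T: "complex_of_real (1 - \<delta> / 2) \<in> T" "open T"
      then obtain e where e: "0 < e" "ball (complex_of_real (1 - \<delta> / 2)) e \<subseteq> T"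
        using open_contains_ball by blast
      define h where "h = min (e / 2) (\<delta> / 4)"
      have h: "0 < h" "h < e" "h < \<delta> / 2" unfolding h_def using e(1) \<delta>(1) by auto
      let ?y = "complex_of_real (1 - \<delta> / 2 + h)"
      have "?y - complex_of_real (1 - \<delta> / 2) = complex_of_real h" by simp
      then have "dist (complex_of_real (1 - \<delta> / 2)) ?y = h"
        using h(1) by (metis abs_of_pos dist_commute dist_norm norm_of_real)
      then have "?y \<in> T" using e(2) h by auto
      moreover have "?y \<in> ?U" using h \<delta> by (intro imageI) auto
      moreover have "?y \<noteq> complex_of_real (1 - \<delta> / 2)" using h by (simp only: of_real_eq_iff)
      ultimately show "\<exists>y\<in>?U. y \<in> T \<and> y \<noteq> complex_of_real (1 - \<delta> / 2)" by blast
    qed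
    show "f z = 0" if z: "z \<in> ?U" for z
    proof -
      obtain x where "x \<in> {1 - \<delta><..<1}" "z = complex_of_real x" using z by blast
      then show ?thesis using zero[of "1 - x"] by simp
    qed
  qed auto
  moreover have "f 0 = complex_of_real (D 0)"
    unfolding f_def using powser_zero[of "\<lambda>n. complex_of_real (D n)"] by simp
  ultimately show ?thesis by (simp add: D_def)
qed

text \<open>Ordered pairs of indices with the diagonal included, as counted by the convolution of a
  configuration with its reflection.\<close>

definition pairs_in :: "(real ^ 'n) measure \<Rightarrow> ((real ^ 'n) \<times> (real ^ 'n)) set \<Rightarrow> (((real ^ 'n) \<times> nat) \<times> ((real ^ 'n) \<times> nat)) set" where
  "pairs_in \<mu> E = {(p, q). p \<in> configuration_points \<mu> \<and> q \<in> configuration_points \<mu> \<and> (fst p, fst q) \<in> E}"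

lemma pairs_in_times: "pairs_in \<mu> (A \<times> B) = points_in \<mu> A \<times> points_in \<mu> B"
  by (auto simp: pairs_in_def points_in_def)

lemma finite_pairs_in:
  assumes "point_configuration (\<mu> :: (real ^ 'n) measure)" "A \<in> sets borel" "bounded A" "E \<subseteq> A \<times> A"
  shows "finite (pairs_in \<mu> E)"
proof (rule finite_subset)
  show "pairs_in \<mu> E \<subseteq> points_in \<mu> A \<times> points_in \<mu> A"
    using assms(4) by (auto simp: pairs_in_def points_in_def)
qed (use finite_points_in[OF assms(1-3)] in auto)

lemma card_points_in_measurable:
  fixes A :: "(real ^ 'n) set"
  assumes "A \<in> sets borel" "bounded A"
  shows "(\<lambda>\<mu>. real (card (points_in \<mu> A))) \<in> borel_measurable configuration_space"
proof -
  have "(\<lambda>\<mu>. enn2real (emeasure \<mu> A)) \<in> borel_measurable configuration_space"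
    using assms by measurable
  then show ?thesis
    by (rule measurable_cong[THEN iffD1, rotated])
      (use assms in \<open>auto simp: space_configuration_space emeasure_eq_card_points_in\<close>)
qed

text \<open>Dynkin induction from rectangles, where the count is a product of two point counts. The
  bounded window R keeps all counts finite, so that complements become differences of real
  numbers.\<close>

lemma card_pairs_in_measurable:
  fixes R :: "(real ^ 'n) set"
  assumes R: "R \<in> sets borel" "bounded R" and E: "E \<in> sets (borel \<Otimes>\<^sub>M borel)"
  shows "(\<lambda>\<mu>. real (card (pairs_in \<mu> (E \<inter> R \<times> R)))) \<in> borel_measurable configuration_space"
proof -
  let ?G = "{a \<times> b | a b. a \<in> sets (borel :: (real ^ 'n) measure) \<and> b \<in> sets (borel :: (real ^ 'n) measure)}"
  let ?C = "configuration_space :: (real ^ 'n) measure measure"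
  have pc: "point_configuration \<mu>" if "\<mu> \<in> space ?C" for \<mu> using that by (simp add: space_configuration_space)
  have fin: "finite (pairs_in \<mu> (E \<inter> R \<times> R))" if "\<mu> \<in> space ?C" for \<mu> E
    by (rule finite_pairs_in[OF pc[OF that] R]) auto
  have st: "Int_stable ?G"
  proof (rule Int_stableI)
    fix X Y assume "X \<in> ?G" "Y \<in> ?G"
    then obtain a b a' b' where "X = a \<times> b" "Y = a' \<times> b'" "a \<in> sets borel" "b \<in> sets borel" "a' \<in> sets borel" "b' \<in> sets borel" by blast
    then show "X \<inter> Y \<in> ?G"
      by (intro CollectI exI[of _ "a \<inter> a'"] exI[of _ "b \<inter> b'"]) auto
  qed
  have sub: "?G \<subseteq> Pow UNIV" by auto
  have E': "E \<in> sigma_sets UNIV ?G" using E by (simp add: sets_pair_measure)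
  show ?thesis
    using st sub E'
  proof (induction rule: sigma_sets_induct_disjoint)
    case (basic E)
    then obtain a b where ab: "E = a \<times> b" "a \<in> sets borel" "b \<in> sets borel" by blast
    have m: "(\<lambda>\<mu>. real (card (points_in \<mu> (a \<inter> R)))) \<in> borel_measurable ?C"
      "(\<lambda>\<mu>. real (card (points_in \<mu> (b \<inter> R)))) \<in> borel_measurable ?C"
      using ab R by (auto intro!: card_points_in_measurable intro: bounded_subset)
    have "E \<inter> R \<times> R = (a \<inter> R) \<times> (b \<inter> R)" using ab(1) by auto
    then show ?case
      using borel_measurable_times[OF m] by (simp only: pairs_in_times card_cartesian_product of_nat_mult)
  next
    case empty
    show ?case by (simp add: pairs_in_def)
  next
    case (compl E)
    have tot: "(\<lambda>\<mu>. real (card (pairs_in \<mu> (R \<times> R)))) \<in> borel_measurable ?C"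
      using borel_measurable_times[OF card_points_in_measurable[OF R] card_points_in_measurable[OF R]]
      by (simp only: pairs_in_times card_cartesian_product of_nat_mult)
    have "(\<lambda>\<mu>. real (card (pairs_in \<mu> (R \<times> R))) - real (card (pairs_in \<mu> (E \<inter> R \<times> R)))) \<in> borel_measurable ?C"
      by (rule borel_measurable_diff[OF tot compl(2)])
    moreover have "real (card (pairs_in \<mu> (R \<times> R))) - real (card (pairs_in \<mu> (E \<inter> R \<times> R)))
       = real (card (pairs_in \<mu> ((UNIV - E) \<inter> R \<times> R)))" if "\<mu> \<in> space ?C" for \<mu>
    proof -
      have "pairs_in \<mu> (R \<times> R) = pairs_in \<mu> (E \<inter> R \<times> R) \<union> pairs_in \<mu> ((UNIV - E) \<inter> R \<times> R)"
        by (auto simp: pairs_in_def)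
      moreover have "pairs_in \<mu> (E \<inter> R \<times> R) \<inter> pairs_in \<mu> ((UNIV - E) \<inter> R \<times> R) = {}"
        by (auto simp: pairs_in_def)
      ultimately have "card (pairs_in \<mu> (R \<times> R)) = card (pairs_in \<mu> (E \<inter> R \<times> R)) + card (pairs_in \<mu> ((UNIV - E) \<inter> R \<times> R))"
        using card_Un_disjoint[OF fin[OF that] fin[OF that]] by simp
      then show ?thesis by simp
    qed
    ultimately show ?case by (rule measurable_cong[THEN iffD1, rotated]) simp
  next
    case (union A)
    have eq: "real (card (pairs_in \<mu> ((\<Union>i. A i) \<inter> R \<times> R))) = (\<Sum>i. real (card (pairs_in \<mu> (A i \<inter> R \<times> R))))" if \<mu>: "\<mu> \<in> space ?C" for \<mu>
    proof -
      let ?P = "\<lambda>i. pairs_in \<mu> (A i \<inter> R \<times> R)"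
      have U: "pairs_in \<mu> ((\<Union>i. A i) \<inter> R \<times> R) = (\<Union>i. ?P i)" by (auto simp: pairs_in_def)
      have dj: "disjoint_family ?P"
        using union(1) unfolding disjoint_family_on_def by (fastforce simp: pairs_in_def)
      have "(\<lambda>i. measure (count_space UNIV) (?P i)) sums measure (count_space UNIV) (\<Union>i. ?P i)"
        using fin[OF \<mu>, of "\<Union>i. A i"] unfolding U
        by (intro measure_UNION[OF _ dj]) (auto simp: emeasure_count_space)
      moreover have "measure (count_space UNIV) S = real (card S)" if "finite S" for S :: "(((real ^ 'n) \<times> nat) \<times> ((real ^ 'n) \<times> nat)) set"
        using that by (simp add: measure_def)
      ultimately show ?thesis
        unfolding U[symmetric] using fin[OF \<mu>] by (simp add: sums_unique)
    qed
    have "(\<lambda>\<mu>. \<Sum>i. real (card (pairs_in \<mu> (A i \<inter> R \<times> R)))) \<in> borel_measurable ?C"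
      using union(3) by (rule borel_measurable_suminf)
    then show ?case by (rule measurable_cong[THEN iffD1, rotated]) (simp add: eq)
  qed
qed

lemma card_factorial_tuples_1:
  "card (factorial_tuples 1 \<mu> {x \<in> {..<1} \<rightarrow>\<^sub>E UNIV. x 0 \<in> A}) = card (points_in \<mu> A)"
proof -
  have "bij_betw (\<lambda>t. t 0) (factorial_tuples 1 \<mu> {x \<in> {..<1} \<rightarrow>\<^sub>E UNIV. x 0 \<in> A}) (points_in \<mu> A)"
  proof (rule bij_betw_byWitness[where f'="\<lambda>p. \<lambda>i\<in>{..<1}. p"])
    show "\<forall>t\<in>factorial_tuples 1 \<mu> {x \<in> {..<1} \<rightarrow>\<^sub>E UNIV. x 0 \<in> A}. (\<lambda>i\<in>{..<1}. t 0) = t"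
      by (auto simp: factorial_tuples_def fun_eq_iff PiE_iff extensional_def)
  qed (auto simp: factorial_tuples_def points_in_def PiE_iff inj_on_def)
  then show ?thesis by (rule bij_betw_same_card)
qed

text \<open>Splits off the pairs of an index with itself. These are responsible for the atom at 0 in
  the autocorrelation, the remaining pairs for the absolutely continuous part.\<close>

lemma card_factorial_tuples_2:
  assumes \<mu>: "point_configuration (\<mu> :: (real ^ 'n) measure)" and R: "R \<in> sets borel" "bounded R" "E \<subseteq> R \<times> R"
  shows "card (pairs_in \<mu> E) = card (factorial_tuples 2 \<mu> {x \<in> {..<2} \<rightarrow>\<^sub>E UNIV. (x 0, x 1) \<in> E}) + card (points_in \<mu> {x. (x, x) \<in> E})"
proof -
  have fin: "finite (pairs_in \<mu> E)" by (rule finite_pairs_in[OF \<mu> R])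
  have "pairs_in \<mu> E = {(p, q) \<in> pairs_in \<mu> E. p \<noteq> q} \<union> {(p, q) \<in> pairs_in \<mu> E. p = q}" by auto
  then have "card (pairs_in \<mu> E) = card ({(p, q) \<in> pairs_in \<mu> E. p \<noteq> q} \<union> {(p, q) \<in> pairs_in \<mu> E. p = q})" by simp
  also have "\<dots> = card {(p, q) \<in> pairs_in \<mu> E. p \<noteq> q} + card {(p, q) \<in> pairs_in \<mu> E. p = q}"
    by (rule card_Un_disjoint) (auto intro: finite_subset[OF _ fin])
  also have "card {(p, q) \<in> pairs_in \<mu> E. p = q} = card (points_in \<mu> {x. (x, x) \<in> E})"
  proof -
    have "bij_betw fst {(p, q) \<in> pairs_in \<mu> E. p = q} (points_in \<mu> {x. (x, x) \<in> E})"
      by (rule bij_betw_byWitness[where f'="\<lambda>p. (p, p)"]) (auto simp: pairs_in_def points_in_def)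
    then show ?thesis by (rule bij_betw_same_card)
  qed
  also have "card {(p, q) \<in> pairs_in \<mu> E. p \<noteq> q} = card (factorial_tuples 2 \<mu> {x \<in> {..<2} \<rightarrow>\<^sub>E UNIV. (x 0, x 1) \<in> E})"
  proof -
    have two: "i < 2 \<longleftrightarrow> i = 0 \<or> i = 1" for i :: nat by auto
    have "bij_betw (\<lambda>(p, q). \<lambda>i\<in>{..<2}. if i = 0 then p else q) {(p, q) \<in> pairs_in \<mu> E. p \<noteq> q}
      (factorial_tuples 2 \<mu> {x \<in> {..<2} \<rightarrow>\<^sub>E UNIV. (x 0, x 1) \<in> E})"
    proof (rule bij_betw_byWitness[where f'="\<lambda>t. (t 0, t 1)"])
      show "\<forall>t\<in>factorial_tuples 2 \<mu> {x \<in> {..<2} \<rightarrow>\<^sub>E UNIV. (x 0, x 1) \<in> E}.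
        (case (t 0, t 1) of (p, q) \<Rightarrow> \<lambda>i\<in>{..<2}. if i = 0 then p else q) = t"
        by (auto simp: factorial_tuples_def fun_eq_iff PiE_iff extensional_def two)
      show "(\<lambda>(p, q). \<lambda>i\<in>{..<2}. if i = 0 then p else q) ` {(p, q) \<in> pairs_in \<mu> E. p \<noteq> q}
        \<subseteq> factorial_tuples 2 \<mu> {x \<in> {..<2} \<rightarrow>\<^sub>E UNIV. (x 0, x 1) \<in> E}"
        by (auto simp: factorial_tuples_def pairs_in_def PiE_iff inj_on_def two split: if_splits)
      show "(\<lambda>t. (t 0, t 1)) ` factorial_tuples 2 \<mu> {x \<in> {..<2} \<rightarrow>\<^sub>E UNIV. (x 0, x 1) \<in> E} \<subseteq> {(p, q) \<in> pairs_in \<mu> E. p \<noteq> q}"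
      proof (rule image_subsetI)
        fix t assume t: "t \<in> factorial_tuples 2 \<mu> {x \<in> {..<2} \<rightarrow>\<^sub>E UNIV. (x 0, x 1) \<in> E}"
        then have "inj_on t {..<2}" by (simp add: factorial_tuples_def)
        from inj_onD[OF this, of 0 1] have "t 0 \<noteq> t 1" by auto
        then show "(t 0, t 1) \<in> {(p, q) \<in> pairs_in \<mu> E. p \<noteq> q}"
          using t by (auto simp: factorial_tuples_def pairs_in_def PiE_iff)
      qed
    qed auto
    then show ?thesis by (simp add: bij_betw_same_card)
  qed
  finally show ?thesis .
qed

lemma card_factorial_tuples_2_measurable:
  fixes R :: "(real ^ 'n) set"
  assumes R: "R \<in> sets borel" "bounded R" and E: "E \<in> sets (borel \<Otimes>\<^sub>M borel)" "E \<subseteq> R \<times> R"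
  shows "(\<lambda>\<mu>. real (card (factorial_tuples 2 \<mu> {x \<in> {..<2} \<rightarrow>\<^sub>E UNIV. (x 0, x 1) \<in> E}))) \<in> borel_measurable configuration_space"
proof -
  have "(\<lambda>x. (x, x)) -` E \<inter> space (borel :: (real ^ 'n) measure) \<in> sets borel"
    by (rule measurable_sets[OF _ E(1)]) measurable
  then have D: "{x. (x, x) \<in> E} \<in> sets (borel :: (real ^ 'n) measure)" by (simp add: vimage_def)
  have Db: "bounded {x. (x, x) \<in> E}" using E(2) by (intro bounded_subset[OF R(2)]) auto
  have "E \<inter> R \<times> R = E" using E(2) by auto
  then have m: "(\<lambda>\<mu>. real (card (pairs_in \<mu> E))) \<in> borel_measurable configuration_space"
    using card_pairs_in_measurable[OF R E(1)] by simp
  have "(\<lambda>\<mu>. real (card (pairs_in \<mu> E)) - real (card (points_in \<mu> {x. (x, x) \<in> E}))) \<in> borel_measurable configuration_space"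
    by (rule borel_measurable_diff[OF m card_points_in_measurable[OF D Db]])
  then show ?thesis
    by (rule measurable_cong[THEN iffD1, rotated])
      (auto simp: space_configuration_space card_factorial_tuples_2[OF _ R E(2)])
qed

section \<open>Void probabilities\<close>

lemma nn_integral_PiM_2:
  assumes f: "case_prod f \<in> borel_measurable (borel \<Otimes>\<^sub>M borel)"
  shows "(\<integral>\<^sup>+x. f (x 0) (x 1) \<partial>Pi\<^sub>M {..<2 :: nat} (\<lambda>_. lborel :: (real ^ 'n) measure)) = (\<integral>\<^sup>+a. \<integral>\<^sup>+b. f a b \<partial>lborel \<partial>lborel)"
proof -
  have two: "{..<2 :: nat} = {0, 1}" by auto
  have "sets (lborel \<Otimes>\<^sub>M lborel :: ((real ^ 'n) \<times> (real ^ 'n)) measure) = sets (borel \<Otimes>\<^sub>M borel)"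
    by (intro sets_pair_measure_cong) auto
  then have m: "case_prod f \<in> borel_measurable (lborel \<Otimes>\<^sub>M lborel)"
    using f measurable_cong_sets[of "lborel \<Otimes>\<^sub>M lborel" "borel \<Otimes>\<^sub>M borel" borel borel] by blast
  have "(\<integral>\<^sup>+x. f (x 0) (x 1) \<partial>Pi\<^sub>M {..<2 :: nat} (\<lambda>_. lborel :: (real ^ 'n) measure)) = (\<integral>\<^sup>+z. f (fst z) (snd z) \<partial>(lborel \<Otimes>\<^sub>M lborel))"
    unfolding two by (rule lborel_product.product_nn_integral_pair[OF m]) simp
  also have "\<dots> = (\<integral>\<^sup>+z. case_prod f z \<partial>(lborel \<Otimes>\<^sub>M lborel))"
    by (simp only: case_prod_beta)
  also have "\<dots> = (\<integral>\<^sup>+a. \<integral>\<^sup>+b. case_prod f (a, b) \<partial>lborel \<partial>lborel)"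
    by (rule lborel.nn_integral_fst[OF m, symmetric])
  finally show ?thesis by simp
qed

lemma measurable_pair_components:
  "(\<lambda>x. (x 0, x 1)) \<in> measurable (Pi\<^sub>M {..<2 :: nat} (\<lambda>_. borel :: (real ^ 'n) measure)) (borel \<Otimes>\<^sub>M borel)"
proof -
  have "(\<lambda>x. x i) \<in> measurable (Pi\<^sub>M {..<2 :: nat} (\<lambda>_. borel :: (real ^ 'n) measure)) borel" if "i < 2" for i
    using that by (intro measurable_component_singleton) auto
  from this[of 0] this[of 1] show ?thesis by (intro measurable_Pair) auto
qed

lemma pair_event_sets:
  assumes "E \<in> sets (borel \<Otimes>\<^sub>M borel)"
  shows "{x \<in> {..<2 :: nat} \<rightarrow>\<^sub>E (UNIV :: (real ^ 'n) set). (x 0, x 1) \<in> E} \<in> sets (Pi\<^sub>M {..<2} (\<lambda>_. borel))"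
  using measurable_sets[OF measurable_pair_components assms] by (simp add: space_PiM vimage_def Int_def conj_commute)

definition simple_configuration :: "(real ^ 'n) measure \<Rightarrow> bool" where
  "simple_configuration \<mu> \<longleftrightarrow> inj_on fst (configuration_points \<mu>)"

text \<open>The number of cells of the dyadic grid of mesh \<open>2\<^sup>-\<^sup>n\<close> in which \<open>A\<close> carries a point depends only on
  void events, and for a simple configuration it converges to the number of points in \<open>A\<close>.\<close>

definition dyadic_cell :: "nat \<Rightarrow> real ^ 'n \<Rightarrow> (real ^ 'n) set" where
  "dyadic_cell n z = {x. floor_vec ((2 ^ n) *\<^sub>R x) = z}"

lemma floor_vec_measurable [measurable]: "floor_vec \<in> borel_measurable (borel :: (real ^ 'n) measure)"
proof -
  have "(\<lambda>x :: real ^ 'n. floor_vec x \<bullet> b) \<in> borel_measurable borel" if b: "b \<in> Basis" for b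
  proof -
    obtain j where "b = axis j 1" using b unfolding Basis_cart_eq by blast
    then show ?thesis by (simp add: floor_vec_def inner_axis)
  qed
  then show ?thesis by (intro borel_measurable_euclidean_space[THEN iffD2]) auto
qed

lemma dyadic_cell_measurable [measurable]: "dyadic_cell n z \<in> sets borel"
proof -
  have "(\<lambda>x. floor_vec ((2 ^ n) *\<^sub>R x)) -` {z} \<inter> space borel \<in> sets borel"
    by (rule measurable_sets[where A=borel]) measurable
  then show ?thesis by (simp add: dyadic_cell_def vimage_def)
qed

text \<open>Rounding moves a point by at most d, so the index set contains every cell of mesh 2^(-n)
  that meets \<open>ball 0 r\<close>. Only finitely many void events enter.\<close>

definition occupied_cells :: "nat \<Rightarrow> real \<Rightarrow> (real ^ 'n) set \<Rightarrow> (real ^ 'n) measure \<Rightarrow> ennreal" where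
  "occupied_cells n r A \<mu> = (\<Sum>z\<in>lattice_ball (2 ^ n * r + real CARD('n)).
      indicator {\<mu>. emeasure \<mu> (A \<inter> ball 0 r \<inter> dyadic_cell n z) \<noteq> 0} \<mu>)"

lemma occupied_cells_eq:
  fixes A :: "(real ^ 'n) set"
  assumes \<mu>: "point_configuration \<mu>" and A: "A \<in> sets borel"
  shows "occupied_cells n r A \<mu> = of_nat (card ((\<lambda>p. floor_vec ((2 ^ n) *\<^sub>R fst p)) ` points_in \<mu> (A \<inter> ball 0 r)))"
proof -
  let ?q = "\<lambda>p :: (real ^ 'n) \<times> nat. floor_vec ((2 ^ n) *\<^sub>R fst p)" and ?B = "lattice_ball (2 ^ n * r + real CARD('n)) :: (real ^ 'n) set"
  have bA: "A \<inter> ball 0 r \<in> sets borel" "bounded (A \<inter> ball 0 r)" using A by auto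
  have nz: "emeasure \<mu> (A \<inter> ball 0 r \<inter> dyadic_cell n z) \<noteq> 0 \<longleftrightarrow> z \<in> ?q ` points_in \<mu> (A \<inter> ball 0 r)" for z
  proof -
    have b: "A \<inter> ball 0 r \<inter> dyadic_cell n z \<in> sets borel" "bounded (A \<inter> ball 0 r \<inter> dyadic_cell n z)"
      using bA by (auto intro: bounded_subset)
    have "emeasure \<mu> (A \<inter> ball 0 r \<inter> dyadic_cell n z) \<noteq> 0 \<longleftrightarrow> points_in \<mu> (A \<inter> ball 0 r \<inter> dyadic_cell n z) \<noteq> {}"
      using emeasure_eq_card_points_in[OF \<mu> b] finite_points_in[OF \<mu> b] by simp
    also have "\<dots> \<longleftrightarrow> z \<in> ?q ` points_in \<mu> (A \<inter> ball 0 r)"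
      by (auto simp: points_in_def dyadic_cell_def image_iff)
    finally show ?thesis .
  qed
  have sub: "?q ` points_in \<mu> (A \<inter> ball 0 r) \<subseteq> ?B"
  proof (rule image_subsetI)
    fix p assume "p \<in> points_in \<mu> (A \<inter> ball 0 r)"
    then have "norm (fst p) < r" by (auto simp: points_in_def)
    then have "norm ((2 ^ n) *\<^sub>R fst p) < 2 ^ n * r" by simp
    moreover have "norm (?q p) \<le> norm ((2 ^ n) *\<^sub>R fst p) + norm ((2 ^ n) *\<^sub>R fst p - ?q p)"
      using norm_triangle_ineq4[of "(2 ^ n) *\<^sub>R fst p" "(2 ^ n) *\<^sub>R fst p - ?q p"] by simp
    moreover have "norm ((2 ^ n) *\<^sub>R fst p - ?q p) \<le> real CARD('n)"
      by (rule norm_diff_lattice_cube[OF mem_lattice_cube_floor_vec])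
    ultimately have "norm (?q p) < 2 ^ n * r + real CARD('n)" by linarith
    then show "?q p \<in> ?B" by (simp add: lattice_ball_def)
  qed
  have "occupied_cells n r A \<mu> = (\<Sum>z\<in>?B. if z \<in> ?q ` points_in \<mu> (A \<inter> ball 0 r) then 1 else 0)"
    unfolding occupied_cells_def by (intro sum.cong) (auto simp: nz indicator_def)
  also have "\<dots> = of_nat (card (?B \<inter> ?q ` points_in \<mu> (A \<inter> ball 0 r)))"
    by (simp add: sum.If_cases Int_def)
  also have "?B \<inter> ?q ` points_in \<mu> (A \<inter> ball 0 r) = ?q ` points_in \<mu> (A \<inter> ball 0 r)" using sub by blast
  finally show ?thesis .
qed

text \<open>Once 2^n exceeds the reciprocal of the gap in some coordinate, the scaled coordinates
  differ by more than 1 and so do their integer parts.\<close>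

lemma eventually_floor_vec_separates:
  fixes x y :: "real ^ 'n"
  assumes "x \<noteq> y"
  shows "\<forall>\<^sub>F n in sequentially. floor_vec ((2 ^ n) *\<^sub>R x) \<noteq> floor_vec ((2 ^ n) *\<^sub>R y)"
proof -
  obtain i where i: "x $ i \<noteq> y $ i" using assms by (auto simp: vec_eq_iff)
  obtain m where m: "1 / \<bar>x $ i - y $ i\<bar> < 2 ^ m" using real_arch_pow[of 2 "1 / \<bar>x $ i - y $ i\<bar>"] by auto
  show ?thesis
    using eventually_ge_at_top[of m]
  proof eventually_elim
    case (elim n)
    have "(2 :: real) ^ m \<le> 2 ^ n" using elim by (intro power_increasing) auto
    then have "1 / \<bar>x $ i - y $ i\<bar> < 2 ^ n" using m by linarith
    then have gt: "1 < \<bar>2 ^ n * x $ i - 2 ^ n * y $ i\<bar>"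
      using i by (simp add: divide_less_eq abs_mult right_diff_distrib[symmetric])
    have "\<lfloor>2 ^ n * x $ i\<rfloor> \<noteq> \<lfloor>2 ^ n * y $ i\<rfloor>"
    proof
      assume "\<lfloor>2 ^ n * x $ i\<rfloor> = \<lfloor>2 ^ n * y $ i\<rfloor>"
      then have "\<bar>2 ^ n * x $ i - 2 ^ n * y $ i\<bar> < 1" by linarith
      then show False using gt by linarith
    qed
    then show ?case by (auto simp: floor_vec_def vec_eq_iff)
  qed
qed

text \<open>The number of occupied cells never exceeds the number of points in the ball, and equals
  it as soon as the grid separates these finitely many distinct positions. Letting the radius grow
  exhausts A.\<close>

lemma SUP_occupied_cells:
  assumes \<mu>: "point_configuration (\<mu> :: (real ^ 'n) measure)" "simple_configuration \<mu>" and A: "A \<in> sets borel"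
  shows "(SUP r::nat. SUP n::nat. occupied_cells n (real r) A \<mu>) = emeasure \<mu> A"
proof -
  have b: "A \<inter> ball 0 (real r) \<in> sets borel" "bounded (A \<inter> ball 0 (real r))" for r :: nat using A by auto
  have inner: "(SUP n::nat. occupied_cells n (real r) A \<mu>) = emeasure \<mu> (A \<inter> ball 0 (real r))" for r :: nat
  proof (rule antisym)
    let ?P = "points_in \<mu> (A \<inter> ball 0 (real r))"
    have fin: "finite ?P" by (rule finite_points_in[OF \<mu>(1) b])
    have e: "emeasure \<mu> (A \<inter> ball 0 (real r)) = of_nat (card ?P)"
      by (rule emeasure_eq_card_points_in[OF \<mu>(1) b])
    show "(SUP n::nat. occupied_cells n (real r) A \<mu>) \<le> emeasure \<mu> (A \<inter> ball 0 (real r))"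
      unfolding e by (intro SUP_least) (simp add: occupied_cells_eq[OF \<mu>(1) A] card_image_le fin)
    have "\<forall>\<^sub>F n in sequentially. \<forall>p\<in>?P. \<forall>q\<in>?P. p \<noteq> q \<longrightarrow> floor_vec ((2 ^ n) *\<^sub>R fst p) \<noteq> floor_vec ((2 ^ n) *\<^sub>R fst q)"
    proof (intro eventually_ball_finite fin ballI)
      fix p q assume pq: "p \<in> ?P" "q \<in> ?P"
      show "\<forall>\<^sub>F n in sequentially. p \<noteq> q \<longrightarrow> floor_vec ((2 ^ n) *\<^sub>R fst p) \<noteq> floor_vec ((2 ^ n) *\<^sub>R fst q)"
      proof (cases "p = q")
        case False
        then have "fst p \<noteq> fst q"
          using \<mu>(2) pq by (auto simp: simple_configuration_def inj_on_def points_in_def)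
        from eventually_floor_vec_separates[OF this] show ?thesis by (rule eventually_mono) simp
      qed simp
    qed
    then obtain n where "\<forall>p\<in>?P. \<forall>q\<in>?P. p \<noteq> q \<longrightarrow> floor_vec ((2 ^ n) *\<^sub>R fst p) \<noteq> floor_vec ((2 ^ n) *\<^sub>R fst q)"
      unfolding eventually_sequentially by blast
    then have "inj_on (\<lambda>p. floor_vec ((2 ^ n) *\<^sub>R fst p)) ?P" by (auto simp: inj_on_def)
    then have "occupied_cells n (real r) A \<mu> = of_nat (card ?P)"
      unfolding occupied_cells_eq[OF \<mu>(1) A] by (simp add: card_image)
    then show "emeasure \<mu> (A \<inter> ball 0 (real r)) \<le> (SUP n::nat. occupied_cells n (real r) A \<mu>)"
      unfolding e by (metis SUP_upper UNIV_I)
  qed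
  have "(SUP r::nat. emeasure \<mu> (A \<inter> ball 0 (real r))) = emeasure \<mu> (\<Union>r::nat. A \<inter> ball 0 (real r))"
  proof (rule SUP_emeasure_incseq)
    show "range (\<lambda>r::nat. A \<inter> ball 0 (real r)) \<subseteq> sets \<mu>" using b sets_point_configuration[OF \<mu>(1)] by auto
    show "incseq (\<lambda>r::nat. A \<inter> ball 0 (real r))" by (auto simp: incseq_def)
  qed
  also have "(\<Union>r::nat. A \<inter> ball 0 (real r)) = A"
    using reals_Archimedean2 by auto
  finally show ?thesis unfolding inner .
qed

text \<open>The smaller sigma-algebra generated by void events. It cannot see multiplicities, which
  is why the comparison of laws has to be restricted to simple configurations.\<close>

definition void_space :: "(real ^ 'n) measure measure" where
  "void_space = sigma (Collect point_configuration)
     {{\<mu>. point_configuration \<mu> \<and> emeasure \<mu> A = 0} | A. A \<in> sets borel \<and> bounded A}"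

lemma void_space_generator: "{{\<mu>. point_configuration \<mu> \<and> emeasure \<mu> A = 0} | A. A \<in> sets borel \<and> bounded A}
    \<subseteq> Pow (Collect point_configuration)"
  by auto

lemma space_void_space [simp]: "space void_space = Collect point_configuration"
  unfolding void_space_def by (rule space_measure_of[OF void_space_generator])

lemma sets_void_space: "sets void_space = sigma_sets (Collect point_configuration)
     {{\<mu>. point_configuration \<mu> \<and> emeasure \<mu> A = 0} | A. A \<in> sets borel \<and> bounded A}"
  unfolding void_space_def by (rule sets_measure_of[OF void_space_generator])

lemma void_event: "A \<in> sets borel \<Longrightarrow> bounded A \<Longrightarrow> {\<mu>. point_configuration \<mu> \<and> emeasure \<mu> A = 0} \<in> sets void_space"
  unfolding sets_void_space by (rule sigma_sets.Basic) blast

lemma occupied_cells_measurable: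
  fixes A :: "(real ^ 'n) set"
  assumes "A \<in> sets borel"
  shows "occupied_cells n r A \<in> borel_measurable void_space"
  unfolding occupied_cells_def
proof (rule borel_measurable_sum)
  fix z :: "real ^ 'n"
  have b: "A \<inter> ball 0 r \<inter> dyadic_cell n z \<in> sets borel" "bounded (A \<inter> ball 0 r \<inter> dyadic_cell n z)"
    using assms by (auto intro: bounded_subset[OF bounded_ball])
  have "space void_space - {\<mu>. point_configuration \<mu> \<and> emeasure \<mu> (A \<inter> ball 0 r \<inter> dyadic_cell n z) = 0} \<in> sets void_space"
    by (rule sets.compl_sets[OF void_event[OF b]])
  then have "(indicator (space void_space - {\<mu>. point_configuration \<mu> \<and> emeasure \<mu> (A \<inter> ball 0 r \<inter> dyadic_cell n z) = 0}) :: _ \<Rightarrow> ennreal) \<in> borel_measurable void_space"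
    by (rule borel_measurable_indicator)
  then show "(\<lambda>\<mu>. indicator {\<mu>. emeasure \<mu> (A \<inter> ball 0 r \<inter> dyadic_cell n z) \<noteq> 0} \<mu> :: ennreal) \<in> borel_measurable void_space"
    by (rule measurable_cong[THEN iffD1, rotated]) (auto simp: indicator_def)
qed

lemma sets_configuration_space:
  "sets (configuration_space :: (real ^ 'n) measure measure) = sigma_sets (Collect point_configuration)
     {{\<mu>. point_configuration \<mu> \<and> emeasure \<mu> A \<in> C} | A C. A \<in> sets borel \<and> C \<in> sets borel}"
proof -
  have "sets (configuration_space :: (real ^ 'n) measure measure) = sigma_sets (Collect point_configuration)
    (\<Union>x\<in>(\<lambda>A. vimage_algebra (Collect point_configuration) (\<lambda>\<mu>. emeasure \<mu> A) borel) ` sets borel. sets x)"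
    unfolding configuration_space_def by (rule sets_Sup_eq) auto
  also have "(\<Union>x\<in>(\<lambda>A. vimage_algebra (Collect point_configuration) (\<lambda>\<mu>. emeasure \<mu> A) borel) ` sets (borel :: (real ^ 'n) measure). sets x)
    = {{\<mu>. point_configuration \<mu> \<and> emeasure \<mu> A \<in> C} | A C. A \<in> sets borel \<and> C \<in> sets (borel :: ennreal measure)}"
  proof -
    have "sets (vimage_algebra (Collect point_configuration) (\<lambda>\<mu>. emeasure \<mu> A) (borel :: ennreal measure))
      = {{\<mu>. point_configuration \<mu> \<and> emeasure \<mu> A \<in> C} | C. C \<in> sets borel}" for A :: "(real ^ 'n) set"
    proof -
      have "(\<lambda>\<mu>. emeasure \<mu> A) -` C \<inter> Collect point_configuration = {\<mu>. point_configuration \<mu> \<and> emeasure \<mu> A \<in> C}" for C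
        by auto
      then show ?thesis by (subst sets_vimage_algebra2) auto
    qed
    then show ?thesis by auto
  qed
  finally show ?thesis .
qed

text \<open>Two sets are both void exactly when their union is, so the void events form a generator
  closed under intersection and the laws agree on \<open>void_space\<close>. Every event of
  \<open>configuration_space\<close> coincides with a \<open>void_space\<close> event on simple
  configurations, which carry both laws.\<close>

theorem law_determined_by_void_probabilities:
  fixes \<omega> \<omega>' :: "'w \<Rightarrow> (real ^ 'n) measure"
  assumes M: "prob_space M"
    and m: "\<omega> \<in> measurable M configuration_space" "\<omega>' \<in> measurable M configuration_space"
    and s: "AE w in M. simple_configuration (\<omega> w)" "AE w in M. simple_configuration (\<omega>' w)"
    and void: "\<And>A. A \<in> sets borel \<Longrightarrow> bounded A \<Longrightarrow>
      measure M {w \<in> space M. emeasure (\<omega> w) A = 0} = measure M {w \<in> space M. emeasure (\<omega>' w) A = 0}"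
  shows "distr M configuration_space \<omega> = distr M configuration_space \<omega>'"
proof -
  interpret prob_space M by (rule M)
  let ?C = "configuration_space :: (real ^ 'n) measure measure" and ?V = "void_space :: (real ^ 'n) measure measure"
  let ?G = "{{\<mu> :: (real ^ 'n) measure. point_configuration \<mu> \<and> emeasure \<mu> A = 0} | A. A \<in> sets borel \<and> bounded A}"
  have V_le: "sets ?V \<subseteq> sets ?C"
    unfolding sets_void_space space_configuration_space[symmetric]
  proof (rule sets.sigma_sets_subset, rule subsetI)
    fix X assume "X \<in> {{\<mu> :: (real ^ 'n) measure. point_configuration \<mu> \<and> emeasure \<mu> A = 0} | A. A \<in> sets borel \<and> bounded A}"
    then obtain A where A: "X = {\<mu>. point_configuration \<mu> \<and> emeasure \<mu> A = 0}" "A \<in> sets borel" by blast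
    have "(\<lambda>\<mu>. emeasure \<mu> A) -` {0} \<inter> space ?C \<in> sets ?C"
      by (rule measurable_sets[OF emeasure_measurable_configuration_space[OF A(2)]]) simp
    also have "(\<lambda>\<mu>. emeasure \<mu> A) -` {0} \<inter> space ?C = X" by (auto simp: A(1) space_configuration_space)
    finally show "X \<in> sets ?C" .
  qed
  have idm: "f \<in> measurable M ?V" if "f \<in> measurable M ?C" for f
  proof (rule measurableI)
    show "f x \<in> space ?V" if "x \<in> space M" for x
      using measurable_space[OF \<open>f \<in> measurable M ?C\<close> that] by (simp add: space_configuration_space)
    show "f -` X \<inter> space M \<in> sets M" if "X \<in> sets ?V" for X
      using measurable_sets[OF \<open>f \<in> measurable M ?C\<close>] V_le that by blast
  qed
  have pc: "point_configuration (f w)" if "f \<in> measurable M ?C" "w \<in> space M" for f w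
    using measurable_space[OF that] by (simp add: space_configuration_space)
  have dV: "distr M ?V \<omega> = distr M ?V \<omega>'"
  proof (rule measure_eqI_generator_eq[where E="?G" and \<Omega>="Collect point_configuration" and A="\<lambda>_. Collect point_configuration"])
    show "Int_stable ?G"
    proof (rule Int_stableI)
      fix X Y assume "X \<in> ?G" "Y \<in> ?G"
      then obtain A B where AB: "X = {\<mu>. point_configuration \<mu> \<and> emeasure \<mu> A = 0}" "A \<in> sets borel" "bounded A"
        "Y = {\<mu>. point_configuration \<mu> \<and> emeasure \<mu> B = 0}" "B \<in> sets borel" "bounded B" by blast
      have "emeasure \<mu> (A \<union> B) = 0 \<longleftrightarrow> emeasure \<mu> A = 0 \<and> emeasure \<mu> B = 0" if "point_configuration \<mu>" for \<mu> :: "(real ^ 'n) measure"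
      proof
        assume "emeasure \<mu> (A \<union> B) = 0"
        moreover have "emeasure \<mu> A \<le> emeasure \<mu> (A \<union> B)" "emeasure \<mu> B \<le> emeasure \<mu> (A \<union> B)"
          using AB sets_point_configuration[OF that] by (auto intro!: emeasure_mono)
        ultimately show "emeasure \<mu> A = 0 \<and> emeasure \<mu> B = 0" by simp
      next
        assume "emeasure \<mu> A = 0 \<and> emeasure \<mu> B = 0"
        moreover have "emeasure \<mu> (A \<union> B) \<le> emeasure \<mu> A + emeasure \<mu> B"
          using AB sets_point_configuration[OF that] by (intro emeasure_subadditive) auto
        ultimately show "emeasure \<mu> (A \<union> B) = 0" by simp
      qed
      then have eq: "X \<inter> Y = {\<mu>. point_configuration \<mu> \<and> emeasure \<mu> (A \<union> B) = 0}"
        unfolding AB(1,4) by blast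
      show "X \<inter> Y \<in> ?G"
        by (intro CollectI exI[of _ "A \<union> B"] conjI eq sets.Un AB bounded_Un[THEN iffD2])
    qed
    show "?G \<subseteq> Pow (Collect point_configuration)" by auto
    show "sets (distr M ?V \<omega>) = sigma_sets (Collect point_configuration) ?G" "sets (distr M ?V \<omega>') = sigma_sets (Collect point_configuration) ?G"
      by (simp_all add: sets_void_space)
    have "Collect point_configuration = {\<mu> :: (real ^ 'n) measure. point_configuration \<mu> \<and> emeasure \<mu> {} = 0}" by auto
    then show "range (\<lambda>_. Collect point_configuration) \<subseteq> ?G" by blast
    show "emeasure (distr M ?V \<omega>) (Collect point_configuration) \<noteq> \<infinity>"
      using prob_space_distr[OF idm[OF m(1)]] by (simp add: finite_measure.emeasure_finite prob_space.finite_measure)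
    show "emeasure (distr M ?V \<omega>) X = emeasure (distr M ?V \<omega>') X" if X: "X \<in> ?G" for X
    proof -
      obtain A where A: "X = {\<mu>. point_configuration \<mu> \<and> emeasure \<mu> A = 0}" "A \<in> sets borel" "bounded A" using X by blast
      have "f -` X \<inter> space M = {w \<in> space M. emeasure (f w) A = 0}" if "f \<in> measurable M ?C" for f
        using pc[OF that] by (auto simp: A(1))
      then have "emeasure (distr M ?V f) X = ennreal (measure M {w \<in> space M. emeasure (f w) A = 0})" if "f \<in> measurable M ?C" for f
        using emeasure_distr[OF idm[OF that], of X] void_event[OF A(2,3)] that by (simp add: A(1) emeasure_eq_measure)
      then show ?thesis using void[OF A(2,3)] m by simp
    qed
  qed auto
  \<comment> \<open>For a generating event the count of points is replaced by the supremum of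
    occupied cells, which is measurable for \<open>void_space\<close> and equal to it on simple
    configurations; the property passes to complements and countable unions.\<close>
  have approx: "\<exists>X'\<in>sets ?V. \<forall>\<mu>. point_configuration \<mu> \<longrightarrow> simple_configuration \<mu> \<longrightarrow> (\<mu> \<in> X \<longleftrightarrow> \<mu> \<in> X')" if X: "X \<in> sets ?C" for X
    using X unfolding sets_configuration_space
  proof (induction rule: sigma_sets.induct)
    case (Basic X)
    then obtain A C where AC: "X = {\<mu>. point_configuration \<mu> \<and> emeasure \<mu> A \<in> C}" "A \<in> sets borel" "C \<in> sets borel" by blast
    let ?f = "\<lambda>\<mu>. SUP r::nat. SUP n::nat. occupied_cells n (real r) A \<mu>"
    have f: "?f \<in> borel_measurable ?V"
      by (intro borel_measurable_SUP occupied_cells_measurable AC) auto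
    have "?f -` C \<inter> space ?V \<in> sets ?V" by (rule measurable_sets[OF f AC(3)])
    moreover have "\<mu> \<in> X \<longleftrightarrow> \<mu> \<in> ?f -` C \<inter> space ?V" if "point_configuration \<mu>" "simple_configuration \<mu>" for \<mu>
      using SUP_occupied_cells[OF that AC(2)] that by (simp add: AC(1))
    ultimately show ?case by blast
  next
    case Empty
    show ?case by (intro bexI[of _ "{}"]) auto
  next
    case (Compl X)
    then obtain X' where X': "X' \<in> sets ?V" "\<forall>\<mu>. point_configuration \<mu> \<longrightarrow> simple_configuration \<mu> \<longrightarrow> (\<mu> \<in> X \<longleftrightarrow> \<mu> \<in> X')" by blast
    show ?case
      by (rule bexI[OF _ sets.compl_sets[OF X'(1)]]) (use X'(2) in simp)
  next
    case (Union X)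
    then obtain X' where "\<And>i. X' i \<in> sets ?V" "\<And>i. \<forall>\<mu>. point_configuration \<mu> \<longrightarrow> simple_configuration \<mu> \<longrightarrow> (\<mu> \<in> X i \<longleftrightarrow> \<mu> \<in> X' i)" by metis
    then show ?case by (intro bexI[of _ "\<Union>i. X' i"]) auto
  qed
  show ?thesis
  proof (rule measure_eqI)
    fix X assume "X \<in> sets (distr M ?C \<omega>)"
    then have X: "X \<in> sets ?C" by simp
    obtain X' where X': "X' \<in> sets ?V" "\<And>\<mu>. point_configuration \<mu> \<Longrightarrow> simple_configuration \<mu> \<Longrightarrow> (\<mu> \<in> X \<longleftrightarrow> \<mu> \<in> X')"
      using approx[OF X] by blast
    have "emeasure (distr M ?C f) X = emeasure (distr M ?V f) X'" if f: "f \<in> measurable M ?C" and sf: "AE w in M. simple_configuration (f w)" for f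
    proof -
      have "emeasure (distr M ?C f) X = emeasure M (f -` X \<inter> space M)" by (rule emeasure_distr[OF f X])
      also have "\<dots> = emeasure M (f -` X' \<inter> space M)"
      proof (rule emeasure_eq_AE)
        show "AE w in M. w \<in> f -` X \<inter> space M \<longleftrightarrow> w \<in> f -` X' \<inter> space M"
          using sf AE_space by eventually_elim (use X'(2) pc[OF f] in auto)
        show "f -` X \<inter> space M \<in> sets M" by (rule measurable_sets[OF f X])
        show "f -` X' \<inter> space M \<in> sets M" by (rule measurable_sets[OF idm[OF f] X'(1)])
      qed
      also have "\<dots> = emeasure (distr M ?V f) X'" by (rule emeasure_distr[OF idm[OF f] X'(1), symmetric])
      finally show ?thesis .
    qed
    then show "emeasure (distr M ?C \<omega>) X = emeasure (distr M ?C \<omega>') X"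
      using m s dV by simp
  qed simp
qed

section \<open>Permanental processes are stationary\<close>

lemma pair_event_subset:
  assumes "E \<subseteq> R \<times> R"
  shows "{x \<in> {..<2 :: nat} \<rightarrow>\<^sub>E UNIV. (x 0, x 1) \<in> E} \<subseteq> Pi\<^sub>E {..<2} (\<lambda>_. R)"
proof
  fix x :: "nat \<Rightarrow> 'a" assume x: "x \<in> {x \<in> {..<2 :: nat} \<rightarrow>\<^sub>E UNIV. (x 0, x 1) \<in> E}"
  then have "(x 0, x 1) \<in> R \<times> R" using assms by blast
  moreover have "i = 0 \<or> i = 1" if "i < 2" for i :: nat using that by linarith
  ultimately have "x i \<in> R" if "i < 2" for i using that by blast
  then show "x \<in> Pi\<^sub>E {..<2} (\<lambda>_. R)" using x by (auto simp: PiE_iff)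
qed

definition tuple_event :: "nat \<Rightarrow> (nat \<Rightarrow> real ^ 'n) set \<Rightarrow> real ^ 'n \<Rightarrow> (nat \<Rightarrow> real ^ 'n) set" where
  "tuple_event k W b = {x \<in> {..<k} \<rightarrow>\<^sub>E UNIV. (\<lambda>i\<in>{..<k}. x i - b) \<in> W}"

lemma tuple_event_sets:
  assumes "W \<in> sets (Pi\<^sub>M {..<k} (\<lambda>_. borel))"
  shows "tuple_event k W b \<in> sets (Pi\<^sub>M {..<k} (\<lambda>_. borel))"
proof -
  have "(\<lambda>x. \<lambda>i\<in>{..<k}. x i - b) -` W \<inter> space (Pi\<^sub>M {..<k} (\<lambda>_. borel)) \<in> sets (Pi\<^sub>M {..<k} (\<lambda>_. borel))"
    using measurable_sets[OF shift_measurable[of "{..<k}" "\<lambda>i. i" "{..<k}" b] assms] by simp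
  then show ?thesis by (simp add: tuple_event_def space_PiM vimage_def Int_def conj_commute)
qed

lemma tuple_event_subset:
  assumes "W \<subseteq> Pi\<^sub>E {..<k} (\<lambda>_. ball 0 \<rho>)"
  shows "tuple_event k W b \<subseteq> Pi\<^sub>E {..<k} (\<lambda>_. ball b \<rho>)"
proof
  fix x assume x: "x \<in> tuple_event k W b"
  then have "(\<lambda>i\<in>{..<k}. x i - b) \<in> W" by (simp add: tuple_event_def)
  then have r: "(\<lambda>i\<in>{..<k}. x i - b) \<in> Pi\<^sub>E {..<k} (\<lambda>_. ball 0 \<rho>)" using assms by (rule rev_subsetD)
  have "x i \<in> ball b \<rho>" if "i < k" for i
    using PiE_mem[OF r, of i] that by (simp add: dist_norm norm_minus_commute)
  then show "x \<in> Pi\<^sub>E {..<k} (\<lambda>_. ball b \<rho>)"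
    using x by (auto simp: tuple_event_def PiE_iff)
qed

lemma card_tuple_event_translate:
  assumes \<mu>: "point_configuration (\<mu> :: (real ^ 'n) measure)"
  shows "card (factorial_tuples k (translate_config (- e) \<mu>) (tuple_event k W c)) = card (factorial_tuples k \<mu> (tuple_event k W (e + c)))"
proof -
  have "(\<lambda>i\<in>{..<k}. fst (t i)) \<in> {x. (\<lambda>i\<in>{..<k}. x i + - e) \<in> tuple_event k W c}
     \<longleftrightarrow> (\<lambda>i\<in>{..<k}. fst (t i)) \<in> tuple_event k W (e + c)" for t :: "nat \<Rightarrow> (real ^ 'n) \<times> nat"
  proof -
    have eq: "(\<lambda>i\<in>{..<k}. (\<lambda>i\<in>{..<k}. (\<lambda>i\<in>{..<k}. fst (t i)) i + - e) i - c) = (\<lambda>i\<in>{..<k}. (\<lambda>i\<in>{..<k}. fst (t i)) i - (e + c))"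
      by (auto simp: fun_eq_iff)
    show ?thesis unfolding tuple_event_def mem_Collect_eq eq by auto
  qed
  then have "factorial_tuples k \<mu> {x. (\<lambda>i\<in>{..<k}. x i + - e) \<in> tuple_event k W c} = factorial_tuples k \<mu> (tuple_event k W (e + c))"
    unfolding factorial_tuples_def by blast
  then show ?thesis by (simp only: card_factorial_tuples_translate[OF \<mu>])
qed

locale permanental_process = density_kernel \<phi> K for \<phi> :: "real ^ 'n \<Rightarrow> real" and K +
  fixes M :: "'w measure" and \<omega> :: "'w \<Rightarrow> (real ^ 'n) measure"
  assumes permanental: "permanental M \<omega> (\<lambda>x y. K (x - y))"
begin

sublocale prob_space M
  using permanental by (simp add: permanental_def point_process_def)

lemma process_measurable: "\<omega> \<in> measurable M configuration_space"
  using permanental by (simp add: permanental_def point_process_def)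

lemma configuration: "w \<in> space M \<Longrightarrow> point_configuration (\<omega> w)"
  using measurable_space[OF process_measurable] by (simp add: space_configuration_space)

text \<open>The modulus gives a real, nonnegative and measurable version of the k-point correlation
  function that is defined everywhere; it agrees with \<rho> wherever \<rho> equals the permanent,
  since \<rho> is nonnegative.\<close>

definition intensity :: "nat \<Rightarrow> (nat \<Rightarrow> real ^ 'n) \<Rightarrow> real" where
  "intensity k x = cmod (permanent k (\<lambda>i j. K (x i - x j)))"

lemma intensity_measurable: "intensity k \<in> borel_measurable (Pi\<^sub>M {..<k} (\<lambda>_. borel))"
proof -
  have "(\<lambda>x. K (x i - x (\<sigma> i))) \<in> borel_measurable (Pi\<^sub>M {..<k} (\<lambda>_. borel))"
    if "\<sigma> permutes {..<k}" "i \<in> {..<k}" for i \<sigma>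
  proof -
    have "\<sigma> i \<in> {..<k}" using permutes_in_image[OF that(1), of i] that(2) by simp
    then have [measurable]: "(\<lambda>x. x i) \<in> borel_measurable (Pi\<^sub>M {..<k} (\<lambda>_. borel :: (real ^ 'n) measure))"
      "(\<lambda>x. x (\<sigma> i)) \<in> borel_measurable (Pi\<^sub>M {..<k} (\<lambda>_. borel :: (real ^ 'n) measure))"
      using that by (auto intro: measurable_component_singleton)
    show ?thesis by measurable
  qed
  then have [measurable]: "(\<lambda>x. permanent k (\<lambda>i j. K (x i - x j))) \<in> borel_measurable (Pi\<^sub>M {..<k} (\<lambda>_. borel))"
    unfolding permanent_def by (intro borel_measurable_sum borel_measurable_prod) auto
  show ?thesis unfolding intensity_def[abs_def] by measurable
qed

lemma intensity_nonneg: "0 \<le> intensity k x"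
  by (simp add: intensity_def)

lemma intensity_le: "intensity k x \<le> fact k"
  unfolding intensity_def by (intro norm_permanent_le norm_K_le_1)

lemma permanent_cong: "(\<And>i j. i < k \<Longrightarrow> j < k \<Longrightarrow> A i j = B i j) \<Longrightarrow> permanent k A = permanent k B"
  unfolding permanent_def
proof (intro sum.cong refl prod.cong)
  fix \<sigma> i assume "\<And>i j. i < k \<Longrightarrow> j < k \<Longrightarrow> A i j = B i j" "\<sigma> \<in> {\<sigma>. \<sigma> permutes {..<k}}" "i \<in> {..<k}"
  then show "A i (\<sigma> i) = B i (\<sigma> i)" using permutes_in_image[of \<sigma> "{..<k}" i] by simp
qed

lemma intensity_shift: "intensity k (\<lambda>i\<in>{..<k}. x i - c) = intensity k x"
  unfolding intensity_def by (intro arg_cong[where f=cmod] permanent_cong) simp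

lemma intensity_1: "intensity 1 x = 1"
  unfolding intensity_def permanent_def by (simp add: K_0 permutes_sing lessThan_Suc permutes_empty)

lemma intensity_2: "intensity 2 x = 1 + (cmod (K (x 0 - x 1)))\<^sup>2"
proof -
  have two: "{..<2 :: nat} = insert 0 {1}" by auto
  have "permanent 2 (\<lambda>i j. K (x i - x j)) = K 0 * K 0 + K (x 0 - x 1) * K (x 1 - x 0)"
  proof -
    have S: "{\<sigma>. \<sigma> permutes {..<2 :: nat}} = {id, Transposition.transpose 0 1}"
    proof (rule card_seteq[symmetric])
      show "{id, Transposition.transpose 0 1} \<subseteq> {\<sigma>. \<sigma> permutes {..<2 :: nat}}"
        by (auto intro: permutes_id permutes_swap_id)
      have "id \<noteq> Transposition.transpose (0::nat) 1" by (metis id_apply transpose_apply_first zero_neq_one)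
      then show "card {\<sigma>. \<sigma> permutes {..<2 :: nat}} \<le> card {id, Transposition.transpose (0::nat) 1}"
        by (simp add: card_permutations)
    qed (simp add: finite_permutations)
    have "id \<noteq> Transposition.transpose (0::nat) 1" by (metis id_apply transpose_apply_first zero_neq_one)
    then show ?thesis
      unfolding permanent_def S by (simp add: two)
  qed
  also have "K (x 1 - x 0) = cnj (K (x 0 - x 1))" using K_uminus[of "x 0 - x 1"] by simp
  finally have "permanent 2 (\<lambda>i j. K (x i - x j)) = complex_of_real (1 + (cmod (K (x 0 - x 1)))\<^sup>2)"
    by (simp add: K_0 complex_norm_square[symmetric])
  then show ?thesis unfolding intensity_def by (simp only: norm_of_real) (simp add: add_nonneg_nonneg)
qed

lemma moment_finite:
  assumes "A \<in> sets borel" "bounded A" "1 \<le> k"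
  shows "(\<integral>\<^sup>+ w. emeasure (\<omega> w) A ^ k \<partial>M) < \<infinity>"
  using permanental assms unfolding permanental_def correlation_function_def by blast

lemma factorial_moment_eq:
  assumes k: "1 \<le> k" and B: "B \<in> sets (Pi\<^sub>M {..<k} (\<lambda>_. borel))"
  shows "(\<integral>\<^sup>+ w. emeasure (count_space UNIV) (factorial_tuples k (\<omega> w) B) \<partial>M) =
    (\<integral>\<^sup>+ x. ennreal (intensity k x) * indicator B x \<partial>Pi\<^sub>M {..<k} (\<lambda>_. lborel))"
proof -
  obtain \<rho> where \<rho>: "correlation_function M \<omega> k \<rho>"
    "AE x in Pi\<^sub>M {..<k} (\<lambda>_. lborel). complex_of_real (\<rho> x) = permanent k (\<lambda>i j. K (x i - x j))"
    using permanental k unfolding permanental_def by blast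
  have "(\<integral>\<^sup>+ w. emeasure (count_space UNIV) (factorial_tuples k (\<omega> w) B) \<partial>M) = factorial_moment M \<omega> k B"
    unfolding factorial_moment_def emeasure_factorial_power[OF B] ..
  also have "\<dots> = emeasure (density (Pi\<^sub>M {..<k} (\<lambda>_. lborel)) (\<lambda>x. ennreal (\<rho> x))) B"
    using \<rho>(1) B unfolding correlation_function_def by blast
  also have "\<dots> = (\<integral>\<^sup>+ x. ennreal (\<rho> x) * indicator B x \<partial>Pi\<^sub>M {..<k} (\<lambda>_. lborel))"
    using \<rho>(1) B unfolding correlation_function_def by (intro emeasure_density) (auto simp: sets_PiM_lborel)
  also have "\<dots> = (\<integral>\<^sup>+ x. ennreal (intensity k x) * indicator B x \<partial>Pi\<^sub>M {..<k} (\<lambda>_. lborel))"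
  proof (rule nn_integral_cong_AE)
    show "AE x in Pi\<^sub>M {..<k} (\<lambda>_. lborel). ennreal (\<rho> x) * indicator B x = ennreal (intensity k x) * indicator B x"
      using \<rho>(2)
    proof eventually_elim
      case (elim x)
      have "0 \<le> \<rho> x" using \<rho>(1) unfolding correlation_function_def by blast
      then have "intensity k x = \<rho> x" unfolding intensity_def elim[symmetric] by simp
      then show ?case by simp
    qed
  qed
  finally show ?thesis .
qed

lemma expected_card:
  assumes k: "1 \<le> k" and B: "B \<in> sets (Pi\<^sub>M {..<k} (\<lambda>_. borel))" "B \<subseteq> Pi\<^sub>E {..<k} (\<lambda>_. A)"
    and A: "A \<in> sets borel" "bounded A"
  shows "(\<integral>\<^sup>+ w. of_nat (card (factorial_tuples k (\<omega> w) B)) \<partial>M) =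
    (\<integral>\<^sup>+ x. ennreal (intensity k x) * indicator B x \<partial>Pi\<^sub>M {..<k} (\<lambda>_. lborel))"
  unfolding factorial_moment_eq[OF k B(1), symmetric]
  using finite_factorial_tuples[OF configuration A B(2)] by (intro nn_integral_cong) simp

lemma expected_choose:
  assumes k: "1 \<le> k" and A: "A \<in> sets borel" "bounded A"
  shows "fact k * (\<integral>\<^sup>+ w. of_nat (card (points_in (\<omega> w) A) choose k) \<partial>M) =
    (\<integral>\<^sup>+ x. ennreal (intensity k x) * indicator (Pi\<^sub>E {..<k} (\<lambda>_. A)) x \<partial>Pi\<^sub>M {..<k} (\<lambda>_. lborel))"
proof -
  have B: "Pi\<^sub>E {..<k} (\<lambda>_. A) \<in> sets (Pi\<^sub>M {..<k} (\<lambda>_. borel))"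
    using A by (intro sets_PiM_I_finite) auto
  have [measurable]: "(\<lambda>w. real (card (points_in (\<omega> w) A))) \<in> borel_measurable M"
    by (rule measurable_compose[OF process_measurable card_points_in_measurable[OF A]])
  \<comment> \<open>Writing the count as the floor of a real number reduces measurability to that of
    the real-valued count.\<close>
  have e: "(\<lambda>w. of_nat (card (points_in (\<omega> w) A) choose k) :: ennreal) = (\<lambda>w. ennreal (real (nat \<lfloor>real (card (points_in (\<omega> w) A))\<rfloor> choose k)))"
    by (simp add: ennreal_of_nat_eq_real_of_nat)
  have m: "(\<lambda>w. of_nat (card (points_in (\<omega> w) A) choose k) :: ennreal) \<in> borel_measurable M"
    unfolding e by measurable
  have "fact k * (\<integral>\<^sup>+ w. of_nat (card (points_in (\<omega> w) A) choose k) \<partial>M)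
    = (\<integral>\<^sup>+ w. fact k * of_nat (card (points_in (\<omega> w) A) choose k) \<partial>M)"
    by (rule nn_integral_cmult[OF m, symmetric])
  also have "\<dots> = (\<integral>\<^sup>+ w. of_nat (card (factorial_tuples k (\<omega> w) (Pi\<^sub>E {..<k} (\<lambda>_. A)))) \<partial>M)"
    by (intro nn_integral_cong) (simp add: card_factorial_tuples_PiE[OF configuration A])
  also have "\<dots> = (\<integral>\<^sup>+ x. ennreal (intensity k x) * indicator (Pi\<^sub>E {..<k} (\<lambda>_. A)) x \<partial>Pi\<^sub>M {..<k} (\<lambda>_. lborel))"
    by (rule expected_card[OF k B _ A]) simp
  finally show ?thesis .
qed

text \<open>The kernel depends on differences only, so \<open>intensity\<close> is unchanged by a
  common shift of all points, and so is Lebesgue measure on tuples.\<close>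

lemma nn_integral_intensity_shift:
  assumes B: "B \<in> sets (Pi\<^sub>M {..<k} (\<lambda>_. borel))" and B': "\<And>x. x \<in> {..<k} \<rightarrow>\<^sub>E UNIV \<Longrightarrow> (\<lambda>i\<in>{..<k}. x i - c) \<in> B \<longleftrightarrow> x \<in> B'"
  shows "(\<integral>\<^sup>+ x. ennreal (intensity k x) * indicator B' x \<partial>Pi\<^sub>M {..<k} (\<lambda>_. lborel))
    = (\<integral>\<^sup>+ x. ennreal (intensity k x) * indicator B x \<partial>Pi\<^sub>M {..<k} (\<lambda>_. lborel))"
proof -
  have [measurable]: "intensity k \<in> borel_measurable (Pi\<^sub>M {..<k} (\<lambda>_. borel))" by (rule intensity_measurable)
  have m: "(\<lambda>x. ennreal (intensity k x) * indicator B x) \<in> borel_measurable (Pi\<^sub>M {..<k} (\<lambda>_. borel))"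
    using B by measurable
  have "(\<integral>\<^sup>+ x. ennreal (intensity k x) * indicator B' x \<partial>Pi\<^sub>M {..<k} (\<lambda>_. lborel))
    = (\<integral>\<^sup>+ x. ennreal (intensity k (\<lambda>i\<in>{..<k}. x i - c)) * indicator B (\<lambda>i\<in>{..<k}. x i - c) \<partial>Pi\<^sub>M {..<k} (\<lambda>_. lborel))"
  proof (rule nn_integral_cong)
    fix x assume "x \<in> space (Pi\<^sub>M {..<k} (\<lambda>_. lborel :: (real ^ 'n) measure))"
    then have "x \<in> {..<k} \<rightarrow>\<^sub>E UNIV" by (simp add: space_PiM)
    from B'[OF this] show "ennreal (intensity k x) * indicator B' x = ennreal (intensity k (\<lambda>i\<in>{..<k}. x i - c)) * indicator B (\<lambda>i\<in>{..<k}. x i - c)"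
      unfolding intensity_shift by (simp add: indicator_def)
  qed
  also have "\<dots> = (\<integral>\<^sup>+ x. ennreal (intensity k x) * indicator B x \<partial>Pi\<^sub>M {..<k} (\<lambda>_. lborel))"
    using nn_integral_reindex_shift[OF _ _ _ m, of "\<lambda>i. i" "{..<k}" c] by (simp add: bij_betw_def)
  finally show ?thesis .
qed

text \<open>The factor k! cancels against the one in \<open>expected_choose\<close>; what remains is
  the geometric bound on binomial moments with ratio the volume of A.\<close>

lemma nn_integral_intensity_PiE_le:
  assumes A: "A \<in> sets borel" "bounded A"
  shows "(\<integral>\<^sup>+ x. ennreal (intensity k x) * indicator (Pi\<^sub>E {..<k} (\<lambda>_. A)) x \<partial>Pi\<^sub>M {..<k} (\<lambda>_. lborel)) \<le> fact k * ennreal (measure lborel A ^ k)"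
proof -
  have e: "emeasure lborel A = ennreal (measure lborel A)"
    using emeasure_bounded_finite[OF A(2)] by (intro emeasure_eq_ennreal_measure) simp
  have B: "Pi\<^sub>E {..<k} (\<lambda>_. A) \<in> sets (Pi\<^sub>M {..<k} (\<lambda>_. lborel))"
    using A by (intro sets_PiM_I_finite) auto
  have "(\<integral>\<^sup>+ x. ennreal (intensity k x) * indicator (Pi\<^sub>E {..<k} (\<lambda>_. A)) x \<partial>Pi\<^sub>M {..<k} (\<lambda>_. lborel))
    \<le> (\<integral>\<^sup>+ x. fact k * indicator (Pi\<^sub>E {..<k} (\<lambda>_. A)) x \<partial>Pi\<^sub>M {..<k} (\<lambda>_. lborel))"
  proof (intro nn_integral_mono mult_right_mono)
    show "ennreal (intensity k x) \<le> fact k" for x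
      using intensity_le[of k x] by (metis ennreal_leI ennreal_of_nat_eq_real_of_nat of_nat_fact)
  qed simp
  also have "\<dots> = fact k * emeasure (Pi\<^sub>M {..<k} (\<lambda>_. lborel)) (Pi\<^sub>E {..<k} (\<lambda>_. A))"
    using B by (rule nn_integral_cmult_indicator)
  also have "emeasure (Pi\<^sub>M {..<k} (\<lambda>_. lborel)) (Pi\<^sub>E {..<k} (\<lambda>_. A)) = ennreal (measure lborel A ^ k)"
    using A by (subst lborel_product.emeasure_PiM) (auto simp: e ennreal_power)
  finally show ?thesis .
qed

text \<open>The counts in A and in its translate have the same binomial moments, and these grow at
  most geometrically, so \<open>zero_probability_from_factorial_moments\<close> applies.\<close>

lemma void_probability_shift:
  assumes A: "A \<in> sets borel" "bounded A"
  shows "measure M {w \<in> space M. emeasure (\<omega> w) A = 0} = measure M {w \<in> space M. emeasure (translate_config a (\<omega> w)) A = 0}"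
proof -
  let ?A' = "(\<lambda>x. x - a) ` A"
  have A': "?A' \<in> sets borel" "bounded ?A'" using A by (auto intro: borel_translate bounded_translate)
  let ?N = "\<lambda>A w. card (points_in (\<omega> w) A)"
  have Nm: "?N A \<in> measurable M (count_space UNIV)" if "A \<in> sets borel" "bounded A" for A
  proof -
    have [measurable]: "(\<lambda>w. real (?N A w)) \<in> borel_measurable M"
      by (rule measurable_compose[OF process_measurable card_points_in_measurable[OF that]])
    have "(\<lambda>w. nat \<lfloor>real (?N A w)\<rfloor>) \<in> measurable M (count_space UNIV)" by measurable
    then show ?thesis by simp
  qed
  have f0: "(fact k :: ennreal) \<noteq> 0" "(fact k :: ennreal) \<noteq> \<infinity>" for k
    by (metis ennreal_eq_0_iff ennreal_of_nat_eq_real_of_nat fact_gt_zero not_less of_nat_fact)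
      (metis ennreal_of_nat_neq_top infinity_ennreal_def of_nat_fact)
  have eq: "(\<integral>\<^sup>+ w. of_nat (?N A w choose k) \<partial>M) = (\<integral>\<^sup>+ w. of_nat (?N ?A' w choose k) \<partial>M)" for k
  proof (cases "k = 0")
    case False
    then have k: "1 \<le> k" by simp
    have "fact k * (\<integral>\<^sup>+ w. of_nat (?N ?A' w choose k) \<partial>M) = fact k * (\<integral>\<^sup>+ w. of_nat (?N A w choose k) \<partial>M)"
      unfolding expected_choose[OF k A] expected_choose[OF k A']
    proof (rule nn_integral_intensity_shift[where c="- a"])
      show "Pi\<^sub>E {..<k} (\<lambda>_. A) \<in> sets (Pi\<^sub>M {..<k} (\<lambda>_. borel))" using A by (intro sets_PiM_I_finite) auto
      fix x :: "nat \<Rightarrow> real ^ 'n" assume x: "x \<in> {..<k} \<rightarrow>\<^sub>E UNIV"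
      have "y - - a \<in> A \<longleftrightarrow> y \<in> ?A'" for y by (force simp: image_iff)
      then show "(\<lambda>i\<in>{..<k}. x i - - a) \<in> Pi\<^sub>E {..<k} (\<lambda>_. A) \<longleftrightarrow> x \<in> Pi\<^sub>E {..<k} (\<lambda>_. ?A')"
        using x by (auto simp: PiE_iff)
    qed
    then show ?thesis using f0[of k] by (simp add: ennreal_mult_cancel_left)
  qed simp
  have bound: "(\<integral>\<^sup>+ w. of_nat (?N A w choose k) \<partial>M) \<le> ennreal (measure lborel A ^ k)" for k
  proof (cases "k = 0")
    case False
    then have "fact k * (\<integral>\<^sup>+ w. of_nat (?N A w choose k) \<partial>M) \<le> fact k * ennreal (measure lborel A ^ k)"
      using nn_integral_intensity_PiE_le[OF A, of k] by (subst expected_choose[OF _ A]) auto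
    then show ?thesis using f0[of k] by (simp add: ennreal_mult_le_mult_iff)
  qed (simp add: emeasure_space_1)
  have "measure M {w \<in> space M. ?N A w = 0} = measure M {w \<in> space M. ?N ?A' w = 0}"
    by (rule zero_probability_from_factorial_moments[OF prob_space_axioms Nm[OF A] Nm[OF A'] bound _ eq]) simp
  moreover have "{w \<in> space M. ?N A w = 0} = {w \<in> space M. emeasure (\<omega> w) A = 0}"
    using emeasure_eq_card_points_in[OF configuration A] by auto
  moreover have "{w \<in> space M. ?N ?A' w = 0} = {w \<in> space M. emeasure (translate_config a (\<omega> w)) A = 0}"
    using emeasure_eq_card_points_in[OF configuration A'] emeasure_translate_config[OF configuration A(1)] by auto
  ultimately show ?thesis by simp
qed

text \<open>The second factorial moment measure has a density, so it does not charge the diagonal.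
  The expected number of ordered pairs of distinct indices over a common point is therefore 0 in
  every ball.\<close>

lemma AE_simple: "AE w in M. simple_configuration (\<omega> w)"
proof -
  let ?E = "\<lambda>r. {z. fst z - snd z = 0 \<and> fst z \<in> ball (0 :: real ^ 'n) r}"
  let ?W = "\<lambda>r. {x \<in> {..<2 :: nat} \<rightarrow>\<^sub>E UNIV. (x 0, x 1) \<in> ?E r}"
  have ae: "AE w in M. card (factorial_tuples 2 (\<omega> w) (?W (real r))) = 0" for r :: nat
  proof -
    let ?R = "ball (0 :: real ^ 'n) (real r)"
    have R: "?R \<in> sets borel" "bounded ?R" by auto
    let ?P = "borel \<Otimes>\<^sub>M borel :: ((real ^ 'n) \<times> (real ^ 'n)) measure"
    have "?E (real r) = ((\<lambda>z. fst z - snd z) -` {0} \<inter> space ?P) \<inter> (fst -` ?R \<inter> space ?P)"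
      by (auto simp: space_pair_measure)
    also have "\<dots> \<in> sets ?P"
    proof (rule sets.Int)
      show "(\<lambda>z. fst z - snd z) -` {0} \<inter> space ?P \<in> sets ?P"
        by (rule measurable_sets[where A=borel]) measurable
      show "fst -` ?R \<inter> space ?P \<in> sets ?P"
        by (rule measurable_sets[where A=borel]) auto
    qed
    finally have E: "?E (real r) \<in> sets (borel \<Otimes>\<^sub>M borel)" .
    have Es: "?E (real r) \<subseteq> ?R \<times> ?R" by auto
    have W: "?W (real r) \<in> sets (Pi\<^sub>M {..<2} (\<lambda>_. borel))" by (rule pair_event_sets[OF E])
    have Wb: "?W (real r) \<subseteq> Pi\<^sub>E {..<2} (\<lambda>_. ?R)" by (rule pair_event_subset[OF Es])
    have m: "(\<lambda>w. ennreal (real (card (factorial_tuples 2 (\<omega> w) (?W (real r)))))) \<in> borel_measurable M"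
      using measurable_compose[OF process_measurable card_factorial_tuples_2_measurable[OF R E Es]] by measurable
    have "(\<integral>\<^sup>+ w. ennreal (real (card (factorial_tuples 2 (\<omega> w) (?W (real r))))) \<partial>M)
      = (\<integral>\<^sup>+ x. ennreal (intensity 2 x) * indicator (?W (real r)) x \<partial>Pi\<^sub>M {..<2} (\<lambda>_. lborel))"
      using expected_card[OF _ W Wb R] by (simp add: ennreal_of_nat_eq_real_of_nat)
    also have "\<dots> \<le> (\<integral>\<^sup>+ x. 2 * (indicator (?E (real r)) (x 0, x 1)) \<partial>Pi\<^sub>M {..<2 :: nat} (\<lambda>_. lborel))"
    proof (rule nn_integral_mono)
      fix x :: "nat \<Rightarrow> real ^ 'n"
      have le: "ennreal (intensity 2 x) \<le> 2"
        using intensity_le[of 2 x] by (metis ennreal_leI ennreal_numeral fact_2)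
      show "ennreal (intensity 2 x) * indicator (?W (real r)) x \<le> 2 * indicator (?E (real r)) (x 0, x 1)"
      proof (cases "x \<in> ?W (real r)")
        case True
        then have "(x 0, x 1) \<in> ?E (real r)" by blast
        with True show ?thesis using le by (simp only: indicator_simps mult_1_right)
      next
        case False
        show ?thesis unfolding indicator_simps(2)[OF False] mult_zero_right by (rule zero_le)
      qed
    qed
    also have "\<dots> = (\<integral>\<^sup>+ a. \<integral>\<^sup>+ b. 2 * (indicator (?E (real r)) (a, b)) \<partial>lborel \<partial>lborel)"
    proof (rule nn_integral_PiM_2[of "\<lambda>a b. 2 * (indicator (?E (real r)) (a, b))"])
      show "(\<lambda>(a, b). 2 * indicator (?E (real r)) (a, b) :: ennreal) \<in> borel_measurable (borel \<Otimes>\<^sub>M borel)"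
        using E by simp
    qed
    \<comment> \<open>Each section of the diagonal is contained in a single point, which is a
      Lebesgue null set.\<close>
    also have "\<dots> \<le> (\<integral>\<^sup>+ a. \<integral>\<^sup>+ b. 2 * indicator {a} b \<partial>lborel \<partial>(lborel :: (real ^ 'n) measure))"
      by (intro nn_integral_mono) (auto simp: indicator_def)
    also have "\<dots> = 0" by (simp add: nn_integral_cmult)
    finally have "(\<integral>\<^sup>+ w. ennreal (real (card (factorial_tuples 2 (\<omega> w) (?W (real r))))) \<partial>M) = 0" by simp
    then have "AE w in M. ennreal (real (card (factorial_tuples 2 (\<omega> w) (?W (real r))))) = 0"
      using nn_integral_0_iff_AE[OF m] by simp
    then show ?thesis by eventually_elim simp
  qed
  have "AE w in M. \<forall>r::nat. card (factorial_tuples 2 (\<omega> w) (?W (real r))) = 0"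
    using ae by (simp add: AE_all_countable)
  then show ?thesis
    using AE_space
  proof eventually_elim
    case (elim w)
    have \<mu>: "point_configuration (\<omega> w)" using elim(2) by (rule configuration)
    show ?case
      unfolding simple_configuration_def
    proof (rule inj_onI, rule ccontr)
      fix p q assume pq: "p \<in> configuration_points (\<omega> w)" "q \<in> configuration_points (\<omega> w)" "fst p = fst q" "p \<noteq> q"
      obtain r :: nat where r: "norm (fst p) < real r" using reals_Archimedean2 by blast
      let ?t = "\<lambda>i\<in>{..<2 :: nat}. if i = 0 then p else q"
      have "?t \<in> factorial_tuples 2 (\<omega> w) (?W (real r))"
        using pq r by (auto simp: factorial_tuples_def PiE_iff inj_on_def less_2_cases_iff split: if_splits)
      moreover have "finite (factorial_tuples 2 (\<omega> w) (?W (real r)))"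
      proof (rule finite_factorial_tuples[OF \<mu>, where A="ball 0 (real r)"])
        show "?W (real r) \<subseteq> Pi\<^sub>E {..<2} (\<lambda>_. ball 0 (real r))"
          by (rule pair_event_subset) auto
      qed auto
      ultimately show False using elim(1) by (auto simp: card_eq_0_iff)
    qed
  qed
qed

lemma simple_configuration_translate:
  assumes "point_configuration (\<mu> :: (real ^ 'n) measure)" "simple_configuration \<mu>"
  shows "simple_configuration (translate_config a \<mu>)"
  using assms(2) unfolding simple_configuration_def configuration_points_translate[OF assms(1)]
  by (auto simp: inj_on_def)

theorem stationary_law:
  "distr M configuration_space (\<lambda>w. translate_config a (\<omega> w)) = distr M configuration_space \<omega>"
proof (rule law_determined_by_void_probabilities[symmetric, OF prob_space_axioms process_measurable])
  show "(\<lambda>w. translate_config a (\<omega> w)) \<in> measurable M configuration_space"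
    by (rule measurable_compose[OF process_measurable translate_config_measurable])
  show "AE w in M. simple_configuration (translate_config a (\<omega> w))"
    using AE_simple AE_space by eventually_elim (auto intro: simple_configuration_translate configuration)
qed (use AE_simple void_probability_shift in auto)

end

section \<open>Averages of local tuple counts\<close>

text \<open>Treats single points (k = 1) and pairs of distinct points (k = 2) together.
  Measurability of the counts is a parameter because it is established separately in these two
  cases.\<close>

locale tuple_field = permanental_process \<phi> K M \<omega> for \<phi> :: "real ^ 'n \<Rightarrow> real" and K and M :: "'w measure" and \<omega> +
  fixes k :: nat and W :: "(nat \<Rightarrow> real ^ 'n) set" and \<rho> :: real
  assumes k: "1 \<le> k" and W: "W \<in> sets (Pi\<^sub>M {..<k} (\<lambda>_. borel))" "W \<subseteq> Pi\<^sub>E {..<k} (\<lambda>_. ball 0 \<rho>)"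
    and count_measurable: "\<And>b. (\<lambda>\<mu>. real (card (factorial_tuples k \<mu> (tuple_event k W b)))) \<in> borel_measurable configuration_space"
begin

definition field :: "real ^ 'n \<Rightarrow> 'w \<Rightarrow> real" where
  "field b w = real (card (factorial_tuples k (\<omega> w) (tuple_event k W b)))"

definition mean_integral :: ennreal where
  "mean_integral = (\<integral>\<^sup>+ x. ennreal (intensity k x) * indicator W x \<partial>Pi\<^sub>M {..<k} (\<lambda>_. lborel))"

lemma field_measurable [measurable]: "field b \<in> borel_measurable M"
  unfolding field_def[abs_def] by (rule measurable_compose[OF process_measurable count_measurable])

lemma stationary_field_field: "stationary_field M field"
  unfolding stationary_field_def
proof (intro conjI ballI field_measurable)
  let ?F = "Pi\<^sub>M lattice (\<lambda>_. borel :: real measure)"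
  let ?P = "\<lambda>\<mu>. \<lambda>c\<in>lattice. real (card (factorial_tuples k \<mu> (tuple_event k W c)))"
  fix e :: "real ^ 'n" assume "e \<in> lattice"
  have P: "?P \<in> measurable configuration_space ?F"
    by (intro measurable_restrict count_measurable)
  have T: "(\<lambda>w. translate_config (- e) (\<omega> w)) \<in> measurable M configuration_space"
    by (rule measurable_compose[OF process_measurable translate_config_measurable])
  have "distr M ?F (\<lambda>w. \<lambda>c\<in>lattice. field (e + c) w) = distr M ?F (\<lambda>w. ?P (translate_config (- e) (\<omega> w)))"
    by (rule distr_cong) (auto simp: field_def card_tuple_event_translate[OF configuration] cong: restrict_cong)
  also have "\<dots> = distr (distr M configuration_space (\<lambda>w. translate_config (- e) (\<omega> w))) ?F ?P"
    by (subst distr_distr[OF P T]) (simp add: o_def)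
  also have "\<dots> = distr (distr M configuration_space \<omega>) ?F ?P"
    by (simp only: stationary_law)
  also have "\<dots> = distr M ?F (\<lambda>w. \<lambda>c\<in>lattice. field c w)"
    by (subst distr_distr[OF P process_measurable]) (simp add: o_def field_def)
  finally show "distr M ?F (\<lambda>w. \<lambda>c\<in>lattice. field (e + c) w) = distr M ?F (\<lambda>w. \<lambda>c\<in>lattice. field c w)" .
qed

lemma ball_bounded: "ball b \<rho> \<in> sets borel" "bounded (ball b \<rho>)"
  by auto

lemma field_le:
  assumes "w \<in> space M"
  shows "field b w \<le> real (card (points_in (\<omega> w) (ball b \<rho>))) ^ k"
proof -
  have fin: "finite ({..<k} \<rightarrow>\<^sub>E points_in (\<omega> w) (ball b \<rho>))"
    by (intro finite_PiE finite_points_in[OF configuration[OF assms] ball_bounded]) auto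
  have "card (factorial_tuples k (\<omega> w) (tuple_event k W b)) \<le> card ({..<k} \<rightarrow>\<^sub>E points_in (\<omega> w) (ball b \<rho>))"
    by (intro card_mono fin factorial_tuples_subset_PiE tuple_event_subset W)
  also have "\<dots> = card (points_in (\<omega> w) (ball b \<rho>)) ^ k" by (simp add: card_PiE)
  finally show ?thesis unfolding field_def by (metis of_nat_mono of_nat_power)
qed

text \<open>The number of k-tuples is at most the k-th power of the number of points in the window,
  so the second moment of the field is bounded by the moment of order 2k of that number.\<close>

lemma field_square_integrable: "integrable M (\<lambda>w. (field b w)\<^sup>2)"
proof (rule integrableI_nonneg)
  have "(\<integral>\<^sup>+ w. ennreal ((field b w)\<^sup>2) \<partial>M) \<le> (\<integral>\<^sup>+ w. emeasure (\<omega> w) (ball b \<rho>) ^ (k * 2) \<partial>M)"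
  proof (rule nn_integral_mono)
    fix w assume w: "w \<in> space M"
    have "(field b w)\<^sup>2 \<le> (real (card (points_in (\<omega> w) (ball b \<rho>))) ^ k)\<^sup>2"
      using field_le[OF w, of b] by (intro power_mono) (auto simp: field_def)
    then have "ennreal ((field b w)\<^sup>2) \<le> ennreal (real (card (points_in (\<omega> w) (ball b \<rho>))) ^ (k * 2))"
      by (simp add: power_mult ennreal_leI)
    also have "\<dots> = emeasure (\<omega> w) (ball b \<rho>) ^ (k * 2)"
      unfolding emeasure_eq_card_points_in[OF configuration[OF w] ball_bounded]
      by (simp add: ennreal_of_nat_eq_real_of_nat ennreal_power)
    finally show "ennreal ((field b w)\<^sup>2) \<le> emeasure (\<omega> w) (ball b \<rho>) ^ (k * 2)" .
  qed
  also have "\<dots> < \<infinity>" using k by (intro moment_finite ball_bounded) simp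
  finally show "(\<integral>\<^sup>+ w. ennreal ((field b w)\<^sup>2) \<partial>M) < \<infinity>" .
qed auto

lemma nn_integral_field: "(\<integral>\<^sup>+ w. ennreal (field b w) \<partial>M) = mean_integral"
proof -
  have "(\<integral>\<^sup>+ w. ennreal (field b w) \<partial>M) = (\<integral>\<^sup>+ w. of_nat (card (factorial_tuples k (\<omega> w) (tuple_event k W b))) \<partial>M)"
    by (simp add: field_def ennreal_of_nat_eq_real_of_nat)
  also have "\<dots> = (\<integral>\<^sup>+ x. ennreal (intensity k x) * indicator (tuple_event k W b) x \<partial>Pi\<^sub>M {..<k} (\<lambda>_. lborel))"
    by (rule expected_card[OF k tuple_event_sets[OF W(1)] tuple_event_subset[OF W(2)] ball_bounded])
  also have "\<dots> = mean_integral"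
    unfolding mean_integral_def
    by (rule nn_integral_intensity_shift[OF W(1), where c=b]) (auto simp: tuple_event_def)
  finally show ?thesis .
qed

lemma mean_integral_finite: "mean_integral < \<infinity>"
proof -
  have "mean_integral \<le> (\<integral>\<^sup>+ x. ennreal (intensity k x) * indicator (Pi\<^sub>E {..<k} (\<lambda>_. ball 0 \<rho>)) x \<partial>Pi\<^sub>M {..<k} (\<lambda>_. lborel))"
    unfolding mean_integral_def using W(2) by (intro nn_integral_mono mult_left_mono) (auto simp: indicator_def)
  also have "\<dots> \<le> fact k * ennreal (measure lborel (ball (0 :: real ^ 'n) \<rho>) ^ k)"
    by (rule nn_integral_intensity_PiE_le[OF ball_bounded])
  also have "\<dots> < \<infinity>"
    by (metis ennreal_less_top ennreal_mult_less_top ennreal_of_nat_eq_real_of_nat infinity_ennreal_def of_nat_fact)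
  finally show ?thesis .
qed

lemma field_mean: "(\<integral>w. field b w \<partial>M) = enn2real mean_integral"
  unfolding nn_integral_field[of b, symmetric]
  by (rule integral_eq_nn_integral[OF field_measurable]) (simp add: field_def)

lemma pair_event_split:
  "{x \<in> {..<k + k} \<rightarrow>\<^sub>E UNIV. (\<lambda>i\<in>{..<k}. x i) \<in> tuple_event k W b \<and> (\<lambda>i\<in>{..<k}. x (i + k)) \<in> tuple_event k W c}
    = {x \<in> {..<k + k} \<rightarrow>\<^sub>E UNIV. (\<lambda>i\<in>{..<k}. x i - b) \<in> W \<and> (\<lambda>i\<in>{..<k}. x (i + k) - c) \<in> W}"
proof -
  have "(\<lambda>i\<in>{..<k}. (\<lambda>i\<in>{..<k}. y i) i - d) = (\<lambda>i\<in>{..<k}. y i - d)" for y :: "nat \<Rightarrow> real ^ 'n" and d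
    by (auto simp: fun_eq_iff)
  from this[of "\<lambda>i. _ (i + k)"] this show ?thesis by (auto simp: tuple_event_def)
qed

lemma intensity_block_le:
  assumes e: "\<And>i j. i < k \<Longrightarrow> j < k \<Longrightarrow> cmod (K (x i - x (j + k))) \<le> \<epsilon>" and "0 \<le> \<epsilon>"
  shows "intensity (k + k) x \<le> intensity k (\<lambda>i\<in>{..<k}. x i - b) * intensity k (\<lambda>i\<in>{..<k}. x (i + k) - c) + fact (k + k) * \<epsilon>"
proof -
  have "intensity k (\<lambda>i\<in>{..<k}. x (i + k) - c) = cmod (permanent k (\<lambda>i j. K (x (i + k) - x (j + k))))"
    using intensity_shift[of k "\<lambda>i. x (i + k)" c] by (simp add: intensity_def)
  moreover have "intensity k (\<lambda>i\<in>{..<k}. x i - b) = cmod (permanent k (\<lambda>i j. K (x i - x j)))"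
    using intensity_shift[of k x b] by (simp add: intensity_def)
  ultimately show ?thesis
    unfolding intensity_def[of "k + k"]
    using norm_permanent_block_le[of k "\<lambda>i j. K (x i - x j)" \<epsilon>] norm_K_le_1 assms by simp
qed

text \<open>The windows are disjoint, so the product of the two counts is at most a count of
  2k-tuples, whose expectation is an integral of the 2k-point intensity. On the event this intensity
  is at most the product of the two k-point intensities plus (2k)! \<epsilon>.\<close>

lemma nn_integral_field_product_le:
  assumes far: "2 * \<rho> \<le> dist b c" and e: "\<And>x y. x \<in> ball b \<rho> \<Longrightarrow> y \<in> ball c \<rho> \<Longrightarrow> cmod (K (x - y)) \<le> \<epsilon>" and \<epsilon>: "0 \<le> \<epsilon>"
  shows "(\<integral>\<^sup>+ w. ennreal (field b w * field c w) \<partial>M) \<le>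
    mean_integral * mean_integral + ennreal (fact (k + k) * \<epsilon>) * (emeasure (Pi\<^sub>M {..<k} (\<lambda>_. lborel)) W * emeasure (Pi\<^sub>M {..<k} (\<lambda>_. lborel)) W)"
proof -
  let ?WW = "{x \<in> {..<k + k} \<rightarrow>\<^sub>E UNIV. (\<lambda>i\<in>{..<k}. x i - b) \<in> W \<and> (\<lambda>i\<in>{..<k}. x (i + k) - c) \<in> W}"
  have dj: "ball b \<rho> \<inter> ball c \<rho> = {}"
  proof (rule ccontr)
    assume "ball b \<rho> \<inter> ball c \<rho> \<noteq> {}"
    then obtain z where "dist b z < \<rho>" "dist c z < \<rho>" by auto
    then show False using far dist_triangle2[of b c z] by linarith
  qed
  have WWs: "?WW \<in> sets (Pi\<^sub>M {..<k + k} (\<lambda>_. borel))"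
  proof -
    let ?Q = "Pi\<^sub>M {..<k + k} (\<lambda>_. borel :: (real ^ 'n) measure)"
    have "((\<lambda>x. \<lambda>i\<in>{..<k}. x i - b) -` W \<inter> space ?Q) \<inter> ((\<lambda>x. \<lambda>i\<in>{..<k}. x (i + k) - c) -` W \<inter> space ?Q) \<in> sets ?Q"
      by (intro sets.Int measurable_sets[OF shift_measurable W(1)]) auto
    moreover have "?WW = ((\<lambda>x. \<lambda>i\<in>{..<k}. x i - b) -` W \<inter> space ?Q) \<inter> ((\<lambda>x. \<lambda>i\<in>{..<k}. x (i + k) - c) -` W \<inter> space ?Q)"
      by (auto simp: space_PiM)
    ultimately show ?thesis by simp
  qed
  have in_ball: "x i \<in> ball b \<rho>" "x (i + k) \<in> ball c \<rho>" if x: "x \<in> ?WW" and i: "i < k" for x i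
  proof -
    have r: "(\<lambda>i\<in>{..<k}. x i - b) \<in> Pi\<^sub>E {..<k} (\<lambda>_. ball 0 \<rho>)" "(\<lambda>i\<in>{..<k}. x (i + k) - c) \<in> Pi\<^sub>E {..<k} (\<lambda>_. ball 0 \<rho>)"
      using x W(2) by blast+
    show "x i \<in> ball b \<rho>" using PiE_mem[OF r(1), of i] i by (simp add: dist_norm norm_minus_commute)
    show "x (i + k) \<in> ball c \<rho>" using PiE_mem[OF r(2), of i] i by (simp add: dist_norm norm_minus_commute)
  qed
  have WWb: "?WW \<subseteq> Pi\<^sub>E {..<k + k} (\<lambda>_. ball b \<rho> \<union> ball c \<rho>)"
  proof
    fix x assume x: "x \<in> ?WW"
    have "x i \<in> ball b \<rho> \<union> ball c \<rho>" if "i < k + k" for i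
    proof (cases "i < k")
      case True
      then show ?thesis using in_ball(1)[OF x] by blast
    next
      case False
      then show ?thesis using in_ball(2)[OF x, of "i - k"] that by simp
    qed
    then show "x \<in> Pi\<^sub>E {..<k + k} (\<lambda>_. ball b \<rho> \<union> ball c \<rho>)" using x by (auto simp: PiE_iff)
  qed
  let ?G = "\<lambda>x. ennreal (intensity k x) * indicator W x" and ?I = "\<lambda>x. indicator W x :: ennreal"
  let ?C = "ennreal (fact (k + k) * \<epsilon>)"
  have Im: "?I \<in> borel_measurable (Pi\<^sub>M {..<k} (\<lambda>_. borel))" using W(1) by simp
  have [measurable]: "intensity k \<in> borel_measurable (Pi\<^sub>M {..<k} (\<lambda>_. borel))" by (rule intensity_measurable)
  have Gm: "?G \<in> borel_measurable (Pi\<^sub>M {..<k} (\<lambda>_. borel))" using Im by measurable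
  have "(\<integral>\<^sup>+ w. ennreal (field b w * field c w) \<partial>M) \<le> (\<integral>\<^sup>+ w. of_nat (card (factorial_tuples (k + k) (\<omega> w) ?WW)) \<partial>M)"
  proof (rule nn_integral_mono)
    fix w assume w: "w \<in> space M"
    have "card (factorial_tuples k (\<omega> w) (tuple_event k W b)) * card (factorial_tuples k (\<omega> w) (tuple_event k W c))
      \<le> card (factorial_tuples (k + k) (\<omega> w) ?WW)"
      using card_factorial_tuples_mult_le[where \<mu>="\<omega> w" and A="ball b \<rho>" and A'="ball c \<rho>" and k=k and B="tuple_event k W b" and B'="tuple_event k W c"]
        configuration[OF w] ball_bounded[of b] ball_bounded[of c] tuple_event_subset[OF W(2), of b] tuple_event_subset[OF W(2), of c] dj
      by (simp only: pair_event_split[of b c])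
    then have "field b w * field c w \<le> real (card (factorial_tuples (k + k) (\<omega> w) ?WW))"
      unfolding field_def of_nat_mult[symmetric] by (rule of_nat_mono)
    then show "ennreal (field b w * field c w) \<le> of_nat (card (factorial_tuples (k + k) (\<omega> w) ?WW))"
      by (simp add: ennreal_of_nat_eq_real_of_nat ennreal_leI)
  qed
  also have "\<dots> = (\<integral>\<^sup>+ x. ennreal (intensity (k + k) x) * indicator ?WW x \<partial>Pi\<^sub>M {..<k + k} (\<lambda>_. lborel))"
    using k by (intro expected_card[OF _ WWs WWb]) auto
  also have "\<dots> \<le> (\<integral>\<^sup>+ x. ?G (\<lambda>i\<in>{..<k}. x i - b) * ?G (\<lambda>i\<in>{..<k}. x (i + k) - c)
      + ?C * (?I (\<lambda>i\<in>{..<k}. x i - b) * ?I (\<lambda>i\<in>{..<k}. x (i + k) - c)) \<partial>Pi\<^sub>M {..<k + k} (\<lambda>_. lborel))"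
  proof (rule nn_integral_mono)
    fix x
    show "ennreal (intensity (k + k) x) * indicator ?WW x \<le> ?G (\<lambda>i\<in>{..<k}. x i - b) * ?G (\<lambda>i\<in>{..<k}. x (i + k) - c)
      + ?C * (?I (\<lambda>i\<in>{..<k}. x i - b) * ?I (\<lambda>i\<in>{..<k}. x (i + k) - c))"
    proof (cases "x \<in> ?WW")
      case True
      then have m: "(\<lambda>i\<in>{..<k}. x i - b) \<in> W" "(\<lambda>i\<in>{..<k}. x (i + k) - c) \<in> W" by blast+
      have "intensity (k + k) x \<le> intensity k (\<lambda>i\<in>{..<k}. x i - b) * intensity k (\<lambda>i\<in>{..<k}. x (i + k) - c) + fact (k + k) * \<epsilon>"
        using in_ball[OF True] by (intro intensity_block_le e \<epsilon>) auto
      then have "ennreal (intensity (k + k) x) \<le> ennreal (intensity k (\<lambda>i\<in>{..<k}. x i - b)) * ennreal (intensity k (\<lambda>i\<in>{..<k}. x (i + k) - c)) + ?C"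
        using \<epsilon> by (simp add: ennreal_leI ennreal_mult[symmetric] ennreal_plus[symmetric] intensity_nonneg del: ennreal_plus)
      then show ?thesis using True by (simp only: indicator_simps(1)[OF m(1)] indicator_simps(1)[OF m(2)] indicator_simps(1)[OF True] mult_1_right)
    next
      case False
      show ?thesis unfolding indicator_simps(2)[OF False] mult_zero_right by (rule zero_le)
    qed
  qed
  also have "\<dots> = (\<integral>\<^sup>+ x. ?G (\<lambda>i\<in>{..<k}. x i - b) * ?G (\<lambda>i\<in>{..<k}. x (i + k) - c) \<partial>Pi\<^sub>M {..<k + k} (\<lambda>_. lborel))
      + ?C * (\<integral>\<^sup>+ x. ?I (\<lambda>i\<in>{..<k}. x i - b) * ?I (\<lambda>i\<in>{..<k}. x (i + k) - c) \<partial>Pi\<^sub>M {..<k + k} (\<lambda>_. lborel))"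
  proof -
    have s1: "(\<lambda>x. \<lambda>i\<in>{..<k}. x i - b) \<in> measurable (Pi\<^sub>M {..<k + k} (\<lambda>_. lborel)) (Pi\<^sub>M {..<k} (\<lambda>_. borel))"
      "(\<lambda>x. \<lambda>i\<in>{..<k}. x (i + k) - c) \<in> measurable (Pi\<^sub>M {..<k + k} (\<lambda>_. lborel)) (Pi\<^sub>M {..<k} (\<lambda>_. borel))"
      unfolding measurable_cong_sets[OF sets_PiM_lborel refl] by (rule shift_measurable, simp)+
    note m = measurable_compose[OF s1(1) Gm] measurable_compose[OF s1(2) Gm] measurable_compose[OF s1(1) Im] measurable_compose[OF s1(2) Im]
    show ?thesis
      by (subst nn_integral_add, intro borel_measurable_times_ennreal m,
          intro borel_measurable_times_ennreal borel_measurable_const m,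
          subst nn_integral_cmult, intro borel_measurable_times_ennreal m, rule refl)
  qed
  also have "(\<integral>\<^sup>+ x. ?G (\<lambda>i\<in>{..<k}. x i - b) * ?G (\<lambda>i\<in>{..<k}. x (i + k) - c) \<partial>Pi\<^sub>M {..<k + k} (\<lambda>_. lborel)) = mean_integral * mean_integral"
    unfolding mean_integral_def by (rule nn_integral_product_split[OF Gm Gm])
  also have "(\<integral>\<^sup>+ x. ?I (\<lambda>i\<in>{..<k}. x i - b) * ?I (\<lambda>i\<in>{..<k}. x (i + k) - c) \<partial>Pi\<^sub>M {..<k + k} (\<lambda>_. lborel))
    = emeasure (Pi\<^sub>M {..<k} (\<lambda>_. lborel)) W * emeasure (Pi\<^sub>M {..<k} (\<lambda>_. lborel)) W"
    unfolding nn_integral_product_split[OF Im Im] using W(1) by (simp add: sets_PiM_lborel)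
  finally show ?thesis .
qed

lemma field_mixing:
  assumes "0 < \<epsilon>"
  shows "\<exists>R. \<forall>b\<in>lattice. \<forall>c\<in>lattice. R \<le> dist b c \<longrightarrow> (\<integral>w. field b w * field c w \<partial>M) \<le> (enn2real mean_integral)\<^sup>2 + \<epsilon>"
proof -
  let ?v = "emeasure (Pi\<^sub>M {..<k} (\<lambda>_. lborel :: (real ^ 'n) measure)) W"
  have "?v \<le> emeasure (Pi\<^sub>M {..<k} (\<lambda>_. lborel)) (Pi\<^sub>E {..<k} (\<lambda>_. ball (0 :: real ^ 'n) \<rho>))"
    using W(2) by (intro emeasure_mono) (auto intro!: sets_PiM_I_finite)
  also have "\<dots> = (\<Prod>i<k. emeasure lborel (ball (0 :: real ^ 'n) \<rho>))"
    by (subst lborel_product.emeasure_PiM) auto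
  also have "\<dots> < \<infinity>"
    using emeasure_lborel_ball_finite[of "0 :: real ^ 'n" \<rho>] by (simp add: power_less_top_ennreal)
  finally have v: "?v = ennreal (enn2real ?v)" by (simp add: ennreal_enn2real_if)
  define V where "V = enn2real ?v"
  have V: "?v = ennreal V" "0 \<le> V" using v by (auto simp: V_def)
  have m: "mean_integral = ennreal (enn2real mean_integral)" using mean_integral_finite by (simp add: ennreal_enn2real_if)
  \<comment> \<open>Makes the error (2k)! \<delta> V^2 at most \<epsilon>; the summand 1 keeps the
    denominator positive when V = 0.\<close>
  define \<delta> where "\<delta> = \<epsilon> / (fact (k + k) * (V * V + 1))"
  have C: "0 < fact (k + k) * (V * V + 1)" by (intro mult_pos_pos add_nonneg_pos) auto
  have \<delta>: "0 < \<delta>" unfolding \<delta>_def using assms C by (rule divide_pos_pos)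
  have \<delta>2: "fact (k + k) * \<delta> * (V * V) \<le> \<epsilon>"
  proof -
    have "fact (k + k) * \<delta> * (V * V) \<le> \<delta> * (fact (k + k) * (V * V + 1))"
      using \<delta> by (simp add: algebra_simps)
    also have "\<dots> = \<epsilon>" unfolding \<delta>_def by (rule nonzero_eq_divide_eq[THEN iffD1, OF less_imp_neq[OF C, symmetric] refl])
    finally show ?thesis .
  qed
  obtain R where R: "\<And>x. R \<le> norm x \<Longrightarrow> cmod (K x) \<le> \<delta>" using K_vanishes[OF \<delta>] by blast
  \<comment> \<open>Taking 2 \<rho> off the distance of the centres leaves at least R between any
    two points of the windows; \<open>max 0 R\<close> ensures in addition that the windows are
    disjoint.\<close>
  have "(\<integral>w. field b w * field c w \<partial>M) \<le> (enn2real mean_integral)\<^sup>2 + \<epsilon>" if bc: "max 0 R + 2 * \<rho> \<le> dist b c" for b c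
  proof -
    have far: "2 * \<rho> \<le> dist b c" using bc by linarith
    have e: "cmod (K (x - y)) \<le> \<delta>" if "x \<in> ball b \<rho>" "y \<in> ball c \<rho>" for x y
    proof (rule R)
      have "dist b c \<le> dist b x + dist x y + dist y c"
        using dist_triangle[of b c x] dist_triangle[of x c y] by linarith
      then show "R \<le> norm (x - y)" using that bc by (simp add: dist_norm norm_minus_commute)
    qed
    have "(\<integral>w. field b w * field c w \<partial>M) = enn2real (\<integral>\<^sup>+ w. ennreal (field b w * field c w) \<partial>M)"
      by (rule integral_eq_nn_integral[OF borel_measurable_times[OF field_measurable field_measurable]]) (simp add: field_def)
    also have "\<dots> \<le> (enn2real mean_integral)\<^sup>2 + \<epsilon>"
    proof (rule enn2real_leI)
      show "0 \<le> (enn2real mean_integral)\<^sup>2 + \<epsilon>" using assms by simp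
      have "(\<integral>\<^sup>+ w. ennreal (field b w * field c w) \<partial>M) \<le> mean_integral * mean_integral + ennreal (fact (k + k) * \<delta>) * (?v * ?v)"
        by (rule nn_integral_field_product_le[OF far e]) (use \<delta> in auto)
      also have "\<dots> = ennreal (enn2real mean_integral * enn2real mean_integral + fact (k + k) * \<delta> * (V * V))"
        unfolding V(1) using \<delta> V(2) by (subst (1 2) m) (simp add: ennreal_mult[symmetric] ennreal_plus[symmetric] del: ennreal_plus)
      also have "\<dots> \<le> ennreal ((enn2real mean_integral)\<^sup>2 + \<epsilon>)"
        using \<delta>2 by (intro ennreal_leI) (simp add: power2_eq_square)
      finally show "(\<integral>\<^sup>+ w. ennreal (field b w * field c w) \<partial>M) \<le> ennreal ((enn2real mean_integral)\<^sup>2 + \<epsilon>)" .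
    qed
    finally show ?thesis .
  qed
  then show ?thesis by blast
qed

theorem field_average:
  "AE w in M. (\<lambda>n. (\<Sum>c\<in>lattice_ball (real n). field c w) / ball_vol TYPE('n) (real n)) \<longlonglongrightarrow> enn2real mean_integral"
proof -
  have "mixing_field M field (enn2real mean_integral)"
    by (intro mixing_field.intro mixing_field_axioms.intro prob_space_axioms stationary_field_field
        field_square_integrable field_mean field_mixing) (simp_all add: field_def)
  then show ?thesis by (rule mixing_field.lattice_ergodic)
qed

end

section \<open>Vague convergence\<close>

text \<open>The value t (n + s) lies between u n and u (n + 2 s). All three may be divided by the
  same volume, since the ratio of the volumes at radii that differ by a fixed amount tends to
  1.\<close>

lemma mean_tendsto_of_interlacing:
  fixes u t :: "nat \<Rightarrow> real"
  assumes u: "(\<lambda>n. u n / ball_vol TYPE('n::finite) (real n)) \<longlonglongrightarrow> m"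
    and ut: "\<And>n. u n \<le> t (n + s)" and tu: "\<And>n. t n \<le> u (n + s)"
  shows "(\<lambda>n. t n / ball_vol TYPE('n) (real n)) \<longlonglongrightarrow> m"
proof -
  let ?v = "\<lambda>n. ball_vol TYPE('n) (real n)"
  have r: "(\<lambda>n. ?v (n + s) / ?v n) \<longlonglongrightarrow> 1"
    using ball_vol_ratio_tendsto[where 'n='n, of "real s"] by simp
  have lower: "(\<lambda>n. u n / ?v n / (?v (n + s) / ?v n)) \<longlonglongrightarrow> m"
    using tendsto_divide[OF u r] by simp
  have lower_le: "eventually (\<lambda>n. u n / ?v n / (?v (n + s) / ?v n) \<le> t (n + s) / ?v (n + s)) sequentially"
    using eventually_gt_at_top[of 0]
  proof eventually_elim
    case (elim n)
    then have "0 < ?v n" by (intro ball_vol_pos) simp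
    then have "u n / ?v n / (?v (n + s) / ?v n) = u n / ?v (n + s)" by simp
    also have "\<dots> \<le> t (n + s) / ?v (n + s)" by (intro divide_right_mono ut) simp
    finally show ?case .
  qed
  have upper: "(\<lambda>n. u (n + s + s) / ?v (n + s + s) * (?v (n + s + s) / ?v (n + s))) \<longlonglongrightarrow> m"
    using tendsto_mult[OF LIMSEQ_ignore_initial_segment[OF u, of "s + s"] LIMSEQ_ignore_initial_segment[OF r, of s]]
    by (simp only: add.assoc mult_1_right)
  have upper_ge: "eventually (\<lambda>n. t (n + s) / ?v (n + s) \<le> u (n + s + s) / ?v (n + s + s) * (?v (n + s + s) / ?v (n + s))) sequentially"
    using eventually_gt_at_top[of 0]
  proof eventually_elim
    case (elim n)
    then have "0 < ?v (n + s + s)" by (intro ball_vol_pos) simp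
    then have "u (n + s + s) / ?v (n + s + s) * (?v (n + s + s) / ?v (n + s)) = u (n + s + s) / ?v (n + s)" by simp
    moreover have "t (n + s) / ?v (n + s) \<le> u (n + s + s) / ?v (n + s)" by (intro divide_right_mono tu) simp
    ultimately show ?case by linarith
  qed
  from lower_le upper_ge lower upper have "(\<lambda>n. t (n + s) / ?v (n + s)) \<longlonglongrightarrow> m" by (rule real_tendsto_sandwich)
  then show ?thesis by (rule LIMSEQ_offset)
qed

lemma norm_diff_floor_vec_le: "norm (x - floor_vec x :: real ^ 'n) \<le> real CARD('n)"
  by (rule norm_diff_lattice_cube[OF mem_lattice_cube_floor_vec])

text \<open>By uniform continuity f is within \<epsilon> of a step function on finitely many cells
  of a fine grid, for which the convergence is the assumption on cells. The error is at most
  \<epsilon> times the number of sample points in these cells, whose normalised limit is bounded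
  independently of the mesh.\<close>

lemma vague_convergence_of_dyadic_cells:
  fixes d :: "'i \<Rightarrow> real ^ 'n" and S :: "nat \<Rightarrow> 'i set" and v :: "nat \<Rightarrow> real" and \<alpha> :: "(real ^ 'n) measure"
  assumes S: "\<And>n. finite (S n)" and v: "\<And>n. 0 \<le> v n"
    and \<alpha>: "locally_finite_measure \<alpha>"
    and cells: "\<And>j z. z \<in> lattice \<Longrightarrow>
      (\<lambda>n. real (card {s \<in> S n. d s \<in> dyadic_cell j z}) / v n) \<longlonglongrightarrow> measure \<alpha> (dyadic_cell j z)"
    and f: "continuous_on UNIV f" "compact (closure {x. f x \<noteq> 0})"
  shows "(\<lambda>n. (\<Sum>s\<in>S n. f (d s)) / v n) \<longlonglongrightarrow> (\<integral>x. (f x :: real) \<partial>\<alpha>)"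
proof -
  let ?C = "real CARD('n)"
  let ?A = "\<lambda>n h. (\<Sum>s\<in>S n. h (d s) :: real) / v n"
  have sets: "sets \<alpha> = sets borel" and fin: "\<And>A. A \<in> sets borel \<Longrightarrow> bounded A \<Longrightarrow> emeasure \<alpha> A < \<infinity>"
    using \<alpha> by (auto simp: locally_finite_measure_def)
  have [measurable_cong]: "sets \<alpha> = sets borel" by (rule sets)
  have "bounded {x. f x \<noteq> 0}"
    using compact_imp_bounded[OF f(2)] bounded_subset closure_subset by blast
  then obtain r where r: "0 < r" "\<And>x. f x \<noteq> 0 \<Longrightarrow> norm x < r"
    unfolding bounded_pos_less by auto
  \<comment> \<open>Corners of the cells used lie within r + d / 2^j of the origin and the cells add
    at most d / 2^j, so this ball contains them for every mesh j.\<close>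
  define Q where "Q = measure \<alpha> (ball 0 (r + 2 * ?C))"
  have cell_bound: "norm (x - (1 / 2 ^ j) *\<^sub>R floor_vec ((2 ^ j) *\<^sub>R x)) \<le> ?C / 2 ^ j" for j and x :: "real ^ 'n"
  proof -
    have "x - (1 / 2 ^ j) *\<^sub>R floor_vec ((2 ^ j) *\<^sub>R x) = (1 / 2 ^ j) *\<^sub>R ((2 ^ j) *\<^sub>R x - floor_vec ((2 ^ j) *\<^sub>R x))"
      by (simp add: scaleR_diff_right)
    then have "norm (x - (1 / 2 ^ j) *\<^sub>R floor_vec ((2 ^ j) *\<^sub>R x)) = norm ((2 ^ j) *\<^sub>R x - floor_vec ((2 ^ j) *\<^sub>R x)) / 2 ^ j" by simp
    also have "\<dots> \<le> ?C / 2 ^ j" by (intro divide_right_mono norm_diff_floor_vec_le) simp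
    finally show ?thesis .
  qed
  have C_le: "?C / 2 ^ j \<le> ?C" for j
    using mult_left_mono[of 1 "2 ^ j" ?C] by (simp add: divide_le_eq)
  have cell_bounded: "bounded (dyadic_cell j z)" for j and z :: "real ^ 'n"
    unfolding bounded_iff
  proof (intro exI ballI)
    fix x assume "x \<in> dyadic_cell j z"
    then have "norm (x - (1 / 2 ^ j) *\<^sub>R z) \<le> ?C" using cell_bound[of x j] C_le[of j] by (simp add: dyadic_cell_def)
    then show "norm x \<le> ?C + norm ((1 / 2 ^ j) *\<^sub>R z)" using norm_triangle_sub[of x "(1 / 2 ^ j) *\<^sub>R z"] by linarith
  qed
  have cell_fin: "emeasure \<alpha> (dyadic_cell j z) < \<infinity>" for j z by (intro fin dyadic_cell_measurable cell_bounded)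
  \<comment> \<open>The error has three parts: \<epsilon> (Q + 1) from replacing f by the step
    function in the sums, \<epsilon> Q from the same replacement under \<alpha>, and \<epsilon> from
    the convergence for the step function.\<close>
  have close: "eventually (\<lambda>n. \<bar>?A n f - (\<integral>x. f x \<partial>\<alpha>)\<bar> \<le> \<epsilon> * (2 * Q + 1) + \<epsilon>) sequentially" if \<epsilon>: "0 < \<epsilon>" for \<epsilon>
  proof -
    have "uniformly_continuous_on (cball 0 (r + 2 * ?C)) f"
      by (intro compact_uniformly_continuous continuous_on_subset[OF f(1)]) auto
    then obtain \<delta> where \<delta>: "0 < \<delta>" "\<And>x y. x \<in> cball 0 (r + 2 * ?C) \<Longrightarrow> y \<in> cball 0 (r + 2 * ?C) \<Longrightarrow> dist x y < \<delta> \<Longrightarrow> dist (f x) (f y) < \<epsilon>"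
      using \<epsilon> unfolding uniformly_continuous_on_def by metis
    obtain j :: nat where "(1 / 2) ^ j < \<delta> / ?C"
      using real_arch_pow_inv[of "\<delta> / ?C" "1 / 2"] \<delta>(1) by auto
    then have j: "?C / 2 ^ j < \<delta>" by (simp add: field_simps power_divide)
    \<comment> \<open>Contains the index of every cell that meets the ball of radius r, outside
      which f vanishes.\<close>
    define Z where "Z = lattice_ball (2 ^ j * r + ?C :: real) \<inter> (UNIV :: (real ^ 'n) set)"
    have Z: "finite Z" "Z \<subseteq> lattice" using lattice_ball_subset by (auto simp: Z_def)
    let ?q = "\<lambda>x :: real ^ 'n. floor_vec ((2 ^ j) *\<^sub>R x)"
    let ?step = "\<lambda>c x. \<Sum>z\<in>Z. c z * indicator (dyadic_cell j z) x :: real"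
    have step: "?step c x = (if ?q x \<in> Z then c (?q x) else 0)" for c x
    proof -
      have "?step c x = (\<Sum>z\<in>Z. if z = ?q x then c z else 0)"
        by (intro sum.cong) (auto simp: dyadic_cell_def)
      then show ?thesis using Z(1) by (simp add: sum.delta)
    qed
    have step_integrable: "integrable \<alpha> (?step c)" for c
      using cell_fin by (intro Bochner_Integration.integrable_sum integrable_mult_right integrable_real_indicator) (auto simp: sets)
    have step_integral: "(\<integral>x. ?step c x \<partial>\<alpha>) = (\<Sum>z\<in>Z. c z * measure \<alpha> (dyadic_cell j z))" for c
      using cell_fin
      by (subst Bochner_Integration.integral_sum) (auto simp: sets intro!: integrable_mult_right integrable_real_indicator)
    have step_tendsto: "(\<lambda>n. ?A n (?step c)) \<longlonglongrightarrow> (\<integral>x. ?step c x \<partial>\<alpha>)" for c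
    proof -
      have "?A n (?step c) = (\<Sum>z\<in>Z. c z * (real (card {s \<in> S n. d s \<in> dyadic_cell j z}) / v n))" for n
      proof -
        have "(\<Sum>s\<in>S n. ?step c (d s)) = (\<Sum>z\<in>Z. c z * (\<Sum>s\<in>S n. indicator (dyadic_cell j z) (d s)))"
          by (subst sum.swap) (simp add: sum_distrib_left)
        also have "(\<lambda>z. \<Sum>s\<in>S n. indicator (dyadic_cell j z) (d s) :: real) = (\<lambda>z. real (card {s \<in> S n. d s \<in> dyadic_cell j z}))"
          using S by (auto simp: indicator_def sum.If_cases Int_def)
        finally show ?thesis by (simp add: sum_divide_distrib)
      qed
      then show ?thesis unfolding step_integral
        by (simp only:) (intro tendsto_sum tendsto_mult tendsto_const cells, use Z(2) in auto)
    qed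
    define g where "g = ?step (\<lambda>z. f ((1 / 2 ^ j) *\<^sub>R z))"
    \<comment> \<open>Indicator of the union of the cells in use; it measures where f and its step
      approximation may differ.\<close>
    define h where "h = ?step (\<lambda>z. 1)"
    have gh: "\<bar>f x - g x\<bar> \<le> \<epsilon> * h x" for x
    proof (cases "?q x \<in> Z")
      case True
      have b: "norm (x - (1 / 2 ^ j) *\<^sub>R ?q x) \<le> ?C / 2 ^ j" by (rule cell_bound)
      have "norm (?q x) < 2 ^ j * r + ?C" using True by (simp add: Z_def lattice_ball_def)
      then have "norm ((1 / 2 ^ j) *\<^sub>R ?q x) < r + ?C / 2 ^ j" by (simp add: field_simps)
      then have "(1 / 2 ^ j) *\<^sub>R ?q x \<in> cball 0 (r + 2 * ?C)" "x \<in> cball 0 (r + 2 * ?C)"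
        using b C_le[of j] norm_triangle_sub[of x "(1 / 2 ^ j) *\<^sub>R ?q x"] unfolding mem_cball_0 by linarith+
      then have "dist (f x) (f ((1 / 2 ^ j) *\<^sub>R ?q x)) < \<epsilon>"
        using b j by (intro \<delta>(2)) (auto simp: dist_norm)
      then show ?thesis using True unfolding g_def h_def step by (simp add: dist_real_def)
    next
      case False
      have "f x = 0"
      proof (rule ccontr)
        assume "f x \<noteq> 0"
        then have "norm ((2 ^ j) *\<^sub>R x) < 2 ^ j * r" using r(2)[of x] by simp
        then have "norm (?q x) < 2 ^ j * r + ?C"
          using norm_diff_floor_vec_le[of "(2 ^ j) *\<^sub>R x"] norm_triangle_sub[of "?q x" "(2 ^ j) *\<^sub>R x"]
            norm_minus_commute[of "?q x" "(2 ^ j) *\<^sub>R x"]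
          by linarith
        then show False using False by (simp add: Z_def lattice_ball_def)
      qed
      then show ?thesis using False unfolding g_def h_def step by simp
    qed
    have h_le: "h x \<le> indicator (ball 0 (r + 2 * ?C)) x" for x
    proof (cases "?q x \<in> Z")
      case True
      have b: "norm (x - (1 / 2 ^ j) *\<^sub>R ?q x) \<le> ?C / 2 ^ j" by (rule cell_bound)
      have "norm (?q x) < 2 ^ j * r + ?C" using True by (simp add: Z_def lattice_ball_def)
      then have "norm ((1 / 2 ^ j) *\<^sub>R ?q x) < r + ?C / 2 ^ j" by (simp add: field_simps)
      then have "x \<in> ball 0 (r + 2 * ?C)"
        using b C_le[of j] norm_triangle_sub[of x "(1 / 2 ^ j) *\<^sub>R ?q x"] unfolding mem_ball_0 by linarith
      then show ?thesis using True unfolding h_def step by simp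
    next
      case False
      then show ?thesis unfolding h_def step by simp
    qed
    have gi: "integrable \<alpha> g" and hi: "integrable \<alpha> h" unfolding g_def h_def by (rule step_integrable)+
    have fm: "f \<in> borel_measurable \<alpha>"
      using borel_measurable_continuous_onI[OF f(1)] by (simp cong: measurable_cong_sets)
    have "integrable \<alpha> (\<lambda>x. f x - g x)"
      by (rule Bochner_Integration.integrable_bound[OF integrable_mult_right[OF hi, of \<epsilon>]])
        (use fm gi gh in \<open>auto intro!: AE_I2 order_trans[OF gh]\<close>)
    from Bochner_Integration.integrable_add[OF this gi] have fi: "integrable \<alpha> f" by simp
    have hQ: "(\<integral>x. h x \<partial>\<alpha>) \<le> Q"
    proof -
      have "(\<integral>x. h x \<partial>\<alpha>) \<le> (\<integral>x. indicator (ball 0 (r + 2 * ?C)) x \<partial>\<alpha>)"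
        using fin[of "ball 0 (r + 2 * ?C)"] by (intro integral_mono hi h_le integrable_real_indicator) (auto simp: sets)
      then show ?thesis by (simp add: Q_def)
    qed
    have fg: "\<bar>(\<integral>x. f x \<partial>\<alpha>) - (\<integral>x. g x \<partial>\<alpha>)\<bar> \<le> \<epsilon> * Q"
    proof -
      have "\<bar>(\<integral>x. f x \<partial>\<alpha>) - (\<integral>x. g x \<partial>\<alpha>)\<bar> = \<bar>\<integral>x. f x - g x \<partial>\<alpha>\<bar>" using fi gi by simp
      also have "\<dots> \<le> (\<integral>x. \<bar>f x - g x\<bar> \<partial>\<alpha>)" by (rule integral_abs_bound)
      also have "\<dots> \<le> (\<integral>x. \<epsilon> * h x \<partial>\<alpha>)" by (intro integral_mono gh) (use fi gi hi in auto)
      also have "\<dots> \<le> \<epsilon> * Q" using hQ \<epsilon> by simp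
      finally show ?thesis .
    qed
    have Afg: "\<bar>?A n f - ?A n g\<bar> \<le> \<epsilon> * ?A n h" for n
    proof -
      have "\<bar>?A n f - ?A n g\<bar> = \<bar>\<Sum>s\<in>S n. f (d s) - g (d s)\<bar> / v n"
        using v[of n] by (simp add: sum_subtractf diff_divide_distrib[symmetric] abs_divide)
      also have "\<dots> \<le> (\<Sum>s\<in>S n. \<epsilon> * h (d s)) / v n"
        by (intro divide_right_mono v order_trans[OF sum_abs] sum_mono gh)
      finally show ?thesis by (simp add: sum_distrib_left)
    qed
    have "eventually (\<lambda>n. \<bar>?A n g - (\<integral>x. g x \<partial>\<alpha>)\<bar> < \<epsilon>) sequentially"
      using tendstoD[OF step_tendsto \<epsilon>] unfolding g_def dist_real_def .
    moreover have "eventually (\<lambda>n. ?A n h < Q + 1) sequentially"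
      using order_tendstoD(2)[OF step_tendsto[of "\<lambda>_. 1"], of "Q + 1"] hQ unfolding h_def by simp
    ultimately show ?thesis
    proof eventually_elim
      case (elim n)
      have "\<epsilon> * ?A n h \<le> \<epsilon> * (Q + 1)" by (rule mult_left_mono[OF less_imp_le[OF elim(2)] less_imp_le[OF \<epsilon>]])
      then show ?case using elim(1) Afg[of n] fg by (simp add: algebra_simps)
    qed
  qed
  have Q: "0 \<le> Q" by (simp add: Q_def)
  show ?thesis
  proof (rule tendstoI)
    fix e :: real assume e: "0 < e"
    define \<epsilon> where "\<epsilon> = e / (2 * Q + 3)"
    have pos: "0 < \<epsilon>" using e Q by (simp add: \<epsilon>_def)
    have "\<epsilon> * (2 * Q + 3) = e" using Q by (simp add: \<epsilon>_def)
    then have "\<epsilon> * (2 * Q + 1) + \<epsilon> < e" using pos by (simp only: distrib_left)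
    with pos show "eventually (\<lambda>n. dist (?A n f) (\<integral>x. f x \<partial>\<alpha>) < e) sequentially"
      using close[of \<epsilon>] by (auto elim!: eventually_mono simp: dist_real_def)
  qed
qed

section \<open>The autocorrelation approximants as sums over pairs of points\<close>

lemma restricted_to_eq_distr:
  assumes \<mu>: "point_configuration (\<mu> :: (real ^ 'n) measure)" and B: "B \<in> sets borel" "bounded B"
  shows "restricted_to \<mu> B = distr (count_space (points_in \<mu> B)) borel fst"
proof (rule measure_eqI)
  have s: "sets \<mu> = sets borel" using \<mu> by (simp add: point_configuration_def locally_finite_measure_def)
  then show "sets (restricted_to \<mu> B) = sets (distr (count_space (points_in \<mu> B)) borel fst)"
    by (simp add: restricted_to_def)
  fix A assume "A \<in> sets (restricted_to \<mu> B)"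
  then have A: "A \<in> sets borel" using s by (simp add: restricted_to_def)
  have "emeasure (restricted_to \<mu> B) A = (\<integral>\<^sup>+x. indicator (A \<inter> B) x \<partial>\<mu>)"
    unfolding restricted_to_def using A B s
    by (subst emeasure_density) (auto simp: indicator_inter_arith[symmetric] Int_commute)
  also have "\<dots> = of_nat (card (points_in \<mu> (A \<inter> B)))"
    using A B s emeasure_eq_card_points_in[OF \<mu>, of "A \<inter> B"] bounded_subset[OF B(2)] by simp
  also have "points_in \<mu> (A \<inter> B) = fst -` A \<inter> points_in \<mu> B" by (auto simp: points_in_def)
  also have "of_nat (card (fst -` A \<inter> points_in \<mu> B)) = emeasure (distr (count_space (points_in \<mu> B)) borel fst) A"
    using A finite_points_in[OF \<mu> B] by (subst emeasure_distr) auto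
  finally show "emeasure (restricted_to \<mu> B) A = emeasure (distr (count_space (points_in \<mu> B)) borel fst) A" .
qed

text \<open>Convolving a finite sum of Dirac masses with its reflection gives one Dirac mass at the
  difference of each ordered pair. Boundedness of B makes the sum finite, which the product measure
  requires.\<close>

lemma convolution_reflected_restricted_to:
  assumes \<mu>: "point_configuration (\<mu> :: (real ^ 'n) measure)" and B: "B \<in> sets borel" "bounded B"
  shows "(restricted_to \<mu> B \<star> reflected (restricted_to \<mu> B))
    = distr (count_space (pairs_in \<mu> (B \<times> B))) borel (\<lambda>s. fst (fst s) - fst (snd s))"
proof -
  let ?P = "points_in \<mu> B"
  have fin: "finite ?P" by (rule finite_points_in[OF \<mu> B])
  have r: "reflected (restricted_to \<mu> B) = distr (count_space ?P) borel (\<lambda>p. - fst p)"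
    unfolding reflected_def restricted_to_eq_distr[OF \<mu> B] by (subst distr_distr) (auto simp: o_def)
  have "finite_measure (distr (count_space ?P) borel (\<lambda>p. - fst p))"
    by (rule finite_measure.finite_measure_distr[OF finite_measure_count_space[OF fin]]) simp
  then have sf: "sigma_finite_measure (distr (count_space ?P) borel (\<lambda>p. - fst p))"
    by (rule finite_measure.axioms)
  have "(restricted_to \<mu> B \<star> reflected (restricted_to \<mu> B))
    = distr (distr (count_space ?P \<Otimes>\<^sub>M count_space ?P) (borel \<Otimes>\<^sub>M borel) (\<lambda>(p, q). (fst p, - fst q))) borel (\<lambda>(x, y). x + y)"
    unfolding convolution_def restricted_to_eq_distr[OF \<mu> B] r[unfolded restricted_to_eq_distr[OF \<mu> B]]
    by (subst pair_measure_distr[OF _ _ sf]) auto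
  also have "\<dots> = distr (count_space (?P \<times> ?P)) borel (\<lambda>s. fst (fst s) - fst (snd s))"
    unfolding pair_measure_count_space[OF fin fin]
    by (subst distr_distr) (auto simp: o_def split_beta' space_pair_measure)
  finally show ?thesis by (simp add: pairs_in_times)
qed

lemma integral_scale_measure_ennreal:
  fixes f :: "'a \<Rightarrow> real"
  assumes "0 \<le> c" and f: "f \<in> borel_measurable M"
  shows "integral\<^sup>L (scale_measure (ennreal c) M) f = c * integral\<^sup>L M f"
proof -
  have "scale_measure (ennreal c) M = density M (\<lambda>_. ennreal c)"
    by (rule measure_eqI) (auto simp: emeasure_density_const)
  then show ?thesis using assms by (simp add: integral_density)
qed

lemma integral_autocorrelation_approximant:
  assumes \<mu>: "point_configuration (\<mu> :: (real ^ 'n) measure)" and n: "0 < n" and f: "f \<in> borel_measurable borel"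
  shows "integral\<^sup>L (scale_measure (inverse (emeasure lborel (ball (0 :: real ^ 'n) (real n))))
      (restricted_to \<mu> (ball 0 (real n)) \<star> reflected (restricted_to \<mu> (ball 0 (real n))))) f
    = (\<Sum>s\<in>pairs_in \<mu> (ball 0 (real n) \<times> ball 0 (real n)). f (fst (fst s) - fst (snd s)) :: real) / ball_vol TYPE('n) (real n)"
proof -
  let ?B = "ball (0 :: real ^ 'n) (real n)"
  have v: "0 < ball_vol TYPE('n) (real n)" using n by (intro ball_vol_pos) simp
  have B: "?B \<in> sets borel" "bounded ?B" by auto
  have fin: "finite (pairs_in \<mu> (?B \<times> ?B))" by (rule finite_pairs_in[OF \<mu> B order_refl])
  have "inverse (emeasure lborel ?B) = ennreal (1 / ball_vol TYPE('n) (real n))"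
    unfolding emeasure_ball_ball_vol using v by (simp add: inverse_ennreal inverse_eq_divide)
  then show ?thesis
    unfolding convolution_reflected_restricted_to[OF \<mu> B]
    using f v fin by (simp add: integral_scale_measure_ennreal integral_distr lebesgue_integral_count_space_finite)
qed

section \<open>The autocorrelation of a permanental process\<close>

lemma nn_integral_lborel_reflect:
  fixes a :: "real ^ 'n"
  assumes f: "f \<in> borel_measurable borel"
  shows "(\<integral>\<^sup>+b. f (a - b) \<partial>lborel) = (\<integral>\<^sup>+b. f b \<partial>lborel)"
proof -
  have "lborel = density (distr lborel borel (\<lambda>x :: real ^ 'n. a + (-1) *\<^sub>R x)) (\<lambda>_. ennreal (\<bar>-1\<bar> ^ DIM(real ^ 'n)))"
    by (rule lborel_affine) simp
  then have "lborel = distr lborel borel (\<lambda>x :: real ^ 'n. a - x)" by (simp add: density_1)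
  then have "(\<integral>\<^sup>+b. f b \<partial>lborel) = (\<integral>\<^sup>+b. f b \<partial>distr lborel borel (\<lambda>x :: real ^ 'n. a - x))" by simp
  also have "\<dots> = (\<integral>\<^sup>+b. f (a - b) \<partial>lborel)" using f by (subst nn_integral_distr) auto
  finally show ?thesis by simp
qed

lemma lattice_cube_subset_ball: "lattice_cube (b :: real ^ 'n) \<subseteq> ball b (real CARD('n) + 1)"
proof
  fix x assume "x \<in> lattice_cube b"
  from norm_diff_lattice_cube[OF this] show "x \<in> ball b (real CARD('n) + 1)"
    by (simp add: dist_norm norm_minus_commute)
qed

text \<open>Only the first point is confined to the cube. As the cubes tile the space, each pair
  with difference in D is counted for exactly one lattice point, and the counts at different lattice
  points are translates of each other.\<close>

definition cube_pairs :: "(real ^ 'n) set \<Rightarrow> real ^ 'n \<Rightarrow> ((real ^ 'n) \<times> (real ^ 'n)) set" where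
  "cube_pairs D b = {(x, y). x \<in> lattice_cube b \<and> x - y \<in> D}"

lemma cube_pairs_sets [measurable]:
  assumes [measurable]: "D \<in> sets borel"
  shows "cube_pairs D b \<in> sets (borel \<Otimes>\<^sub>M borel)"
proof -
  have "{z \<in> space (borel \<Otimes>\<^sub>M borel). fst z \<in> lattice_cube b \<and> fst z - snd z \<in> D} \<in> sets (borel \<Otimes>\<^sub>M borel)"
    by measurable
  then show ?thesis by (simp add: cube_pairs_def split_beta' space_pair_measure)
qed

lemma cube_pairs_subset:
  assumes "D \<subseteq> ball 0 r"
  shows "cube_pairs D (b :: real ^ 'n) \<subseteq> ball b (real CARD('n) + 1 + r) \<times> ball b (real CARD('n) + 1 + r)"
proof
  fix z assume "z \<in> cube_pairs D b"
  then obtain x y where z: "z = (x, y)" "x \<in> lattice_cube b" "x - y \<in> D" by (auto simp: cube_pairs_def)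
  have "x \<in> ball b (real CARD('n) + 1)" by (rule subsetD[OF lattice_cube_subset_ball z(2)])
  then have "dist b x < real CARD('n) + 1" by simp
  moreover have "x - y \<in> ball 0 r" by (rule subsetD[OF assms z(3)])
  then have "dist x y < r" by (simp add: dist_norm norm_minus_commute)
  moreover have "0 \<le> dist x y" by simp
  ultimately have "dist b x < real CARD('n) + 1 + r" "dist b y < real CARD('n) + 1 + r"
    using dist_triangle[of b y x] by linarith+
  then show "z \<in> ball b (real CARD('n) + 1 + r) \<times> ball b (real CARD('n) + 1 + r)" by (simp add: z)
qed

lemma dyadic_cell_bounded: "bounded (dyadic_cell j (z :: real ^ 'n))"
  unfolding bounded_iff
proof (intro exI ballI)
  fix x assume x: "x \<in> dyadic_cell j z"
  then have "norm ((2 ^ j) *\<^sub>R x) \<le> norm z + real CARD('n)"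
    using norm_diff_floor_vec_le[of "(2 ^ j) *\<^sub>R x"] norm_triangle_sub[of "(2 ^ j) *\<^sub>R x" z] by (simp add: dyadic_cell_def)
  moreover have "norm x \<le> norm ((2 ^ j) *\<^sub>R x)" by (simp add: mult_le_cancel_right1)
  ultimately show "norm x \<le> norm z + real CARD('n)" by linarith
qed

context permanental_process
begin

lemma emeasure_autocorrelation_limit:
  assumes "D \<in> sets borel"
  shows "emeasure autocorrelation_limit D
    = indicator D 0 + (\<integral>\<^sup>+x. ennreal (1 + (cmod (K x))\<^sup>2) * indicator D x \<partial>lborel)"
  unfolding autocorrelation_limit_def using assms K_measurable
  by (subst emeasure_add_measure) (auto simp: emeasure_density)

lemma locally_finite_autocorrelation_limit: "locally_finite_measure autocorrelation_limit"
  unfolding locally_finite_measure_def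
proof (intro conjI ballI impI)
  fix A :: "(real ^ 'n) set" assume A: "A \<in> sets borel" "bounded A"
  have "ennreal (1 + (cmod (K x))\<^sup>2) * indicator A x \<le> 2 * indicator A x" for x
  proof -
    have "(cmod (K x))\<^sup>2 \<le> 1" using norm_K_le_1[of x] by (simp add: abs_square_le_1)
    then have "ennreal (1 + (cmod (K x))\<^sup>2) \<le> ennreal 2" by (intro ennreal_leI) simp
    then show ?thesis by (intro mult_right_mono) auto
  qed
  then have "(\<integral>\<^sup>+x. ennreal (1 + (cmod (K x))\<^sup>2) * indicator A x \<partial>lborel) \<le> (\<integral>\<^sup>+x. 2 * indicator A x \<partial>lborel)"
    by (rule nn_integral_mono)
  also have "\<dots> = 2 * emeasure lborel A" using A by (simp add: nn_integral_cmult)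
  also have "\<dots> < \<infinity>" using emeasure_bounded_finite[OF A(2)] by (simp add: ennreal_mult_less_top)
  finally show "emeasure autocorrelation_limit A < \<infinity>"
    unfolding emeasure_autocorrelation_limit[OF A(1)] by (simp add: indicator_def)
qed simp

text \<open>The case k = 1 of \<open>tuple_field\<close>. The intensity K(0) = 1 and the unit volume
  of the cube give the mean 1, which becomes the weight of the atom at 0.\<close>

lemma cube_count_average:
  "AE w in M. (\<lambda>n. (\<Sum>c\<in>lattice_ball (real n). real (card (points_in (\<omega> w) (lattice_cube c)))) / ball_vol TYPE('n) (real n)) \<longlonglongrightarrow> 1"
proof -
  define W where "W = {x \<in> {..<1 :: nat} \<rightarrow>\<^sub>E UNIV. x 0 \<in> lattice_cube (0 :: real ^ 'n)}"
  have "(\<lambda>x. x 0) -` lattice_cube (0 :: real ^ 'n) \<inter> space (Pi\<^sub>M {..<1 :: nat} (\<lambda>_. borel)) \<in> sets (Pi\<^sub>M {..<1} (\<lambda>_. borel))"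
    by (rule measurable_sets[OF measurable_component_singleton]) auto
  then have Ws: "W \<in> sets (Pi\<^sub>M {..<1} (\<lambda>_. borel))"
    by (simp add: W_def space_PiM vimage_def Int_def conj_commute)
  have Wb: "W \<subseteq> Pi\<^sub>E {..<1} (\<lambda>_. ball 0 (real CARD('n) + 1))"
    using lattice_cube_subset_ball[of "0 :: real ^ 'n"] by (auto simp: W_def PiE_iff extensional_def)
  have event: "tuple_event 1 W b = {x \<in> {..<1} \<rightarrow>\<^sub>E UNIV. x 0 \<in> lattice_cube b}" for b
    using lattice_cube_translate[of _ b 0] by (auto simp: tuple_event_def W_def)
  have W_eq: "W = Pi\<^sub>E {..<1} (\<lambda>_. lattice_cube 0)"
    unfolding W_def by (intro set_eqI) (simp add: PiE_iff lessThan_Suc conj_commute)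
  have W_emeasure: "emeasure (Pi\<^sub>M {..<1} (\<lambda>_. lborel)) W = 1"
    unfolding W_eq by (subst lborel_product.emeasure_PiM) (simp_all add: emeasure_lattice_cube)
  interpret tuple_field \<phi> K M \<omega> 1 W "real CARD('n) + 1"
  proof (intro tuple_field.intro tuple_field_axioms.intro permanental_process_axioms Ws Wb)
    fix b :: "real ^ 'n"
    show "(\<lambda>\<mu>. real (card (factorial_tuples 1 \<mu> (tuple_event 1 W b)))) \<in> borel_measurable configuration_space"
      unfolding event card_factorial_tuples_1
      by (rule card_points_in_measurable) (auto intro: bounded_subset[OF bounded_ball lattice_cube_subset_ball])
  qed simp
  have "mean_integral = emeasure (Pi\<^sub>M {..<1} (\<lambda>_. lborel)) W"
    unfolding mean_integral_def using Ws by (simp add: intensity_1[unfolded One_nat_def] sets_PiM_lborel)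
  then have "mean_integral = 1" by (simp only: W_emeasure)
  then show ?thesis
    using field_average unfolding field_def event card_factorial_tuples_1 by simp
qed

text \<open>The case k = 2. For a fixed first point a the substitution b -> a - b turns the inner
  integral into one over D that no longer involves a, and the cube contributes its volume 1.\<close>

lemma distinct_pair_count_average:
  assumes D: "D \<in> sets borel" "bounded D"
  shows "AE w in M. (\<lambda>n. (\<Sum>c\<in>lattice_ball (real n). real (card (factorial_tuples 2 (\<omega> w)
      {x \<in> {..<2} \<rightarrow>\<^sub>E UNIV. (x 0, x 1) \<in> cube_pairs D c}))) / ball_vol TYPE('n) (real n))
    \<longlonglongrightarrow> enn2real (\<integral>\<^sup>+x. ennreal (1 + (cmod (K x))\<^sup>2) * indicator D x \<partial>lborel)"
proof -
  obtain r where r: "D \<subseteq> ball 0 r" using bounded_subset_ballD[OF D(2), of 0] by auto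
  define W where "W = {x \<in> {..<2 :: nat} \<rightarrow>\<^sub>E UNIV. (x 0, x 1) \<in> cube_pairs D (0 :: real ^ 'n)}"
  have Ws: "W \<in> sets (Pi\<^sub>M {..<2} (\<lambda>_. borel))"
    unfolding W_def by (rule pair_event_sets[OF cube_pairs_sets[OF D(1)]])
  have Wb: "W \<subseteq> Pi\<^sub>E {..<2} (\<lambda>_. ball 0 (real CARD('n) + 1 + r))"
    unfolding W_def by (rule pair_event_subset[OF cube_pairs_subset[OF r]])
  have event: "tuple_event 2 W b = {x \<in> {..<2} \<rightarrow>\<^sub>E UNIV. (x 0, x 1) \<in> cube_pairs D b}" for b
    using lattice_cube_translate[of _ b 0] by (auto simp: tuple_event_def W_def cube_pairs_def)
  interpret tuple_field \<phi> K M \<omega> 2 W "real CARD('n) + 1 + r"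
  proof (intro tuple_field.intro tuple_field_axioms.intro permanental_process_axioms Ws Wb)
    fix b :: "real ^ 'n"
    show "(\<lambda>\<mu>. real (card (factorial_tuples 2 \<mu> (tuple_event 2 W b)))) \<in> borel_measurable configuration_space"
      unfolding event
      by (rule card_factorial_tuples_2_measurable[OF _ _ cube_pairs_sets[OF D(1)] cube_pairs_subset[OF r]]) auto
  qed simp
  let ?k = "\<lambda>x. ennreal (1 + (cmod (K x))\<^sup>2)"
  have [measurable]: "K \<in> borel_measurable borel" "D \<in> sets borel" by (rule K_measurable, rule D)
  have "mean_integral = (\<integral>\<^sup>+ x. ?k (x 0 - x 1) * indicator (cube_pairs D 0) (x 0, x 1) \<partial>Pi\<^sub>M {..<2 :: nat} (\<lambda>_. lborel))"
    unfolding mean_integral_def intensity_2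
    by (intro nn_integral_cong) (auto simp: W_def space_PiM split: split_indicator)
  also have "\<dots> = (\<integral>\<^sup>+a. \<integral>\<^sup>+b. ?k (a - b) * indicator (cube_pairs D 0) (a, b) \<partial>lborel \<partial>lborel)"
    using cube_pairs_sets[OF D(1)] by (intro nn_integral_PiM_2) measurable
  also have "\<dots> = (\<integral>\<^sup>+a. indicator (lattice_cube (0 :: real ^ 'n)) a * (\<integral>\<^sup>+b. ?k b * indicator D b \<partial>lborel) \<partial>lborel)"
  proof (intro nn_integral_cong)
    fix a :: "real ^ 'n"
    have "(\<integral>\<^sup>+b. ?k (a - b) * indicator (cube_pairs D 0) (a, b) \<partial>lborel)
      = (\<integral>\<^sup>+b. indicator (lattice_cube 0) a * (?k (a - b) * indicator D (a - b)) \<partial>lborel)"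
      by (intro nn_integral_cong) (auto simp: cube_pairs_def split: split_indicator)
    also have "\<dots> = indicator (lattice_cube 0) a * (\<integral>\<^sup>+b. ?k (a - b) * indicator D (a - b) \<partial>lborel)"
      by (rule nn_integral_cmult) measurable
    also have "(\<integral>\<^sup>+b. ?k (a - b) * indicator D (a - b) \<partial>lborel) = (\<integral>\<^sup>+b. ?k b * indicator D b \<partial>lborel)"
      by (rule nn_integral_lborel_reflect) measurable
    finally show "(\<integral>\<^sup>+b. ?k (a - b) * indicator (cube_pairs D 0) (a, b) \<partial>lborel)
      = indicator (lattice_cube 0) a * (\<integral>\<^sup>+b. ?k b * indicator D b \<partial>lborel)" .
  qed
  also have "\<dots> = (\<integral>\<^sup>+b. ?k b * indicator D b \<partial>lborel)"
    by (simp add: nn_integral_multc emeasure_lattice_cube)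
  finally show ?thesis using field_average unfolding field_def event by simp
qed

text \<open>A pair of an index with itself has difference 0, so the diagonal enters only when 0 is
  in D, and then each point of the cube is counted once.\<close>

lemma cube_pair_count_average:
  assumes D: "D \<in> sets borel" "bounded D"
  shows "AE w in M. (\<lambda>n. (\<Sum>c\<in>lattice_ball (real n). real (card (pairs_in (\<omega> w) (cube_pairs D c)))) / ball_vol TYPE('n) (real n))
    \<longlonglongrightarrow> measure autocorrelation_limit D"
  using distinct_pair_count_average[OF D] cube_count_average AE_space
proof eventually_elim
  case (elim w)
  obtain r where r: "D \<subseteq> ball 0 r" using bounded_subset_ballD[OF D(2), of 0] by auto
  let ?T = "\<lambda>c. real (card (factorial_tuples 2 (\<omega> w) {x \<in> {..<2} \<rightarrow>\<^sub>E UNIV. (x 0, x 1) \<in> cube_pairs D c}))"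
  let ?N = "\<lambda>c. real (card (points_in (\<omega> w) (lattice_cube c)))"
  have "{x. (x, x) \<in> cube_pairs D c} = (if 0 \<in> D then lattice_cube c else {})" for c
    by (auto simp: cube_pairs_def)
  then have "card (points_in (\<omega> w) {x. (x, x) \<in> cube_pairs D c}) = (if 0 \<in> D then card (points_in (\<omega> w) (lattice_cube c)) else 0)" for c
    by (simp add: points_in_def)
  then have e: "real (card (pairs_in (\<omega> w) (cube_pairs D c))) = ?T c + ?N c * indicator D 0" for c
    using card_factorial_tuples_2[OF configuration[OF elim(3)] _ _ cube_pairs_subset[OF r, of c]] by simp
  have "measure autocorrelation_limit D = enn2real (\<integral>\<^sup>+x. ennreal (1 + (cmod (K x))\<^sup>2) * indicator D x \<partial>lborel) + 1 * indicator D 0"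
  proof -
    have f: "emeasure autocorrelation_limit D < \<infinity>"
      using locally_finite_autocorrelation_limit D by (simp add: locally_finite_measure_def)
    show ?thesis using f unfolding measure_def emeasure_autocorrelation_limit[OF D(1)]
      by (subst enn2real_plus) (auto simp: indicator_def)
  qed
  moreover have "(\<lambda>n. (\<Sum>c\<in>lattice_ball (real n). ?T c) / ball_vol TYPE('n) (real n) + (\<Sum>c\<in>lattice_ball (real n). ?N c) / ball_vol TYPE('n) (real n) * indicator D 0)
    \<longlonglongrightarrow> enn2real (\<integral>\<^sup>+x. ennreal (1 + (cmod (K x))\<^sup>2) * indicator D x \<partial>lborel) + 1 * indicator D 0"
    by (intro tendsto_add tendsto_mult tendsto_const elim(1,2))
  ultimately show ?case unfolding e by (simp add: sum.distrib sum_distrib_right add_divide_distrib)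
qed

text \<open>The field sum counts the pairs \<open>U\<close> whose first point lies in a cube at a
  lattice point of the ball; the approximant counts the pairs \<open>T\<close> with both points in
  the ball. The two families interlace with a fixed change of radius.\<close>

lemma ball_pair_count_average:
  assumes D: "D \<in> sets borel" "bounded D"
  shows "AE w in M. (\<lambda>n. real (card {s \<in> pairs_in (\<omega> w) (ball 0 (real n) \<times> ball 0 (real n)). fst (fst s) - fst (snd s) \<in> D}) / ball_vol TYPE('n) (real n))
    \<longlonglongrightarrow> measure autocorrelation_limit D"
  using cube_pair_count_average[OF D] AE_space
proof eventually_elim
  case (elim w)
  obtain r where r: "0 < r" "D \<subseteq> ball 0 r" using bounded_subset_ballD[OF D(2), of 0] by auto
  let ?C = "real CARD('n)"
  let ?R = "\<lambda>n. ball (0 :: real ^ 'n) (real n)"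
  note \<mu> = configuration[OF elim(2)]
  define U where "U n = {s \<in> pairs_in (\<omega> w) UNIV. floor_vec (fst (fst s)) \<in> lattice_ball (real n) \<and> fst (fst s) - fst (snd s) \<in> D}" for n
  define T where "T n = {s \<in> pairs_in (\<omega> w) (?R n \<times> ?R n). fst (fst s) - fst (snd s) \<in> D}" for n
  \<comment> \<open>The summand d accounts for rounding the first point to its lattice point, the
    summand r for the distance from the first point to the second.\<close>
  define s where "s = nat \<lceil>?C + r\<rceil>"
  have s: "?C + r \<le> real s" unfolding s_def by (rule real_nat_ceiling_ge)
  have sub: "lattice_ball (real n) \<subseteq> (lattice :: (real ^ 'n) set)" for n by (rule lattice_ball_subset)
  have U: "U n = (\<Union>c\<in>lattice_ball (real n). pairs_in (\<omega> w) (cube_pairs D c))" for n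
    using sub[of n]
    by (auto simp: U_def pairs_in_def cube_pairs_def in_lattice_cube_iff mem_lattice_cube_floor_vec)
  have fin: "finite (pairs_in (\<omega> w) (cube_pairs D c))" for c
    by (rule finite_pairs_in[OF \<mu> _ _ cube_pairs_subset[OF r(2)]]) auto
  have card_U: "real (card (U n)) = (\<Sum>c\<in>lattice_ball (real n). real (card (pairs_in (\<omega> w) (cube_pairs D c))))" for n
  proof -
    have "card (U n) = (\<Sum>c\<in>lattice_ball (real n). card (pairs_in (\<omega> w) (cube_pairs D c)))"
      unfolding U
    proof (intro card_UN_disjoint ballI impI fin finite_lattice_ball)
      fix c c' :: "real ^ 'n" assume c: "c \<in> lattice_ball (real n)" "c' \<in> lattice_ball (real n)" "c \<noteq> c'"
      then have "lattice_cube c \<inter> lattice_cube c' = {}"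
        using sub[of n] by (auto simp: in_lattice_cube_iff subset_iff)
      then show "pairs_in (\<omega> w) (cube_pairs D c) \<inter> pairs_in (\<omega> w) (cube_pairs D c') = {}"
        by (auto simp: pairs_in_def cube_pairs_def)
    qed
    then show ?thesis by simp
  qed
  have finU: "finite (U n)" for n unfolding U by (intro finite_UN_I finite_lattice_ball fin)
  have finT: "finite (T n)" for n
    unfolding T_def by (rule finite_subset[OF _ finite_pairs_in[OF \<mu> _ _ order_refl, of "?R n"]]) auto
  have UT: "U n \<subseteq> T (n + s)" for n
  proof
    fix t assume t: "t \<in> U n"
    have "norm (fst (fst t)) < real n + ?C"
      using t norm_diff_floor_vec_le[of "fst (fst t)"] norm_triangle_sub[of "fst (fst t)" "floor_vec (fst (fst t))"]
      by (simp add: U_def lattice_ball_def)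
    moreover have "norm (fst (fst t) - fst (snd t)) < r" using t r(2) by (auto simp: U_def)
    ultimately have "norm (fst (fst t)) < real (n + s)" "norm (fst (snd t)) < real (n + s)"
      using norm_triangle_sub[of "fst (snd t)" "fst (fst t)"] s r(1) by (simp_all add: norm_minus_commute)
    then show "t \<in> T (n + s)" using t by (auto simp: U_def T_def pairs_in_def)
  qed
  have TU: "T n \<subseteq> U (n + s)" for n
  proof
    fix t assume t: "t \<in> T n"
    then have "norm (fst (fst t)) < real n" by (auto simp: T_def pairs_in_def)
    then have "norm (floor_vec (fst (fst t))) < real (n + s)"
      using norm_diff_floor_vec_le[of "fst (fst t)"] norm_triangle_sub[of "floor_vec (fst (fst t))" "fst (fst t)"] s r(1)
      by (simp add: norm_minus_commute)
    then show "t \<in> U (n + s)" using t by (auto simp: U_def T_def pairs_in_def lattice_ball_def)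
  qed
  have "(\<lambda>n. real (card (T n)) / ball_vol TYPE('n) (real n)) \<longlonglongrightarrow> measure autocorrelation_limit D"
  proof (rule mean_tendsto_of_interlacing)
    show "(\<lambda>n. real (card (U n)) / ball_vol TYPE('n) (real n)) \<longlonglongrightarrow> measure autocorrelation_limit D"
      unfolding card_U by (rule elim(1))
    show "real (card (U n)) \<le> real (card (T (n + s)))" for n using card_mono[OF finT UT] by simp
    show "real (card (T n)) \<le> real (card (U (n + s)))" for n using card_mono[OF finU TU] by simp
  qed
  then show ?case by (simp add: T_def)
qed

theorem autocorrelation_AE: "AE w in M. autocorrelation (\<omega> w) autocorrelation_limit"
proof -
  have "AE w in M. \<forall>j. \<forall>z\<in>lattice.
    (\<lambda>n. real (card {s \<in> pairs_in (\<omega> w) (ball 0 (real n) \<times> ball 0 (real n)). fst (fst s) - fst (snd s) \<in> dyadic_cell j z}) / ball_vol TYPE('n) (real n))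
      \<longlonglongrightarrow> measure autocorrelation_limit (dyadic_cell j z)"
    by (simp add: AE_all_countable AE_ball_countable ball_pair_count_average dyadic_cell_bounded)
  then show ?thesis using AE_space
  proof eventually_elim
    case (elim w)
    note \<mu> = configuration[OF elim(2)]
    let ?S = "\<lambda>n. pairs_in (\<omega> w) (ball 0 (real n) \<times> ball 0 (real n))"
    show ?case
      unfolding autocorrelation_def vague_limit_def
    proof (intro conjI allI impI locally_finite_autocorrelation_limit)
      fix f :: "real ^ 'n \<Rightarrow> real" assume f: "continuous_on UNIV f" "compact (closure {x. f x \<noteq> 0})"
      have "(\<lambda>n. (\<Sum>s\<in>?S n. f (fst (fst s) - fst (snd s))) / ball_vol TYPE('n) (real n)) \<longlonglongrightarrow> integral\<^sup>L autocorrelation_limit f"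
      proof (rule vague_convergence_of_dyadic_cells[OF _ _ locally_finite_autocorrelation_limit _ f])
        show "finite (?S n)" for n by (rule finite_pairs_in[OF \<mu> _ _ order_refl]) auto
      qed (use elim(1) in auto)
      moreover have "eventually (\<lambda>n. (\<Sum>s\<in>?S n. f (fst (fst s) - fst (snd s))) / ball_vol TYPE('n) (real n)
        = integral\<^sup>L (scale_measure (inverse (emeasure lborel (ball (0 :: real ^ 'n) (real n))))
            (restricted_to (\<omega> w) (ball 0 (real n)) \<star> reflected (restricted_to (\<omega> w) (ball 0 (real n))))) f) sequentially"
        \<comment> \<open>At n = 0 the ball is empty and the normalising factor is infinite, so the
          identity with the sum over pairs is used for positive n.\<close>
        using eventually_gt_at_top[of 0]
        by eventually_elim (rule integral_autocorrelation_approximant[OF \<mu> _ borel_measurable_continuous_onI[OF f(1)], symmetric])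
      ultimately show "(\<lambda>n. integral\<^sup>L (scale_measure (inverse (emeasure lborel (ball (0 :: real ^ 'n) (real n))))
            (restricted_to (\<omega> w) (ball 0 (real n)) \<star> reflected (restricted_to (\<omega> w) (ball 0 (real n))))) f)
        \<longlonglongrightarrow> integral\<^sup>L autocorrelation_limit f"
        by (rule Lim_transform_eventually)
    qed
  qed
qed

end

theorem proposition4p3:
  fixes \<phi> :: "real ^ 'n \<Rightarrow> real"
    and K :: "real ^ 'n \<Rightarrow> complex"
    and M :: "'w measure"
    and \<omega> :: "'w \<Rightarrow> (real ^ 'n) measure"
  assumes \<phi>_measurable: "\<phi> \<in> borel_measurable borel"
    and \<phi>_nonneg: "\<And>x. 0 \<le> \<phi> x"
    and \<phi>_prob: "(\<integral>\<^sup>+ x. ennreal (\<phi> x) \<partial>lborel) = 1"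
    and K: "K = fourier_transform (\<lambda>x. complex_of_real (\<phi> x))"
    and \<omega>: "permanental M \<omega> (\<lambda>x y. K (x - y))"
  shows "AE w in M.
    autocorrelation (\<omega> w)
      (add_measure (return borel 0) (density lborel (\<lambda>x. ennreal (1 + (cmod (K x))\<^sup>2)))) \<and>
    diffraction (\<omega> w)
      (add_measure (return borel 0)
        (density lborel (\<lambda>x. ennreal (1 + fun_convolution \<phi> (\<lambda>y. \<phi> (- y)) x))))"
proof -
  interpret permanental_process \<phi> K M \<omega>
    by (intro permanental_process.intro density_kernel.intro permanental_process_axioms.intro assms)
  have "AE w in M. autocorrelation (\<omega> w) autocorrelation_limit \<and> diffraction (\<omega> w) diffraction_limit"
    using autocorrelation_AE
    by eventually_elim (auto simp: diffraction_def intro: is_fourier_measure_limits)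
  then show ?thesis
    by (simp only: autocorrelation_limit_def diffraction_limit_def pair_density_def)
qed

end
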